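(* Let $f:\mathbb S^1\times\mathbb R\to\mathbb R$ be smooth and tame, and let $F:B^1\to B^0$, $F(u)(t)=u'(t)+f(t,u(t))$. For $u\in B^1$ define (with $w=w_u$) $$\begin{aligned} \Sigma_1(u)&=\int_0^1 D_2f(t,u(t))\,dt,\\ \Sigma_2(u)&=\int_0^1 D_2^2f(t,u(t))\,w(t)\,dt,\\ \Sigma_3(u)&=\int_0^1 D_2^3f(t,u(t))\,w^2(t)\,dt,\\ \Sigma_4(u)&=\int_0^1\Big[D_2^4f(t,u(t))\,w^3(t)-2D_2^3f(t,u(t))\,w^2(t)\,A(t)\Big]dt,\\ \Sigma_5(u)&=\int_0^1\Big[D_2^5f(t,u(t))\,w^4(t)-5D_2^4f(t,u(t))\,w^3(t)\,A(t)+5D_2^3f(t,u(t))\,w^2(t)\,A(t)^2\Big]dt, \end{aligned}$$ where $A(t)=\int_0^tD_2^2f(s,u(s))\,w(s)\,ds$ and $w^j(t)=(w(t))^j$. Assume that $0$ is a regular value of $\Sigma_1$. Then, for $k=1,\dots,5$, $$S_k=\{u\in B^1:\Sigma_i(u)=0,\ i=1,\dots,k\}.$$ Furthermore, for $k=1,\dots,4$, $u\in B^1$ is a Morin singularity of $F$ of order $k$ if and only if (a) $\Sigma_i(u)=0$ for $i=1,\dots,k$; (b) $\Sigma_{k+1}(u)\neq0$; (c) the derivative $D\Sigma(u)$ of the function $\Sigma:B^1\to\mathbb R^{k-1}$, $u\mapsto(\Sigma_1(u),\dots,\Sigma_{k-1}(u))$, is surjective.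
   Context: $\mathbb S^1=\mathbb R/\mathbb Z$. The pair $(B^1,B^0)$ is either $(H^1(\mathbb S^1;\mathbb R),L^2(\mathbb S^1;\mathbb R))$ or $(C^1(\mathbb S^1;\mathbb R),C^0(\mathbb S^1;\mathbb R))$; the result is asserted in both cases. $D_2^jf$ is the $j$-th partial derivative in the second variable. $\tilde B^0$ is the space of average-zero functions in $B^0$. $f$ is *wild at $+\infty$* (resp. $-\infty$) if both $\int_I\frac{ds}{\max(1,\sup_t f(t,s))}<\infty$ and $\int_I\frac{ds}{\max(1,\sup_t(-f(t,s)))}<\infty$ for $I=[0,+\infty)$ (resp. $(-\infty,0]$); $f$ is *tame* if wild neither at $+\infty$ nor at $-\infty$. $w_u(t)=\exp\left(-\int_{\mathbb S^1}\kappa(s-t)D_2f(s,u(s))\,ds\right)$ with $\kappa(x)=x-\lfloor x\rfloor-1/2$. For tame $f$ the map $\Psi:B^1\to B^0$, $\Psi(u)=F(u)-\int F(u)+\int u$, is a diffeomorphism and $F\circ\Psi^{-1}(\tilde v,\overline u)=(\tilde v,\phi(\tilde v,\overline u))$ on $B^0=\tilde B^0\oplus\mathbb R$, with $\phi$ smooth. $D_2\phi$ is the derivative in the real variable $\overline u$. $S_k\subset B^1$ is the set of $u$ with $D_2\phi=\dots=D_2^k\phi=0$ at $\Psi(u)$. The point $u$ is a *Morin singularity of order $k$* of $F$ if at $\Psi(u)$: $D_2\phi=\dots=D_2^k\phi=0$; $D_2^{k+1}\phi\neq0$; and the derivative $D(D_2\phi,\dots,D_2^{k-1}\phi)$ is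 surjective onto $\mathbb R^{k-1}$. *)

theory Defs
  imports "HOL-Analysis.Analysis"
begin

text \<open>
  Functions on the circle \<open>\<real>/\<int>\<close> are represented by \<open>1\<close>-periodic functions on the real line, or,
  for \<open>L\<^sup>2\<close>, by functions on the fundamental domain \<open>[0,1)\<close> up to null sets.
\<close>

section \<open>Function spaces on the circle\<close>

subsection \<open>Continuous functions\<close>

typedef c0 = "{u :: real \<Rightarrow>\<^sub>C real. \<forall>t. apply_bcontfun u (t + 1) = apply_bcontfun u t}"
  morphisms bcontfun_of_c0 c0_of_bcontfun
  by (rule exI[of _ 0]) simp

setup_lifting type_definition_c0

instantiation c0 :: real_vector
begin

lift_definition zero_c0 :: c0 is 0 by simp
lift_definition plus_c0 :: "c0 \<Rightarrow> c0 \<Rightarrow> c0" is "(+)" by simp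
lift_definition minus_c0 :: "c0 \<Rightarrow> c0 \<Rightarrow> c0" is "(-)" by simp
lift_definition uminus_c0 :: "c0 \<Rightarrow> c0" is uminus by simp
lift_definition scaleR_c0 :: "real \<Rightarrow> c0 \<Rightarrow> c0" is scaleR by simp

instance
proof
  fix x y z :: c0 and a b :: real
  show "x + y + z = x + (y + z)" by transfer (rule add.assoc)
  show "x + y = y + x" by transfer (rule add.commute)
  show "0 + x = x" by transfer simp
  show "- x + x = 0" by transfer simp
  show "x - y = x + - y" by transfer simp
  show "a *\<^sub>R (x + y) = a *\<^sub>R x + a *\<^sub>R y" by transfer (rule scaleR_add_right)
  show "(a + b) *\<^sub>R x = a *\<^sub>R x + b *\<^sub>R x" by transfer (rule scaleR_add_left)
  show "a *\<^sub>R b *\<^sub>R x = (a * b) *\<^sub>R x" by transfer simp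
  show "1 *\<^sub>R x = x" by transfer simp
qed

end

instantiation c0 :: real_normed_vector
begin

lift_definition norm_c0 :: "c0 \<Rightarrow> real" is norm .
definition "dist (u::c0) v = norm (u - v)"
definition "sgn (u::c0) = u /\<^sub>R norm u"
definition "(uniformity :: (c0 \<times> c0) filter) = (INF e\<in>{0<..}. principal {(x, y). dist x y < e})"
definition "open (U :: c0 set) = (\<forall>x\<in>U. eventually (\<lambda>(x', y). x' = x \<longrightarrow> y \<in> U) uniformity)"

instance
proof
  fix x y :: c0 and a :: real
  show "dist x y = norm (x - y)" by (rule dist_c0_def)
  show "sgn x = x /\<^sub>R norm x" by (rule sgn_c0_def)
  show "(uniformity :: (c0 \<times> c0) filter) = (INF e\<in>{0<..}. principal {(x, y). dist x y < e})"
    by (rule uniformity_c0_def)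
  show "open U = (\<forall>x\<in>U. eventually (\<lambda>(x', y). x' = x \<longrightarrow> y \<in> U) uniformity)" for U :: "c0 set"
    by (rule open_c0_def)
  show "norm x = 0 \<longleftrightarrow> x = 0" by transfer simp
  show "norm (x + y) \<le> norm x + norm y" by transfer (rule norm_triangle_ineq)
  show "norm (a *\<^sub>R x) = \<bar>a\<bar> * norm x" by transfer simp
qed

end

subsection \<open>Continuously differentiable functions\<close>

typedef c1 = "{u :: real \<Rightarrow> real. (\<forall>t. u (t + 1) = u t) \<and> (\<forall>t. u differentiable at t) \<and>
                 continuous_on UNIV (deriv u)}"
  morphisms fun_of_c1 c1_of_fun
proof (rule exI[of _ "\<lambda>_. 0"])
qed (auto simp: deriv_const)

setup_lifting type_definition_c1

lemma fun_of_c1_has_deriv: "(fun_of_c1 u has_real_derivative deriv (fun_of_c1 u) t) (at t)"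
  using fun_of_c1[of u] by (auto simp: DERIV_deriv_iff_real_differentiable)

lemma deriv_periodic:
  fixes u :: "real \<Rightarrow> real"
  assumes "\<And>t. u (t + 1) = u t" "\<And>t. u differentiable at t"
  shows "deriv u (t + 1) = deriv u t"
proof -
  have "(u has_real_derivative deriv u (t + 1)) (at (t + 1))"
    using assms by (simp add: DERIV_deriv_iff_real_differentiable)
  then have "((\<lambda>x. u (x + 1)) has_real_derivative deriv u (t + 1)) (at t)"
    by (simp add: DERIV_shift)
  then show ?thesis
    using assms(1) by (simp add: DERIV_imp_deriv)
qed

lemma periodic_int_shift:
  fixes u :: "real \<Rightarrow> real"
  assumes per: "\<And>t. u (t + 1) = u t"
  shows "u (t + of_int n) = u t"
proof (induction n rule: int_induct[where k = 0])
  case (step1 i)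
  then show ?case using per[of "t + of_int i"] by (simp add: add.assoc)
next
  case (step2 i)
  then show ?case using per[of "t + of_int i - 1"] by (simp add: algebra_simps)
qed simp

lemma periodic_continuous_bcontfun:
  fixes u :: "real \<Rightarrow> real"
  assumes "continuous_on UNIV u" "\<And>t. u (t + 1) = u t"
  shows "u \<in> bcontfun"
proof -
  have "range u \<subseteq> u ` {0..1}"
  proof
    fix y assume "y \<in> range u"
    then obtain t where "y = u t" by auto
    then have "y = u (frac t)"
      using periodic_int_shift[of u "frac t" "\<lfloor>t\<rfloor>", OF assms(2)] by (simp add: frac_def)
    then show "y \<in> u ` {0..1}"
      by (intro image_eqI[of _ _ "frac t"]) (auto simp: frac_lt_1 less_imp_le)
  qed
  moreover have "bounded (u ` {0..1})"
    by (intro compact_imp_bounded compact_continuous_image continuous_on_subset[OF assms(1)]) auto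
  ultimately show ?thesis
    using assms(1) bounded_subset by (auto simp: bcontfun_def)
qed

definition c0_of_fun :: "(real \<Rightarrow> real) \<Rightarrow> c0" where
  "c0_of_fun h = c0_of_bcontfun (Bcontfun h)"

lemma apply_c0_of_fun:
  assumes "continuous_on UNIV u" "\<And>t. u (t + 1) = u t"
  shows "apply_bcontfun (bcontfun_of_c0 (c0_of_fun u)) = u"
proof -
  have *: "apply_bcontfun (Bcontfun u) = u"
    by (rule Bcontfun_inverse) (rule periodic_continuous_bcontfun[OF assms])
  then show ?thesis
    unfolding c0_of_fun_def using assms by (subst c0_of_bcontfun_inverse) auto
qed

definition c0_of_c1 :: "c1 \<Rightarrow> c0" where
  "c0_of_c1 u = c0_of_fun (fun_of_c1 u)"

definition deriv_c1 :: "c1 \<Rightarrow> c0" where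
  "deriv_c1 u = c0_of_fun (deriv (fun_of_c1 u))"

lemma apply_c0_of_c1: "apply_bcontfun (bcontfun_of_c0 (c0_of_c1 u)) = fun_of_c1 u"
  unfolding c0_of_c1_def using fun_of_c1[of u]
  by (intro apply_c0_of_fun differentiable_imp_continuous_on)
     (auto simp: differentiable_on_def)

lemma apply_deriv_c1: "apply_bcontfun (bcontfun_of_c0 (deriv_c1 u)) = deriv (fun_of_c1 u)"
  unfolding deriv_c1_def using fun_of_c1[of u]
  by (intro apply_c0_of_fun) (auto intro: deriv_periodic)

lemma c0_eqI: "apply_bcontfun (bcontfun_of_c0 u) = apply_bcontfun (bcontfun_of_c0 v) \<Longrightarrow> u = v"
  by (simp add: bcontfun_of_c0_inject apply_bcontfun_inject)

instantiation c1 :: real_vector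
begin

lift_definition zero_c1 :: c1 is "\<lambda>_. 0" by (auto simp: deriv_const)

lift_definition plus_c1 :: "c1 \<Rightarrow> c1 \<Rightarrow> c1" is "\<lambda>u v t. u t + v t"
proof -
  fix u v :: "real \<Rightarrow> real"
  assume u: "(\<forall>t. u (t + 1) = u t) \<and> (\<forall>t. u differentiable at t) \<and> continuous_on UNIV (deriv u)"
    and v: "(\<forall>t. v (t + 1) = v t) \<and> (\<forall>t. v differentiable at t) \<and> continuous_on UNIV (deriv v)"
  have "deriv (\<lambda>t. u t + v t) = (\<lambda>t. deriv u t + deriv v t)"
    using u v by (intro ext DERIV_imp_deriv DERIV_add) (auto simp: DERIV_deriv_iff_real_differentiable)
  then show "(\<forall>t. u (t + 1) + v (t + 1) = u t + v t) \<and> (\<forall>t. (\<lambda>t. u t + v t) differentiable at t) \<and>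
    continuous_on UNIV (deriv (\<lambda>t. u t + v t))"
    using u v by (auto intro!: continuous_intros)
qed

lift_definition scaleR_c1 :: "real \<Rightarrow> c1 \<Rightarrow> c1" is "\<lambda>a u t. a * u t"
proof -
  fix a and u :: "real \<Rightarrow> real"
  assume u: "(\<forall>t. u (t + 1) = u t) \<and> (\<forall>t. u differentiable at t) \<and> continuous_on UNIV (deriv u)"
  have "deriv (\<lambda>t. a * u t) = (\<lambda>t. a * deriv u t)"
    using u by (intro ext DERIV_imp_deriv DERIV_cmult) (auto simp: DERIV_deriv_iff_real_differentiable)
  then show "(\<forall>t. a * u (t + 1) = a * u t) \<and> (\<forall>t. (\<lambda>t. a * u t) differentiable at t) \<and>
    continuous_on UNIV (deriv (\<lambda>t. a * u t))"
    using u by (auto intro!: continuous_intros)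
qed

definition uminus_c1 :: "c1 \<Rightarrow> c1" where "uminus_c1 u = (-1) *\<^sub>R u"
definition minus_c1 :: "c1 \<Rightarrow> c1 \<Rightarrow> c1" where "minus_c1 u v = u + (-1) *\<^sub>R v"

instance
proof
  fix x y z :: c1 and a b :: real
  show "x + y + z = x + (y + z)" by transfer (simp add: algebra_simps)
  show "x + y = y + x" by transfer (simp add: algebra_simps)
  show "0 + x = x" by transfer simp
  show "- x + x = 0" unfolding uminus_c1_def by transfer simp
  show "x - y = x + - y" unfolding uminus_c1_def minus_c1_def ..
  show "a *\<^sub>R (x + y) = a *\<^sub>R x + a *\<^sub>R y" by transfer (simp add: algebra_simps)
  show "(a + b) *\<^sub>R x = a *\<^sub>R x + b *\<^sub>R x" by transfer (simp add: algebra_simps)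
  show "a *\<^sub>R b *\<^sub>R x = (a * b) *\<^sub>R x" by transfer (simp add: mult.assoc)
  show "1 *\<^sub>R x = x" by transfer simp
qed

end

lemma c0_of_c1_linear:
  "c0_of_c1 (u + v) = c0_of_c1 u + c0_of_c1 v" "c0_of_c1 (a *\<^sub>R u) = a *\<^sub>R c0_of_c1 u"
  by (rule c0_eqI; simp add: apply_c0_of_c1 plus_c0.rep_eq scaleR_c0.rep_eq plus_c1.rep_eq
      scaleR_c1.rep_eq fun_eq_iff)+

lemma deriv_c1_linear:
  "deriv_c1 (u + v) = deriv_c1 u + deriv_c1 v" "deriv_c1 (a *\<^sub>R u) = a *\<^sub>R deriv_c1 u"
proof -
  have "deriv (\<lambda>t. fun_of_c1 u t + fun_of_c1 v t) t = deriv (fun_of_c1 u) t + deriv (fun_of_c1 v) t"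
    for t by (intro DERIV_imp_deriv DERIV_add fun_of_c1_has_deriv)
  then show "deriv_c1 (u + v) = deriv_c1 u + deriv_c1 v"
    by (intro c0_eqI) (simp add: apply_deriv_c1 plus_c0.rep_eq plus_c1.rep_eq fun_eq_iff)
  have "deriv (\<lambda>t. a * fun_of_c1 u t) t = a * deriv (fun_of_c1 u) t"
    for t by (intro DERIV_imp_deriv DERIV_cmult fun_of_c1_has_deriv)
  then show "deriv_c1 (a *\<^sub>R u) = a *\<^sub>R deriv_c1 u"
    by (intro c0_eqI) (simp add: apply_deriv_c1 scaleR_c0.rep_eq scaleR_c1.rep_eq fun_eq_iff)
qed

lemma c0_of_c1_eq_0_iff: "c0_of_c1 u = 0 \<longleftrightarrow> u = 0"
proof
  assume "c0_of_c1 u = 0"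
  then have "fun_of_c1 u = (\<lambda>_. 0)"
    using apply_c0_of_c1[of u] by (simp add: zero_c0.rep_eq fun_eq_iff)
  then show "u = 0" by (simp add: fun_of_c1_inject[symmetric] zero_c1.rep_eq)
next
  assume "u = 0"
  then show "c0_of_c1 u = 0"
    using c0_of_c1_linear(2)[of 0 u] by simp
qed

instantiation c1 :: real_normed_vector
begin

definition norm_c1 :: "c1 \<Rightarrow> real" where "norm_c1 u = norm (c0_of_c1 u) + norm (deriv_c1 u)"
definition "dist (u::c1) v = norm (u - v)"
definition "sgn (u::c1) = u /\<^sub>R norm u"
definition "(uniformity :: (c1 \<times> c1) filter) = (INF e\<in>{0<..}. principal {(x, y). dist x y < e})"
definition "open (U :: c1 set) = (\<forall>x\<in>U. eventually (\<lambda>(x', y). x' = x \<longrightarrow> y \<in> U) uniformity)"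

instance
proof
  fix x y :: c1 and a :: real
  show "dist x y = norm (x - y)" by (rule dist_c1_def)
  show "sgn x = x /\<^sub>R norm x" by (rule sgn_c1_def)
  show "(uniformity :: (c1 \<times> c1) filter) = (INF e\<in>{0<..}. principal {(x, y). dist x y < e})"
    by (rule uniformity_c1_def)
  show "open U = (\<forall>x\<in>U. eventually (\<lambda>(x', y). x' = x \<longrightarrow> y \<in> U) uniformity)" for U :: "c1 set"
    by (rule open_c1_def)
  have "deriv_c1 0 = 0" using deriv_c1_linear(2)[of 0 0] by simp
  then show "norm x = 0 \<longleftrightarrow> x = 0"
    by (auto simp: norm_c1_def add_nonneg_eq_0_iff c0_of_c1_eq_0_iff)
  show "norm (x + y) \<le> norm x + norm y"
    unfolding norm_c1_def c0_of_c1_linear deriv_c1_linear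
    using norm_triangle_ineq[of "c0_of_c1 x" "c0_of_c1 y"]
      norm_triangle_ineq[of "deriv_c1 x" "deriv_c1 y"] by linarith
  show "norm (a *\<^sub>R x) = \<bar>a\<bar> * norm x"
    unfolding norm_c1_def c0_of_c1_linear deriv_c1_linear by (simp add: algebra_simps)
qed

end

subsection \<open>Square-integrable functions\<close>

definition circle_measure :: "real measure" where
  "circle_measure = restrict_space lborel {0..<1}"

lemma finite_circle_measure: "finite_measure circle_measure"
  unfolding circle_measure_def
  by (rule finite_measureI) (simp add: emeasure_restrict_space space_restrict_space)

interpretation circle_measure: finite_measure circle_measure
  by (rule finite_circle_measure)

definition square_integrable :: "(real \<Rightarrow> real) \<Rightarrow> bool" where
  "square_integrable g \<longleftrightarrow>
     g \<in> borel_measurable circle_measure \<and> integrable circle_measure (\<lambda>t. (g t)\<^sup>2)"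

definition l2_rel :: "(real \<Rightarrow> real) \<Rightarrow> (real \<Rightarrow> real) \<Rightarrow> bool" where
  "l2_rel g h \<longleftrightarrow> square_integrable g \<and> square_integrable h \<and> (AE t in circle_measure. g t = h t)"

quotient_type l2 = "real \<Rightarrow> real" / partial: l2_rel
  morphisms fun_of_l2 l2_of_fun
proof (rule part_equivpI)
  show "\<exists>g. l2_rel g g"
    by (rule exI[of _ "\<lambda>_. 0"]) (simp add: l2_rel_def square_integrable_def)
  show "symp l2_rel" by (auto simp: symp_def l2_rel_def)
  show "transp l2_rel" by (auto simp: transp_def l2_rel_def)
qed

lemma square_integrable_mult:
  assumes "square_integrable g" "square_integrable h"
  shows "integrable circle_measure (\<lambda>t. g t * h t)"
proof (rule Bochner_Integration.integrable_bound)
  show "integrable circle_measure (\<lambda>t. (g t)\<^sup>2 + (h t)\<^sup>2)"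
    using assms by (auto simp: square_integrable_def)
  show "(\<lambda>t. g t * h t) \<in> borel_measurable circle_measure"
    using assms by (auto simp: square_integrable_def)
  show "AE t in circle_measure. norm (g t * h t) \<le> norm ((g t)\<^sup>2 + (h t)\<^sup>2)"
  proof (rule AE_I2)
    fix t
    have "2 * (\<bar>g t\<bar> * \<bar>h t\<bar>) \<le> (g t)\<^sup>2 + (h t)\<^sup>2"
      using sum_squares_bound[of "\<bar>g t\<bar>" "\<bar>h t\<bar>"] by simp
    moreover have "0 \<le> \<bar>g t\<bar> * \<bar>h t\<bar>" by simp
    ultimately have "\<bar>g t\<bar> * \<bar>h t\<bar> \<le> (g t)\<^sup>2 + (h t)\<^sup>2" by linarith
    then show "norm (g t * h t) \<le> norm ((g t)\<^sup>2 + (h t)\<^sup>2)"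
      by (simp add: abs_mult)
  qed
qed

lemma square_integrable_integrable:
  "square_integrable g \<Longrightarrow> integrable circle_measure g"
  using square_integrable_mult[of g "\<lambda>_. 1"] by (simp add: square_integrable_def)

lemma square_integrable_add:
  assumes "square_integrable g" "square_integrable h"
  shows "square_integrable (\<lambda>t. g t + h t)"
  using assms square_integrable_mult[OF assms]
  by (auto simp: square_integrable_def power2_sum mult.assoc)

lemma square_integrable_scale: "square_integrable g \<Longrightarrow> square_integrable (\<lambda>t. a * g t)"
  by (auto simp: square_integrable_def power_mult_distrib)

lemma l2_relI:
  assumes "square_integrable g" "\<And>t. g t = h t"
  shows "l2_rel g h"
proof -
  have "g = h" using assms(2) by (rule ext)
  then show ?thesis using assms(1) by (simp add: l2_rel_def)
qed

lemma l2_relD: "l2_rel g g \<Longrightarrow> square_integrable g"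
  by (simp add: l2_rel_def)

instantiation l2 :: real_vector
begin

lift_definition zero_l2 :: l2 is "\<lambda>_. 0" by (simp add: l2_rel_def square_integrable_def)
lift_definition plus_l2 :: "l2 \<Rightarrow> l2 \<Rightarrow> l2" is "\<lambda>g h t. g t + h t"
  by (auto simp: l2_rel_def square_integrable_add)
lift_definition scaleR_l2 :: "real \<Rightarrow> l2 \<Rightarrow> l2" is "\<lambda>a g t. a * g t"
  by (auto simp: l2_rel_def square_integrable_scale)
definition uminus_l2 :: "l2 \<Rightarrow> l2" where "uminus_l2 u = (-1) *\<^sub>R u"
definition minus_l2 :: "l2 \<Rightarrow> l2 \<Rightarrow> l2" where "minus_l2 u v = u + (-1) *\<^sub>R v"
instance
proof
  fix x y z :: l2 and a b :: real
  show "x + y + z = x + (y + z)" 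
    by (transfer, rule l2_relI; (intro square_integrable_add square_integrable_scale l2_relD)?;
        simp add: algebra_simps)
  show "x + y = y + x" 
    by (transfer, rule l2_relI; (intro square_integrable_add square_integrable_scale l2_relD)?;
        simp add: algebra_simps)
  show "0 + x = x" 
    by (transfer, rule l2_relI; (simp add: l2_relD)?;
        simp add: algebra_simps)
  show "- x + x = 0" unfolding uminus_l2_def
    by (transfer, rule l2_relI; (intro square_integrable_add square_integrable_scale l2_relD)?;
        simp add: algebra_simps)
  show "x - y = x + - y" unfolding uminus_l2_def minus_l2_def ..
  show "a *\<^sub>R (x + y) = a *\<^sub>R x + a *\<^sub>R y" 
    by (transfer, rule l2_relI; (intro square_integrable_add square_integrable_scale l2_relD)?;
        simp add: algebra_simps)
  show "(a + b) *\<^sub>R x = a *\<^sub>R x + b *\<^sub>R x" 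
    by (transfer, rule l2_relI; (intro square_integrable_add square_integrable_scale l2_relD)?;
        simp add: algebra_simps)
  show "a *\<^sub>R b *\<^sub>R x = (a * b) *\<^sub>R x" 
    by (transfer, rule l2_relI; (intro square_integrable_add square_integrable_scale l2_relD)?;
        simp add: algebra_simps)
  show "1 *\<^sub>R x = x" 
    by (transfer, rule l2_relI; (simp add: l2_relD)?;
        simp add: algebra_simps)
qed

end

instantiation l2 :: real_inner
begin

lift_definition inner_l2 :: "l2 \<Rightarrow> l2 \<Rightarrow> real" is "\<lambda>g h. LINT t|circle_measure. g t * h t"
  by (rule integral_cong_AE) (auto simp: l2_rel_def square_integrable_def)
definition "norm (u::l2) = sqrt (inner u u)"
definition "dist (u::l2) v = norm (u - v)"
definition "sgn (u::l2) = u /\<^sub>R norm u"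
definition "(uniformity :: (l2 \<times> l2) filter) = (INF e\<in>{0<..}. principal {(x, y). dist x y < e})"
definition "open (U :: l2 set) = (\<forall>x\<in>U. eventually (\<lambda>(x', y). x' = x \<longrightarrow> y \<in> U) uniformity)"

instance
proof
  fix x y z :: l2 and a :: real
  show "dist x y = norm (x - y)" by (rule dist_l2_def)
  show "sgn x = x /\<^sub>R norm x" by (rule sgn_l2_def)
  show "(uniformity :: (l2 \<times> l2) filter) = (INF e\<in>{0<..}. principal {(x, y). dist x y < e})"
    by (rule uniformity_l2_def)
  show "open U = (\<forall>x\<in>U. eventually (\<lambda>(x', y). x' = x \<longrightarrow> y \<in> U) uniformity)" for U :: "l2 set"
    by (rule open_l2_def)
  show "norm x = sqrt (inner x x)" by (rule norm_l2_def)
  show "inner x y = inner y x"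
    by transfer (subst mult.commute, rule refl)
  show "inner (x + y) z = inner x z + inner y z"
  proof transfer
    fix g h k assume "l2_rel g g" "l2_rel h h" "l2_rel k k"
    then have "integrable circle_measure (\<lambda>t. g t * k t)" "integrable circle_measure (\<lambda>t. h t * k t)"
      by (auto simp: l2_rel_def intro: square_integrable_mult)
    then show "(LINT t|circle_measure. (g t + h t) * k t) =
        (LINT t|circle_measure. g t * k t) + (LINT t|circle_measure. h t * k t)"
      unfolding distrib_right by (rule Bochner_Integration.integral_add)
  qed
  show "inner (a *\<^sub>R x) y = a * inner x y"
    by transfer (simp add: mult.assoc)
  show "0 \<le> inner x x"
    by transfer (rule integral_nonneg_AE, simp)
  show "inner x x = 0 \<longleftrightarrow> x = 0"
  proof transfer
    fix g assume "l2_rel g g"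
    then have g: "square_integrable g" by (simp add: l2_rel_def)
    then have "(LINT t|circle_measure. g t * g t) = 0 \<longleftrightarrow> (AE t in circle_measure. g t * g t = 0)"
      by (intro integral_nonneg_eq_0_iff_AE square_integrable_mult) auto
    then show "(LINT t|circle_measure. g t * g t) = 0 \<longleftrightarrow> l2_rel g (\<lambda>_. 0)"
      using g by (simp add: l2_rel_def square_integrable_def)
  qed
qed

end

subsection \<open>The Sobolev space\<close>

text \<open>\<open>primitive_l2 g t\<close> is \<open>\<integral>\<^sub>0\<^sup>t g\<close> for \<open>0 \<le> t \<le> 1\<close>.\<close>

lift_definition primitive_l2 :: "l2 \<Rightarrow> real \<Rightarrow> real"
  is "\<lambda>g t. LINT s:{0..<t}|circle_measure. g s"
proof (rule ext)
  fix g h :: "real \<Rightarrow> real" and t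
  assume gh: "l2_rel g h"
  have [measurable]: "indicator {0..<t} \<in> borel_measurable circle_measure"
    unfolding circle_measure_def by (intro measurable_restrict_space1) simp
  have [measurable]: "g \<in> borel_measurable circle_measure" "h \<in> borel_measurable circle_measure"
    using gh by (auto simp: l2_rel_def square_integrable_def)
  have "AE s in circle_measure. g s = h s" using gh by (simp add: l2_rel_def)
  then show "(LINT s:{0..<t}|circle_measure. g s) = (LINT s:{0..<t}|circle_measure. h s)"
    unfolding set_lebesgue_integral_def by (intro integral_cong_AE) (measurable, auto)
qed

lemma space_circle_measure [simp]: "space circle_measure = {0..<1}"
  by (simp add: circle_measure_def space_restrict_space)

lemma integrable_circle_measure_iff:
  fixes g :: "real \<Rightarrow> real"
  shows "integrable circle_measure g \<longleftrightarrow> integrable lborel (\<lambda>x. indicator {0..<1} x * g x)"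
  unfolding circle_measure_def by (simp add: integrable_restrict_space)

lemma set_integral_circle_measure:
  fixes g :: "real \<Rightarrow> real"
  shows "(LINT s:A|circle_measure. g s) = (LINT s:A|lborel. indicator {0..<1} s * g s)"
  unfolding circle_measure_def set_lebesgue_integral_def
  by (simp add: integral_restrict_space mult.left_commute)

lemma integrable_l2_rel: "l2_rel g g \<Longrightarrow> integrable circle_measure g"
  by (simp add: l2_rel_def square_integrable_integrable)

lemma set_integrable_circle_measure:
  fixes g :: "real \<Rightarrow> real"
  assumes "integrable circle_measure g"
  shows "set_integrable circle_measure {0..<t} g"
proof -
  have "integrable lborel (\<lambda>x. indicator {0..<t} x *\<^sub>R (indicator {0..<1} x * g x))"
    using assms by (intro integrable_mult_indicator) (auto simp: integrable_circle_measure_iff)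
  then show ?thesis
    by (simp add: set_integrable_def integrable_circle_measure_iff mult.left_commute)
qed

lemma primitive_l2_linear:
  "primitive_l2 (g + h) t = primitive_l2 g t + primitive_l2 h t"
  "primitive_l2 (a *\<^sub>R g) t = a * primitive_l2 g t"
proof -
  show "primitive_l2 (g + h) t = primitive_l2 g t + primitive_l2 h t"
    by transfer (intro set_integral_add set_integrable_circle_measure integrable_l2_rel)
  show "primitive_l2 (a *\<^sub>R g) t = a * primitive_l2 g t"
    by transfer simp
qed

lemma primitive_zero_AE:
  fixes g :: "real \<Rightarrow> real"
  assumes int: "integrable circle_measure g"
    and zero: "\<And>t. t \<in> {0..1} \<Longrightarrow> (LINT s:{0..<t}|circle_measure. g s) = 0"
  shows "AE t in circle_measure. g t = 0"
proof -
  define G where "G = (\<lambda>x. indicator {0..<1} x * g x)"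
  have G: "integrable lborel G"
    using int by (simp add: integrable_circle_measure_iff G_def)
  have set_G: "set_integrable lborel A G" if "A \<in> sets borel" for A
    unfolding set_integrable_def using that G by (intro integrable_mult_indicator) auto
  have less: "(LINT s:{..<a}|lborel. G s) = 0" for a
  proof -
    have "(LINT s:{..<a}|lborel. G s) = (LINT s:{0..<max 0 (min a 1)}|lborel. G s)"
      unfolding set_lebesgue_integral_def
      by (rule Bochner_Integration.integral_cong) (auto simp: G_def indicator_def)
    also have "\<dots> = 0"
      using zero[of "max 0 (min a 1)"] by (simp add: set_integral_circle_measure G_def)
    finally show ?thesis .
  qed
  have total: "(LINT s:UNIV|lborel. G s) = 0"
  proof -
    have "(LINT s:UNIV|lborel. G s) = (LINT s:{..<1}|lborel. G s)"
      unfolding set_lebesgue_integral_def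
      by (rule Bochner_Integration.integral_cong) (auto simp: G_def indicator_def)
    then show ?thesis using less by simp
  qed
  have borel_sigma: "sets (borel :: real measure) = sigma_sets UNIV (range lessThan)"
    by (subst borel_Iio) simp
  have stable: "Int_stable (range lessThan :: real set set)"
  proof (rule Int_stableI_image)
    show "\<exists>k\<in>UNIV. {..<i} \<inter> {..<j} = {..<k}" for i j :: real
      by (rule bexI[of _ "min i j"]) auto
  qed
  have sub: "range lessThan \<subseteq> Pow (UNIV :: real set)" by simp
  have all: "(LINT s:A|lborel. G s) = 0" if "A \<in> sigma_sets UNIV (range lessThan)" for A
    using stable sub that
  proof (induction rule: sigma_sets_induct_disjoint)
    case (basic A)
    then show ?case using less by auto
  next
    case empty
    show ?case by (simp add: set_lebesgue_integral_def)
  next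
    case (compl A)
    then have A: "A \<in> sets borel" by (simp add: borel_sigma)
    have "(LINT s:A \<union> (UNIV - A)|lborel. G s) =
        (LINT s:A|lborel. G s) + (LINT s:UNIV - A|lborel. G s)"
      using A by (intro set_integral_Un set_G) auto
    then show ?case using total compl.IH by simp
  next
    case (union B)
    then have B: "B i \<in> sets borel" for i by (auto simp: borel_sigma)
    then have "(LINT s:(\<Union>i. B i)|lborel. G s) = (\<Sum>i. (LINT s:B i|lborel. G s))"
      using union.hyps by (intro lebesgue_integral_countable_add set_G)
        (auto simp: disjoint_family_on_def)
    then show ?case using union.IH by simp
  qed
  have "AE x in lborel. G x = 0"
    using G all by (intro density_unique_real) (auto simp: borel_sigma)
  then show ?thesis
    unfolding circle_measure_def
    by (subst AE_restrict_space_iff) (auto simp: G_def elim!: eventually_mono)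
qed

lemma primitive_l2_inject:
  assumes "\<And>t. t \<in> {0..1} \<Longrightarrow> primitive_l2 g t = primitive_l2 h t"
  shows "g = h"
proof -
  have "primitive_l2 (g + (-1) *\<^sub>R h) t = 0" if "t \<in> {0..1}" for t
    using assms[OF that] unfolding primitive_l2_linear by simp
  then have "g + (-1) *\<^sub>R h = 0"
  proof transfer
    fix g h :: "real \<Rightarrow> real"
    assume "l2_rel g g" "l2_rel h h"
      and *: "\<And>t. t \<in> {0..1} \<Longrightarrow> (LINT s:{0..<t}|circle_measure. g s + -1 * h s) = 0"
    then have sq: "square_integrable (\<lambda>t. g t + -1 * h t)"
      by (intro square_integrable_add square_integrable_scale l2_relD)
    have "AE t in circle_measure. g t + -1 * h t = 0"
      using sq * by (intro primitive_zero_AE square_integrable_integrable)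
    with sq show "l2_rel (\<lambda>t. g t + -1 * h t) (\<lambda>_. 0)"
      by (simp add: l2_rel_def) (simp add: square_integrable_def)
  qed
  then show ?thesis by simp
qed

lemma continuous_on_primitive_l2: "continuous_on {0..1} (primitive_l2 g)"
proof transfer
  fix g assume "l2_rel g g"
  then have G: "integrable lborel (\<lambda>x. indicator {0..<1} x * g x)" (is "integrable _ ?G")
    by (simp add: integrable_l2_rel integrable_circle_measure_iff[symmetric])
  have set_G: "set_integrable lborel A ?G" if "A \<in> sets borel" for A
    unfolding set_integrable_def using that G by (intro integrable_mult_indicator) auto
  have eq: "(LINT s:{0..<t}|circle_measure. g s) = integral {0..t} ?G" for t
  proof -
    have "(LINT s:{0..<t}|circle_measure. g s) = integral {0..<t} ?G"
      unfolding set_integral_circle_measure by (intro set_borel_integral_eq_integral set_G) simp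
    also have "\<dots> = integral {0..t} ?G"
      by (rule integral_subset_negligible) (auto intro: negligible_subset[of "{t}"])
    finally show ?thesis .
  qed
  have "?G integrable_on {0..1}"
    by (intro set_borel_integral_eq_integral set_G) simp
  then show "continuous_on {0..1} (\<lambda>t. LINT s:{0..<t}|circle_measure. g s)"
    unfolding eq by (rule indefinite_integral_continuous_1)
qed

text \<open>
  \<open>H\<^sup>1\<close> consists of the absolutely continuous periodic functions with derivative in \<open>L\<^sup>2\<close>: each
  Sobolev class is given by its continuous representative.
\<close>

typedef h1 = "{u :: real \<Rightarrow> real. (\<forall>t. u (t + 1) = u t) \<and>
                 (\<exists>g. \<forall>t\<in>{0..1}. u t = u 0 + primitive_l2 g t)}"
  morphisms fun_of_h1 h1_of_fun
  by (rule exI[of _ "\<lambda>_. 0"])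
     (auto intro!: exI[of _ "0 *\<^sub>R 0"] simp: primitive_l2_linear
       simp del: scaleR_zero_left scaleR_zero_right)

setup_lifting type_definition_h1

definition deriv_h1 :: "h1 \<Rightarrow> l2" where
  "deriv_h1 u = (THE g. \<forall>t\<in>{0..1}. fun_of_h1 u t = fun_of_h1 u 0 + primitive_l2 g t)"

definition l2_of_h1 :: "h1 \<Rightarrow> l2" where
  "l2_of_h1 u = l2_of_fun (fun_of_h1 u)"

lemma deriv_h1_eqI:
  assumes "\<And>t. t \<in> {0..1} \<Longrightarrow> fun_of_h1 u t = fun_of_h1 u 0 + primitive_l2 g t"
  shows "deriv_h1 u = g"
  unfolding deriv_h1_def
proof (rule the_equality)
  show "\<forall>t\<in>{0..1}. fun_of_h1 u t = fun_of_h1 u 0 + primitive_l2 g t"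
    using assms by blast
  fix h assume h: "\<forall>t\<in>{0..1}. fun_of_h1 u t = fun_of_h1 u 0 + primitive_l2 h t"
  show "h = g"
  proof (rule primitive_l2_inject)
    fix t :: real assume t: "t \<in> {0..1}"
    from h t have "fun_of_h1 u t = fun_of_h1 u 0 + primitive_l2 h t" by (rule bspec)
    with assms[OF t] show "primitive_l2 h t = primitive_l2 g t" by linarith
  qed
qed

lemma fun_of_h1_eq_primitive:
  assumes "t \<in> {0..1}"
  shows "fun_of_h1 u t = fun_of_h1 u 0 + primitive_l2 (deriv_h1 u) t"
proof -
  obtain g where g: "\<forall>t\<in>{0..1}. fun_of_h1 u t = fun_of_h1 u 0 + primitive_l2 g t"
    using fun_of_h1[of u] unfolding mem_Collect_eq by blast
  then have "deriv_h1 u = g" by (intro deriv_h1_eqI) blast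
  then show ?thesis using bspec[OF g assms] by (simp only:)
qed

lemma fun_of_h1_periodic: "fun_of_h1 u (t + 1) = fun_of_h1 u t"
  using fun_of_h1[of u] by simp

lemma continuous_on_fun_of_h1: "continuous_on {0..1} (fun_of_h1 u)"
proof -
  have "continuous_on {0..1} (\<lambda>t. fun_of_h1 u 0 + primitive_l2 (deriv_h1 u) t)"
    by (intro continuous_intros continuous_on_primitive_l2)
  then show ?thesis
    by (rule continuous_on_eq) (rule fun_of_h1_eq_primitive[symmetric])
qed

lemma square_integrable_fun_of_h1: "square_integrable (fun_of_h1 u)"
proof -
  have cont: "continuous_on {0..<1} (fun_of_h1 u)"
    by (rule continuous_on_subset[OF continuous_on_fun_of_h1]) auto
  have meas [measurable]: "fun_of_h1 u \<in> borel_measurable circle_measure"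
  proof -
    have "fun_of_h1 u \<in> borel_measurable (restrict_space borel {0..<1})"
      by (rule borel_measurable_continuous_on_restrict[OF cont])
    moreover have "sets circle_measure = sets (restrict_space borel {0..<1})"
      by (simp add: circle_measure_def sets_restrict_space)
    ultimately show ?thesis by (simp cong: measurable_cong_sets)
  qed
  have "bounded (fun_of_h1 u ` {0..1})"
    by (intro compact_imp_bounded compact_continuous_image continuous_on_fun_of_h1) auto
  then obtain b where "\<forall>x\<in>fun_of_h1 u ` {0..1}. norm x \<le> b"
    unfolding bounded_iff by blast
  then have b: "\<And>t. t \<in> {0..1} \<Longrightarrow> \<bar>fun_of_h1 u t\<bar> \<le> b"
    by auto
  have "integrable circle_measure (\<lambda>t. (fun_of_h1 u t)\<^sup>2)"
  proof (rule circle_measure.integrable_const_bound[where B = "b\<^sup>2"])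
    show "AE t in circle_measure. norm ((fun_of_h1 u t)\<^sup>2) \<le> b\<^sup>2"
    proof (rule AE_I2)
      fix t assume "t \<in> space circle_measure"
      then have "\<bar>fun_of_h1 u t\<bar>\<^sup>2 \<le> b\<^sup>2" by (intro power_mono b) auto
      then show "norm ((fun_of_h1 u t)\<^sup>2) \<le> b\<^sup>2" by simp
    qed
  qed simp
  with meas show ?thesis by (simp add: square_integrable_def)
qed

instantiation h1 :: real_vector
begin

lift_definition zero_h1 :: h1 is "\<lambda>_. 0"
  by (auto intro!: exI[of _ "0 *\<^sub>R 0"] simp: primitive_l2_linear
      simp del: scaleR_zero_left scaleR_zero_right)

lift_definition plus_h1 :: "h1 \<Rightarrow> h1 \<Rightarrow> h1" is "\<lambda>u v t. u t + v t"
proof (intro conjI)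
  fix u v :: "real \<Rightarrow> real"
  assume u: "(\<forall>t. u (t + 1) = u t) \<and> (\<exists>g. \<forall>t\<in>{0..1}. u t = u 0 + primitive_l2 g t)"
    and v: "(\<forall>t. v (t + 1) = v t) \<and> (\<exists>g. \<forall>t\<in>{0..1}. v t = v 0 + primitive_l2 g t)"
  then show "\<forall>t. u (t + 1) + v (t + 1) = u t + v t" by simp
  obtain g h where g: "\<forall>t\<in>{0..1}. u t = u 0 + primitive_l2 g t"
    and h: "\<forall>t\<in>{0..1}. v t = v 0 + primitive_l2 h t" using u v by blast
  have "\<forall>t\<in>{0..1}. u t + v t = u 0 + v 0 + primitive_l2 (g + h) t"
  proof
    fix t :: real assume t: "t \<in> {0..1}"
    from bspec[OF g t] bspec[OF h t]
    show "u t + v t = u 0 + v 0 + primitive_l2 (g + h) t"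
      unfolding primitive_l2_linear by linarith
  qed
  then show "\<exists>g. \<forall>t\<in>{0..1}. u t + v t = u 0 + v 0 + primitive_l2 g t" by blast
qed

lift_definition scaleR_h1 :: "real \<Rightarrow> h1 \<Rightarrow> h1" is "\<lambda>a u t. a * u t"
proof (intro conjI)
  fix a and u :: "real \<Rightarrow> real"
  assume u: "(\<forall>t. u (t + 1) = u t) \<and> (\<exists>g. \<forall>t\<in>{0..1}. u t = u 0 + primitive_l2 g t)"
  then show "\<forall>t. a * u (t + 1) = a * u t" by simp
  obtain g where g: "\<forall>t\<in>{0..1}. u t = u 0 + primitive_l2 g t" using u by blast
  have "\<forall>t\<in>{0..1}. a * u t = a * u 0 + primitive_l2 (a *\<^sub>R g) t"
  proof
    fix t :: real assume "t \<in> {0..1}"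
    show "a * u t = a * u 0 + primitive_l2 (a *\<^sub>R g) t"
      by (subst bspec[OF g \<open>t \<in> {0..1}\<close>]) (simp only: primitive_l2_linear distrib_left)
  qed
  then show "\<exists>g. \<forall>t\<in>{0..1}. a * u t = a * u 0 + primitive_l2 g t" by blast
qed

definition uminus_h1 :: "h1 \<Rightarrow> h1" where "uminus_h1 u = (-1) *\<^sub>R u"
definition minus_h1 :: "h1 \<Rightarrow> h1 \<Rightarrow> h1" where "minus_h1 u v = u + (-1) *\<^sub>R v"

instance
proof
  fix x y z :: h1 and a b :: real
  show "x + y + z = x + (y + z)" by transfer (simp add: algebra_simps)
  show "x + y = y + x" by transfer (simp add: algebra_simps)
  show "0 + x = x" by transfer simp
  show "- x + x = 0" unfolding uminus_h1_def by transfer simp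
  show "x - y = x + - y" unfolding uminus_h1_def minus_h1_def ..
  show "a *\<^sub>R (x + y) = a *\<^sub>R x + a *\<^sub>R y" by transfer (simp add: algebra_simps)
  show "(a + b) *\<^sub>R x = a *\<^sub>R x + b *\<^sub>R x" by transfer (simp add: algebra_simps)
  show "a *\<^sub>R b *\<^sub>R x = (a * b) *\<^sub>R x" by transfer (simp add: mult.assoc)
  show "1 *\<^sub>R x = x" by transfer simp
qed

end

lemma deriv_h1_linear:
  "deriv_h1 (u + v) = deriv_h1 u + deriv_h1 v" "deriv_h1 (a *\<^sub>R u) = a *\<^sub>R deriv_h1 u"
proof -
  show "deriv_h1 (u + v) = deriv_h1 u + deriv_h1 v"
  proof (rule deriv_h1_eqI)
    fix t :: real assume "t \<in> {0..1}"
    from fun_of_h1_eq_primitive[OF this, of u] fun_of_h1_eq_primitive[OF this, of v]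
    show "fun_of_h1 (u + v) t = fun_of_h1 (u + v) 0 + primitive_l2 (deriv_h1 u + deriv_h1 v) t"
      unfolding plus_h1.rep_eq primitive_l2_linear by linarith
  qed
  show "deriv_h1 (a *\<^sub>R u) = a *\<^sub>R deriv_h1 u"
  proof (rule deriv_h1_eqI)
    fix t :: real assume "t \<in> {0..1}"
    then show "fun_of_h1 (a *\<^sub>R u) t = fun_of_h1 (a *\<^sub>R u) 0 + primitive_l2 (a *\<^sub>R deriv_h1 u) t"
      unfolding scaleR_h1.rep_eq primitive_l2_linear
      by (subst fun_of_h1_eq_primitive[of t u]) (simp_all only: distrib_left)
  qed
qed

lemma l2_of_h1_linear:
  "l2_of_h1 (u + v) = l2_of_h1 u + l2_of_h1 v" "l2_of_h1 (a *\<^sub>R u) = a *\<^sub>R l2_of_h1 u"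
  unfolding l2_of_h1_def plus_h1.rep_eq scaleR_h1.rep_eq
  by (rule plus_l2.abs_eq[symmetric] scaleR_l2.abs_eq[symmetric];
      simp add: l2_rel_def square_integrable_fun_of_h1)+

lemma h1_eq_0I:
  assumes l2: "l2_of_h1 u = 0" and deriv: "deriv_h1 u = 0"
  shows "u = 0"
proof -
  have const: "fun_of_h1 u t = fun_of_h1 u 0" if "t \<in> {0..1}" for t
  proof -
    have "primitive_l2 (deriv_h1 u) t = 0"
      using primitive_l2_linear(2)[of 0 0 t] unfolding deriv by simp
    with fun_of_h1_eq_primitive[OF that, of u] show ?thesis by linarith
  qed
  have "l2_rel (fun_of_h1 u) (fun_of_h1 u)" "l2_rel (\<lambda>_. 0) (\<lambda>_. 0)"
    by (simp_all add: l2_rel_def square_integrable_fun_of_h1) (simp add: square_integrable_def)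
  with l2 have "l2_rel (fun_of_h1 u) (\<lambda>_. 0)"
    unfolding l2_of_h1_def zero_l2_def
    using Quotient_rel[OF Quotient_l2, of "fun_of_h1 u" "\<lambda>_. 0"] by blast
  then have "AE t in circle_measure. fun_of_h1 u t = 0" by (simp add: l2_rel_def)
  then have AE: "AE t in circle_measure. fun_of_h1 u 0 = 0"
  proof (rule AE_mp, intro AE_I2 impI)
    fix t assume t: "t \<in> space circle_measure" and 0: "fun_of_h1 u t = 0"
    have "t \<in> {0..1}" using t by auto
    from const[OF this] 0 show "fun_of_h1 u 0 = 0" by (rule trans[OF sym])
  qed
  have zero: "fun_of_h1 u 0 = 0"
  proof (rule ccontr)
    assume "fun_of_h1 u 0 \<noteq> 0"
    with AE have "AE t in circle_measure. False" by simp
    then have "emeasure circle_measure (space circle_measure) = 0"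
      by (subst (asm) AE_iff_measurable[OF sets.top]) auto
    then show False
      by (simp add: circle_measure_def emeasure_restrict_space)
  qed
  have "fun_of_h1 u t = 0" for t
  proof -
    have "frac t \<in> {0..1}" by (simp add: frac_lt_1 less_imp_le)
    from trans[OF const[OF this] zero] have "fun_of_h1 u (frac t) = 0" .
    moreover have "fun_of_h1 u (frac t + of_int \<lfloor>t\<rfloor>) = fun_of_h1 u (frac t)"
      by (rule periodic_int_shift) (rule fun_of_h1_periodic)
    moreover have "frac t + of_int \<lfloor>t\<rfloor> = t" by (simp add: frac_def)
    ultimately show ?thesis by (simp only:)
  qed
  then have "fun_of_h1 u = fun_of_h1 0" by (simp add: fun_eq_iff zero_h1.rep_eq)
  then show ?thesis by (simp only: fun_of_h1_inject)
qed

instantiation h1 :: real_inner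
begin

definition inner_h1 :: "h1 \<Rightarrow> h1 \<Rightarrow> real" where
  "inner_h1 u v = inner (l2_of_h1 u) (l2_of_h1 v) + inner (deriv_h1 u) (deriv_h1 v)"
definition "norm (u::h1) = sqrt (inner u u)"
definition "dist (u::h1) v = norm (u - v)"
definition "sgn (u::h1) = u /\<^sub>R norm u"
definition "(uniformity :: (h1 \<times> h1) filter) = (INF e\<in>{0<..}. principal {(x, y). dist x y < e})"
definition "open (U :: h1 set) = (\<forall>x\<in>U. eventually (\<lambda>(x', y). x' = x \<longrightarrow> y \<in> U) uniformity)"

instance
proof
  fix x y z :: h1 and a :: real
  show "dist x y = norm (x - y)" by (rule dist_h1_def)
  show "sgn x = x /\<^sub>R norm x" by (rule sgn_h1_def)
  show "(uniformity :: (h1 \<times> h1) filter) = (INF e\<in>{0<..}. principal {(x, y). dist x y < e})"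
    by (rule uniformity_h1_def)
  show "open U = (\<forall>x\<in>U. eventually (\<lambda>(x', y). x' = x \<longrightarrow> y \<in> U) uniformity)" for U :: "h1 set"
    by (rule open_h1_def)
  show "norm x = sqrt (inner x x)" by (rule norm_h1_def)
  show "inner x y = inner y x" unfolding inner_h1_def by (simp add: inner_commute)
  show "inner (x + y) z = inner x z + inner y z"
    unfolding inner_h1_def l2_of_h1_linear deriv_h1_linear by (simp add: inner_add_left)
  show "inner (a *\<^sub>R x) y = a * inner x y"
    unfolding inner_h1_def l2_of_h1_linear deriv_h1_linear by (simp add: distrib_left)
  show "0 \<le> inner x x" unfolding inner_h1_def by simp
  show "inner x x = 0 \<longleftrightarrow> x = 0"
  proof
    assume "inner x x = 0"
    then have "inner (l2_of_h1 x) (l2_of_h1 x) = 0 \<and> inner (deriv_h1 x) (deriv_h1 x) = 0"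
      unfolding inner_h1_def by (subst (asm) add_nonneg_eq_0_iff) auto
    then show "x = 0" by (intro h1_eq_0I) auto
  next
    assume "x = 0"
    then have "l2_of_h1 x = 0" "deriv_h1 x = 0"
      using l2_of_h1_linear(2)[of 0 x] deriv_h1_linear(2)[of 0 x] by auto
    then show "inner x x = 0" by (simp add: inner_h1_def)
  qed
qed

end

section \<open>The differential operator\<close>

text \<open>Common interface of the two domains \<open>B\<^sup>1\<close>: pointwise evaluation.\<close>

class circle_domain = real_normed_vector +
  fixes ev :: "'a \<Rightarrow> real \<Rightarrow> real"

instantiation c1 :: circle_domain
begin
definition ev_c1 :: "c1 \<Rightarrow> real \<Rightarrow> real" where "ev_c1 = fun_of_c1"
instance ..
end

instantiation h1 :: circle_domain
begin
definition ev_h1 :: "h1 \<Rightarrow> real \<Rightarrow> real" where "ev_h1 = fun_of_h1"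
instance ..
end

text \<open>Common interface of the two codomains \<open>B\<^sup>0\<close>: the element given by a function, and the mean.\<close>

class circle_codomain = real_normed_vector +
  fixes of_fun :: "(real \<Rightarrow> real) \<Rightarrow> 'a"
    and mean :: "'a \<Rightarrow> real"

instantiation c0 :: circle_codomain
begin
definition of_fun_c0 :: "(real \<Rightarrow> real) \<Rightarrow> c0" where "of_fun_c0 = c0_of_fun"
definition mean_c0 :: "c0 \<Rightarrow> real" where
  "mean_c0 v = integral {0..1} (apply_bcontfun (bcontfun_of_c0 v))"
instance ..
end

instantiation l2 :: circle_codomain
begin
definition of_fun_l2 :: "(real \<Rightarrow> real) \<Rightarrow> l2" where "of_fun_l2 = l2_of_fun"
lift_definition mean_l2 :: "l2 \<Rightarrow> real" is "\<lambda>g. LINT t|circle_measure. g t"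
  by (rule integral_cong_AE) (auto simp: l2_rel_def square_integrable_def)
instance ..
end

definition F_C :: "(real \<Rightarrow> real \<Rightarrow> real) \<Rightarrow> c1 \<Rightarrow> c0" where
  "F_C f u = deriv_c1 u + of_fun (\<lambda>t. f t (ev u t))"

definition F_H :: "(real \<Rightarrow> real \<Rightarrow> real) \<Rightarrow> h1 \<Rightarrow> l2" where
  "F_H f u = deriv_h1 u + of_fun (\<lambda>t. f t (ev u t))"

subsection \<open>Hypotheses on the nonlinearity\<close>

text \<open>
  \<open>cont_diff k\<close> is the class \<open>C\<^sup>k\<close> on the plane: all iterated directional derivatives up to order
  \<open>k\<close> exist and are continuous.
\<close>

primrec cont_diff :: "nat \<Rightarrow> (real \<times> real \<Rightarrow> real) \<Rightarrow> bool" where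
  "cont_diff 0 g \<longleftrightarrow> continuous_on UNIV g"
| "cont_diff (Suc k) g \<longleftrightarrow> (\<forall>p. g differentiable at p) \<and>
     (\<forall>h. cont_diff k (\<lambda>p. frechet_derivative g (at p) h))"

definition smooth_on_circle :: "(real \<Rightarrow> real \<Rightarrow> real) \<Rightarrow> bool" where
  "smooth_on_circle f \<longleftrightarrow>
     (\<forall>t x. f (t + 1) x = f t x) \<and> (\<forall>k. cont_diff k (\<lambda>(t, x). f t x))"

definition wild_on :: "real set \<Rightarrow> (real \<Rightarrow> real \<Rightarrow> real) \<Rightarrow> bool" where
  "wild_on I f \<longleftrightarrow>
     (\<integral>\<^sup>+s\<in>I. ennreal (1 / max 1 (SUP t. f t s)) \<partial>lborel) < \<infinity> \<and>
     (\<integral>\<^sup>+s\<in>I. ennreal (1 / max 1 (SUP t. - f t s)) \<partial>lborel) < \<infinity>"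

definition tame :: "(real \<Rightarrow> real \<Rightarrow> real) \<Rightarrow> bool" where
  "tame f \<longleftrightarrow> \<not> wild_on {0..} f \<and> \<not> wild_on {..0} f"

subsection \<open>Normal form and Morin singularities\<close>

definition const :: "real \<Rightarrow> 'b :: circle_codomain" where
  "const c = of_fun (\<lambda>_. c)"

definition Psi :: "('a :: circle_domain \<Rightarrow> 'b :: circle_codomain) \<Rightarrow> 'a \<Rightarrow> 'b" where
  "Psi F u = F u - const (mean (F u)) + const (integral {0..1} (ev u))"

text \<open>
  With \<open>B\<^sup>0 = {v. mean v = 0} \<oplus> \<real>\<close>, the pair \<open>(v, s)\<close> stands for \<open>v + const s\<close>, and
  \<open>F \<circ> \<Psi>\<inverse>\<close> maps it to \<open>(v, Phi F v s)\<close>.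
\<close>

definition Phi :: "('a :: circle_domain \<Rightarrow> 'b :: circle_codomain) \<Rightarrow> 'b \<Rightarrow> real \<Rightarrow> real" where
  "Phi F v s = mean (F (inv (Psi F) (v + const s)))"

definition D2_Phi ::
    "('a :: circle_domain \<Rightarrow> 'b :: circle_codomain) \<Rightarrow> nat \<Rightarrow> 'b \<Rightarrow> real" where
  "D2_Phi F j v = (deriv ^^ j) (Phi F (v - const (mean v))) (mean v)"

definition S_set :: "('a :: circle_domain \<Rightarrow> 'b :: circle_codomain) \<Rightarrow> nat \<Rightarrow> 'a set" where
  "S_set F k = {u. \<forall>j\<in>{1..k}. D2_Phi F j (Psi F u) = 0}"

text \<open>
  \<open>surj_derivative m G x\<close>: the map \<open>(G 1, \<dots>, G m)\<close> into \<open>\<real>\<^sup>m\<close> is differentiable at \<open>x\<close> with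
  surjective derivative.  Elements of \<open>\<real>\<^sup>m\<close> are functions considered on \<open>{1..m}\<close> only.
\<close>

definition surj_derivative ::
    "nat \<Rightarrow> (nat \<Rightarrow> 'a :: real_normed_vector \<Rightarrow> real) \<Rightarrow> 'a \<Rightarrow> bool" where
  "surj_derivative m G x \<longleftrightarrow> (\<exists>D. (\<forall>i\<in>{1..m}. (G i has_derivative D i) (at x)) \<and>
     (\<forall>y :: nat \<Rightarrow> real. \<exists>h. \<forall>i\<in>{1..m}. D i h = y i))"

definition regular_value :: "('a :: real_normed_vector \<Rightarrow> real) \<Rightarrow> real \<Rightarrow> bool" where
  "regular_value G c \<longleftrightarrow> (\<forall>x. G x = c \<longrightarrow> (\<exists>D. (G has_derivative D) (at x) \<and> surj D))"

definition morin_singularity ::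
    "('a :: circle_domain \<Rightarrow> 'b :: circle_codomain) \<Rightarrow> nat \<Rightarrow> 'a \<Rightarrow> bool" where
  "morin_singularity F k u \<longleftrightarrow>
     (\<forall>j\<in>{1..k}. D2_Phi F j (Psi F u) = 0) \<and>
     D2_Phi F (k + 1) (Psi F u) \<noteq> 0 \<and>
     surj_derivative (k - 1) (D2_Phi F) (Psi F u)"

subsection \<open>The functionals \<open>\<Sigma>\<^sub>k\<close>\<close>

definition D2 :: "nat \<Rightarrow> (real \<Rightarrow> real \<Rightarrow> real) \<Rightarrow> real \<Rightarrow> real \<Rightarrow> real" where
  "D2 j f t x = (deriv ^^ j) (f t) x"

definition kappa :: "real \<Rightarrow> real" where
  "kappa x = x - of_int \<lfloor>x\<rfloor> - 1 / 2"

definition weight :: "(real \<Rightarrow> real \<Rightarrow> real) \<Rightarrow> (real \<Rightarrow> real) \<Rightarrow> real \<Rightarrow> real" where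
  "weight f u t = exp (- integral {0..1} (\<lambda>s. kappa (s - t) * D2 1 f s (u s)))"

definition A_fun :: "(real \<Rightarrow> real \<Rightarrow> real) \<Rightarrow> (real \<Rightarrow> real) \<Rightarrow> real \<Rightarrow> real" where
  "A_fun f u t = integral {0..t} (\<lambda>s. D2 2 f s (u s) * weight f u s)"

definition Sigma1 :: "(real \<Rightarrow> real \<Rightarrow> real) \<Rightarrow> (real \<Rightarrow> real) \<Rightarrow> real" where
  "Sigma1 f u = integral {0..1} (\<lambda>t. D2 1 f t (u t))"

definition Sigma2 :: "(real \<Rightarrow> real \<Rightarrow> real) \<Rightarrow> (real \<Rightarrow> real) \<Rightarrow> real" where
  "Sigma2 f u = integral {0..1} (\<lambda>t. D2 2 f t (u t) * weight f u t)"

definition Sigma3 :: "(real \<Rightarrow> real \<Rightarrow> real) \<Rightarrow> (real \<Rightarrow> real) \<Rightarrow> real" where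
  "Sigma3 f u = integral {0..1} (\<lambda>t. D2 3 f t (u t) * weight f u t ^ 2)"

definition Sigma4 :: "(real \<Rightarrow> real \<Rightarrow> real) \<Rightarrow> (real \<Rightarrow> real) \<Rightarrow> real" where
  "Sigma4 f u = integral {0..1} (\<lambda>t.
     D2 4 f t (u t) * weight f u t ^ 3
     - 2 * D2 3 f t (u t) * weight f u t ^ 2 * A_fun f u t)"

definition Sigma5 :: "(real \<Rightarrow> real \<Rightarrow> real) \<Rightarrow> (real \<Rightarrow> real) \<Rightarrow> real" where
  "Sigma5 f u = integral {0..1} (\<lambda>t.
     D2 5 f t (u t) * weight f u t ^ 4
     - 5 * D2 4 f t (u t) * weight f u t ^ 3 * A_fun f u t
     + 5 * D2 3 f t (u t) * weight f u t ^ 2 * (A_fun f u t) ^ 2)"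

definition Sigma_fun :: "(real \<Rightarrow> real \<Rightarrow> real) \<Rightarrow> nat \<Rightarrow> 'a :: circle_domain \<Rightarrow> real" where
  "Sigma_fun f i u =
     [Sigma1 f (ev u), Sigma2 f (ev u), Sigma3 f (ev u), Sigma4 f (ev u), Sigma5 f (ev u)] ! (i - 1)"

end

(* A primitive of the right-hand side turns u' + f(t,u) = v + c into an integral equation for
   continuous functions, which treats the two pairs of spaces at once.  Tameness bounds the periodic
   solutions of prescribed mean a priori; existence follows from a fixed point argument for the
   truncated nonlinearity, and differences of solutions solve linear equations, so Psi is a bijection
   whose inverse is locally Lipschitz and differentiable.

   Along a fibre s |-> U(s) = Psi^{-1}(v + s) one has dU/ds = p with p' + D2 f(t,U) p = phi',
   which is solved explicitly: phi' = g Sigma_1 with g > 0, and p = c w modulo Sigma_1 with c > 0.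
   Differentiating the functionals along the fibre gives
     d/ds Sigma_i = c Sigma_{i+1}   modulo   Sigma_1, ..., Sigma_i.
   Hence D_2^i phi = h_ii Sigma_i + ... + h_i1 Sigma_1 with h_ii > 0 and continuous coefficients.
   Where the Sigma_j vanish this triangular relation transports vanishing, differentiability and
   surjectivity of the derivative between the two families; no regularity of the coefficients beyond
   continuity is needed. *)
theory Submission
  imports Defs
begin

section \<open>Periodic solutions for bounded nonlinearities\<close>

text \<open>Elements of \<open>l2\<close> have no pointwise values; what the norm of B^0 controls in
  both cases is the total variation of the primitive. This is why the a priori estimate measures
  transit times of continuous functions instead of using differential inequalities, and why the
  forcing is subtracted wherever a C^1 function is wanted. Higher derivatives are taken along a
  fibre only. There the difference quotient of two solutions solves a linear periodic equation with
  an averaged slope, so Caratheodory's criterion yields the derivative as an explicit functional of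
  the solution itself, and this formula bootstraps to all orders. Where Sigma_1 = 0 the tangent p is
  an exact multiple of w, but moving along the fibre leaves this set. The error terms are therefore
  kept as multiples of the Sigma_j with coefficients that can be differentiated and integrated
  again, which leads to ideals with smooth coefficients. The factor Sigma_1 is always extracted from
  exp(m t) - 1 = m times a cofactor regular at m = 0.\<close>

lemma abs_integral_le:
  fixes g :: "real \<Rightarrow> real"
  assumes "continuous_on {a..b} g" "a \<le> b" "\<And>t. t \<in> {a..b} \<Longrightarrow> \<bar>g t\<bar> \<le> C"
  shows "\<bar>integral {a..b} g\<bar> \<le> C * (b - a)"
  using integral_bound[OF assms(2,1), of C] assms(3) by simp

lemma continuous_on_compose_graph:
  fixes h :: "real \<Rightarrow> real \<Rightarrow> real"
  assumes "continuous_on ({0..1} \<times> UNIV) (\<lambda>(t, x). h t x)" "continuous_on S u" "S \<subseteq> {0..1}"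
  shows "continuous_on S (\<lambda>t. h t (u t))"
proof -
  have "continuous_on S (\<lambda>t. (\<lambda>(t, x). h t x) (t, u t))"
    by (rule continuous_on_compose2[OF assms(1)]) (use assms in \<open>auto intro!: continuous_intros\<close>)
  then show ?thesis by simp
qed

text \<open>The fixed point theorem is applied in the space of bounded continuous functions on the
  whole line; a function given on [0,1] is extended to it by its end values.\<close>

definition unit_clamp :: "real \<Rightarrow> real" where
  "unit_clamp t = max 0 (min 1 t)"

lemma unit_clamp_mem: "unit_clamp t \<in> {0..1}"
  by (simp add: unit_clamp_def)

lemma unit_clamp_id: "t \<in> {0..1} \<Longrightarrow> unit_clamp t = t"
  by (simp add: unit_clamp_def)

lemma unit_clamp_bcontfun:
  fixes g :: "real \<Rightarrow> real"
  assumes "continuous_on {0..1} g"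
  shows "(\<lambda>t. g (unit_clamp t)) \<in> bcontfun"
proof -
  have "continuous_on UNIV unit_clamp"
    unfolding unit_clamp_def by (intro continuous_intros)
  then have "continuous_on UNIV (\<lambda>t. g (unit_clamp t))"
    by (rule continuous_on_compose2[OF assms]) (use unit_clamp_mem in auto)
  moreover have "bounded (g ` {0..1})"
    by (intro compact_imp_bounded compact_continuous_image assms) auto
  then have "bounded (range (\<lambda>t. g (unit_clamp t)))"
    by (rule bounded_subset) (use unit_clamp_mem in auto)
  ultimately show ?thesis by (simp add: bcontfun_def)
qed

lemma integral_exp_weight:
  fixes L t :: real
  assumes "0 < L" "0 \<le> t"
  shows "integral {0..t} (\<lambda>s. exp (2 * L * s)) = (exp (2 * L * t) - 1) / (2 * L)"
proof -
  have "((\<lambda>s. exp (2 * L * s)) has_integral exp (2 * L * t) / (2 * L) - exp (2 * L * 0) / (2 * L)) {0..t}"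
    using assms
    by (intro fundamental_theorem_of_calculus)
       (auto intro!: derivative_eq_intros simp flip: has_real_derivative_iff_has_vector_derivative)
  then show ?thesis by (simp add: integral_unique diff_divide_distrib)
qed

text \<open>
  The weight \<open>exp (- 2 L t)\<close> turns the Volterra operator of an \<open>L\<close>-Lipschitz function into a
  contraction on the whole interval.
\<close>

lemma volterra_weighted_contraction:
  fixes h :: "real \<Rightarrow> real \<Rightarrow> real"
  assumes h: "continuous_on ({0..1} \<times> UNIV) (\<lambda>(t, x). h t x)"
    and lip: "\<And>t x y. t \<in> {0..1} \<Longrightarrow> \<bar>h t x - h t y\<bar> \<le> L * \<bar>x - y\<bar>"
    and L: "0 < L" and t: "t \<in> {0..1}"
    and u: "continuous_on {0..1} u1" "continuous_on {0..1} u2"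
    and D: "\<And>s. s \<in> {0..1} \<Longrightarrow> \<bar>u1 s - u2 s\<bar> \<le> exp (2 * L * s) * D"
  shows "exp (- (2 * L * t)) * \<bar>integral {0..t} (\<lambda>s. h s (u1 s)) - integral {0..t} (\<lambda>s. h s (u2 s))\<bar>
    \<le> D / 2"
proof -
  have c: "continuous_on {0..t} (\<lambda>s. h s (u1 s))" "continuous_on {0..t} (\<lambda>s. h s (u2 s))"
    using t by (auto intro!: continuous_on_compose_graph[OF h] continuous_on_subset[OF u(1)]
        continuous_on_subset[OF u(2)])
  have "0 \<le> D" using D[of 0] by simp
  have "\<bar>integral {0..t} (\<lambda>s. h s (u1 s)) - integral {0..t} (\<lambda>s. h s (u2 s))\<bar>
      = norm (integral {0..t} (\<lambda>s. h s (u1 s) - h s (u2 s)))"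
    using c by (subst integral_diff) (auto intro!: integrable_continuous_real)
  also have "\<dots> \<le> integral {0..t} (\<lambda>s. L * D * exp (2 * L * s))"
  proof (rule integral_norm_bound_integral)
    fix s assume "s \<in> {0..t}"
    then have s: "s \<in> {0..1}" using t by auto
    have "\<bar>h s (u1 s) - h s (u2 s)\<bar> \<le> L * \<bar>u1 s - u2 s\<bar>" by (rule lip[OF s])
    also have "\<dots> \<le> L * (exp (2 * L * s) * D)"
      using L D[OF s] by (intro mult_left_mono) auto
    finally show "norm (h s (u1 s) - h s (u2 s)) \<le> L * D * exp (2 * L * s)"
      by (simp add: mult_ac)
  qed (auto intro!: integrable_continuous_real continuous_intros c)
  also have "\<dots> = L * D * ((exp (2 * L * t) - 1) / (2 * L))"
    using integral_exp_weight[OF L, of t] t by simp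
  also have "\<dots> = D / 2 * (exp (2 * L * t) - 1)"
    using L by (simp add: field_simps)
  also have "\<dots> \<le> D / 2 * exp (2 * L * t)"
    using \<open>0 \<le> D\<close> by (intro mult_left_mono) auto
  finally have "exp (- (2 * L * t)) * \<bar>integral {0..t} (\<lambda>s. h s (u1 s)) - integral {0..t} (\<lambda>s. h s (u2 s))\<bar>
      \<le> exp (- (2 * L * t)) * (D / 2 * exp (2 * L * t))"
    by (intro mult_left_mono) auto
  also have "\<dots> = D / 2" by (simp add: exp_minus)
  finally show ?thesis .
qed

text \<open>A Gronwall estimate read off the weighted norm: at the maximum of \<open>m\<close> the
  contraction absorbs half of \<open>m s0\<close>, which leaves
  \<open>m s0 \<le> 2 * e\<close>.\<close>

lemma volterra_lipschitz_dependence: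
  fixes h :: "real \<Rightarrow> real \<Rightarrow> real"
  assumes h: "continuous_on ({0..1} \<times> UNIV) (\<lambda>(t, x). h t x)"
    and lip: "\<And>t x y. t \<in> {0..1} \<Longrightarrow> \<bar>h t x - h t y\<bar> \<le> L * \<bar>x - y\<bar>"
    and L: "0 < L"
    and u: "continuous_on {0..1} u1" "continuous_on {0..1} u2"
    and eq1: "\<And>t. t \<in> {0..1} \<Longrightarrow> u1 t = G1 t - integral {0..t} (\<lambda>s. h s (u1 s))"
    and eq2: "\<And>t. t \<in> {0..1} \<Longrightarrow> u2 t = G2 t - integral {0..t} (\<lambda>s. h s (u2 s))"
    and G: "\<And>t. t \<in> {0..1} \<Longrightarrow> \<bar>G1 t - G2 t\<bar> \<le> e"
    and t: "t \<in> {0..1}"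
  shows "\<bar>u1 t - u2 t\<bar> \<le> 2 * exp (2 * L) * e"
proof -
  define m where "m = (\<lambda>s. exp (- (2 * L * s)) * \<bar>u1 s - u2 s\<bar>)"
  have "continuous_on {0..1} m" unfolding m_def by (intro continuous_intros u)
  then obtain s0 where s0: "s0 \<in> {0..1}" "\<And>s. s \<in> {0..1} \<Longrightarrow> m s \<le> m s0"
    using continuous_attains_sup[of "{0..1::real}" m] by auto
  have D: "\<bar>u1 s - u2 s\<bar> \<le> exp (2 * L * s) * m s0" if "s \<in> {0..1}" for s
  proof -
    have "\<bar>u1 s - u2 s\<bar> = exp (2 * L * s) * m s"
      unfolding m_def by (simp add: exp_minus)
    then show ?thesis using s0(2)[OF that] by simp
  qed
  have e0: "0 \<le> e" using G[of 0] abs_ge_zero order_trans by fastforce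
  have "m s0 \<le> exp (- (2 * L * s0)) * (\<bar>G1 s0 - G2 s0\<bar> +
      \<bar>integral {0..s0} (\<lambda>s. h s (u1 s)) - integral {0..s0} (\<lambda>s. h s (u2 s))\<bar>)"
    unfolding m_def
  proof (rule mult_left_mono)
    show "\<bar>u1 s0 - u2 s0\<bar> \<le> \<bar>G1 s0 - G2 s0\<bar> +
        \<bar>integral {0..s0} (\<lambda>s. h s (u1 s)) - integral {0..s0} (\<lambda>s. h s (u2 s))\<bar>"
      by (subst eq1[OF s0(1)], subst eq2[OF s0(1)]) linarith
  qed simp
  also have "\<dots> \<le> e + m s0 / 2"
  proof -
    have "exp (- (2 * L * s0)) * \<bar>G1 s0 - G2 s0\<bar> \<le> 1 * e"
      using s0(1) L e0 by (intro mult_mono G) auto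
    then show ?thesis
      using volterra_weighted_contraction[OF h lip L s0(1) u D] by (simp add: distrib_left)
  qed
  finally have "m s0 \<le> 2 * e" by simp
  have "\<bar>u1 t - u2 t\<bar> \<le> exp (2 * L * t) * m s0" by (rule D[OF t])
  also have "\<dots> \<le> exp (2 * L) * (2 * e)"
    using \<open>m s0 \<le> 2 * e\<close> t L e0
    by (intro mult_mono) (auto simp: m_def mult_left_le)
  finally show ?thesis by (simp add: mult_ac)
qed

text \<open>In the weighted norm the Volterra operator contracts by the factor 1/2 on all of [0,1],
  so a single fixed point covers the whole interval.\<close>

lemma volterra_existence:
  fixes h :: "real \<Rightarrow> real \<Rightarrow> real"
  assumes h: "continuous_on ({0..1} \<times> UNIV) (\<lambda>(t, x). h t x)"
    and lip: "\<And>t x y. t \<in> {0..1} \<Longrightarrow> \<bar>h t x - h t y\<bar> \<le> L * \<bar>x - y\<bar>"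
    and L: "0 < L"
    and G: "continuous_on {0..1} G"
  obtains u where "continuous_on {0..1} u"
    "\<And>t. t \<in> {0..1} \<Longrightarrow> u t = G t - integral {0..t} (\<lambda>s. h s (u s))"
proof -
  \<comment> \<open>The fixed point is sought for \<open>y t = exp (- (2 * L * t)) * u t\<close>:
    its sup norm is the weighted norm of \<open>u\<close>, and \<open>W y\<close> recovers
    \<open>u\<close>.\<close>
  define W :: "(real \<Rightarrow>\<^sub>C real) \<Rightarrow> real \<Rightarrow> real" where "W y s = exp (2 * L * s) * y s" for y s
  define R where "R y t = exp (- (2 * L * t)) * (G t - integral {0..t} (\<lambda>s. h s (W y s)))" for y t
  define T where "T y = Bcontfun (\<lambda>t. R y (unit_clamp t))" for y
  have contW: "continuous_on S (W y)" for S y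
    unfolding W_def by (intro continuous_intros continuous_on_apply_bcontfun continuous_on_id)
  have contR: "continuous_on {0..1} (R y)" for y
    unfolding R_def
    by (intro continuous_intros G indefinite_integral_continuous_1 integrable_continuous_real
        continuous_on_compose_graph[OF h] contW order_refl)
  have T: "apply_bcontfun (T y) t = R y (unit_clamp t)" for y t
    unfolding T_def using unit_clamp_bcontfun[OF contR] by (simp add: Bcontfun_inverse)
  have "dist (T y) (T z) \<le> 1 / 2 * dist y z" for y z
  proof (rule dist_bound)
    fix t
    define s where "s = unit_clamp t"
    have s: "s \<in> {0..1}" unfolding s_def by (rule unit_clamp_mem)
    have "\<bar>W y r - W z r\<bar> \<le> exp (2 * L * r) * dist y z" for r
    proof -
      have "\<bar>W y r - W z r\<bar> = exp (2 * L * r) * dist (y r) (z r)"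
        unfolding W_def dist_real_def by (simp add: abs_mult right_diff_distrib[symmetric])
      then show ?thesis by (simp add: dist_bounded)
    qed
    then have "exp (- (2 * L * s)) *
        \<bar>integral {0..s} (\<lambda>r. h r (W y r)) - integral {0..s} (\<lambda>r. h r (W z r))\<bar> \<le> dist y z / 2"
      by (intro volterra_weighted_contraction[OF h lip L s] contW)
    then show "dist (T y t) (T z t) \<le> 1 / 2 * dist y z"
      unfolding T s_def[symmetric] dist_real_def R_def right_diff_distrib[symmetric] abs_mult
      by (simp add: abs_minus_commute)
  qed
  then have "\<exists>!y. T y = y" by (intro banach_fix_type[of "1/2"]) auto
  then obtain y where y: "T y = y" by blast
  have "W y t = G t - integral {0..t} (\<lambda>s. h s (W y s))" if "t \<in> {0..1}" for t
    using T[of y t] unfolding y unit_clamp_id[OF that] by (simp add: W_def R_def exp_minus)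
  with contW show ?thesis by (rule that)
qed

text \<open>
  In the notation of the paper: \<open>u' + h(t,u) = v + c\<close> for a primitive \<open>V\<close> of \<open>v\<close>, with \<open>u\<close>
  periodic of mean \<open>s\<close>.
\<close>

definition periodic_solution ::
    "(real \<Rightarrow> real \<Rightarrow> real) \<Rightarrow> (real \<Rightarrow> real) \<Rightarrow> real \<Rightarrow> real \<Rightarrow> (real \<Rightarrow> real) \<Rightarrow> bool" where
  "periodic_solution h V c s u \<longleftrightarrow> continuous_on {0..1} u \<and>
     (\<forall>t\<in>{0..1}. u t = u 0 + V t + c * t - integral {0..t} (\<lambda>r. h r (u r))) \<and>
     u 1 = u 0 \<and> integral {0..1} u = s"

lemma periodic_solutionD:
  assumes "periodic_solution h V c s u"
  shows "continuous_on {0..1} u"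
    "t \<in> {0..1} \<Longrightarrow> u t = u 0 + V t + c * t - integral {0..t} (\<lambda>r. h r (u r))"
    "u 1 = u 0" "integral {0..1} u = s"
  using assms unfolding periodic_solution_def by blast+

text \<open>
  The pair \<open>(u 0, c)\<close> is found as a fixed point of a continuous map of a rectangle into itself:
  integrating the equation expresses both numbers through integrals of \<open>h(t,u)\<close>.
\<close>

lemma periodic_solution_bounded_existence:
  fixes h :: "real \<Rightarrow> real \<Rightarrow> real"
  assumes h: "continuous_on ({0..1} \<times> UNIV) (\<lambda>(t, x). h t x)"
    and lip: "\<And>t x y. t \<in> {0..1} \<Longrightarrow> \<bar>h t x - h t y\<bar> \<le> L * \<bar>x - y\<bar>"
    and bound: "\<And>t x. t \<in> {0..1} \<Longrightarrow> \<bar>h t x\<bar> \<le> M"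
    and V: "continuous_on {0..1} V" "V 0 = 0" "V 1 = 0"
  shows "\<exists>c u. periodic_solution h V c s u"
proof -
  define L' where "L' = max L 1"
  have L': "0 < L'" "\<bar>h t x - h t y\<bar> \<le> L' * \<bar>x - y\<bar>" if "t \<in> {0..1}" for t x y
  proof -
    show "0 < L'" by (simp add: L'_def)
    have "L * \<bar>x - y\<bar> \<le> L' * \<bar>x - y\<bar>" unfolding L'_def by (intro mult_right_mono) auto
    then show "\<bar>h t x - h t y\<bar> \<le> L' * \<bar>x - y\<bar>" using lip[OF that, of x y] by linarith
  qed
  have L'0: "0 < L'" by (simp add: L'_def)
  have "\<exists>u. continuous_on {0..1} u \<and>
      (\<forall>t\<in>{0..1}. u t = (fst p + V t + snd p * t) - integral {0..t} (\<lambda>r. h r (u r)))" for p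
    by (rule volterra_existence[OF h L'(2) L'0, of "\<lambda>t. fst p + V t + snd p * t"])
       (auto intro!: continuous_intros V)
  then obtain U where U: "\<And>p. continuous_on {0..1} (U p)"
    "\<And>p t. t \<in> {0..1} \<Longrightarrow> U p t = (fst p + V t + snd p * t) - integral {0..t} (\<lambda>r. h r (U p r))"
    by metis
  define H where "H p t = integral {0..t} (\<lambda>r. h r (U p r))" for p t
  define Vb where "Vb = integral {0..1} V"
  \<comment> \<open>For the solution started at \<open>p = (u 0, c)\<close>, the components are the
    condition \<open>integral {0..1} u = s\<close> solved for \<open>u 0\<close> and the condition
    \<open>u 1 = u 0\<close> solved for \<open>c\<close>.\<close>
  define T where "T p = (s - Vb - snd p / 2 + integral {0..1} (H p), H p 1)" for p :: "real \<times> real"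
  have M: "0 \<le> M" using bound[of 0 0] by simp
  have contH: "continuous_on {0..1} (H p)" for p
    unfolding H_def
    by (intro indefinite_integral_continuous_1 integrable_continuous_real
        continuous_on_compose_graph[OF h] U order_refl)
  have boundH: "\<bar>H p t\<bar> \<le> M" if "t \<in> {0..1}" for p t
  proof -
    have "\<bar>H p t\<bar> \<le> M * (t - 0)"
      unfolding H_def using that
      by (intro abs_integral_le continuous_on_compose_graph[OF h] bound
          continuous_on_subset[OF U(1)]) auto
    also have "\<dots> \<le> M" using that M by (simp add: mult_left_le)
    finally show ?thesis .
  qed
  have lipU: "\<bar>U p t - U q t\<bar> \<le> 2 * exp (2 * L') * (2 * dist p q)" if "t \<in> {0..1}" for p q t
  proof (rule volterra_lipschitz_dependence[OF h L'(2) L'0 U(1) U(1) U(2) U(2) _ that])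
    fix t :: real assume t: "t \<in> {0..1}"
    have "\<bar>(snd p - snd q) * t\<bar> \<le> \<bar>snd p - snd q\<bar>"
      using t by (simp add: abs_mult mult_left_le)
    moreover have "\<bar>fst p - fst q\<bar> \<le> dist p q" "\<bar>snd p - snd q\<bar> \<le> dist p q"
      using dist_fst_le[of p q] dist_snd_le[of p q] by (simp_all add: dist_real_def)
    ultimately show "\<bar>(fst p + V t + snd p * t) - (fst q + V t + snd q * t)\<bar> \<le> 2 * dist p q"
      by (simp add: algebra_simps)
  qed
  define K where "K = L' * (2 * exp (2 * L') * 2)"
  have lipH: "\<bar>H p t - H q t\<bar> \<le> K * dist p q" if t: "t \<in> {0..1}" for p q t
  proof -
    have c: "continuous_on {0..t} (\<lambda>r. h r (U p r))" for p
      using t by (intro continuous_on_compose_graph[OF h] continuous_on_subset[OF U(1)]) auto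
    have "H p t - H q t = integral {0..t} (\<lambda>r. h r (U p r) - h r (U q r))"
      unfolding H_def by (rule integral_diff[symmetric]) (auto intro!: integrable_continuous_real c)
    moreover have "\<bar>\<dots>\<bar> \<le> K * dist p q * (t - 0)"
    proof (rule abs_integral_le)
      fix r assume "r \<in> {0..t}"
      then have r: "r \<in> {0..1}" using t by auto
      have "\<bar>h r (U p r) - h r (U q r)\<bar> \<le> L' * \<bar>U p r - U q r\<bar>" by (rule L'(2)[OF r])
      also have "\<dots> \<le> L' * (2 * exp (2 * L') * (2 * dist p q))"
        using lipU[OF r] L'0 by (intro mult_left_mono) auto
      finally show "\<bar>h r (U p r) - h r (U q r)\<bar> \<le> K * dist p q" by (simp add: K_def mult_ac)
    qed (use t in \<open>auto intro!: continuous_intros c\<close>)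
    moreover have "K * dist p q * (t - 0) \<le> K * dist p q"
      using t L'0 by (simp add: mult_left_le K_def)
    ultimately show ?thesis by linarith
  qed
  have K0: "0 < K" using L'0 by (simp add: K_def)
  have dist_cont: "continuous_on UNIV g" if "\<And>p q. \<bar>g p - g q\<bar> \<le> K * dist p q"
    for g :: "real \<times> real \<Rightarrow> real"
    unfolding continuous_on_iff
  proof (intro ballI allI impI)
    fix p :: "real \<times> real" and e :: real assume "0 < e"
    show "\<exists>d>0. \<forall>q\<in>UNIV. dist q p < d \<longrightarrow> dist (g q) (g p) < e"
    proof (intro exI[of _ "e / K"] conjI ballI impI)
      show "0 < e / K" using \<open>0 < e\<close> K0 by simp
      fix q assume "dist q p < e / K"
      then have "K * dist q p < e" using K0 by (simp add: field_simps)
      then show "dist (g q) (g p) < e" using that[of q p] by (simp add: dist_real_def)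
    qed
  qed
  have "\<bar>integral {0..1} (H p) - integral {0..1} (H q)\<bar> \<le> K * dist p q" for p q
  proof -
    have "integral {0..1} (H p) - integral {0..1} (H q) = integral {0..1} (\<lambda>t. H p t - H q t)"
      by (rule integral_diff[symmetric]) (auto intro!: integrable_continuous_real contH)
    moreover have "\<bar>\<dots>\<bar> \<le> K * dist p q * (1 - 0)"
      by (rule abs_integral_le) (auto intro!: continuous_intros contH lipH)
    ultimately show ?thesis by simp
  qed
  then have contT: "continuous_on S T" for S
    unfolding T_def
    by (intro continuous_intros continuous_on_subset[OF dist_cont] subset_UNIV lipH) auto
  \<comment> \<open>As \<open>H\<close> is bounded by \<open>M\<close>, the second component of
    \<open>T p\<close> is at most \<open>M\<close> in size, and the first then differs from
    \<open>s - Vb\<close> by at most \<open>M / 2 + M\<close>.\<close>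
  define S where "S = cbox (s - Vb - M / 2 - M, - M) (s - Vb + M / 2 + M, M)"
  have "T \<in> S \<rightarrow> S"
  proof
    fix p assume "p \<in> S"
    then have "\<bar>snd p\<bar> \<le> M" by (cases p) (auto simp: S_def mem_box Basis_prod_def)
    moreover have "\<bar>integral {0..1} (H p)\<bar> \<le> M * (1 - 0)"
      by (rule abs_integral_le) (auto intro!: contH boundH)
    moreover have "\<bar>H p 1\<bar> \<le> M" by (rule boundH) simp
    ultimately show "T p \<in> S" by (auto simp: S_def T_def)
  qed
  moreover have "(s - Vb, 0) \<in> S" using M by (auto simp: S_def)
  then have "S \<noteq> {}" by blast
  moreover have "compact S" "convex S" by (simp_all add: S_def compact_cbox convex_box)
  ultimately obtain p where p: "T p = p"
    using brouwer[of S T] contT by blast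
  then have p1: "fst p = s - Vb - snd p / 2 + integral {0..1} (H p)" and p2: "snd p = H p 1"
    by (simp_all add: T_def prod_eq_iff)
  have U_H: "U p t = fst p + V t + snd p * t - H p t" if "t \<in> {0..1}" for t
    using U(2)[OF that, of p] by (simp add: H_def)
  have U0: "U p 0 = fst p" using U_H[of 0] V(2) by (simp add: H_def)
  have "integral {0..1} (U p) = integral {0..1} (\<lambda>t. (fst p + V t + snd p * t) - H p t)"
    by (rule integral_cong) (rule U_H)
  also have "\<dots> = integral {0..1} (\<lambda>t. fst p + V t + snd p * t) - integral {0..1} (H p)"
    by (rule integral_diff) (auto intro!: integrable_continuous_real continuous_intros contH V)
  also have "integral {0..1} (\<lambda>t. fst p + V t + snd p * t) =
      integral {0..1} (\<lambda>t. fst p + V t) + integral {0..1} (\<lambda>t. snd p * t)"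
    by (rule integral_add) (auto intro!: integrable_continuous_real continuous_intros V)
  also have "integral {0..1} (\<lambda>t. fst p + V t) = fst p + Vb"
    unfolding Vb_def
    by (subst integral_add) (auto intro!: integrable_continuous_real continuous_intros V)
  also have "integral {0..1} (\<lambda>t. snd p * t) = snd p / 2"
    using integral_unique[OF ident_has_integral[of 0 "1::real"]] by simp
  finally have "integral {0..1} (U p) = s" using p1 by simp
  moreover have "U p 1 = U p 0" using U_H[of 1] U0 p2 V(3) by simp
  moreover have "\<forall>t\<in>{0..1}. U p t = U p 0 + V t + snd p * t - integral {0..t} (\<lambda>r. h r (U p r))"
    using U_H U0 by (simp add: H_def)
  ultimately show ?thesis
    unfolding periodic_solution_def using U(1) by blast
qed

section \<open>A priori bounds\<close>

lemma continuous_antiderivative: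
  fixes g :: "real \<Rightarrow> real"
  assumes "continuous_on UNIV g"
  obtains G where "\<And>x. (G has_real_derivative g x) (at x)"
  using einterval_antiderivative[of "-\<infinity>" \<infinity> g] assms
  by (auto simp: continuous_on_eq_continuous_at has_real_derivative_iff_has_vector_derivative)

text \<open>Mean value theorem for integrals, by connectedness of the range. It supplies a time at
  which a solution equals its prescribed mean, the anchor of the pointwise bounds.\<close>

lemma integral_attained:
  fixes u :: "real \<Rightarrow> real"
  assumes u: "continuous_on {0..1} u"
  obtains t where "t \<in> {0..1}" "u t = integral {0..1} u"
proof -
  obtain a where a: "a \<in> {0..1}" "\<And>t. t \<in> {0..1} \<Longrightarrow> u a \<le> u t"
    using continuous_attains_inf[OF _ _ u] by auto
  obtain b where b: "b \<in> {0..1}" "\<And>t. t \<in> {0..1} \<Longrightarrow> u t \<le> u b"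
    using continuous_attains_sup[OF _ _ u] by auto
  have int: "u integrable_on {0..1}" by (rule integrable_continuous_real[OF u])
  have "integral {0..1} (\<lambda>_::real. u a) \<le> integral {0..1} u"
    by (rule integral_le) (auto simp: int a)
  moreover have "integral {0..1} u \<le> integral {0..1} (\<lambda>_::real. u b)"
    by (rule integral_le) (auto simp: int b)
  ultimately have "u a \<le> integral {0..1} u" "integral {0..1} u \<le> u b" by simp_all
  moreover have "connected (u ` {0..1})" by (intro connected_continuous_image u) simp
  ultimately have "integral {0..1} u \<in> u ` {0..1}"
    using a(1) b(1) connectedD_interval by blast
  then show ?thesis using that by auto
qed

lemma integral_combine_left:
  fixes g :: "real \<Rightarrow> real"
  assumes "continuous_on {0..1} g" "0 \<le> x" "x \<le> y" "y \<le> 1"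
  shows "integral {0..y} g - integral {0..x} g = integral {x..y} g"
proof -
  have "g integrable_on {0..y}"
    using assms by (intro integrable_continuous_real continuous_on_subset[OF assms(1)]) auto
  then have "integral {0..x} g + integral {x..y} g = integral {0..y} g"
    using assms by (intro Henstock_Kurzweil_Integration.integral_combine) auto
  then show ?thesis by simp
qed

text \<open>Changing the sign of \<open>u\<close> exchanges the roles of upper and lower bounds for
  the nonlinearity, the drift and the solution, so one-sided estimates yield two-sided ones.\<close>

lemma periodic_solution_reflect:
  assumes "periodic_solution h V c s u"
  shows "periodic_solution (\<lambda>t x. - h t (- x)) (\<lambda>t. - V t) (- c) (- s) (\<lambda>t. - u t)"
proof -
  note sol = periodic_solutionD[OF assms]
  have "- u t = - u 0 + - V t + - c * t - integral {0..t} (\<lambda>r. - h r (- (- u r)))" if "t \<in> {0..1}" for t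
    using sol(2)[OF that] by simp
  moreover have "continuous_on {0..1} (\<lambda>t. - u t)" by (intro continuous_intros sol(1))
  moreover have "integral {0..1} (\<lambda>t. - u t) = - s" using sol(4) by simp
  moreover have "- u 1 = - u 0" using sol(3) by simp
  ultimately show ?thesis unfolding periodic_solution_def by blast
qed

text \<open>
  The antiderivative of a bump function along the periodic \<open>C\<^sup>1\<close> function \<open>z = u - V\<close> gives
  \<open>\<integral> bump(z) z' = 0\<close>, so \<open>z' = c - h(t,u)\<close> cannot be positive wherever \<open>bump(z) > 0\<close>.
\<close>

lemma periodic_solution_drift_le:
  fixes h :: "real \<Rightarrow> real \<Rightarrow> real"
  assumes sol: "periodic_solution h V c s u"
    and h: "continuous_on ({0..1} \<times> UNIV) (\<lambda>(t, x). h t x)"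
    and V: "continuous_on {0..1} V" "V 0 = 0" "V 1 = 0" "\<And>t. t \<in> {0..1} \<Longrightarrow> \<bar>V t\<bar> \<le> w"
    and B: "\<And>t x. t \<in> {0..1} \<Longrightarrow> \<bar>x - s\<bar> \<le> 2 * w + \<eta> \<Longrightarrow> h t x \<le> B" and \<eta>: "0 < \<eta>"
  shows "c \<le> B"
proof (rule ccontr)
  assume "\<not> c \<le> B"
  then have cB: "B < c" by simp
  note u = periodic_solutionD[OF sol]
  define z where "z t = u t - V t" for t
  \<comment> \<open>Centred at the mean: where \<open>bump (z t)\<close> is positive,
    \<open>u t\<close> is within \<open>2 * w + \<eta>\<close> of \<open>s\<close>, because
    \<open>u\<close> and \<open>z\<close> differ by at most \<open>w\<close>. The margin
    \<open>\<eta>\<close> makes it positive at a time where \<open>u\<close> equals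
    \<open>s\<close>, even if \<open>\<bar>V\<bar>\<close> reaches \<open>w\<close> there.\<close>
  define bump where "bump x = max 0 (w + \<eta> - \<bar>x - s\<bar>)" for x
  have hu: "continuous_on {0..1} (\<lambda>t. h t (u t))"
    by (rule continuous_on_compose_graph[OF h u(1)]) simp
  have z: "z t = u 0 + c * t - integral {0..t} (\<lambda>r. h r (u r))" if "t \<in> {0..1}" for t
    using u(2)[OF that] by (simp add: z_def)
  have dz: "(z has_real_derivative c - h t (u t)) (at t within {0..1})" if t: "t \<in> {0..1}" for t
  proof -
    have "((\<lambda>t. u 0 + c * t - integral {0..t} (\<lambda>r. h r (u r))) has_real_derivative c - h t (u t))
        (at t within {0..1})"
      using t by (auto intro!: derivative_eq_intros integral_has_real_derivative[OF hu])
    then show ?thesis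
      by (rule has_field_derivative_transform_within[where d = 1]) (use z t in auto)
  qed
  have "continuous_on UNIV bump" unfolding bump_def by (intro continuous_intros)
  then obtain X where X: "\<And>x. (X has_real_derivative bump x) (at x)"
    using continuous_antiderivative by blast
  have "((\<lambda>t. bump (z t) * (c - h t (u t))) has_integral X (z 1) - X (z 0)) {0..1}"
  proof (rule fundamental_theorem_of_calculus)
    fix t :: real assume t: "t \<in> {0..1}"
    have "((\<lambda>t. X (z t)) has_real_derivative bump (z t) * (c - h t (u t))) (at t within {0..1})"
      by (rule DERIV_chain2[OF X dz[OF t]])
    then show "((\<lambda>t. X (z t)) has_vector_derivative bump (z t) * (c - h t (u t))) (at t within {0..1})"
      by (simp add: has_real_derivative_iff_has_vector_derivative)
  qed simp
  then have int0: "integral {0..1} (\<lambda>t. bump (z t) * (c - h t (u t))) = 0"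
    using u(3) V by (simp add: z_def integral_unique)
  have "continuous_on {0..1} (\<lambda>t. bump (z t) * (c - h t (u t)))"
    unfolding bump_def z_def by (intro continuous_intros hu u(1) V(1))
  moreover have pos: "0 < c - h t (u t)" if "t \<in> {0..1}" "0 < bump (z t)" for t
  proof -
    have "\<bar>u t - s\<bar> \<le> 2 * w + \<eta>"
      using that V(4)[OF that(1)] by (auto simp: bump_def z_def max_def split: if_splits)
    then show ?thesis using B[OF that(1), of "u t"] cB by simp
  qed
  have nonneg: "0 \<le> bump (z t) * (c - h t (u t))" if "t \<in> {0..1}" for t
  proof (cases "0 < bump (z t)")
    case True
    then show ?thesis using pos[OF that True] by simp
  next
    case False
    then have "bump (z t) = 0" by (auto simp: bump_def)
    then show ?thesis by simp
  qed
  ultimately have zero: "bump (z t) * (c - h t (u t)) = 0" if "t \<in> {0..1}" for t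
    using int0 that by (subst (asm) integral_eq_0_iff) auto
  obtain t0 where t0: "t0 \<in> {0..1}" "u t0 = s"
    using integral_attained[OF u(1)] u(4) by metis
  have "0 < bump (z t0)" using V(4)[OF t0(1)] t0(2) \<eta> by (auto simp: bump_def z_def)
  then show False using zero[OF t0(1)] pos[OF t0(1)] by simp
qed

text \<open>The lower bound on the drift is the upper bound for the reflected solution.\<close>

lemma periodic_solution_drift_bound:
  fixes h :: "real \<Rightarrow> real \<Rightarrow> real"
  assumes sol: "periodic_solution h V c s u"
    and h: "continuous_on ({0..1} \<times> UNIV) (\<lambda>(t, x). h t x)"
    and V: "continuous_on {0..1} V" "V 0 = 0" "V 1 = 0" "\<And>t. t \<in> {0..1} \<Longrightarrow> \<bar>V t\<bar> \<le> w"
    and B: "\<And>t x. t \<in> {0..1} \<Longrightarrow> \<bar>x - s\<bar> \<le> 2 * w + \<eta> \<Longrightarrow> \<bar>h t x\<bar> \<le> B" and \<eta>: "0 < \<eta>"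
  shows "\<bar>c\<bar> \<le> B"
proof -
  have "c \<le> B"
    by (rule periodic_solution_drift_le[OF sol h V _ \<eta>]) (use B in fastforce)+
  moreover have "- c \<le> B"
  proof (rule periodic_solution_drift_le[OF periodic_solution_reflect[OF sol] _ _ _ _ _ _ \<eta>])
    have "continuous_on ({0..1} \<times> UNIV) (\<lambda>p. - (\<lambda>(t, x). h t x) (fst p, - snd p))"
      by (intro continuous_intros continuous_on_compose2[OF h]) auto
    then show "continuous_on ({0..1} \<times> UNIV) (\<lambda>(t, x). - h t (- x))"
      by (simp add: case_prod_unfold)
    fix t x :: real assume "t \<in> {0..1}" "\<bar>x - - s\<bar> \<le> 2 * w + \<eta>"
    then have "\<bar>h t (- x)\<bar> \<le> B" by (intro B) auto
    then show "- h t (- x) \<le> B" by linarith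
  qed (use V in \<open>auto intro!: continuous_intros\<close>)
  ultimately show ?thesis by simp
qed

text \<open>
  Comparison with the autonomous equation \<open>u' = M(u)\<close> for functions whose derivative is not
  defined pointwise; the local estimate is chained by bisection.
\<close>

lemma growth_comparison:
  fixes u n M \<Phi> :: "real \<Rightarrow> real"
  assumes ab: "a \<le> b" and u: "continuous_on {a..b} u"
    and M: "continuous_on UNIV M" "\<And>x. 1 \<le> M x"
    and \<Phi>: "\<And>x. (\<Phi> has_real_derivative 1 / M x) (at x)"
    and n: "\<And>x y. a \<le> x \<Longrightarrow> x \<le> y \<Longrightarrow> y \<le> b \<Longrightarrow> n x \<le> n y" and B: "0 \<le> B"
    and inc: "\<And>x y. a \<le> x \<Longrightarrow> x \<le> y \<Longrightarrow> y \<le> b \<Longrightarrow>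
      u y - u x \<le> n y - n x + B * (y - x) + integral {x..y} (\<lambda>r. M (u r))"
  shows "\<Phi> (u b) - \<Phi> (u a) \<le> n b - n a + (B + 1) * (b - a)"
proof -
  \<comment> \<open>\<open>W\<close> is the total allowance: the variation of the forcing,
    \<open>B\<close> per unit time for the drift, and elapsed time itself for the flow of
    \<open>M\<close>, whose transit time \<open>\<Phi>\<close> measures.\<close>
  define W where "W t = n t + (B + 1) * t" for t
  have W: "W x \<le> W y" if "a \<le> x" "x \<le> y" "y \<le> b" for x y
    unfolding W_def using n[OF that] B that by (intro add_mono mult_left_mono) auto
  have \<Phi>_mono: "\<Phi> x \<le> \<Phi> y" if "x \<le> y" for x y
  proof (rule DERIV_nonneg_imp_nondecreasing[OF that])
    fix x show "\<exists>D. (\<Phi> has_real_derivative D) (at x) \<and> 0 \<le> D"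
      using \<Phi>[of x] M(2)[of x] by (intro exI[of _ "1 / M x"]) auto
  qed
  have main: "\<Phi> (u b) - \<Phi> (u a) \<le> (1 + e) * (W b - W a)" if e: "0 < e" for e
  proof -
    define P where "P x y \<longleftrightarrow> (a \<le> x \<and> x \<le> y \<and> y \<le> b \<longrightarrow>
      \<Phi> (u y) - \<Phi> (u x) \<le> (1 + e) * (W y - W x))" for x y
    from ab have "P a b"
    proof (induction rule: Bolzano)
      case (trans x y z)
      show ?case unfolding P_def
      proof
        assume "a \<le> x \<and> x \<le> z \<and> z \<le> b"
        then have "\<Phi> (u y) - \<Phi> (u x) \<le> (1 + e) * (W y - W x)"
          "\<Phi> (u z) - \<Phi> (u y) \<le> (1 + e) * (W z - W y)"
          using trans unfolding P_def by linarith+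
        moreover have "(1 + e) * (W z - W x) = (1 + e) * (W y - W x) + (1 + e) * (W z - W y)"
          by (simp add: algebra_simps)
        ultimately show "\<Phi> (u z) - \<Phi> (u x) \<le> (1 + e) * (W z - W x)" by linarith
      qed
    next
      case (local x0)
      \<comment> \<open>Chosen so that \<open>e' * (2 + e) = e\<close>. As \<open>M \<ge> 1\<close>,
        this gives \<open>M (u x0) + e' \<le> (1 + e) * (M (u x0) - e')\<close>, so any two values
        of \<open>M\<close> on the small interval agree up to the factor
        \<open>1 + e\<close>.\<close>
      define e' where "e' = e / (2 + e)"
      have e': "0 < e'" using e by (simp add: e'_def)
      have "isCont M (u x0)" using M(1) by (simp add: continuous_on_eq_continuous_at)
      from this[unfolded continuous_at_eps_delta, rule_format, OF e']
      obtain \<delta> where "0 < \<delta>"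
        and "\<forall>y. dist y (u x0) < \<delta> \<longrightarrow> dist (M y) (M (u x0)) < e'"
        by (elim exE conjE)
      then have \<delta>: "0 < \<delta>" "\<And>y. \<bar>y - u x0\<bar> < \<delta> \<Longrightarrow> \<bar>M y - M (u x0)\<bar> < e'"
        by (simp_all add: dist_real_def)
      have "x0 \<in> {a..b}" using local by simp
      from u[unfolded continuous_on_iff, rule_format, OF this \<delta>(1)]
      obtain d where "0 < d" and "\<forall>r\<in>{a..b}. dist r x0 < d \<longrightarrow> dist (u r) (u x0) < \<delta>"
        by (elim exE conjE)
      then have d: "0 < d" "\<And>r. r \<in> {a..b} \<Longrightarrow> \<bar>r - x0\<bar> < d \<Longrightarrow> \<bar>u r - u x0\<bar> < \<delta>"
        by (simp_all add: dist_real_def)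
      have "P x y" if xy: "x \<le> x0 \<and> x0 \<le> y \<and> y - x < d" for x y
        unfolding P_def
      proof
        assume ax: "a \<le> x \<and> x \<le> y \<and> y \<le> b"
        have near: "\<bar>u r - u x0\<bar> < \<delta>" if "r \<in> {x..y}" for r
          using that xy ax by (intro d) auto
        show "\<Phi> (u y) - \<Phi> (u x) \<le> (1 + e) * (W y - W x)"
        proof (cases "u y \<le> u x")
          case True
          then have "\<Phi> (u y) - \<Phi> (u x) \<le> 0" using \<Phi>_mono by simp
          also have "0 \<le> (1 + e) * (W y - W x)" using W[of x y] ax e by simp
          finally show ?thesis .
        next
          case False
          \<comment> \<open>Mean value theorem in the state variable: the increment of
            \<open>\<Phi>\<close> is that of \<open>u\<close> divided by one value of
            \<open>M\<close>.\<close>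
          then obtain \<xi> where \<xi>: "u x < \<xi>" "\<xi> < u y" "\<Phi> (u y) - \<Phi> (u x) = (u y - u x) * (1 / M \<xi>)"
            using MVT2[of "u x" "u y" \<Phi> "\<lambda>x. 1 / M x"] \<Phi> by auto
          have "\<bar>\<xi> - u x0\<bar> < \<delta>" using \<xi> near[of x] near[of y] ax by auto
          then have M\<xi>: "M (u x0) - e' < M \<xi>" using \<delta>(2)[of \<xi>] by auto
          \<comment> \<open>\<open>q\<close> dominates \<open>M\<close> along the segment and is at
            least 1, so the forcing and drift terms may be multiplied by it as well; division by
            \<open>M \<xi>\<close> then leaves only the factor \<open>1 + e\<close>.\<close>
          define q where "q = (1 + e) * M \<xi>"
          have q1: "1 \<le> q" unfolding q_def using mult_mono[of 1 "1 + e" 1 "M \<xi>"] e M(2)[of \<xi>] by simp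
          have "M (u x0) + e' \<le> (1 + e) * (M (u x0) - e')"
          proof -
            have "e' * (2 + e) = e" using e by (simp add: e'_def)
            also have "e \<le> e * M (u x0)" using e M(2)[of "u x0"] by simp
            finally show ?thesis by (simp add: algebra_simps)
          qed
          also have "\<dots> \<le> q" unfolding q_def using M\<xi> e by (intro mult_left_mono) auto
          finally have q2: "M (u x0) + e' \<le> q" .
          have cMu: "continuous_on {x..y} (\<lambda>r. M (u r))"
            using ax by (intro continuous_on_compose2[OF M(1)] continuous_on_subset[OF u]) auto
          have "integral {x..y} (\<lambda>r. M (u r)) \<le> integral {x..y} (\<lambda>r. q)"
          proof (rule integral_le)
            fix r assume "r \<in> {x..y}"
            then show "M (u r) \<le> q" using \<delta>(2)[OF near, of r] q2 by auto
          qed (auto intro!: integrable_continuous_real cMu)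
          then have I: "integral {x..y} (\<lambda>r. M (u r)) \<le> q * (y - x)" using ax by (simp add: mult.commute)
          have n0: "0 \<le> n y - n x" and yx: "0 \<le> B * (y - x)" using n[of x y] ax B by auto
          have "u y - u x \<le> n y - n x + B * (y - x) + integral {x..y} (\<lambda>r. M (u r))"
            using ax by (intro inc) auto
          also have "\<dots> \<le> q * (n y - n x) + q * (B * (y - x)) + q * (y - x)"
            using I mult_right_mono[OF q1 n0] mult_right_mono[OF q1 yx] by simp
          also have "\<dots> = (1 + e) * (W y - W x) * M \<xi>" by (simp add: q_def W_def algebra_simps)
          finally have "(u y - u x) / M \<xi> \<le> (1 + e) * (W y - W x)"
            using M(2)[of \<xi>] by (subst pos_divide_le_eq) auto
          then show ?thesis using \<xi>(3) by simp
        qed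
      qed
      then show ?case using d(1) by blast
    qed
    then show ?thesis unfolding P_def using ab by simp
  qed
  have w0: "0 \<le> W b - W a" using W[of a b] ab by simp
  have "\<Phi> (u b) - \<Phi> (u a) \<le> W b - W a"
  proof (rule field_le_epsilon)
    fix e :: real assume "0 < e"
    then have "\<Phi> (u b) - \<Phi> (u a) \<le> (1 + e / (W b - W a + 1)) * (W b - W a)"
      using w0 by (intro main) (auto intro!: divide_pos_pos)
    also have "\<dots> = (W b - W a) + e * ((W b - W a) / (W b - W a + 1))"
      by (simp add: algebra_simps)
    also have "\<dots> \<le> (W b - W a) + e * 1"
      using w0 \<open>0 < e\<close> by (intro add_left_mono mult_left_mono) auto
    finally show "\<Phi> (u b) - \<Phi> (u a) \<le> W b - W a + e" by simp
  qed
  then show ?thesis by (simp add: W_def algebra_simps)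
qed

text \<open>\<open>\<Phi>\<close> is the transit time of the autonomous equation with speed
  \<open>M\<close>, so a periodic solution cannot climb farther than one period, the drift and the
  variation of the forcing together pay for.\<close>

lemma periodic_solution_transit_up:
  fixes h :: "real \<Rightarrow> real \<Rightarrow> real"
  assumes sol: "periodic_solution h V c s u"
    and h: "continuous_on ({0..1} \<times> UNIV) (\<lambda>(t, x). h t x)"
    and n: "\<And>x y. 0 \<le> x \<Longrightarrow> x \<le> y \<Longrightarrow> y \<le> 1 \<Longrightarrow> \<bar>V y - V x\<bar> \<le> n y - n x"
    and c: "\<bar>c\<bar> \<le> B"
    and M: "continuous_on UNIV M" "\<And>x. 1 \<le> M x"
    and \<Phi>: "\<And>x. (\<Phi> has_real_derivative 1 / M x) (at x)"
    and hM: "\<And>t x. t \<in> {0..1} \<Longrightarrow> - h t x \<le> M x"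
    and t: "t0 \<in> {0..1}" "t1 \<in> {0..1}"
  shows "\<Phi> (u t1) - \<Phi> (u t0) \<le> n 1 - n 0 + B + 1"
proof -
  note u = periodic_solutionD[OF sol]
  have n_mono: "n x \<le> n y" if "0 \<le> x" "x \<le> y" "y \<le> 1" for x y
    using n[OF that] by linarith
  have B: "0 \<le> B" using c by linarith
  have seg: "\<Phi> (u b) - \<Phi> (u a) \<le> n b - n a + (B + 1) * (b - a)" if ab: "0 \<le> a" "a \<le> b" "b \<le> 1" for a b
  proof (rule growth_comparison[OF ab(2) _ M \<Phi> _ B])
    show "continuous_on {a..b} u" using ab by (intro continuous_on_subset[OF u(1)]) auto
    fix x y :: real assume xy: "a \<le> x" "x \<le> y" "y \<le> b"
    then have xy': "x \<in> {0..1}" "y \<in> {0..1}" using ab by auto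
    show "n x \<le> n y" using xy ab by (intro n_mono) auto
    have hu: "continuous_on {0..1} (\<lambda>r. h r (u r))"
      by (rule continuous_on_compose_graph[OF h u(1)]) simp
    have hu': "continuous_on {x..y} (\<lambda>r. h r (u r))" "continuous_on {x..y} (\<lambda>r. M (u r))"
      using xy' by (auto intro!: continuous_on_subset[OF hu] continuous_on_compose2[OF M(1)]
          continuous_on_subset[OF u(1)])
    have "u y - u x = V y - V x + c * (y - x)
        - (integral {0..y} (\<lambda>r. h r (u r)) - integral {0..x} (\<lambda>r. h r (u r)))"
      using u(2)[OF xy'(1)] u(2)[OF xy'(2)] by (simp add: algebra_simps)
    also have "integral {0..y} (\<lambda>r. h r (u r)) - integral {0..x} (\<lambda>r. h r (u r))
        = integral {x..y} (\<lambda>r. h r (u r))"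
      using xy xy' by (intro integral_combine_left hu) auto
    also have "V y - V x + c * (y - x) - \<dots> \<le> n y - n x + B * (y - x) + integral {x..y} (\<lambda>r. M (u r))"
    proof -
      have "integral {x..y} (\<lambda>r. - h r (u r)) \<le> integral {x..y} (\<lambda>r. M (u r))"
        using xy' by (intro integral_le hM) (auto intro!: integrable_continuous_real continuous_intros hu')
      moreover have "V y - V x \<le> n y - n x" using n[of x y] xy ab by auto
      moreover have "c * (y - x) \<le> B * (y - x)" using c xy by (intro mult_right_mono) auto
      ultimately show ?thesis by simp
    qed
    finally show "u y - u x \<le> n y - n x + B * (y - x) + integral {x..y} (\<lambda>r. M (u r))" .
  qed
  show ?thesis
  proof (cases "t0 \<le> t1")
    case True
    have "(B + 1) * (t1 - t0) \<le> (B + 1) * 1" using t B by (intro mult_left_mono) auto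
    moreover have "n t1 - n t0 \<le> n 1 - n 0" using n_mono[of t1 1] n_mono[of 0 t0] t by auto
    ultimately show ?thesis using seg[of t0 t1] t True by auto
  next
    case False
    \<comment> \<open>An earlier time is reached by following the solution through the end of the
      period, where it closes up.\<close>
    have "(B + 1) * (1 - t0) + (B + 1) * (t1 - 0) \<le> (B + 1) * 1"
      unfolding distrib_left[symmetric] using False t B by (intro mult_left_mono) auto
    moreover have "n 1 - n t0 + (n t1 - n 0) \<le> n 1 - n 0" using n_mono[of t1 t0] t False by auto
    ultimately show ?thesis using seg[of t0 1] seg[of 0 t1] t u(3) by auto
  qed
qed

text \<open>A periodic solution that climbs must also descend, so a one-sided bound of either sign
  limits the climb: the case \<open>h \<le> M\<close> is the previous estimate for the reflected
  solution with the two times interchanged.\<close>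

lemma periodic_solution_transit:
  fixes h :: "real \<Rightarrow> real \<Rightarrow> real"
  assumes sol: "periodic_solution h V c s u"
    and h: "continuous_on ({0..1} \<times> UNIV) (\<lambda>(t, x). h t x)"
    and n: "\<And>x y. 0 \<le> x \<Longrightarrow> x \<le> y \<Longrightarrow> y \<le> 1 \<Longrightarrow> \<bar>V y - V x\<bar> \<le> n y - n x"
    and c: "\<bar>c\<bar> \<le> B"
    and M: "continuous_on UNIV M" "\<And>x. 1 \<le> M x"
    and \<Phi>: "\<And>x. (\<Phi> has_real_derivative 1 / M x) (at x)"
    and hM: "(\<forall>t\<in>{0..1}. \<forall>x. h t x \<le> M x) \<or> (\<forall>t\<in>{0..1}. \<forall>x. - h t x \<le> M x)"
    and t: "t0 \<in> {0..1}" "t1 \<in> {0..1}"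
  shows "\<Phi> (u t1) - \<Phi> (u t0) \<le> n 1 - n 0 + B + 1"
  using hM
proof
  assume "\<forall>t\<in>{0..1}. \<forall>x. - h t x \<le> M x"
  then show ?thesis by (intro periodic_solution_transit_up[OF sol h n c M \<Phi> _ t]) auto
next
  assume hM: "\<forall>t\<in>{0..1}. \<forall>x. h t x \<le> M x"
  have "- \<Phi> (- (- u t0)) - - \<Phi> (- (- u t1)) \<le> n 1 - n 0 + B + 1"
  proof (rule periodic_solution_transit_up[OF periodic_solution_reflect[OF sol], where M = "\<lambda>x. M (- x)"
        and \<Phi> = "\<lambda>x. - \<Phi> (- x)"])
    have "continuous_on ({0..1} \<times> UNIV) (\<lambda>p. - (\<lambda>(t, x). h t x) (fst p, - snd p))"
      by (intro continuous_intros continuous_on_compose2[OF h]) auto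
    then show "continuous_on ({0..1} \<times> UNIV) (\<lambda>(t, x). - h t (- x))"
      by (simp add: case_prod_unfold)
    show "continuous_on UNIV (\<lambda>x. M (- x))"
      by (rule continuous_on_compose2[OF M(1)]) (auto intro!: continuous_intros)
    show "((\<lambda>x. - \<Phi> (- x)) has_real_derivative 1 / M (- x)) (at x)" for x
    proof -
      have "((\<lambda>x. \<Phi> (- x)) has_real_derivative 1 / M (- x) * (- 1)) (at x)"
        by (rule DERIV_chain2[OF \<Phi>]) (auto intro!: derivative_eq_intros)
      then show ?thesis using DERIV_minus by fastforce
    qed
    show "\<bar>- V y - - V x\<bar> \<le> n y - n x" if "0 \<le> x" "x \<le> y" "y \<le> 1" for x y
      using n[OF that] by linarith
  qed (use c M(2) hM t in auto)
  then show ?thesis by simp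
qed

section \<open>Growth conditions and bounds uniform in the truncation\<close>

text \<open>Divergence of the integral of \<open>1 / M\<close> over the right half-line: solutions
  of \<open>x' = M x\<close> do not escape to infinity in finite time.\<close>

definition slow :: "(real \<Rightarrow> real) \<Rightarrow> bool" where
  "slow M \<longleftrightarrow> (\<forall>B. \<exists>N\<ge>0. B \<le> integral {0..N} (\<lambda>x. 1 / M x))"

text \<open>Tameness in the form that the estimates use. Continuous majorants replace the suprema,
  and at each end one of the two has to be slow, which mirrors the negation of being wild there.
  Linear equations satisfy it as well, so the linearised problem falls under the same
  theory.\<close>

definition slow_growth :: "(real \<Rightarrow> real \<Rightarrow> real) \<Rightarrow> bool" where
  "slow_growth f \<longleftrightarrow> (\<exists>Mp Mm. continuous_on UNIV Mp \<and> continuous_on UNIV Mm \<and>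
     (\<forall>x. 1 \<le> Mp x) \<and> (\<forall>x. 1 \<le> Mm x) \<and>
     (\<forall>t\<in>{0..1}. \<forall>x. f t x \<le> Mp x) \<and> (\<forall>t\<in>{0..1}. \<forall>x. - f t x \<le> Mm x) \<and>
     (slow Mp \<or> slow Mm) \<and> (slow (\<lambda>x. Mp (- x)) \<or> slow (\<lambda>x. Mm (- x))))"

definition clamp_at :: "real \<Rightarrow> real \<Rightarrow> real" where
  "clamp_at R x = max (- R) (min R x)"

lemma clamp_at_id: "\<bar>x\<bar> \<le> R \<Longrightarrow> clamp_at R x = x"
  by (auto simp: clamp_at_def)

lemma abs_clamp_at: "0 \<le> R \<Longrightarrow> \<bar>clamp_at R x\<bar> \<le> R"
  by (auto simp: clamp_at_def)

lemma clamp_at_minus: "0 \<le> R \<Longrightarrow> clamp_at R (- x) = - clamp_at R x"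
  by (auto simp: clamp_at_def)

lemma clamp_at_lipschitz: "\<bar>clamp_at R x - clamp_at R y\<bar> \<le> \<bar>x - y\<bar>"
  by (auto simp: clamp_at_def)

lemma continuous_on_clamp_at: "continuous_on S (clamp_at R)"
  unfolding clamp_at_def by (intro continuous_intros)

lemma continuous_on_clamp_graph:
  fixes f :: "real \<Rightarrow> real \<Rightarrow> real"
  assumes "continuous_on ({0..1} \<times> UNIV) (\<lambda>(t, x). f t x)"
  shows "continuous_on ({0..1} \<times> UNIV) (\<lambda>(t, x). f t (clamp_at R x))"
proof -
  have "continuous_on ({0..1} \<times> UNIV) (\<lambda>p. (\<lambda>(t, x). f t x) (fst p, clamp_at R (snd p)))"
    by (intro continuous_on_compose2[OF assms] continuous_intros
        continuous_on_compose2[OF continuous_on_clamp_at[of UNIV]]) auto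
  then show ?thesis by (simp add: case_prod_unfold)
qed

lemma continuous_on_reflect_graph:
  fixes f :: "real \<Rightarrow> real \<Rightarrow> real"
  assumes "continuous_on ({0..1} \<times> UNIV) (\<lambda>(t, x). f t x)"
  shows "continuous_on ({0..1} \<times> UNIV) (\<lambda>(t, x). - f t (- x))"
proof -
  have "continuous_on ({0..1} \<times> UNIV) (\<lambda>p. - (\<lambda>(t, x). f t x) (fst p, - snd p))"
    by (intro continuous_on_compose2[OF assms] continuous_intros) auto
  then show ?thesis by (simp add: case_prod_unfold)
qed

lemma bounded_on_strip:
  fixes f :: "real \<Rightarrow> real \<Rightarrow> real"
  assumes "continuous_on ({0..1} \<times> UNIV) (\<lambda>(t, x). f t x)"
  obtains B where "0 \<le> B" "\<And>t x. t \<in> {0..1} \<Longrightarrow> \<bar>x\<bar> \<le> R \<Longrightarrow> \<bar>f t x\<bar> \<le> B"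
proof -
  have "compact ((\<lambda>(t, x). f t x) ` ({0..1} \<times> {-R..R}))"
    by (intro compact_continuous_image continuous_on_subset[OF assms] compact_Times) auto
  then have "bounded ((\<lambda>(t, x). f t x) ` ({0..1} \<times> {-R..R}))" by (rule compact_imp_bounded)
  then obtain B where B: "\<And>y. y \<in> (\<lambda>(t, x). f t x) ` ({0..1} \<times> {-R..R}) \<Longrightarrow> norm y \<le> B"
    unfolding bounded_iff by blast
  show ?thesis
  proof (rule that[of "max 0 B"])
    fix t x :: real assume "t \<in> {0..1}" "\<bar>x\<bar> \<le> R"
    then have "f t x \<in> (\<lambda>(t, x). f t x) ` ({0..1} \<times> {-R..R})"
      by (intro image_eqI[of _ _ "(t, x)"]) auto
    from B[OF this] show "\<bar>f t x\<bar> \<le> max 0 B" by simp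
  qed simp
qed

text \<open>The bound must be independent of the truncation level \<open>R\<close>, which is chosen
  beyond it afterwards. This works because the truncated majorant agrees with \<open>M\<close> on
  [0,R], so transit times below \<open>R\<close> are those of \<open>M\<close>.\<close>

lemma a_priori_upper_bound:
  fixes f :: "real \<Rightarrow> real \<Rightarrow> real"
  assumes f: "continuous_on ({0..1} \<times> UNIV) (\<lambda>(t, x). f t x)"
    and M: "continuous_on UNIV M" "\<And>x. 1 \<le> M x" "slow M"
    and fM: "(\<forall>t\<in>{0..1}. \<forall>x. f t x \<le> M x) \<or> (\<forall>t\<in>{0..1}. \<forall>x. - f t x \<le> M x)"
    and k: "0 \<le> k"
  obtains R0 where "k \<le> R0"
    "\<And>R V n c s u t. \<lbrakk>R0 \<le> R; periodic_solution (\<lambda>t x. f t (clamp_at R x)) V c s u;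
      \<And>x y. 0 \<le> x \<Longrightarrow> x \<le> y \<Longrightarrow> y \<le> 1 \<Longrightarrow> \<bar>V y - V x\<bar> \<le> n y - n x;
      n 1 - n 0 \<le> k; \<bar>c\<bar> \<le> B; \<bar>s\<bar> \<le> k; t \<in> {0..1}\<rbrakk> \<Longrightarrow> u t \<le> R0"
proof -
  \<comment> \<open>The transit from \<open>k\<close> to \<open>N\<close> takes at least
    \<open>k + B + 2\<close>, one more than the \<open>k + B + 1\<close> available from a time at
    which \<open>u\<close> equals \<open>s \<le> k\<close>.\<close>
  obtain N where N: "0 \<le> N" "k + B + 2 + integral {0..k} (\<lambda>x. 1 / M x) \<le> integral {0..N} (\<lambda>x. 1 / M x)"
    using M(3) unfolding slow_def by blast
  define R0 where "R0 = max N k"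
  show ?thesis
  proof (rule that[of R0])
    show "k \<le> R0" by (simp add: R0_def)
    fix R c s t :: real and V n u :: "real \<Rightarrow> real"
    assume R: "R0 \<le> R"
      and sol: "periodic_solution (\<lambda>t x. f t (clamp_at R x)) V c s u"
      and n: "\<And>x y. 0 \<le> x \<Longrightarrow> x \<le> y \<Longrightarrow> y \<le> 1 \<Longrightarrow> \<bar>V y - V x\<bar> \<le> n y - n x"
        "n 1 - n 0 \<le> k"
      and c: "\<bar>c\<bar> \<le> B" and s: "\<bar>s\<bar> \<le> k" and t: "t \<in> {0..1}"
    define MR where "MR x = M (clamp_at R x)" for x
    have MR: "continuous_on UNIV MR" "\<And>x. 1 \<le> MR x"
      unfolding MR_def using M(2)
      by (auto intro!: continuous_on_compose2[OF M(1)] continuous_on_clamp_at)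
    have "continuous_on UNIV (\<lambda>x. 1 / MR x)"
    proof (intro continuous_intros MR ballI)
      show "MR x \<noteq> 0" for x using MR(2)[of x] by linarith
    qed
    then obtain \<Phi> where \<Phi>: "\<And>x. (\<Phi> has_real_derivative 1 / MR x) (at x)"
      using continuous_antiderivative by blast
    have mono: "\<Phi> x \<le> \<Phi> y" if "x \<le> y" for x y
    proof (rule DERIV_nonneg_imp_nondecreasing[OF that])
      fix x show "\<exists>D. (\<Phi> has_real_derivative D) (at x) \<and> 0 \<le> D"
        using \<Phi>[of x] MR(2)[of x] by (intro exI[of _ "1 / MR x"]) auto
    qed
    have val: "\<Phi> y - \<Phi> 0 = integral {0..y} (\<lambda>x. 1 / M x)" if y: "0 \<le> y" "y \<le> R" for y
    proof -
      have "((\<lambda>x. 1 / MR x) has_integral \<Phi> y - \<Phi> 0) {0..y}"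
        using y by (intro fundamental_theorem_of_calculus)
          (auto simp flip: has_real_derivative_iff_has_vector_derivative intro: has_field_derivative_at_within \<Phi>)
      then have "integral {0..y} (\<lambda>x. 1 / MR x) = \<Phi> y - \<Phi> 0" by (rule integral_unique)
      moreover have "integral {0..y} (\<lambda>x. 1 / MR x) = integral {0..y} (\<lambda>x. 1 / M x)"
        using y by (intro integral_cong) (auto simp: MR_def clamp_at_id)
      ultimately show ?thesis by simp
    qed
    obtain t0 where t0: "t0 \<in> {0..1}" "u t0 = s"
      using integral_attained[OF periodic_solutionD(1)[OF sol]] periodic_solutionD(4)[OF sol] by metis
    have "\<Phi> (u t) - \<Phi> (u t0) \<le> n 1 - n 0 + B + 1"
      by (rule periodic_solution_transit[OF sol continuous_on_clamp_graph[OF f] n(1) c MR \<Phi> _ t0(1) t])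
         (use fM in \<open>auto simp: MR_def\<close>)
    moreover have "\<Phi> s \<le> \<Phi> k" using s by (intro mono) auto
    ultimately have upper: "\<Phi> (u t) \<le> \<Phi> k + k + B + 1" using n(2) t0(2) by simp
    show "u t \<le> R0"
    proof (rule ccontr)
      assume "\<not> u t \<le> R0"
      then have "\<Phi> N \<le> \<Phi> (u t)" by (intro mono) (simp add: R0_def)
      moreover have "\<Phi> k + k + B + 2 \<le> \<Phi> N"
        using val[of k] val[of N] N R k by (simp add: R0_def)
      ultimately show False using upper by simp
    qed
  qed
qed

lemma slow_growth_reflect:
  assumes "slow_growth f"
  shows "slow_growth (\<lambda>t x. - f t (- x))"
proof -
  obtain Mp Mm where M: "continuous_on UNIV Mp" "continuous_on UNIV Mm"
    "\<And>x. 1 \<le> Mp x" "\<And>x. 1 \<le> Mm x" "\<And>t x. t \<in> {0..1} \<Longrightarrow> f t x \<le> Mp x"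
    "\<And>t x. t \<in> {0..1} \<Longrightarrow> - f t x \<le> Mm x" "slow Mp \<or> slow Mm"
    "slow (\<lambda>x. Mp (- x)) \<or> slow (\<lambda>x. Mm (- x))"
    using assms unfolding slow_growth_def by blast
  have "continuous_on UNIV (\<lambda>x. Mp (- x))" "continuous_on UNIV (\<lambda>x. Mm (- x))"
    by (auto intro!: continuous_on_compose2[OF M(1)] continuous_on_compose2[OF M(2)] continuous_intros)
  then show ?thesis
    unfolding slow_growth_def
    by (intro exI[of _ "\<lambda>x. Mm (- x)"] exI[of _ "\<lambda>x. Mp (- x)"]) (use M in auto)
qed

text \<open>Whichever of the two majorants is slow on the right, the transit estimate accepts its
  sign.\<close>

lemma a_priori_one_sided:
  fixes f :: "real \<Rightarrow> real \<Rightarrow> real"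
  assumes f: "continuous_on ({0..1} \<times> UNIV) (\<lambda>(t, x). f t x)" and slow: "slow_growth f"
    and k: "0 \<le> k"
  obtains R0 where "k \<le> R0"
    "\<And>R V n c s u t. \<lbrakk>R0 \<le> R; periodic_solution (\<lambda>t x. f t (clamp_at R x)) V c s u;
      \<And>x y. 0 \<le> x \<Longrightarrow> x \<le> y \<Longrightarrow> y \<le> 1 \<Longrightarrow> \<bar>V y - V x\<bar> \<le> n y - n x;
      n 1 - n 0 \<le> k; \<bar>c\<bar> \<le> B; \<bar>s\<bar> \<le> k; t \<in> {0..1}\<rbrakk> \<Longrightarrow> u t \<le> R0"
proof -
  obtain M where "continuous_on UNIV M" "\<And>x. 1 \<le> M x" "slow M"
    "(\<forall>t\<in>{0..1}. \<forall>x. f t x \<le> M x) \<or> (\<forall>t\<in>{0..1}. \<forall>x. - f t x \<le> M x)"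
    using slow unfolding slow_growth_def by blast
  from a_priori_upper_bound[OF f this k, of B] that show ?thesis by blast
qed

text \<open>The drift comes first. As \<open>V\<close> vanishes at both ends and has variation at
  most \<open>k\<close>, it is at most \<open>k\<close> in size, so the drift estimate only sees
  states with \<open>\<bar>x\<bar> \<le> 3 * k + 1\<close>, where truncation at
  \<open>R \<ge> R0\<close> is invisible. The lower bound on \<open>u\<close> is the upper bound for
  the reflected solution.\<close>

lemma a_priori_bound:
  fixes f :: "real \<Rightarrow> real \<Rightarrow> real"
  assumes f: "continuous_on ({0..1} \<times> UNIV) (\<lambda>(t, x). f t x)" and slow: "slow_growth f"
    and k: "0 \<le> k"
  obtains R0 where "k \<le> R0"
    "\<And>R V n c s u t. \<lbrakk>R0 \<le> R; periodic_solution (\<lambda>t x. f t (clamp_at R x)) V c s u;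
      continuous_on {0..1} V; V 0 = 0; V 1 = 0;
      \<And>x y. 0 \<le> x \<Longrightarrow> x \<le> y \<Longrightarrow> y \<le> 1 \<Longrightarrow> \<bar>V y - V x\<bar> \<le> n y - n x;
      n 1 - n 0 \<le> k; \<bar>s\<bar> \<le> k; t \<in> {0..1}\<rbrakk> \<Longrightarrow> \<bar>u t\<bar> \<le> R0"
proof -
  obtain B where B: "0 \<le> B" "\<And>t x. t \<in> {0..1} \<Longrightarrow> \<bar>x\<bar> \<le> 3 * k + 1 \<Longrightarrow> \<bar>f t x\<bar> \<le> B"
    using bounded_on_strip[OF f] by blast
  obtain R1 where R1: "k \<le> R1"
    "\<And>R V n c s u t. \<lbrakk>R1 \<le> R; periodic_solution (\<lambda>t x. f t (clamp_at R x)) V c s u;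
      \<And>x y. 0 \<le> x \<Longrightarrow> x \<le> y \<Longrightarrow> y \<le> 1 \<Longrightarrow> \<bar>V y - V x\<bar> \<le> n y - n x;
      n 1 - n 0 \<le> k; \<bar>c\<bar> \<le> B; \<bar>s\<bar> \<le> k; t \<in> {0..1}\<rbrakk> \<Longrightarrow> u t \<le> R1"
    using a_priori_one_sided[OF f slow k, of B] by blast
  obtain R2 where R2: "k \<le> R2"
    "\<And>R V n c s u t. \<lbrakk>R2 \<le> R; periodic_solution (\<lambda>t x. - f t (- clamp_at R x)) V c s u;
      \<And>x y. 0 \<le> x \<Longrightarrow> x \<le> y \<Longrightarrow> y \<le> 1 \<Longrightarrow> \<bar>V y - V x\<bar> \<le> n y - n x;
      n 1 - n 0 \<le> k; \<bar>c\<bar> \<le> B; \<bar>s\<bar> \<le> k; t \<in> {0..1}\<rbrakk> \<Longrightarrow> u t \<le> R2"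
    using a_priori_one_sided[OF continuous_on_reflect_graph[OF f] slow_growth_reflect[OF slow] k, of B]
    by blast
  define R0 where "R0 = max (max R1 R2) (3 * k + 1)"
  show ?thesis
  proof (rule that[of R0])
    show "k \<le> R0" using k by (simp add: R0_def)
    fix R c s t :: real and V n u :: "real \<Rightarrow> real"
    assume R: "R0 \<le> R"
      and sol: "periodic_solution (\<lambda>t x. f t (clamp_at R x)) V c s u"
      and V: "continuous_on {0..1} V" "V 0 = 0" "V 1 = 0"
      and n: "\<And>x y. 0 \<le> x \<Longrightarrow> x \<le> y \<Longrightarrow> y \<le> 1 \<Longrightarrow> \<bar>V y - V x\<bar> \<le> n y - n x"
        "n 1 - n 0 \<le> k"
      and s: "\<bar>s\<bar> \<le> k" and t: "t \<in> {0..1}"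
    have "0 \<le> R" using R k by (simp add: R0_def)
    have "\<bar>V r\<bar> \<le> k" if r: "r \<in> {0..1}" for r
    proof -
      have "\<bar>V r - V 0\<bar> \<le> n r - n 0" "\<bar>V 1 - V r\<bar> \<le> n 1 - n r" using r by (auto intro!: n(1))
      then show ?thesis using n(2) V(2) by linarith
    qed
    then have c: "\<bar>c\<bar> \<le> B"
    proof (rule periodic_solution_drift_bound[OF sol continuous_on_clamp_graph[OF f] V, where \<eta> = 1])
      fix t x :: real assume tx: "t \<in> {0..1}" "\<bar>x - s\<bar> \<le> 2 * k + 1"
      then have "\<bar>x\<bar> \<le> 3 * k + 1" using s by linarith
      moreover from this have "clamp_at R x = x" using R by (intro clamp_at_id) (simp add: R0_def)
      ultimately show "\<bar>f t (clamp_at R x)\<bar> \<le> B" using B(2) tx(1) by simp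
    qed auto
    have "u t \<le> R1" by (rule R1(2)[OF _ sol n c s t]) (use R in \<open>simp_all add: R0_def\<close>)
    moreover have "- u t \<le> R2"
    proof (rule R2(2)[OF _ _ _ n(2) _ _ t])
      show "R2 \<le> R" using R by (simp add: R0_def)
      show "periodic_solution (\<lambda>t x. - f t (- clamp_at R x)) (\<lambda>t. - V t) (- c) (- s) (\<lambda>t. - u t)"
        using periodic_solution_reflect[OF sol] \<open>0 \<le> R\<close> by (simp add: clamp_at_minus)
      show "\<bar>- V y - - V x\<bar> \<le> n y - n x" if "0 \<le> x" "x \<le> y" "y \<le> 1" for x y
        using n(1)[OF that] by linarith
    qed (use c s in simp_all)
    ultimately show "\<bar>u t\<bar> \<le> R0" by (simp add: R0_def)
  qed
qed

lemma periodic_solution_cong: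
  assumes "periodic_solution h V c s u" "\<And>t. t \<in> {0..1} \<Longrightarrow> h t (u t) = k t (u t)"
  shows "periodic_solution k V c s u"
proof -
  have "integral {0..t} (\<lambda>r. h r (u r)) = integral {0..t} (\<lambda>r. k r (u r))" if "t \<in> {0..1}" for t
    using that by (intro integral_cong assms(2)) auto
  then show ?thesis using assms(1) unfolding periodic_solution_def by metis
qed

text \<open>A continuous solution is bounded, hence also solves the equation truncated beyond its
  own maximum, to which the uniform bound applies.\<close>

lemma periodic_solution_bound:
  fixes f :: "real \<Rightarrow> real \<Rightarrow> real"
  assumes f: "continuous_on ({0..1} \<times> UNIV) (\<lambda>(t, x). f t x)" and slow: "slow_growth f"
    and k: "0 \<le> k"
  obtains R0 where "0 \<le> R0"
    "\<And>V n c s u t. \<lbrakk>periodic_solution f V c s u; continuous_on {0..1} V; V 0 = 0; V 1 = 0;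
      \<And>x y. 0 \<le> x \<Longrightarrow> x \<le> y \<Longrightarrow> y \<le> 1 \<Longrightarrow> \<bar>V y - V x\<bar> \<le> n y - n x;
      n 1 - n 0 \<le> k; \<bar>s\<bar> \<le> k; t \<in> {0..1}\<rbrakk> \<Longrightarrow> \<bar>u t\<bar> \<le> R0"
proof -
  obtain R0 where R0: "k \<le> R0"
    "\<And>R V n c s u t. \<lbrakk>R0 \<le> R; periodic_solution (\<lambda>t x. f t (clamp_at R x)) V c s u;
      continuous_on {0..1} V; V 0 = 0; V 1 = 0;
      \<And>x y. 0 \<le> x \<Longrightarrow> x \<le> y \<Longrightarrow> y \<le> 1 \<Longrightarrow> \<bar>V y - V x\<bar> \<le> n y - n x;
      n 1 - n 0 \<le> k; \<bar>s\<bar> \<le> k; t \<in> {0..1}\<rbrakk> \<Longrightarrow> \<bar>u t\<bar> \<le> R0"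
    using a_priori_bound[OF assms] by blast
  show ?thesis
  proof (rule that[of R0])
    show "0 \<le> R0" using R0(1) k by simp
    fix c s t :: real and V n u :: "real \<Rightarrow> real"
    assume sol: "periodic_solution f V c s u" and V: "continuous_on {0..1} V" "V 0 = 0" "V 1 = 0"
      and n: "\<And>x y. 0 \<le> x \<Longrightarrow> x \<le> y \<Longrightarrow> y \<le> 1 \<Longrightarrow> \<bar>V y - V x\<bar> \<le> n y - n x"
        "n 1 - n 0 \<le> k" and s: "\<bar>s\<bar> \<le> k" and t: "t \<in> {0..1}"
    have "bounded (u ` {0..1})"
      by (intro compact_imp_bounded compact_continuous_image periodic_solutionD(1)[OF sol]) auto
    then obtain R' where "\<forall>y\<in>u ` {0..1}. norm y \<le> R'"
      unfolding bounded_iff by blast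
    then have R': "\<And>t. t \<in> {0..1} \<Longrightarrow> \<bar>u t\<bar> \<le> R'" by simp
    have "periodic_solution (\<lambda>t x. f t (clamp_at (max R0 R') x)) V c s u"
    proof (rule periodic_solution_cong[OF sol])
      fix t :: real assume "t \<in> {0..1}"
      then have "clamp_at (max R0 R') (u t) = u t" using R'[of t] by (intro clamp_at_id) auto
      then show "f t (u t) = f t (clamp_at (max R0 R') (u t))" by simp
    qed
    from R0(2)[OF _ this V n s t] show "\<bar>u t\<bar> \<le> R0" by simp
  qed
qed

text \<open>The truncated nonlinearity is bounded and Lipschitz, so it has a periodic solution; by
  the a priori bound this solution stays where the truncation is the identity.\<close>

lemma periodic_solution_existence:
  fixes f f' :: "real \<Rightarrow> real \<Rightarrow> real"
  assumes f: "continuous_on ({0..1} \<times> UNIV) (\<lambda>(t, x). f t x)"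
    and f': "continuous_on ({0..1} \<times> UNIV) (\<lambda>(t, x). f' t x)"
    and deriv: "\<And>t x. t \<in> {0..1} \<Longrightarrow> (f t has_real_derivative f' t x) (at x)"
    and slow: "slow_growth f"
    and V: "continuous_on {0..1} V" "V 0 = 0" "V 1 = 0"
    and n: "\<And>x y. 0 \<le> x \<Longrightarrow> x \<le> y \<Longrightarrow> y \<le> 1 \<Longrightarrow> \<bar>V y - V x\<bar> \<le> n y - n x"
  shows "\<exists>c u. periodic_solution f V c s u"
proof -
  define k where "k = max \<bar>s\<bar> (n 1 - n 0)"
  have k: "0 \<le> k" "\<bar>s\<bar> \<le> k" "n 1 - n 0 \<le> k" by (auto simp: k_def)
  obtain R where R: "k \<le> R"
    "\<And>c u t. \<lbrakk>periodic_solution (\<lambda>t x. f t (clamp_at R x)) V c s u; t \<in> {0..1}\<rbrakk> \<Longrightarrow> \<bar>u t\<bar> \<le> R"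
    using a_priori_bound[OF f slow k(1)] V n k by (metis order_refl)
  have R0: "0 \<le> R" using R k by simp
  obtain L where L: "0 \<le> L" "\<And>t x. t \<in> {0..1} \<Longrightarrow> \<bar>x\<bar> \<le> R \<Longrightarrow> \<bar>f' t x\<bar> \<le> L"
    using bounded_on_strip[OF f'] by blast
  obtain B where B: "0 \<le> B" "\<And>t x. t \<in> {0..1} \<Longrightarrow> \<bar>x\<bar> \<le> R \<Longrightarrow> \<bar>f t x\<bar> \<le> B"
    using bounded_on_strip[OF f] by blast
  have "\<bar>f t (clamp_at R x) - f t (clamp_at R y)\<bar> \<le> L * \<bar>x - y\<bar>" if t: "t \<in> {0..1}" for t x y
  proof -
    have "norm (f t (clamp_at R x) - f t (clamp_at R y)) \<le> L * norm (clamp_at R x - clamp_at R y)"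
    proof (rule field_differentiable_bound[of "{-R..R}"])
      fix z assume z: "z \<in> {-R..R}"
      show "(f t has_field_derivative f' t z) (at z within {-R..R})"
        using deriv[OF t] by (rule has_field_derivative_at_within)
      show "norm (f' t z) \<le> L" using L(2)[OF t, of z] z by auto
    qed (use abs_clamp_at[OF R0] in \<open>auto simp: abs_le_iff minus_le_iff\<close>)
    also have "\<dots> \<le> L * \<bar>x - y\<bar>"
      using clamp_at_lipschitz L(1) by (auto intro!: mult_left_mono)
    finally show ?thesis by simp
  qed
  moreover have "\<bar>f t (clamp_at R x)\<bar> \<le> B" if "t \<in> {0..1}" for t x
    using that B(2) abs_clamp_at[OF R0] by blast
  ultimately obtain c u where sol: "periodic_solution (\<lambda>t x. f t (clamp_at R x)) V c s u"
    using periodic_solution_bounded_existence[OF continuous_on_clamp_graph[OF f] _ _ V] by blast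
  have "periodic_solution f V c s u"
    by (rule periodic_solution_cong[OF sol]) (use R(2)[OF sol] in \<open>auto simp: clamp_at_id\<close>)
  then show ?thesis by blast
qed

section \<open>Differences of solutions: linear equations and Lipschitz dependence\<close>

text \<open>For \<open>g\<close> the derivative of \<open>f\<close> in the state this is the
  difference quotient with its singularity removed: averaging over the segment is jointly
  continuous, also at \<open>x = y\<close>.\<close>

definition mean_slope :: "(real \<Rightarrow> real \<Rightarrow> real) \<Rightarrow> real \<Rightarrow> real \<Rightarrow> real \<Rightarrow> real" where
  "mean_slope g t x y = integral {0..1} (\<lambda>\<theta>. g t (x + \<theta> * (y - x)))"

lemma mean_slope:
  fixes f f' :: "real \<Rightarrow> real \<Rightarrow> real"
  assumes f': "continuous_on ({0..1} \<times> UNIV) (\<lambda>(t, x). f' t x)"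
    and deriv: "\<And>t x. t \<in> {0..1} \<Longrightarrow> (f t has_real_derivative f' t x) (at x)"
    and t: "t \<in> {0..1}"
  shows "f t y - f t x = mean_slope f' t x y * (y - x)"
proof -
  have "((\<lambda>\<theta>. f' t (x + \<theta> * (y - x)) * (y - x)) has_integral
      f t (x + 1 * (y - x)) - f t (x + 0 * (y - x))) {0..1}"
  proof (rule fundamental_theorem_of_calculus)
    fix \<theta> :: real
    have "((\<lambda>\<theta>. f t (x + \<theta> * (y - x))) has_real_derivative f' t (x + \<theta> * (y - x)) * (y - x))
        (at \<theta> within {0..1})"
      by (rule DERIV_chain2[OF deriv[OF t]]) (auto intro!: derivative_eq_intros)
    then show "((\<lambda>\<theta>. f t (x + \<theta> * (y - x))) has_vector_derivative f' t (x + \<theta> * (y - x)) * (y - x))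
        (at \<theta> within {0..1})"
      by (simp add: has_real_derivative_iff_has_vector_derivative)
  qed simp
  then show ?thesis unfolding mean_slope_def by (simp add: integral_unique flip: integral_mult_left)
qed

lemma continuous_on_mean_slope:
  fixes f' :: "real \<Rightarrow> real \<Rightarrow> real" and x y :: "'a::topological_space \<Rightarrow> real"
  assumes f': "continuous_on ({0..1} \<times> UNIV) (\<lambda>(t, x). f' t x)"
    and t: "continuous_on S t" "\<And>p. p \<in> S \<Longrightarrow> t p \<in> {0..1}"
    and xy: "continuous_on S x" "continuous_on S y"
  shows "continuous_on S (\<lambda>p. mean_slope f' (t p) (x p) (y p))"
proof -
  have fst: "continuous_on (S \<times> {0..1::real}) (\<lambda>q. g (fst q))"
    if "continuous_on S g" for g :: "'a \<Rightarrow> real"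
    by (rule continuous_on_compose2[OF that]) (auto intro!: continuous_intros)
  have "continuous_on (S \<times> cbox 0 1)
      (\<lambda>q. (\<lambda>(t, x). f' t x) (t (fst q), x (fst q) + snd q * (y (fst q) - x (fst q))))"
    by (rule continuous_on_compose2[OF f']) (use t(2) in \<open>auto intro!: continuous_intros fst t xy\<close>)
  then have "continuous_on S (\<lambda>p. integral (cbox 0 1) (\<lambda>\<theta>. f' (t p) (x p + \<theta> * (y p - x p))))"
    by (intro integral_continuous_on_param) (simp add: case_prod_unfold)
  then show ?thesis by (simp add: mean_slope_def)
qed

lemma mean_slope_bound:
  fixes f' :: "real \<Rightarrow> real \<Rightarrow> real"
  assumes f': "continuous_on ({0..1} \<times> UNIV) (\<lambda>(t, x). f' t x)"
    and K: "\<And>z. \<bar>z\<bar> \<le> R \<Longrightarrow> \<bar>f' t z\<bar> \<le> K" and t: "t \<in> {0..1}"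
    and xy: "\<bar>x\<bar> \<le> R" "\<bar>y\<bar> \<le> R"
  shows "\<bar>mean_slope f' t x y\<bar> \<le> K"
proof -
  have "\<bar>mean_slope f' t x y\<bar> \<le> K * (1 - 0)"
    unfolding mean_slope_def
  proof (rule abs_integral_le)
    have "continuous_on {0..1} (\<lambda>\<theta>. (\<lambda>(t, x). f' t x) (t, x + \<theta> * (y - x)))"
      by (rule continuous_on_compose2[OF f']) (use t in \<open>auto intro!: continuous_intros\<close>)
    then show "continuous_on {0..1} (\<lambda>\<theta>. f' t (x + \<theta> * (y - x)))" by simp
    fix \<theta> :: real assume \<theta>: "\<theta> \<in> {0..1}"
    have "x + \<theta> * (y - x) = (1 - \<theta>) * x + \<theta> * y" by (simp add: algebra_simps)
    also have "\<bar>\<dots>\<bar> \<le> (1 - \<theta>) * R + \<theta> * R"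
    proof -
      have "\<bar>(1 - \<theta>) * x\<bar> \<le> (1 - \<theta>) * R" "\<bar>\<theta> * y\<bar> \<le> \<theta> * R"
        using \<theta> xy by (auto simp: abs_mult intro!: mult_left_mono)
      then show ?thesis by linarith
    qed
    finally show "\<bar>f' t (x + \<theta> * (y - x))\<bar> \<le> K" by (intro K) (simp add: algebra_simps)
  qed simp
  then show ?thesis by simp
qed

text \<open>Lipschitz dependence, and with it uniqueness, as well as differentiability along the
  fibres are reduced to linear equations by this averaging.\<close>

lemma periodic_solution_difference:
  fixes f f' :: "real \<Rightarrow> real \<Rightarrow> real"
  assumes f: "continuous_on ({0..1} \<times> UNIV) (\<lambda>(t, x). f t x)"
    and f': "continuous_on ({0..1} \<times> UNIV) (\<lambda>(t, x). f' t x)"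
    and deriv: "\<And>t x. t \<in> {0..1} \<Longrightarrow> (f t has_real_derivative f' t x) (at x)"
    and 1: "periodic_solution f V1 c1 s1 u1" and 2: "periodic_solution f V2 c2 s2 u2"
  shows "periodic_solution (\<lambda>t x. mean_slope f' t (u1 t) (u2 t) * x)
    (\<lambda>t. V2 t - V1 t) (c2 - c1) (s2 - s1) (\<lambda>t. u2 t - u1 t)"
proof -
  note u1 = periodic_solutionD[OF 1] and u2 = periodic_solutionD[OF 2]
  have fu: "continuous_on {0..1} (\<lambda>r. f r (u1 r))" "continuous_on {0..1} (\<lambda>r. f r (u2 r))"
    by (auto intro!: continuous_on_compose_graph[OF f] u1(1) u2(1))
  have "u2 t - u1 t = (u2 0 - u1 0) + (V2 t - V1 t) + (c2 - c1) * t
      - integral {0..t} (\<lambda>r. mean_slope f' r (u1 r) (u2 r) * (u2 r - u1 r))" if t: "t \<in> {0..1}" for t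
  proof -
    have sub: "{0..t} \<subseteq> {0..1}" using t by auto
    have "integral {0..t} (\<lambda>r. mean_slope f' r (u1 r) (u2 r) * (u2 r - u1 r))
        = integral {0..t} (\<lambda>r. f r (u2 r) - f r (u1 r))"
      using sub by (intro integral_cong mean_slope[OF f' deriv, symmetric]) auto
    also have "\<dots> = integral {0..t} (\<lambda>r. f r (u2 r)) - integral {0..t} (\<lambda>r. f r (u1 r))"
      using fu by (intro integral_diff integrable_continuous_real) (auto intro: continuous_on_subset[OF _ sub])
    finally show ?thesis using u1(2)[OF t] u2(2)[OF t] by (simp add: algebra_simps)
  qed
  moreover have "continuous_on {0..1} (\<lambda>t. u2 t - u1 t)" by (intro continuous_intros u1(1) u2(1))
  moreover have "integral {0..1} (\<lambda>t. u2 t - u1 t) = s2 - s1"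
    using u1(4) u2(4) integrable_continuous_real[OF u1(1)] integrable_continuous_real[OF u2(1)]
    by (simp add: integral_diff)
  moreover have "u2 1 - u1 1 = u2 0 - u1 0" using u1(3) u2(3) by simp
  ultimately show ?thesis unfolding periodic_solution_def by blast
qed

lemma continuous_on_affine_graph:
  fixes a b :: "real \<Rightarrow> real"
  assumes "continuous_on {0..1} a" "continuous_on {0..1} b"
  shows "continuous_on ({0..1} \<times> UNIV) (\<lambda>(t, x::real). a t * x + b t)"
proof -
  have "continuous_on ({0..1} \<times> UNIV) (\<lambda>p. a (fst p) * snd p + b (fst p) :: real)"
    by (intro continuous_intros continuous_on_compose2[OF assms(1)] continuous_on_compose2[OF assms(2)]) auto
  then show ?thesis by (simp add: case_prod_unfold)
qed

lemma linear_integrating_factor: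
  fixes a b y :: "real \<Rightarrow> real"
  assumes a: "continuous_on {0..1} a" and b: "continuous_on {0..1} b"
    and y: "continuous_on {0..1} y"
      "\<And>t. t \<in> {0..1} \<Longrightarrow> y t = y 0 + c * t - integral {0..t} (\<lambda>r. a r * y r + b r)"
    and t: "t \<in> {0..1}"
  shows "((\<lambda>t. exp (integral {0..t} a) * y t) has_real_derivative
    exp (integral {0..t} a) * (c - b t)) (at t within {0..1})"
proof -
  have "continuous_on {0..1} (\<lambda>r. a r * y r + b r)" by (intro continuous_intros a b y(1))
  then have "((\<lambda>t. y 0 + c * t - integral {0..t} (\<lambda>r. a r * y r + b r)) has_real_derivative
      c - (a t * y t + b t)) (at t within {0..1})"
    using t by (auto intro!: derivative_eq_intros integral_has_real_derivative)
  then have dy: "(y has_real_derivative c - (a t * y t + b t)) (at t within {0..1})"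
    by (rule has_field_derivative_transform_within[where d = 1])
       (use t in \<open>simp_all only: y(2)[symmetric] zero_less_one\<close>)
  have "((\<lambda>t. integral {0..t} a) has_real_derivative a t) (at t within {0..1})"
    by (rule integral_has_real_derivative[OF a t])
  then have "((\<lambda>t. exp (integral {0..t} a)) has_real_derivative exp (integral {0..t} a) * a t)
      (at t within {0..1})"
    by (rule DERIV_chain2[OF DERIV_exp])
  from DERIV_mult[OF this dy] show ?thesis by (rule DERIV_cong) (simp add: algebra_simps)
qed

text \<open>The drift bound with zero forcing controls \<open>c\<close>. The integrating factor then
  bounds the increments of \<open>E t * y t\<close>, measured from a time where \<open>y\<close>
  equals its mean; since \<open>E\<close> lies between \<open>exp (- K)\<close> and
  \<open>exp K\<close>, this costs \<open>exp (2 * K)\<close>.\<close>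

lemma linear_periodic_solution_bound:
  fixes a b y :: "real \<Rightarrow> real"
  assumes a: "continuous_on {0..1} a" and b: "continuous_on {0..1} b"
    and K: "\<And>t. t \<in> {0..1} \<Longrightarrow> \<bar>a t\<bar> \<le> K" "\<And>t. t \<in> {0..1} \<Longrightarrow> \<bar>b t\<bar> \<le> \<beta>"
    and sol: "periodic_solution (\<lambda>t x. a t * x + b t) (\<lambda>_. 0) c \<sigma> y"
  shows "\<bar>c\<bar> \<le> K * \<bar>\<sigma>\<bar> + \<beta>"
    and "t \<in> {0..1} \<Longrightarrow> \<bar>y t\<bar> \<le> exp (2 * K) * (\<bar>\<sigma>\<bar> + \<bar>c\<bar> + \<beta>)"
proof -
  have K0: "0 \<le> K" "0 \<le> \<beta>" using K(1)[of 0] K(2)[of 0] by auto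
  note y = periodic_solutionD[OF sol]
  show "\<bar>c\<bar> \<le> K * \<bar>\<sigma>\<bar> + \<beta>"
  proof (rule field_le_epsilon)
    fix e :: real assume e: "0 < e"
    \<comment> \<open>The drift bound asks for a positive margin; the cost \<open>K * \<eta>\<close>
      of this one is at most the arbitrary \<open>e\<close>.\<close>
    define \<eta> where "\<eta> = e / (K + 1)"
    have \<eta>: "0 < \<eta>" "K * \<eta> \<le> e" using e K0 by (auto simp: \<eta>_def field_simps)
    have "\<bar>c\<bar> \<le> K * (\<bar>\<sigma>\<bar> + \<eta>) + \<beta>"
    proof (rule periodic_solution_drift_bound[OF sol continuous_on_affine_graph[OF a b], where w = 0 and \<eta> = \<eta>])
      fix t x :: real assume t: "t \<in> {0..1}" and x: "\<bar>x - \<sigma>\<bar> \<le> 2 * 0 + \<eta>"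
      then have "\<bar>x\<bar> \<le> \<bar>\<sigma>\<bar> + \<eta>" by linarith
      then have "\<bar>a t * x\<bar> \<le> K * (\<bar>\<sigma>\<bar> + \<eta>)" unfolding abs_mult using K0 K(1)[OF t] by (intro mult_mono) auto
      then show "\<bar>a t * x + b t\<bar> \<le> K * (\<bar>\<sigma>\<bar> + \<eta>) + \<beta>" using K(2)[OF t] by linarith
    qed (use \<eta> in auto)
    then show "\<bar>c\<bar> \<le> K * \<bar>\<sigma>\<bar> + \<beta> + e" using \<eta>(2) by (simp add: algebra_simps)
  qed
  assume t: "t \<in> {0..1}"
  define E where "E t = exp (integral {0..t} a)" for t
  have E: "E r \<le> exp K" "exp (- K) \<le> E r" "0 < E r" if r: "r \<in> {0..1}" for r
  proof -
    have "\<bar>integral {0..r} a\<bar> \<le> K * (r - 0)"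
      using r by (intro abs_integral_le K continuous_on_subset[OF a]) auto
    also have "\<dots> \<le> K" using r K0 by (simp add: mult_left_le)
    finally show "E r \<le> exp K" "exp (- K) \<le> E r" "0 < E r" by (auto simp: E_def)
  qed
  have deriv: "((\<lambda>t. E t * y t) has_real_derivative E t * (c - b t)) (at t within {0..1})"
    if "t \<in> {0..1}" for t
    unfolding E_def by (rule linear_integrating_factor[OF a b y(1) y(2)[unfolded add_0_right] that])
  obtain t0 where t0: "t0 \<in> {0..1}" "y t0 = \<sigma>"
    using integral_attained[OF y(1)] y(4) by metis
  have "norm (E t * y t - E t0 * y t0) \<le> exp K * (\<bar>c\<bar> + \<beta>) * norm (t - t0)"
  proof (rule field_differentiable_bound[of "{0..1}" _ "\<lambda>t. E t * (c - b t)"])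
    fix r :: real assume r: "r \<in> {0..1}"
    show "((\<lambda>t. E t * y t) has_field_derivative E r * (c - b r)) (at r within {0..1})"
      by (rule deriv[OF r])
    have "\<bar>c - b r\<bar> \<le> \<bar>c\<bar> + \<beta>" using K(2)[OF r] by linarith
    then show "norm (E r * (c - b r)) \<le> exp K * (\<bar>c\<bar> + \<beta>)"
      using E[OF r] K0 by (auto simp: abs_mult intro!: mult_mono)
  qed (use t t0 in auto)
  also have "\<dots> \<le> exp K * (\<bar>c\<bar> + \<beta>) * 1"
    using t t0 K0 by (intro mult_left_mono) auto
  finally have 1: "\<bar>E t * y t - E t0 * y t0\<bar> \<le> exp K * (\<bar>c\<bar> + \<beta>)" by simp
  have 2: "\<bar>E t0 * y t0\<bar> \<le> exp K * \<bar>\<sigma>\<bar>"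
    using E[OF t0(1)] t0(2) by (auto simp: abs_mult intro!: mult_right_mono)
  have "exp (- K) * \<bar>y t\<bar> \<le> E t * \<bar>y t\<bar>" using E[OF t] by (intro mult_right_mono) auto
  also have "\<dots> = \<bar>E t * y t\<bar>" using E[OF t] by (simp add: abs_mult)
  also have "\<dots> \<le> exp K * (\<bar>\<sigma>\<bar> + \<bar>c\<bar> + \<beta>)" using 1 2 by (simp add: distrib_left)
  finally have "exp K * (exp (- K) * \<bar>y t\<bar>) \<le> exp K * (exp K * (\<bar>\<sigma>\<bar> + \<bar>c\<bar> + \<beta>))"
    by (intro mult_left_mono) auto
  moreover have "exp K * (exp (- K) * \<bar>y t\<bar>) = \<bar>y t\<bar>" by (simp add: exp_minus)
  moreover have "exp K * (exp K * (\<bar>\<sigma>\<bar> + \<bar>c\<bar> + \<beta>)) = exp (2 * K) * (\<bar>\<sigma>\<bar> + \<bar>c\<bar> + \<beta>)"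
    by (simp only: mult.assoc[symmetric] exp_add[symmetric] mult_2)
  ultimately show "\<bar>y t\<bar> \<le> exp (2 * K) * (\<bar>\<sigma>\<bar> + \<bar>c\<bar> + \<beta>)" by simp
qed

text \<open>Subtracting the non-smooth forcing \<open>V2 - V1\<close> turns the difference into a \<open>C\<^sup>1\<close> function.\<close>

lemma periodic_solution_lipschitz:
  fixes f f' :: "real \<Rightarrow> real \<Rightarrow> real"
  assumes f: "continuous_on ({0..1} \<times> UNIV) (\<lambda>(t, x). f t x)"
    and f': "continuous_on ({0..1} \<times> UNIV) (\<lambda>(t, x). f' t x)"
    and deriv: "\<And>t x. t \<in> {0..1} \<Longrightarrow> (f t has_real_derivative f' t x) (at x)"
    and K: "\<And>t x. t \<in> {0..1} \<Longrightarrow> \<bar>x\<bar> \<le> R \<Longrightarrow> \<bar>f' t x\<bar> \<le> K"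
    and 1: "periodic_solution f V1 c1 s1 u1" and 2: "periodic_solution f V2 c2 s2 u2"
    and R: "\<And>t. t \<in> {0..1} \<Longrightarrow> \<bar>u1 t\<bar> \<le> R" "\<And>t. t \<in> {0..1} \<Longrightarrow> \<bar>u2 t\<bar> \<le> R"
    and V: "continuous_on {0..1} V1" "V1 0 = 0" "V1 1 = 0" "continuous_on {0..1} V2" "V2 0 = 0" "V2 1 = 0"
    and w: "\<And>t. t \<in> {0..1} \<Longrightarrow> \<bar>V2 t - V1 t\<bar> \<le> w"
    and t: "t \<in> {0..1}"
  shows "\<bar>u2 t - u1 t\<bar> \<le> (1 + exp (2 * K) * (1 + 3 * K)) * (w + \<bar>s2 - s1\<bar>)"
proof -
  define a where "a t = mean_slope f' t (u1 t) (u2 t)" for t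
  define v where "v t = V2 t - V1 t" for t
  define d where "d t = u2 t - u1 t" for t
  have "\<bar>u1 0\<bar> \<le> R" using R(1)[of 0] by simp
  then have K0: "0 \<le> K" using K[of 0 "u1 0"] by simp
  have w0: "0 \<le> w" using w[of 0] by simp
  have a: "continuous_on {0..1} a"
    unfolding a_def by (intro continuous_on_mean_slope[OF f'] periodic_solutionD(1)[OF 1]
        periodic_solutionD(1)[OF 2] continuous_on_id) auto
  have v: "continuous_on {0..1} v" unfolding v_def by (intro continuous_intros V)
  have aK: "\<bar>a t\<bar> \<le> K" if "t \<in> {0..1}" for t
    unfolding a_def by (rule mean_slope_bound[OF f' K that R[OF that]]) (rule that)
  have "periodic_solution (\<lambda>t x. a t * x) v (c2 - c1) (s2 - s1) d"
    unfolding a_def v_def d_def by (rule periodic_solution_difference[OF f f' deriv 1 2])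
  note d = periodic_solutionD[OF this]
  have sol: "periodic_solution (\<lambda>t x. a t * x + a t * v t) (\<lambda>_. 0) (c2 - c1)
      (s2 - s1 - integral {0..1} v) (\<lambda>t. d t - v t)"
  proof -
    have "d t - v t = (d 0 - v 0) + 0 + (c2 - c1) * t - integral {0..t} (\<lambda>r. a r * (d r - v r) + a r * v r)"
      if "t \<in> {0..1}" for t
    proof -
      have eq: "(\<lambda>r. a r * (d r - v r) + a r * v r) = (\<lambda>r. a r * d r)" by (simp add: algebra_simps)
      have "v 0 = 0" using V by (simp add: v_def)
      then show ?thesis using d(2)[OF that] unfolding eq by linarith
    qed
    moreover have "continuous_on {0..1} (\<lambda>t. d t - v t)" by (intro continuous_intros d(1) v)
    moreover have "d 1 - v 1 = d 0 - v 0" using d(3) V by (simp add: v_def)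
    moreover have "integral {0..1} (\<lambda>t. d t - v t) = s2 - s1 - integral {0..1} v"
      using d(4) integrable_continuous_real[OF d(1)] integrable_continuous_real[OF v]
      by (simp add: integral_diff)
    ultimately show ?thesis unfolding periodic_solution_def by blast
  qed
  have av: "continuous_on {0..1} (\<lambda>t. a t * v t)" by (intro continuous_intros a v)
  have avK: "\<bar>a t * v t\<bar> \<le> K * w" if "t \<in> {0..1}" for t
    unfolding abs_mult using aK[OF that] w[OF that] K0 by (intro mult_mono) (auto simp: v_def)
  define S where "S = \<bar>s2 - s1\<bar> + w"
  have "\<bar>integral {0..1} v\<bar> \<le> w * (1 - 0)"
    by (rule abs_integral_le[OF v]) (use w in \<open>auto simp: v_def\<close>)
  then have \<sigma>: "\<bar>s2 - s1 - integral {0..1} v\<bar> \<le> S" by (simp add: S_def)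
  have "\<bar>c2 - c1\<bar> \<le> K * \<bar>s2 - s1 - integral {0..1} v\<bar> + K * w"
    by (rule linear_periodic_solution_bound(1)[OF a av aK avK sol])
  also have "\<dots> \<le> K * S + K * S"
    using \<sigma> K0 by (intro add_mono mult_left_mono) (auto simp: S_def)
  finally have c: "\<bar>c2 - c1\<bar> \<le> 2 * K * S" by simp
  have "\<bar>d t - v t\<bar> \<le> exp (2 * K) * (\<bar>s2 - s1 - integral {0..1} v\<bar> + \<bar>c2 - c1\<bar> + K * w)"
    by (rule linear_periodic_solution_bound(2)[OF a av aK avK sol t])
  also have "\<dots> \<le> exp (2 * K) * (S + 2 * K * S + K * S)"
    using \<sigma> c K0 by (intro mult_left_mono add_mono mult_left_mono) (auto simp: S_def)
  also have "\<dots> = exp (2 * K) * (1 + 3 * K) * S" by (simp add: algebra_simps)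
  finally have "\<bar>d t - v t\<bar> \<le> exp (2 * K) * (1 + 3 * K) * S" .
  moreover have "\<bar>v t\<bar> \<le> S" using w[OF t] by (simp add: S_def v_def)
  ultimately have "\<bar>d t\<bar> \<le> S + exp (2 * K) * (1 + 3 * K) * S" by linarith
  then show ?thesis by (simp add: d_def S_def algebra_simps)
qed

section \<open>The global diffeomorphism\<close>

lemma slow_linear:
  assumes "1 \<le> L"
  shows "slow (\<lambda>x. 1 + L * \<bar>x\<bar>)"
  unfolding slow_def
proof
  fix B :: real
  \<comment> \<open>The solution of \<open>ln (1 + L * N) / L = max 0 B\<close>.\<close>
  define N where "N = (exp (L * max 0 B) - 1) / L"
  have N: "0 \<le> N" "1 + L * N = exp (L * max 0 B)" using assms by (simp_all add: N_def)
  have "((\<lambda>x. 1 / (1 + L * x)) has_integral ln (1 + L * N) / L - ln (1 + L * 0) / L) {0..N}"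
  proof (rule fundamental_theorem_of_calculus[OF N(1)])
    fix x :: real assume "x \<in> {0..N}"
    then have "0 < 1 + L * x" using assms by (auto intro: add_pos_nonneg)
    then have "((\<lambda>x. ln (1 + L * x) / L) has_real_derivative 1 / (1 + L * x)) (at x within {0..N})"
      using assms by (auto intro!: derivative_eq_intros simp: divide_simps)
    then show "((\<lambda>x. ln (1 + L * x) / L) has_vector_derivative 1 / (1 + L * x)) (at x within {0..N})"
      by (simp add: has_real_derivative_iff_has_vector_derivative)
  qed
  then have "integral {0..N} (\<lambda>x. 1 / (1 + L * x)) = max 0 B"
    using N assms by (simp add: integral_unique)
  moreover have "integral {0..N} (\<lambda>x. 1 / (1 + L * \<bar>x\<bar>)) = integral {0..N} (\<lambda>x. 1 / (1 + L * x))"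
    by (rule integral_cong) auto
  ultimately show "\<exists>N\<ge>0. B \<le> integral {0..N} (\<lambda>x. 1 / (1 + L * \<bar>x\<bar>))"
    using N(1) by (intro exI[of _ N]) auto
qed

text \<open>This puts the linearised problem under the same solution theory, so the derivative of
  \<open>Psi\<close> is inverted by the argument that inverts \<open>Psi\<close>.\<close>

lemma slow_growth_linear:
  fixes a :: "real \<Rightarrow> real"
  assumes a: "continuous_on {0..1} a"
  shows "slow_growth (\<lambda>t x. a t * x)"
proof -
  have "bounded (a ` {0..1})" by (intro compact_imp_bounded compact_continuous_image a) simp
  then obtain L0 where "\<forall>y\<in>a ` {0..1}. norm y \<le> L0" unfolding bounded_iff by blast
  then have L0: "\<bar>a t\<bar> \<le> L0" if "t \<in> {0..1}" for t using that by simp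
  define L where "L = max 1 L0"
  have L: "1 \<le> L" by (simp add: L_def)
  have le: "\<bar>a t * x\<bar> \<le> 1 + L * \<bar>x\<bar>" if "t \<in> {0..1}" for t x
  proof -
    have "\<bar>a t\<bar> * \<bar>x\<bar> \<le> L * \<bar>x\<bar>" using L0[OF that] by (intro mult_right_mono) (auto simp: L_def)
    then show ?thesis by (simp add: abs_mult)
  qed
  have "continuous_on UNIV (\<lambda>x. 1 + L * \<bar>x\<bar>)" by (intro continuous_intros)
  moreover have "\<forall>t\<in>{0..1}. \<forall>x. a t * x \<le> 1 + L * \<bar>x\<bar>" using le by (auto simp: abs_le_iff)
  moreover have "\<forall>t\<in>{0..1}. \<forall>x. - (a t * x) \<le> 1 + L * \<bar>x\<bar>" using le by (fastforce simp: abs_le_iff)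
  ultimately show ?thesis
    unfolding slow_growth_def using slow_linear[OF L] L
    by (intro exI[of _ "\<lambda>x. 1 + L * \<bar>x\<bar>"]) auto
qed

section \<open>Abstract interface to the two pairs of spaces; bijectivity of
  \<open>Psi\<close>\<close>

definition circle_function :: "(real \<Rightarrow> real) \<Rightarrow> bool" where
  "circle_function g \<longleftrightarrow> (\<forall>t. g (t + 1) = g t) \<and> continuous_on {0..1} g"

lemma circle_function_bounded:
  assumes "circle_function g"
  obtains C where "0 \<le> C" "\<And>t. t \<in> {0..1} \<Longrightarrow> \<bar>g t\<bar> \<le> C"
proof -
  have "bounded (g ` {0..1})"
    using assms by (intro compact_imp_bounded compact_continuous_image) (auto simp: circle_function_def)
  then obtain C where C: "\<forall>y\<in>g ` {0..1}. norm y \<le> C" unfolding bounded_iff by blast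
  then have "\<bar>g 0\<bar> \<le> C" by simp
  then have "0 \<le> C" by linarith
  with C show ?thesis by (intro that[of C]) auto
qed

text \<open>The common ground of a tame nonlinearity with its partial derivative and of a linear
  equation with periodic coefficient; everything about \<open>Psi\<close> is proved at this level
  and then used for both.\<close>

definition admissible :: "(real \<Rightarrow> real \<Rightarrow> real) \<Rightarrow> (real \<Rightarrow> real \<Rightarrow> real) \<Rightarrow> bool" where
  "admissible f f' \<longleftrightarrow> (\<forall>t x. f (t + 1) x = f t x) \<and> (\<forall>t x. f' (t + 1) x = f' t x) \<and>
     continuous_on ({0..1} \<times> UNIV) (\<lambda>(t, x). f t x) \<and>
     continuous_on ({0..1} \<times> UNIV) (\<lambda>(t, x). f' t x) \<and>
     (\<forall>t\<in>{0..1}. \<forall>x. (f t has_real_derivative f' t x) (at x)) \<and> slow_growth f"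

lemma admissibleD:
  assumes "admissible f f'"
  shows "f (t + 1) x = f t x" "f' (t + 1) x = f' t x"
    "continuous_on ({0..1} \<times> UNIV) (\<lambda>(t, x). f t x)"
    "continuous_on ({0..1} \<times> UNIV) (\<lambda>(t, x). f' t x)"
    "t \<in> {0..1} \<Longrightarrow> (f t has_real_derivative f' t x) (at x)"
    "slow_growth f"
  using assms unfolding admissible_def by blast+

lemma admissible_linear:
  assumes "circle_function a"
  shows "admissible (\<lambda>t x. a t * x) (\<lambda>t x. a t)"
proof -
  have a: "continuous_on {0..1} a" using assms by (simp add: circle_function_def)
  have "continuous_on ({0..1} \<times> UNIV) (\<lambda>p::real \<times> real. a (fst p))"
    by (intro continuous_on_compose2[OF a] continuous_intros) auto
  moreover have "continuous_on ({0..1} \<times> UNIV) (\<lambda>(t, x). a t * x)"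
    using continuous_on_affine_graph[OF a continuous_on_const, of 0] by simp
  ultimately show ?thesis
    using assms slow_growth_linear[OF a]
    by (auto simp: admissible_def circle_function_def case_prod_unfold intro!: derivative_eq_intros)
qed

text \<open>
  Both pairs of function spaces are handled through the primitive \<open>prim v t = \<integral>\<^sub>0\<^sup>t v\<close>, which turns
  elements of \<open>B\<^sup>0\<close> into continuous functions of bounded variation.
\<close>

locale circle_pair =
  fixes der :: "'a :: circle_domain \<Rightarrow> 'b :: circle_codomain"
    and prim :: "'b \<Rightarrow> real \<Rightarrow> real" and K :: real
  assumes ev_linear: "linear (\<lambda>u :: 'a. ev u t)"
    and der_linear: "linear der"
    and prim_linear: "linear (\<lambda>v. prim v t)"
    and ev_circle: "circle_function (ev (u :: 'a))"
    and K1: "1 \<le> K"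
    and ev_bound: "t \<in> {0..1} \<Longrightarrow> \<bar>ev (u :: 'a) t\<bar> \<le> K * norm u"
    and der_bound: "norm (der u) \<le> K * norm u"
    and prim_bound: "t \<in> {0..1} \<Longrightarrow> \<bar>prim v t\<bar> \<le> K * norm v"
    and norm_le: "(\<And>t. t \<in> {0..1} \<Longrightarrow> \<bar>ev (u :: 'a) t\<bar> \<le> C) \<Longrightarrow> norm u \<le> K * (C + norm (der u))"
    and of_fun_bound: "circle_function g \<Longrightarrow> (\<And>t. t \<in> {0..1} \<Longrightarrow> \<bar>g t\<bar> \<le> C) \<Longrightarrow>
      norm (of_fun g :: 'b) \<le> K * C"
    and ev_prim: "t \<in> {0..1} \<Longrightarrow> ev u t = ev u 0 + prim (der u) t"
    and prim_0: "prim v 0 = 0"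
    and prim_continuous: "continuous_on {0..1} (prim v)"
    and mean_eq: "mean v = prim v 1"
    and prim_inject: "(\<And>t. t \<in> {0..1} \<Longrightarrow> prim v t = prim w t) \<Longrightarrow> v = w"
    and prim_of_fun: "circle_function g \<Longrightarrow> t \<in> {0..1} \<Longrightarrow> prim (of_fun g) t = integral {0..t} g"
    and prim_variation: "\<exists>n. (\<forall>x y. 0 \<le> x \<longrightarrow> x \<le> y \<longrightarrow> y \<le> 1 \<longrightarrow> \<bar>prim v y - prim v x\<bar> \<le> n y - n x) \<and>
      n 1 - n 0 \<le> K * norm v"
    and der_surj: "mean v = 0 \<Longrightarrow> \<exists>u. der u = v \<and> ev u 0 = x"
begin

lemmas ev_simps = linear_add[OF ev_linear] linear_diff[OF ev_linear] linear_cmul[OF ev_linear] linear_0[OF ev_linear]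
lemmas der_simps = linear_add[OF der_linear] linear_diff[OF der_linear] linear_cmul[OF der_linear]
lemmas prim_simps = linear_add[OF prim_linear] linear_diff[OF prim_linear] linear_cmul[OF prim_linear]

lemma mean_simps: "mean (v + w) = mean v + mean (w :: 'b)" "mean (v - w) = mean v - mean (w :: 'b)"
  "mean (c *\<^sub>R v) = c * mean (v :: 'b)"
  by (simp_all add: mean_eq prim_simps)

lemma K0: "0 \<le> K"
  using K1 by simp

lemma circle_function_const: "circle_function (\<lambda>_. c)"
  by (simp add: circle_function_def)

lemma prim_const: "t \<in> {0..1} \<Longrightarrow> prim (const c) t = c * t"
  unfolding const_def by (subst prim_of_fun) (auto simp: circle_function_const mult.commute)

lemma mean_const: "mean (const c :: 'b) = c"
  by (simp add: mean_eq prim_const)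

lemma const_simps: "const (c + d) = (const c + const d :: 'b)" "const (c - d) = (const c - const d :: 'b)"
  "const (r * c) = (r *\<^sub>R const c :: 'b)" "const 0 = (0 :: 'b)"
  by (rule prim_inject; simp add: prim_simps prim_const linear_0[OF prim_linear] algebra_simps)+

lemma norm_const: "norm (const c :: 'b) \<le> K * \<bar>c\<bar>"
  unfolding const_def by (rule of_fun_bound) (auto simp: circle_function_const)

lemma mean_bound: "\<bar>mean v\<bar> \<le> K * norm (v :: 'b)"
  unfolding mean_eq by (rule prim_bound) simp

lemma of_fun_simps:
  assumes g: "circle_function g" and h: "circle_function h"
  shows "of_fun (\<lambda>t. g t + h t) = (of_fun g + of_fun h :: 'b)"
    "of_fun (\<lambda>t. g t - h t) = (of_fun g - of_fun h :: 'b)"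
    "of_fun (\<lambda>t. r * g t) = (r *\<^sub>R of_fun g :: 'b)"
proof -
  have c: "circle_function (\<lambda>t. g t + h t)" "circle_function (\<lambda>t. g t - h t)" "circle_function (\<lambda>t. r * g t)"
    using g h by (auto simp: circle_function_def intro!: continuous_intros)
  have i: "g integrable_on {0..t}" "h integrable_on {0..t}" if "t \<in> {0..1}" for t
    using g h that unfolding circle_function_def
    by (auto intro!: integrable_continuous_real elim: continuous_on_subset)
  show "of_fun (\<lambda>t. g t + h t) = (of_fun g + of_fun h :: 'b)"
    by (rule prim_inject) (simp add: prim_simps prim_of_fun c g h integral_add i)
  show "of_fun (\<lambda>t. g t - h t) = (of_fun g - of_fun h :: 'b)"
    by (rule prim_inject) (simp add: prim_simps prim_of_fun c g h integral_diff i)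
  show "of_fun (\<lambda>t. r * g t) = (r *\<^sub>R of_fun g :: 'b)"
    by (rule prim_inject) (simp add: prim_simps prim_of_fun c g h)
qed

lemma mean_of_fun: "circle_function g \<Longrightarrow> mean (of_fun g :: 'b) = integral {0..1} g"
  by (simp add: mean_eq prim_of_fun)

lemma ev_continuous: "continuous_on {0..1} (ev (u :: 'a))"
  using ev_circle by (simp add: circle_function_def)

lemma ev_1: "ev (u :: 'a) 1 = ev u 0"
  using ev_circle[of u] unfolding circle_function_def by (metis add_0)

lemma mean_der: "mean (der u) = 0"
  using ev_prim[of 1 u] ev_1[of u] by (simp add: mean_eq)

lemma circle_function_compose:
  fixes h :: "real \<Rightarrow> real \<Rightarrow> real"
  assumes "continuous_on ({0..1} \<times> UNIV) (\<lambda>(t, x). h t x)" "\<And>t x. h (t + 1) x = h t x"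
  shows "circle_function (\<lambda>t. h t (ev (u :: 'a) t))"
  using ev_circle[of u] continuous_on_compose_graph[OF assms(1) ev_continuous[of u]] assms(2)
  by (simp add: circle_function_def)

definition F :: "(real \<Rightarrow> real \<Rightarrow> real) \<Rightarrow> 'a \<Rightarrow> 'b" where
  "F f u = der u + of_fun (\<lambda>t. f t (ev u t))"

context
  fixes f f' :: "real \<Rightarrow> real \<Rightarrow> real"
  assumes adm: "admissible f f'"
begin

lemma circle_f: "circle_function (\<lambda>t. f t (ev (u :: 'a) t))"
  by (rule circle_function_compose[OF admissibleD(3,1)[OF adm]])

lemma mean_Psi: "mean (Psi (F f) u) = integral {0..1} (ev u)"
  by (simp add: Psi_def mean_simps mean_const)

lemma F_eq: "F f u = Psi (F f) u - const (mean (Psi (F f) u)) + const (mean (F f u))"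
  unfolding mean_Psi by (simp add: Psi_def)

text \<open>\<open>Psi\<close> keeps the mean-zero part of \<open>F f u\<close> and replaces its
  mean by that of \<open>u\<close>. After integration the discarded number
  \<open>mean (F f u)\<close> is the free drift \<open>c\<close> of the periodic problem.\<close>

lemma Psi_solution:
  "periodic_solution f (prim (Psi (F f) u - const (mean (Psi (F f) u)))) (mean (F f u))
    (mean (Psi (F f) u)) (ev u)"
proof -
  define v where "v = Psi (F f) u - const (mean (Psi (F f) u))"
  have "der u = v + const (mean (F f u)) - of_fun (\<lambda>t. f t (ev u t))"
    using F_eq[of u] unfolding v_def F_def by (simp add: algebra_simps)
  then have "ev u t = ev u 0 + prim v t + mean (F f u) * t - integral {0..t} (\<lambda>r. f r (ev u r))"
    if "t \<in> {0..1}" for t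
    using ev_prim[OF that, of u] that by (simp add: prim_simps prim_const prim_of_fun circle_f)
  then show ?thesis
    unfolding periodic_solution_def v_def[symmetric]
    by (intro conjI ballI ev_continuous ev_1 mean_Psi[symmetric])
qed

lemma Psi_of_solution:
  assumes v: "mean v = 0" and sol: "periodic_solution f (prim v) c s y"
  shows "\<exists>u. Psi (F f) u = v + const s"
proof -
  note y = periodic_solutionD[OF sol]
  \<comment> \<open>The solution is only controlled on [0,1]; its periodic extension is what
    \<open>of_fun\<close> can be applied to.\<close>
  define y' where "y' t = y (frac t)" for t
  have y': "y' t = y t" if "t \<in> {0..1}" for t
    using that y(3) by (cases "t = 1") (auto simp: y'_def frac_eq)
  have "continuous_on {0..1} y'" by (rule continuous_on_eq[OF y(1)]) (simp add: y')
  then have "circle_function (\<lambda>t. f t (y' t))"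
    unfolding circle_function_def using admissibleD(1)[OF adm]
    by (auto intro!: continuous_on_compose_graph[OF admissibleD(3)[OF adm]] simp: y'_def frac_1_eq)
  note circ = this
  \<comment> \<open>The derivative that the equation prescribes. It has mean zero because
    \<open>y\<close> returns to its initial value, so it is in the range of
    \<open>der\<close>.\<close>
  define w where "w = v + const c - of_fun (\<lambda>t. f t (y' t))"
  have int: "integral {0..t} (\<lambda>t. f t (y' t)) = integral {0..t} (\<lambda>t. f t (y t))" if "t \<in> {0..1}" for t
    using that by (intro integral_cong) (simp add: y')
  have prim_w: "prim w t = y t - y 0" if "t \<in> {0..1}" for t
    using y(2)[OF that] that by (simp add: w_def prim_simps prim_const prim_of_fun circ int)
  then have "mean w = 0" using y(3) by (simp add: mean_eq)
  then obtain u where u: "der u = w" "ev u 0 = y 0" using der_surj by blast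
  have ev: "ev u t = y t" if "t \<in> {0..1}" for t
    using ev_prim[OF that, of u] prim_w[OF that] u by simp
  have "of_fun (\<lambda>t. f t (ev u t)) = (of_fun (\<lambda>t. f t (y' t)) :: 'b)"
  proof (rule prim_inject)
    fix t :: real assume t: "t \<in> {0..1}"
    then have "integral {0..t} (\<lambda>t. f t (ev u t)) = integral {0..t} (\<lambda>t. f t (y' t))"
      by (intro integral_cong) (simp add: y' ev)
    then show "prim (of_fun (\<lambda>t. f t (ev u t))) t = prim (of_fun (\<lambda>t. f t (y' t))) t"
      using t by (simp add: prim_of_fun circ circle_f)
  qed
  then have "F f u = v + const c" by (simp add: F_def u w_def)
  moreover have "integral {0..1} (ev u) = s"
    using y(4) ev integral_cong[of "{0..1}" "ev u" y] by simp
  ultimately have "Psi (F f) u = v + const s" by (simp add: Psi_def mean_simps v mean_const)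
  then show ?thesis by blast
qed

lemma Psi_surj: "\<exists>u. Psi (F f) u = v"
proof -
  define v' where "v' = v - const (mean v)"
  have v': "mean v' = 0" by (simp add: v'_def mean_simps mean_const)
  obtain n where n: "\<And>x y. 0 \<le> x \<Longrightarrow> x \<le> y \<Longrightarrow> y \<le> 1 \<Longrightarrow> \<bar>prim v' y - prim v' x\<bar> \<le> n y - n x"
    using prim_variation by metis
  have "prim v' 1 = 0" using v' by (simp add: mean_eq)
  then obtain c u where "periodic_solution f (prim v') c (mean v) u"
    using periodic_solution_existence[OF admissibleD(3,4)[OF adm] admissibleD(5)[OF adm]
        admissibleD(6)[OF adm] prim_continuous prim_0 _ n] by blast
  from Psi_of_solution[OF v' this] show ?thesis by (simp add: v'_def)
qed

text \<open>A bound on \<open>Psi\<close> bounds the variation of the forcing and the mean, hence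
  the solutions by \<open>R\<close> and the slope of \<open>f\<close> along them by
  \<open>L\<close>. The difference is estimated in the sup norm; its derivative is then read off the
  equation, where the sup norm controls the change of \<open>f\<close>.\<close>

lemma Psi_lipschitz:
  assumes k: "0 \<le> k"
  obtains C where "0 \<le> C" "\<And>u1 u2. norm (Psi (F f) u1) \<le> k \<Longrightarrow> norm (Psi (F f) u2) \<le> k \<Longrightarrow>
    norm (u2 - u1) \<le> C * norm (Psi (F f) u2 - Psi (F f) u1)"
proof -
  \<comment> \<open>Norm bound for the projection that removes the mean; \<open>mean\<close> and
    \<open>const\<close> each cost a factor \<open>K\<close>.\<close>
  define q where "q = 1 + K * K"
  define k' where "k' = K * (q * k)"
  have q1: "1 \<le> q" using K1 by (simp add: q_def)
  have "k \<le> q * k" using mult_right_mono[OF q1 k] by simp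
  then have "K * k \<le> k'" unfolding k'_def using K0 by (rule mult_left_mono)
  have k': "0 \<le> k'" using K0 k q1 by (simp add: k'_def)
  note fc = admissibleD(3)[OF adm] and f'c = admissibleD(4)[OF adm] and fd = admissibleD(5)[OF adm]
  obtain R where R: "0 \<le> R"
    "\<And>V n c s u t. \<lbrakk>periodic_solution f V c s u; continuous_on {0..1} V; V 0 = 0; V 1 = 0;
      \<And>x y. 0 \<le> x \<Longrightarrow> x \<le> y \<Longrightarrow> y \<le> 1 \<Longrightarrow> \<bar>V y - V x\<bar> \<le> n y - n x;
      n 1 - n 0 \<le> k'; \<bar>s\<bar> \<le> k'; t \<in> {0..1}\<rbrakk> \<Longrightarrow> \<bar>u t\<bar> \<le> R"
    using periodic_solution_bound[OF fc admissibleD(6)[OF adm] k'] by blast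
  obtain L where L: "0 \<le> L" "\<And>t x. t \<in> {0..1} \<Longrightarrow> \<bar>x\<bar> \<le> R \<Longrightarrow> \<bar>f' t x\<bar> \<le> L"
    using bounded_on_strip[OF f'c] by blast
  define P where "P u = Psi (F f) u - const (mean (Psi (F f) u))" for u
  have proj: "norm (v - const (mean v)) \<le> q * norm v" for v :: 'b
  proof -
    have "norm (v - const (mean v)) \<le> norm v + K * \<bar>mean v\<bar>"
      using norm_triangle_ineq4[of v "const (mean v)"] norm_const[of "mean v"] by linarith
    also have "\<dots> \<le> norm v + K * (K * norm v)" using mean_bound K0 by (intro add_left_mono mult_left_mono)
    finally show ?thesis by (simp add: q_def algebra_simps)
  qed
  have P_0: "prim (P u) 1 = 0" for u
    by (simp add: mean_eq[symmetric] P_def mean_simps mean_const)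
  have sol: "periodic_solution f (prim (P u)) (mean (F f u)) (mean (Psi (F f) u)) (ev u)" for u
    unfolding P_def by (rule Psi_solution)
  have evR: "\<bar>ev u t\<bar> \<le> R" if u: "norm (Psi (F f) u) \<le> k" and t: "t \<in> {0..1}" for u t
  proof -
    obtain n where n: "\<And>x y. 0 \<le> x \<Longrightarrow> x \<le> y \<Longrightarrow> y \<le> 1 \<Longrightarrow> \<bar>prim (P u) y - prim (P u) x\<bar> \<le> n y - n x"
      "n 1 - n 0 \<le> K * norm (P u)"
      using prim_variation by metis
    show ?thesis
    proof (rule R(2)[OF sol prim_continuous prim_0 P_0 n(1) _ _ t])
      have "norm (P u) \<le> q * k"
        unfolding P_def using order_trans[OF proj mult_left_mono[OF u, of q]] q1 by simp
      then have "K * norm (P u) \<le> k'" unfolding k'_def using K0 by (rule mult_left_mono)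
      then show "n 1 - n 0 \<le> k'" using n(2) by simp
      have "\<bar>mean (Psi (F f) u)\<bar> \<le> K * k"
        using mean_bound[of "Psi (F f) u"] mult_left_mono[OF u K0] by linarith
      then show "\<bar>mean (Psi (F f) u)\<bar> \<le> k'" using \<open>K * k \<le> k'\<close> by linarith
    qed
  qed
  define C1 where "C1 = (1 + exp (2 * L) * (1 + 3 * L)) * (K * q + K)"
  have C1: "0 \<le> C1" using L(1) K0 q1 by (simp add: C1_def)
  define C where "C = K * (C1 + (q + K * (L * C1) + K * (L * C1)))"
  show ?thesis
  proof (rule that[of C])
    show "0 \<le> C" using C1 K0 L(1) q1 by (simp add: C_def)
    fix u1 u2 assume u: "norm (Psi (F f) u1) \<le> k" "norm (Psi (F f) u2) \<le> k"
    define D where "D = norm (Psi (F f) u2 - Psi (F f) u1)"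
    have D0: "0 \<le> D" by (simp add: D_def)
    have PD: "P u2 - P u1 = (Psi (F f) u2 - Psi (F f) u1) - const (mean (Psi (F f) u2 - Psi (F f) u1))"
      by (simp add: P_def mean_simps const_simps)
    have PD': "norm (P u2 - P u1) \<le> q * D" unfolding PD D_def by (rule proj)
    have d: "\<bar>ev u2 t - ev u1 t\<bar> \<le> C1 * D" if t: "t \<in> {0..1}" for t
    proof -
      have "\<bar>ev u2 t - ev u1 t\<bar> \<le> (1 + exp (2 * L) * (1 + 3 * L)) *
          (K * (q * D) + \<bar>mean (Psi (F f) u2) - mean (Psi (F f) u1)\<bar>)"
      proof (rule periodic_solution_lipschitz[OF fc f'c fd L(2) sol sol evR[OF u(1)] evR[OF u(2)]
            prim_continuous prim_0 P_0 prim_continuous prim_0 P_0 _ t])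
        fix t :: real assume "t \<in> {0..1}"
        then have "\<bar>prim (P u2 - P u1) t\<bar> \<le> K * norm (P u2 - P u1)" by (rule prim_bound)
        also have "\<dots> \<le> K * (q * D)" using PD' K0 by (rule mult_left_mono)
        finally show "\<bar>prim (P u2) t - prim (P u1) t\<bar> \<le> K * (q * D)" by (simp add: prim_simps)
      qed
      also have "\<dots> \<le> (1 + exp (2 * L) * (1 + 3 * L)) * (K * (q * D) + K * D)"
        using mean_bound[of "Psi (F f) u2 - Psi (F f) u1"] L(1)
        by (intro mult_left_mono add_left_mono) (auto simp: mean_simps D_def)
      also have "\<dots> = C1 * D" by (simp add: C1_def algebra_simps)
      finally show ?thesis .
    qed
    define g where "g t = f t (ev u2 t) - f t (ev u1 t)" for t
    have g: "\<bar>g t\<bar> \<le> L * (C1 * D)" if t: "t \<in> {0..1}" for t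
    proof -
      have "g t = mean_slope f' t (ev u1 t) (ev u2 t) * (ev u2 t - ev u1 t)"
        unfolding g_def by (rule mean_slope[OF f'c fd t])
      also have "\<bar>\<dots>\<bar> \<le> L * (C1 * D)"
        unfolding abs_mult
        by (intro mult_mono mean_slope_bound[OF f'c L(2) t evR[OF u(1) t] evR[OF u(2) t]] d t L(1)) (auto simp: t)
      finally show ?thesis .
    qed
    have circ_g: "circle_function g"
      using circle_f[of u1] circle_f[of u2] unfolding g_def circle_function_def by (auto intro!: continuous_intros)
    have of_g: "of_fun g = (of_fun (\<lambda>t. f t (ev u2 t)) - of_fun (\<lambda>t. f t (ev u1 t)) :: 'b)"
      unfolding g_def by (rule of_fun_simps(2)[OF circle_f circle_f])
    have "mean (F f u2) - mean (F f u1) = mean (of_fun g :: 'b)"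
      unfolding F_def of_g by (simp add: mean_simps mean_der)
    also have "\<bar>\<dots>\<bar> \<le> L * (C1 * D) * (1 - 0)"
      unfolding mean_of_fun[OF circ_g] using circ_g
      by (intro abs_integral_le g) (auto simp: circle_function_def)
    finally have c: "\<bar>mean (F f u2) - mean (F f u1)\<bar> \<le> L * (C1 * D)" by simp
    have der_eq: "der u = P u + const (mean (F f u)) - of_fun (\<lambda>t. f t (ev u t))" for u
      using F_eq[of u] F_def[of f u] unfolding P_def by (simp add: eq_diff_eq)
    have "der (u2 - u1) = (P u2 - P u1) + const (mean (F f u2) - mean (F f u1)) - of_fun g"
    proof -
      have "p2 + k2 - o2 - (p1 + k1 - o1) = (p2 - p1) + (k2 - k1) - (o2 - o1)"
        for p1 p2 k1 k2 o1 o2 :: 'b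
        by (simp add: algebra_simps)
      then show ?thesis unfolding der_simps(2) of_g const_simps(2) der_eq[of u1] der_eq[of u2] .
    qed
    also have "norm \<dots> \<le> norm (P u2 - P u1) + norm (const (mean (F f u2) - mean (F f u1)) :: 'b) + norm (of_fun g :: 'b)"
      by (intro norm_triangle_le_diff add_right_mono norm_triangle_ineq)
    also have "\<dots> \<le> q * D + K * (L * (C1 * D)) + K * (L * (C1 * D))"
    proof (intro add_mono PD')
      show "norm (const (mean (F f u2) - mean (F f u1)) :: 'b) \<le> K * (L * (C1 * D))"
        using order_trans[OF norm_const mult_left_mono[OF c K0]] .
      show "norm (of_fun g :: 'b) \<le> K * (L * (C1 * D))" by (rule of_fun_bound[OF circ_g g])
    qed
    finally have der: "norm (der (u2 - u1)) \<le> q * D + K * (L * (C1 * D)) + K * (L * (C1 * D))" .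
    have "norm (u2 - u1) \<le> K * (C1 * D + norm (der (u2 - u1)))"
      by (rule norm_le) (simp add: ev_simps d)
    also have "\<dots> \<le> K * (C1 * D + (q * D + K * (L * (C1 * D)) + K * (L * (C1 * D))))"
      using der K0 by (intro mult_left_mono add_left_mono)
    also have "\<dots> = C * D" by (simp add: C_def algebra_simps)
    finally show "norm (u2 - u1) \<le> C * norm (Psi (F f) u2 - Psi (F f) u1)" unfolding D_def .
  qed
qed

lemma Psi_bij: "bij (Psi (F f))"
proof (rule bijI)
  show "surj (Psi (F f))" unfolding surj_def using Psi_surj by metis
  show "inj (Psi (F f))"
  proof (rule injI)
    fix u1 u2 assume eq: "Psi (F f) u1 = Psi (F f) u2"
    obtain C where C: "\<And>v1 v2. norm (Psi (F f) v1) \<le> norm (Psi (F f) u1) \<Longrightarrow>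
      norm (Psi (F f) v2) \<le> norm (Psi (F f) u1) \<Longrightarrow> norm (v2 - v1) \<le> C * norm (Psi (F f) v2 - Psi (F f) v1)"
      using Psi_lipschitz[of "norm (Psi (F f) u1)"] norm_ge_zero by metis
    have "norm (u2 - u1) \<le> C * norm (Psi (F f) u2 - Psi (F f) u1)"
      by (rule C) (simp_all add: eq)
    then show "u1 = u2" by (simp add: eq)
  qed
qed

lemma Psi_inv: "Psi (F f) (inv (Psi (F f)) v) = v" "inv (Psi (F f)) (Psi (F f) u) = u"
  using Psi_bij by (simp_all add: bij_is_inj bij_is_surj surj_f_inv_f)

lemma inv_Psi_continuous: "continuous (at v) (inv (Psi (F f)))"
proof -
  obtain C where C: "0 \<le> C" "\<And>u1 u2. norm (Psi (F f) u1) \<le> norm v + 1 \<Longrightarrow> norm (Psi (F f) u2) \<le> norm v + 1 \<Longrightarrow>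
    norm (u2 - u1) \<le> C * norm (Psi (F f) u2 - Psi (F f) u1)"
    using Psi_lipschitz[of "norm v + 1"] by auto
  show ?thesis
    unfolding continuous_at_eps_delta
  proof (intro allI impI)
    fix e :: real assume e: "0 < e"
    show "\<exists>d>0. \<forall>w. dist w v < d \<longrightarrow> dist (inv (Psi (F f)) w) (inv (Psi (F f)) v) < e"
    proof (intro exI[of _ "min 1 (e / (C + 1))"] conjI allI impI)
      show "0 < min 1 (e / (C + 1))" using e C(1) by simp
      fix w assume w: "dist w v < min 1 (e / (C + 1))"
      then have "norm w \<le> norm v + 1" using norm_triangle_ineq2[of w v] by (simp add: dist_norm)
      then have "dist (inv (Psi (F f)) w) (inv (Psi (F f)) v) \<le> C * dist w v"
        using C(2)[of "inv (Psi (F f)) v" "inv (Psi (F f)) w"] by (simp add: Psi_inv dist_norm)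
      also have "\<dots> \<le> (C + 1) * dist w v" by (intro mult_right_mono) auto
      also have "\<dots> < e" using w C(1) by (simp add: field_simps)
      finally show "dist (inv (Psi (F f)) w) (inv (Psi (F f)) v) < e" .
    qed
  qed
qed

end

end

section \<open>Triangular relations and surjectivity of derivatives\<close>

text \<open>The error is \<open>(h y - h x) * s y\<close> plus \<open>h x\<close> times the
  remainder of \<open>s\<close>. Because \<open>s x = 0\<close>, \<open>s y\<close> is of linear
  size in \<open>y - x\<close>, so continuity of \<open>h\<close> makes the first term small
  enough.\<close>

lemma has_derivative_mult_at_zero:
  fixes h s :: "'a :: real_normed_vector \<Rightarrow> real"
  assumes s: "(s has_derivative D) (at x)" "s x = 0" and h: "continuous (at x) h"
  shows "((\<lambda>y. h y * s y) has_derivative (\<lambda>p. h x * D p)) (at x)"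
  unfolding has_derivative_at_alt
proof (intro conjI allI impI)
  have D: "bounded_linear D" using s(1) by (rule has_derivative_bounded_linear)
  then show "bounded_linear (\<lambda>p. h x * D p)" by (rule bounded_linear_const_mult)
  obtain B where B: "0 < B" "\<And>p. norm (D p) \<le> norm p * B"
    using bounded_linear.pos_bounded[OF D] by blast
  fix e :: real assume e: "0 < e"
  define e1 where "e1 = e / (2 * (\<bar>h x\<bar> + 1))"
  define e2 where "e2 = e / (2 * (B + 1))"
  have e12: "0 < e1" "0 < e2" using e B by (auto simp: e1_def e2_def intro!: divide_pos_pos)
  have 1: "\<bar>h x\<bar> * e1 \<le> e / 2"
  proof -
    have "\<bar>h x\<bar> * e1 = (e / 2) * (\<bar>h x\<bar> / (\<bar>h x\<bar> + 1))" by (simp add: e1_def)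
    also have "\<dots> \<le> (e / 2) * 1" using e by (intro mult_left_mono) auto
    finally show ?thesis by simp
  qed
  have 2: "e2 * (B + 1) = e / 2" using B(1) by (simp add: e2_def field_simps)
  have "0 < min 1 e1" using e12 by simp
  from s(1)[unfolded has_derivative_at_alt, THEN conjunct2, rule_format, OF this]
  obtain d1 where d1: "0 < d1" "\<And>y. norm (y - x) < d1 \<Longrightarrow> norm (s y - s x - D (y - x)) \<le> min 1 e1 * norm (y - x)"
    by blast
  from h[unfolded continuous_at_eps_delta, rule_format, OF e12(2)]
  obtain d2 where d2: "0 < d2" "\<And>y. dist y x < d2 \<Longrightarrow> dist (h y) (h x) < e2"
    by blast
  show "\<exists>d>0. \<forall>y. norm (y - x) < d \<longrightarrow> norm (h y * s y - h x * s x - h x * D (y - x)) \<le> e * norm (y - x)"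
  proof (intro exI[of _ "min d1 d2"] conjI allI impI)
    show "0 < min d1 d2" using d1 d2 by simp
    fix y assume y: "norm (y - x) < min d1 d2"
    have r: "\<bar>s y - D (y - x)\<bar> \<le> min 1 e1 * norm (y - x)" using d1(2)[of y] y s(2) by simp
    have r1: "\<bar>s y - D (y - x)\<bar> \<le> e1 * norm (y - x)" "\<bar>s y - D (y - x)\<bar> \<le> 1 * norm (y - x)"
      by (rule order_trans[OF r]; intro mult_right_mono; simp)+
    have "\<bar>s y\<bar> \<le> (B + 1) * norm (y - x)" using r1(2) B(2)[of "y - x"] by (simp add: algebra_simps)
    moreover have "\<bar>h y - h x\<bar> \<le> e2" using d2(2)[of y] y by (simp add: dist_norm)
    ultimately have "\<bar>(h y - h x) * s y\<bar> \<le> e2 * ((B + 1) * norm (y - x))"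
      unfolding abs_mult using e12 by (intro mult_mono) auto
    also have "\<dots> = e / 2 * norm (y - x)" by (simp only: mult.assoc[symmetric] 2)
    finally have A: "\<bar>(h y - h x) * s y\<bar> \<le> e / 2 * norm (y - x)" .
    have "\<bar>h x * (s y - D (y - x))\<bar> \<le> \<bar>h x\<bar> * (e1 * norm (y - x))"
      unfolding abs_mult using r1(1) by (intro mult_left_mono) auto
    also have "\<dots> \<le> e / 2 * norm (y - x)"
      unfolding mult.assoc[symmetric] using 1 by (intro mult_right_mono) auto
    finally have "\<bar>h x * (s y - D (y - x))\<bar> \<le> e / 2 * norm (y - x)" .
    moreover have "h y * s y - h x * s x - h x * D (y - x) = (h y - h x) * s y + h x * (s y - D (y - x))"
      by (simp add: s(2) algebra_simps)
    ultimately show "norm (h y * s y - h x * s x - h x * D (y - x)) \<le> e * norm (y - x)"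
      using A by simp
  qed
qed

lemma triangular_solvable:
  fixes h :: "nat \<Rightarrow> nat \<Rightarrow> real"
  assumes "\<And>i. h i i \<noteq> 0"
  shows "\<exists>w. \<forall>i\<in>{1..m}. (\<Sum>j=1..i. h i j * w j) = y i"
proof (induction m)
  case (Suc m)
  then obtain w where w: "\<forall>i\<in>{1..m}. (\<Sum>j=1..i. h i j * w j) = y i" by blast
  define w' where "w' = w(Suc m := (y (Suc m) - (\<Sum>j=1..m. h (Suc m) j * w j)) / h (Suc m) (Suc m))"
  have "(\<Sum>j=1..i. h k j * w' j) = (\<Sum>j=1..i. h k j * w j)" if "i \<le> m" for i k
    using that by (intro sum.cong) (auto simp: w'_def)
  moreover have "h (Suc m) (Suc m) * w' (Suc m) = y (Suc m) - (\<Sum>j=1..m. h (Suc m) j * w j)"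
    using assms[of "Suc m"] by (simp add: w'_def)
  ultimately have "\<forall>i\<in>{1..Suc m}. (\<Sum>j=1..i. h i j * w' j) = y i"
    using w by (auto simp: le_Suc_eq)
  then show ?case by blast
qed simp

lemma triangular_inject:
  fixes h :: "nat \<Rightarrow> nat \<Rightarrow> real"
  assumes "\<And>i. h i i \<noteq> 0" "\<And>i. i \<in> {1..m} \<Longrightarrow> (\<Sum>j=1..i. h i j * w j) = (\<Sum>j=1..i. h i j * y j)"
  shows "i \<in> {1..m} \<Longrightarrow> w i = y i"
proof (induction i rule: less_induct)
  case (less i)
  then obtain k where k: "i = Suc k" by (cases i) auto
  have "(\<Sum>j=1..k. h i j * w j) = (\<Sum>j=1..k. h i j * y j)"
    using less k by (intro sum.cong) auto
  with assms(2)[OF less.prems] have "h i i * w i = h i i * y i" by (simp add: k)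
  then show ?case using assms(1) by simp
qed

text \<open>
  Since the \<open>S j\<close> vanish at \<open>x\<close>, mere continuity of the coefficients is enough to differentiate
  the relation, in both directions.
\<close>

lemma surj_derivative_triangular:
  fixes G S :: "nat \<Rightarrow> 'a :: real_normed_vector \<Rightarrow> real"
  assumes G: "\<And>i y. i \<in> {1..m} \<Longrightarrow> G i y = (\<Sum>j=1..i. h i j y * S j y)"
    and h: "\<And>i j. continuous (at x) (h i j)" "\<And>i y. h i i y \<noteq> 0"
    and S: "\<And>j. j \<in> {1..m} \<Longrightarrow> S j x = 0"
  shows "surj_derivative m G x \<longleftrightarrow> surj_derivative m S x"
proof
  have G_deriv: "(G i has_derivative (\<lambda>p. \<Sum>j=1..i. h i j x * D j p)) (at x)"
    if i: "i \<in> {1..m}" and D: "\<And>j. j \<in> {1..i} \<Longrightarrow> (S j has_derivative D j) (at x)" for D i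
  proof -
    have "((\<lambda>y. \<Sum>j=1..i. h i j y * S j y) has_derivative (\<lambda>p. \<Sum>j=1..i. h i j x * D j p)) (at x)"
      by (intro has_derivative_sum has_derivative_mult_at_zero D h(1) S) (use i in auto)
    moreover have "G i = (\<lambda>y. \<Sum>j=1..i. h i j y * S j y)" using G[OF i] by blast
    ultimately show ?thesis by simp
  qed
  show "surj_derivative m G x" if "surj_derivative m S x"
  proof -
    from that obtain D where D: "\<forall>j\<in>{1..m}. (S j has_derivative D j) (at x)"
      "\<forall>y :: nat \<Rightarrow> real. \<exists>p. \<forall>j\<in>{1..m}. D j p = y j"
      unfolding surj_derivative_def by blast
    show ?thesis
      unfolding surj_derivative_def
    proof (intro exI[of _ "\<lambda>i p. \<Sum>j=1..i. h i j x * D j p"] conjI ballI allI)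
      show "(G i has_derivative (\<lambda>p. \<Sum>j=1..i. h i j x * D j p)) (at x)" if "i \<in> {1..m}" for i
        using that D(1) by (intro G_deriv) auto
      fix y :: "nat \<Rightarrow> real"
      obtain w where w: "\<forall>i\<in>{1..m}. (\<Sum>j=1..i. h i j x * w j) = y i"
        using triangular_solvable[of "\<lambda>i j. h i j x" m y] h(2) by blast
      obtain p where p: "\<forall>j\<in>{1..m}. D j p = w j" using D(2) by blast
      have "(\<Sum>j=1..i. h i j x * D j p) = y i" if i: "i \<in> {1..m}" for i
      proof -
        have "(\<Sum>j=1..i. h i j x * D j p) = (\<Sum>j=1..i. h i j x * w j)"
          using i p by (intro sum.cong) auto
        then show ?thesis using w i by simp
      qed
      then show "\<exists>p. \<forall>i\<in>{1..m}. (\<Sum>j=1..i. h i j x * D j p) = y i" by blast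
    qed
  qed
  show "surj_derivative m S x" if "surj_derivative m G x"
  proof -
    from that obtain E where E: "\<forall>i\<in>{1..m}. (G i has_derivative E i) (at x)"
      "\<forall>y :: nat \<Rightarrow> real. \<exists>p. \<forall>i\<in>{1..m}. E i p = y i"
      unfolding surj_derivative_def by blast
    have "\<exists>D. (S i has_derivative D) (at x)" if "i \<in> {1..m}" for i
      using that
    proof (induction i rule: less_induct)
      case (less i)
      then obtain k where k: "i = Suc k" by (cases i) auto
      have "\<forall>j\<in>{1..k}. \<exists>D. (S j has_derivative D) (at x)" using less k by auto
      then obtain D where D: "\<And>j. j \<in> {1..k} \<Longrightarrow> (S j has_derivative D j) (at x)" by metis
      \<comment> \<open>Row \<open>i\<close> solved for \<open>S i\<close>. The bracket is
        differentiable by induction and vanishes at \<open>x\<close>, so multiplying it by the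
        continuous function \<open>inverse (h i i y)\<close> keeps it differentiable there.\<close>
      have "S i y = inverse (h i i y) * (G i y - (\<Sum>j=1..k. h i j y * S j y))" for y
        using G[OF less.prems, of y] h(2)[of i y] by (simp add: k)
      then have eq: "S i = (\<lambda>y. inverse (h i i y) * (G i y - (\<Sum>j=1..k. h i j y * S j y)))" by blast
      have "((\<lambda>y. G i y - (\<Sum>j=1..k. h i j y * S j y)) has_derivative
          (\<lambda>p. E i p - (\<Sum>j=1..k. h i j x * D j p))) (at x)"
        using E(1) less.prems k
        by (intro has_derivative_diff has_derivative_sum has_derivative_mult_at_zero D h(1) S) auto
      moreover have "G i x - (\<Sum>j=1..k. h i j x * S j x) = 0"
        using G[OF less.prems, of x] S less.prems by (simp add: k)
      moreover have "continuous (at x) (\<lambda>y. inverse (h i i y))"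
        by (intro continuous_intros continuous_at_within_inverse h)
      ultimately have "((\<lambda>y. inverse (h i i y) * (G i y - (\<Sum>j=1..k. h i j y * S j y))) has_derivative
          (\<lambda>p. inverse (h i i x) * (E i p - (\<Sum>j=1..k. h i j x * D j p)))) (at x)"
        by (rule has_derivative_mult_at_zero)
      then show ?case using eq by metis
    qed
    then obtain D where D: "\<And>i. i \<in> {1..m} \<Longrightarrow> (S i has_derivative D i) (at x)" by metis
    have ED: "E i = (\<lambda>p. \<Sum>j=1..i. h i j x * D j p)" if i: "i \<in> {1..m}" for i
      using i E(1) by (intro has_derivative_unique[OF _ G_deriv[OF i]] D) auto
    show ?thesis
      unfolding surj_derivative_def
    proof (intro exI[of _ D] conjI ballI allI D)
      fix y :: "nat \<Rightarrow> real"
      obtain p where p: "\<forall>i\<in>{1..m}. E i p = (\<Sum>j=1..i. h i j x * y j)"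
        using spec[OF E(2), of "\<lambda>i. \<Sum>j=1..i. h i j x * y j"] by blast
      have "D i p = y i" if "i \<in> {1..m}" for i
        by (rule triangular_inject[of "\<lambda>i j. h i j x" m "\<lambda>i. D i p" y, OF h(2) _ that])
           (use p ED in auto)
      then show "\<exists>p. \<forall>i\<in>{1..m}. D i p = y i" by blast
    qed
  qed
qed

lemma surj_derivative_compose:
  assumes G: "surj_derivative m G (g x)" and g: "(g has_derivative g') (at x)" "surj g'"
  shows "surj_derivative m (\<lambda>i y. G i (g y)) x"
proof -
  obtain D where D: "\<forall>i\<in>{1..m}. (G i has_derivative D i) (at (g x))"
    "\<forall>y :: nat \<Rightarrow> real. \<exists>p. \<forall>i\<in>{1..m}. D i p = y i"
    using G unfolding surj_derivative_def by blast
  show ?thesis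
    unfolding surj_derivative_def
  proof (intro exI[of _ "\<lambda>i p. D i (g' p)"] conjI ballI allI)
    show "((\<lambda>y. G i (g y)) has_derivative (\<lambda>p. D i (g' p))) (at x)" if "i \<in> {1..m}" for i
      using D(1) that by (intro has_derivative_compose[OF g(1)]) auto
    fix y :: "nat \<Rightarrow> real"
    obtain p where "\<forall>i\<in>{1..m}. D i p = y i" using D(2) by blast
    then show "\<exists>p. \<forall>i\<in>{1..m}. D i (g' p) = y i" using g(2) by (metis surjD)
  qed
qed

section \<open>Differentiability of \<open>Psi\<close> and of its inverse\<close>

text \<open>Uniform continuity of \<open>f'\<close> on a compact strip gives one \<open>d\<close>
  for all times at once, which is what differentiating the substitution of \<open>u\<close> into
  \<open>f\<close> in the sup norm requires.\<close>

lemma taylor_uniform_remainder: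
  fixes f f' :: "real \<Rightarrow> real \<Rightarrow> real"
  assumes f': "continuous_on ({0..1} \<times> UNIV) (\<lambda>(t, x). f' t x)"
    and deriv: "\<And>t x. t \<in> {0..1} \<Longrightarrow> (f t has_real_derivative f' t x) (at x)" and e: "0 < e"
  obtains d where "0 < d" "\<And>t x h. t \<in> {0..1} \<Longrightarrow> \<bar>x\<bar> \<le> R \<Longrightarrow> \<bar>h\<bar> < d \<Longrightarrow>
    \<bar>f t (x + h) - f t x - f' t x * h\<bar> \<le> e * \<bar>h\<bar>"
proof -
  \<comment> \<open>Widened by 1 to contain all points \<open>x + h\<close> with
    \<open>\<bar>h\<bar> < 1\<close>.\<close>
  define C where "C = {0..1::real} \<times> {- R - 1..R + 1}"
  have "uniformly_continuous_on C (\<lambda>(t, x). f' t x)"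
    unfolding C_def by (intro compact_uniformly_continuous continuous_on_subset[OF f'] compact_Times) auto
  from this[unfolded uniformly_continuous_on_def, rule_format, OF e]
  obtain d where d: "0 < d"
    "\<And>p q. p \<in> C \<Longrightarrow> q \<in> C \<Longrightarrow> dist q p < d \<Longrightarrow> dist ((\<lambda>(t, x). f' t x) q) ((\<lambda>(t, x). f' t x) p) < e"
    by blast
  show ?thesis
  proof (rule that[of "min d 1"])
    show "0 < min d 1" using d by simp
    fix t x h :: real assume t: "t \<in> {0..1}" and x: "\<bar>x\<bar> \<le> R" and h: "\<bar>h\<bar> < min d 1"
    have "norm ((f t (x + h) - f' t x * (x + h)) - (f t x - f' t x * x)) \<le> e * norm (x + h - x)"
    proof (rule field_differentiable_bound[of "cball x \<bar>h\<bar>" _ "\<lambda>z. f' t z - f' t x"])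
      fix z assume z: "z \<in> cball x \<bar>h\<bar>"
      show "((\<lambda>z. f t z - f' t x * z) has_field_derivative f' t z - f' t x) (at z within cball x \<bar>h\<bar>)"
        by (rule has_field_derivative_at_within) (auto intro!: derivative_eq_intros deriv[OF t])
      have "\<bar>z - x\<bar> \<le> \<bar>h\<bar>" using z by (simp add: dist_real_def abs_minus_commute)
      then have "(t, z) \<in> C" "(t, x) \<in> C" "dist (t, z) (t, x) < d"
        using t x h by (auto simp: C_def dist_Pair_Pair dist_real_def)
      then show "norm (f' t z - f' t x) \<le> e" using d(2)[of "(t, x)" "(t, z)"] by (simp add: dist_real_def)
    qed (auto simp: dist_real_def)
    then show "\<bar>f t (x + h) - f t x - f' t x * h\<bar> \<le> e * \<bar>h\<bar>" by (simp add: algebra_simps)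
  qed
qed

context circle_pair
begin

lemma linear_Psi:
  assumes "linear (G :: 'a \<Rightarrow> 'b)"
  shows "linear (Psi G)"
proof -
  have int: "ev (u :: 'a) integrable_on {0..1}" for u by (rule integrable_continuous_real[OF ev_continuous])
  have "integral {0..1} (ev (x + y :: 'a)) = integral {0..1} (ev x) + integral {0..1} (ev y)" for x y
  proof -
    have "ev (x + y) = (\<lambda>t. ev x t + ev y t)" by (simp add: ev_simps fun_eq_iff)
    then show ?thesis by (simp add: integral_add int)
  qed
  moreover have "integral {0..1} (ev (r *\<^sub>R x :: 'a)) = r * integral {0..1} (ev x)" for r x
  proof -
    have "ev (r *\<^sub>R x) = (\<lambda>t. r * ev x t)" by (simp add: ev_simps fun_eq_iff)
    then show ?thesis by simp
  qed
  ultimately show ?thesis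
    unfolding Psi_def
    by (intro linearI) (simp_all add: linear_add[OF assms] linear_cmul[OF assms] mean_simps const_simps algebra_simps)
qed

lemma linear_F:
  assumes "circle_function a"
  shows "linear (F (\<lambda>t x. a t * x))"
proof -
  have c: "circle_function (\<lambda>t. a t * ev (u :: 'a) t)" for u
    using assms ev_circle[of u] by (auto simp: circle_function_def intro!: continuous_intros)
  have "of_fun (\<lambda>t. a t * ev (x + y :: 'a) t) = (of_fun (\<lambda>t. a t * ev x t) + of_fun (\<lambda>t. a t * ev y t) :: 'b)" for x y
    using of_fun_simps(1)[OF c[of x] c[of y]] by (simp add: ev_simps distrib_left)
  moreover have "of_fun (\<lambda>t. a t * ev (r *\<^sub>R x :: 'a) t) = (r *\<^sub>R of_fun (\<lambda>t. a t * ev x t) :: 'b)" for r x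
    using of_fun_simps(3)[OF c[of x] c[of x], where r = r] by (simp add: ev_simps mult.left_commute)
  ultimately show ?thesis
    unfolding F_def by (intro linearI) (simp_all add: der_simps algebra_simps)
qed

context
  fixes f f' :: "real \<Rightarrow> real \<Rightarrow> real" and u :: 'a
  assumes adm: "admissible f f'"
begin

definition linearization :: "real \<Rightarrow> real \<Rightarrow> real" where
  "linearization t x = f' t (ev u t) * x"

lemma circle_slope: "circle_function (\<lambda>t. f' t (ev u t))"
  by (rule circle_function_compose[OF admissibleD(4,2)[OF adm]])

text \<open>The linearised operator belongs to the class already treated, so its \<open>Psi\<close>
  is bijective and satisfies the Lipschitz estimate for the inverse.\<close>

lemma admissible_linearization: "admissible linearization (\<lambda>t x. f' t (ev u t))"
  unfolding linearization_def[abs_def] by (rule admissible_linear[OF circle_slope])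

lemma linear_Psi_linearization: "linear (Psi (F linearization))"
  unfolding linearization_def[abs_def] by (intro linear_Psi linear_F circle_slope)

lemma norm_Psi_le: "norm (Psi G h) \<le> (1 + K * K) * norm (G h) + K * (K * norm h)" for G :: "'a \<Rightarrow> 'b"
proof -
  have "norm (const (mean (G h)) :: 'b) \<le> K * (K * norm (G h))"
    using order_trans[OF norm_const mult_left_mono[OF mean_bound K0]] .
  moreover have "\<bar>integral {0..1} (ev h)\<bar> \<le> K * norm h * (1 - 0)"
    by (rule abs_integral_le[OF ev_continuous]) (auto intro: ev_bound)
  then have "norm (const (integral {0..1} (ev h)) :: 'b) \<le> K * (K * norm h)"
    using order_trans[OF norm_const mult_left_mono[OF _ K0]] by simp
  moreover have "norm (Psi G h) \<le> norm (G h) + norm (const (mean (G h)) :: 'b) + norm (const (integral {0..1} (ev h)) :: 'b)"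
    unfolding Psi_def by (intro norm_triangle_le add_right_mono norm_triangle_ineq4)
  ultimately show ?thesis by (simp add: algebra_simps)
qed

lemma bounded_linear_Psi_linearization: "bounded_linear (Psi (F linearization))"
proof -
  obtain C where C: "0 \<le> C" "\<And>t. t \<in> {0..1} \<Longrightarrow> \<bar>f' t (ev u t)\<bar> \<le> C"
    using circle_function_bounded[OF circle_slope] by blast
  show ?thesis
  proof (rule bounded_linear_intro)
    fix h :: 'a
    have "norm (of_fun (\<lambda>t. linearization t (ev h t)) :: 'b) \<le> K * (C * (K * norm h))"
    proof (rule of_fun_bound)
      show "circle_function (\<lambda>t. linearization t (ev h t))"
        by (rule circle_f[OF admissible_linearization])
      show "\<bar>linearization t (ev h t)\<bar> \<le> C * (K * norm h)" if "t \<in> {0..1}" for t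
        unfolding linearization_def abs_mult using C that by (intro mult_mono ev_bound) auto
    qed
    then have "norm (F linearization h) \<le> K * norm h + K * (C * (K * norm h))"
      unfolding F_def using der_bound[of h] by (intro norm_triangle_le) simp
    then have "(1 + K * K) * norm (F linearization h) \<le> (1 + K * K) * (K * norm h + K * (C * (K * norm h)))"
      using K0 by (intro mult_left_mono) auto
    then show "norm (Psi (F linearization) h) \<le> norm h * ((1 + K * K) * (K + K * C * K) + K * K)"
      using norm_Psi_le[of "F linearization" h] by (simp add: algebra_simps)
  qed (simp_all add: linear_add[OF linear_Psi_linearization] linear_cmul[OF linear_Psi_linearization])
qed

text \<open>Since \<open>der\<close> enters linearly, the remainder of \<open>F f\<close> is
  \<open>of_fun\<close> of the pointwise Taylor remainder along \<open>u\<close>, and passing to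
  \<open>Psi\<close> only removes its mean.\<close>

lemma Psi_has_derivative: "(Psi (F f) has_derivative Psi (F linearization)) (at u)"
  unfolding has_derivative_at_alt
proof (intro conjI allI impI bounded_linear_Psi_linearization)
  fix e :: real assume e: "0 < e"
  obtain R where R: "\<And>t. t \<in> {0..1} \<Longrightarrow> \<bar>ev u t\<bar> \<le> R"
    using circle_function_bounded[OF ev_circle] by blast
  \<comment> \<open>The norm constants collected: \<open>K\<close> from \<open>ev_bound\<close>,
    \<open>K\<close> from \<open>of_fun_bound\<close>, and \<open>1 + K * K\<close> from removing
    the mean.\<close>
  define q where "q = (1 + K * K) * (K * K)"
  have q: "0 < q" using K1 by (simp add: q_def add_pos_pos)
  obtain d where d: "0 < d" "\<And>t x h. t \<in> {0..1} \<Longrightarrow> \<bar>x\<bar> \<le> R \<Longrightarrow> \<bar>h\<bar> < d \<Longrightarrow>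
    \<bar>f t (x + h) - f t x - f' t x * h\<bar> \<le> e / q * \<bar>h\<bar>"
    using taylor_uniform_remainder[OF admissibleD(4,5)[OF adm], of "e / q"] e q by (metis divide_pos_pos)
  show "\<exists>d>0. \<forall>y. norm (y - u) < d \<longrightarrow>
    norm (Psi (F f) y - Psi (F f) u - Psi (F linearization) (y - u)) \<le> e * norm (y - u)"
  proof (intro exI[of _ "d / K"] conjI allI impI)
    show "0 < d / K" using d K1 by simp
    fix y assume y: "norm (y - u) < d / K"
    define h where "h = y - u"
    define r where "r t = f t (ev y t) - f t (ev u t) - linearization t (ev h t)" for t
    have circ: "circle_function r"
      using circle_f[OF adm, of y] circle_f[OF adm, of u] circle_f[OF admissible_linearization, of h]
      unfolding r_def circle_function_def by (auto intro!: continuous_intros)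
    have r: "\<bar>r t\<bar> \<le> e / q * (K * norm h)" if t: "t \<in> {0..1}" for t
    proof -
      have ev: "ev y t = ev u t + ev h t" by (simp add: h_def ev_simps)
      have b: "\<bar>ev h t\<bar> \<le> K * norm h" by (rule ev_bound[OF t])
      also have "\<dots> < d" using y K1 by (simp add: h_def field_simps)
      finally have "\<bar>r t\<bar> \<le> e / q * \<bar>ev h t\<bar>"
        unfolding r_def ev linearization_def by (rule d(2)[OF t R[OF t]])
      also have "\<dots> \<le> e / q * (K * norm h)" using b e q by (intro mult_left_mono) auto
      finally show ?thesis .
    qed
    have nr: "norm (of_fun r :: 'b) \<le> K * (e / q * (K * norm h))" by (rule of_fun_bound[OF circ r])
    have "of_fun r = (of_fun (\<lambda>t. f t (ev y t)) - of_fun (\<lambda>t. f t (ev u t)) - of_fun (\<lambda>t. linearization t (ev h t)) :: 'b)"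
      unfolding r_def
      using circle_f[OF adm, of y] circle_f[OF adm, of u] circle_f[OF admissible_linearization, of h]
      by (subst of_fun_simps(2)) (auto simp: of_fun_simps(2) circle_function_def intro!: continuous_intros)
    then have F: "F f y - F f u - F linearization h = of_fun r"
      unfolding F_def h_def by (simp add: der_simps)
    have int: "integral {0..1} (ev h) = integral {0..1} (ev y) - integral {0..1} (ev u)"
    proof -
      have "ev h = (\<lambda>t. ev y t - ev u t)" by (simp add: h_def ev_simps fun_eq_iff)
      then show ?thesis by (simp add: integral_diff integrable_continuous_real[OF ev_continuous])
    qed
    have "Psi (F f) y - Psi (F f) u - Psi (F linearization) h = of_fun r - const (mean (of_fun r :: 'b))"
      unfolding Psi_def F[symmetric] int mean_simps const_simps by (simp add: algebra_simps)
    also have "norm \<dots> \<le> norm (of_fun r :: 'b) + norm (const (mean (of_fun r :: 'b)) :: 'b)"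
      by (rule norm_triangle_ineq4)
    also have "\<dots> \<le> norm (of_fun r :: 'b) + K * (K * norm (of_fun r :: 'b))"
      using order_trans[OF norm_const mult_left_mono[OF mean_bound K0], of "of_fun r :: 'b"] by simp
    also have "\<dots> = (1 + K * K) * norm (of_fun r :: 'b)" by (simp add: algebra_simps)
    also have "\<dots> \<le> (1 + K * K) * (K * (e / q * (K * norm h)))"
      using nr K0 by (intro mult_left_mono) auto
    also have "\<dots> = q * (e / q) * norm h" by (simp add: q_def mult_ac)
    also have "\<dots> = e * norm h" using q by simp
    finally show "norm (Psi (F f) y - Psi (F f) u - Psi (F linearization) (y - u)) \<le> e * norm (y - u)"
      unfolding h_def .
  qed
qed

text \<open>The Lipschitz estimate on the unit ball bounds the inverse on unit vectors, and
  homogeneity extends the bound.\<close>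

lemma bounded_linear_inv_Psi_linearization: "bounded_linear (inv (Psi (F linearization)))"
proof -
  let ?\<Psi> = "Psi (F linearization)"
  note inv = Psi_inv[OF admissible_linearization]
  obtain C where C: "0 \<le> C" "\<And>u1 u2. norm (?\<Psi> u1) \<le> 1 \<Longrightarrow> norm (?\<Psi> u2) \<le> 1 \<Longrightarrow>
    norm (u2 - u1) \<le> C * norm (?\<Psi> u2 - ?\<Psi> u1)"
    using Psi_lipschitz[OF admissible_linearization, of 1] by auto
  have add: "inv ?\<Psi> (x + y) = inv ?\<Psi> x + inv ?\<Psi> y" for x y
    using inv(2)[of "inv ?\<Psi> x + inv ?\<Psi> y"] by (simp add: linear_add[OF linear_Psi_linearization] inv(1))
  have scale: "inv ?\<Psi> (r *\<^sub>R x) = r *\<^sub>R inv ?\<Psi> x" for r x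
    using inv(2)[of "r *\<^sub>R inv ?\<Psi> x"] by (simp add: linear_cmul[OF linear_Psi_linearization] inv(1))
  show ?thesis
  proof (rule bounded_linear_intro[OF add scale])
    fix v
    show "norm (inv ?\<Psi> v) \<le> norm v * C"
    proof (cases "v = 0")
      case True
      then show ?thesis using scale[of 0 0] by simp
    next
      case False
      define w where "w = v /\<^sub>R norm v"
      have w: "norm w = 1" "inv ?\<Psi> w = inv ?\<Psi> v /\<^sub>R norm v" using False by (simp_all add: w_def scale)
      have "norm (inv ?\<Psi> w - 0) \<le> C * norm (?\<Psi> (inv ?\<Psi> w) - ?\<Psi> 0)"
        by (rule C(2)) (simp_all add: inv w(1) linear_0[OF linear_Psi_linearization])
      then have "norm (inv ?\<Psi> w) \<le> C"
        by (simp add: inv(1) linear_0[OF linear_Psi_linearization] w(1))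
      then have "norm (inv ?\<Psi> v) / norm v \<le> C"
        unfolding w(2) by (simp add: divide_inverse_commute)
      then show ?thesis using False by (simp add: field_simps)
    qed
  qed
qed

lemma inv_Psi_has_derivative:
  "(inv (Psi (F f)) has_derivative inv (Psi (F linearization))) (at (Psi (F f) u))"
proof (rule has_derivative_inverse_basic[where T = UNIV])
  show "(Psi (F f) has_derivative Psi (F linearization)) (at (inv (Psi (F f)) (Psi (F f) u)))"
    by (simp add: Psi_inv[OF adm] Psi_has_derivative)
  show "inv (Psi (F linearization)) \<circ> Psi (F linearization) = id"
    by (simp add: fun_eq_iff Psi_inv[OF admissible_linearization])
  show "bounded_linear (inv (Psi (F linearization)))" by (rule bounded_linear_inv_Psi_linearization)
  show "continuous (at (Psi (F f) u)) (inv (Psi (F f)))" by (rule inv_Psi_continuous[OF adm])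
  show "Psi (F f) (inv (Psi (F f)) v) = v" for v by (rule Psi_inv(1)[OF adm])
qed simp_all

text \<open>Transports the surjectivity condition between B^0, where Morin singularities are
  defined, and B^1, where the Sigma functionals live: \<open>Psi\<close> and its inverse are both
  differentiable, with bijective derivatives.\<close>

lemma surj_derivative_Psi:
  "surj_derivative m G (Psi (F f) u) \<longleftrightarrow> surj_derivative m (\<lambda>i x. G i (Psi (F f) x)) u"
proof
  have bij: "bij (Psi (F linearization))" by (rule Psi_bij[OF admissible_linearization])
  show "surj_derivative m (\<lambda>i x. G i (Psi (F f) x)) u" if "surj_derivative m G (Psi (F f) u)"
    using that Psi_has_derivative bij_is_surj[OF bij] by (rule surj_derivative_compose)
  assume "surj_derivative m (\<lambda>i x. G i (Psi (F f) x)) u"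
  then have "surj_derivative m (\<lambda>i x. G i (Psi (F f) x)) (inv (Psi (F f)) (Psi (F f) u))"
    by (simp add: Psi_inv[OF adm])
  from surj_derivative_compose[OF this inv_Psi_has_derivative bij_is_surj[OF bij_imp_bij_inv[OF bij]]]
  show "surj_derivative m G (Psi (F f) u)" by (simp add: Psi_inv[OF adm])
qed

lemma Psi_continuous: "continuous (at u) (Psi (F f))"
  using Psi_has_derivative by (rule has_derivative_continuous)

end

end

section \<open>Explicit solution of the linear periodic problem\<close>

lemma integral_pos_continuous:
  fixes g :: "real \<Rightarrow> real"
  assumes "continuous_on {0..1} g" "\<And>t. t \<in> {0..1} \<Longrightarrow> 0 < g t"
  shows "0 < integral {0..1} g"
  using integral_attained[OF assms(1)] assms(2) by metis

lemma integral_linear_combination: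
  fixes f g :: "real \<Rightarrow> real"
  assumes "continuous_on {0..1} f" "continuous_on {0..1} g"
  shows "integral {0..1} (\<lambda>t. a * f t + b * g t) = a * integral {0..1} f + b * integral {0..1} g"
proof -
  have "integral {0..1} (\<lambda>t. a * f t + b * g t) = integral {0..1} (\<lambda>t. a * f t) + integral {0..1} (\<lambda>t. b * g t)"
    by (intro integral_add integrable_continuous_real continuous_intros assms)
  then show ?thesis by simp
qed

definition int_factor :: "(real \<Rightarrow> real) \<Rightarrow> real \<Rightarrow> real" where
  "int_factor a t = exp (integral {0..t} a)"

definition int_factor_primitive :: "(real \<Rightarrow> real) \<Rightarrow> real \<Rightarrow> real" where
  "int_factor_primitive a t = integral {0..t} (int_factor a)"

text \<open>
  The determinant of the linear system that periodicity and the prescribed mean impose on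
  \<open>(y 0, c)\<close> for the solutions \<open>y\<close> of \<open>y' + a y = c\<close>.
\<close>

definition period_det :: "(real \<Rightarrow> real) \<Rightarrow> real" where
  "period_det a = (int_factor a 1 - 1) * integral {0..1} (\<lambda>t. int_factor_primitive a t / int_factor a t)
     + int_factor_primitive a 1 * integral {0..1} (\<lambda>t. 1 / int_factor a t)"

text \<open>Cramer's rule for that linear system with prescribed mean 1: the periodic solution of
  \<open>y' + a y = c\<close> of mean 1, where \<open>c\<close> is
  \<open>unit_drift a\<close>.\<close>

definition unit_solution :: "(real \<Rightarrow> real) \<Rightarrow> real \<Rightarrow> real" where
  "unit_solution a t = (int_factor_primitive a 1 + (int_factor a 1 - 1) * int_factor_primitive a t)
     / (period_det a * int_factor a t)"

definition unit_drift :: "(real \<Rightarrow> real) \<Rightarrow> real" where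
  "unit_drift a = (int_factor a 1 - 1) / period_det a"

lemma int_factor_pos: "0 < int_factor a t"
  by (simp add: int_factor_def)

lemma int_factor_continuous: "continuous_on {0..1} a \<Longrightarrow> continuous_on {0..1} (int_factor a)"
  unfolding int_factor_def
  by (intro continuous_intros indefinite_integral_continuous_1 integrable_continuous_real)

lemma int_factor_primitive_continuous:
  "continuous_on {0..1} a \<Longrightarrow> continuous_on {0..1} (int_factor_primitive a)"
  unfolding int_factor_primitive_def
  by (intro indefinite_integral_continuous_1 integrable_continuous_real int_factor_continuous)

lemma int_factor_primitive_pos:
  assumes "continuous_on {0..1} a"
  shows "0 < int_factor_primitive a 1"
  unfolding int_factor_primitive_def
  by (intro integral_pos_continuous int_factor_continuous assms int_factor_pos)

text \<open>Under one integral sign the integrand is \<open>((I 1 - I t) + E 1 * I t) / E t\<close>,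
  which is positive because \<open>0 \<le> I t \<le> I 1\<close> and \<open>0 < I 1\<close>.\<close>

lemma period_det_pos:
  assumes a: "continuous_on {0..1} a"
  shows "0 < period_det a"
proof -
  define E I where "E = int_factor a" and "I = int_factor_primitive a"
  have E: "continuous_on {0..1} E" "\<And>t. 0 < E t"
    unfolding E_def using int_factor_continuous[OF a] int_factor_pos by auto
  have I: "continuous_on {0..1} I" unfolding I_def by (rule int_factor_primitive_continuous[OF a])
  have nz: "\<forall>t\<in>{0..1}. E t \<noteq> 0" using E(2) by (metis less_irrefl)
  have I_mono: "0 \<le> I t" "I t \<le> I 1" if t: "t \<in> {0..1}" for t
  proof -
    have int: "E integrable_on {0..1}" "E integrable_on {0..t}"
      using t by (auto intro!: integrable_continuous_real continuous_on_subset[OF E(1)])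
    show "0 \<le> I t" unfolding I_def int_factor_primitive_def E_def[symmetric]
      using E(2) by (intro integral_nonneg int) (auto intro: less_imp_le)
    show "I t \<le> I 1" unfolding I_def int_factor_primitive_def E_def[symmetric]
      using E(2) t by (intro integral_subset_le int) (auto intro: less_imp_le)
  qed
  have I1: "0 < I 1" unfolding I_def by (rule int_factor_primitive_pos[OF a])
  have "period_det a = integral {0..1} (\<lambda>t. (E 1 - 1) * (I t / E t) + I 1 * (1 / E t))"
    unfolding period_det_def E_def[symmetric] I_def[symmetric]
    by (rule integral_linear_combination[symmetric]) (intro continuous_intros E I nz)+
  moreover have "0 < integral {0..1} (\<lambda>t. (E 1 - 1) * (I t / E t) + I 1 * (1 / E t))"
  proof (rule integral_pos_continuous)
    show "continuous_on {0..1} (\<lambda>t. (E 1 - 1) * (I t / E t) + I 1 * (1 / E t))"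
      by (intro continuous_intros E I nz)
    fix t :: real assume t: "t \<in> {0..1}"
    have "0 < (I 1 - I t) + E 1 * I t"
      using I_mono[OF t] E(2)[of 1] I1 by (cases "I t = 0") (auto intro: add_nonneg_pos)
    then have "0 < ((I 1 - I t) + E 1 * I t) / E t" using E(2)[of t] by simp
    also have "\<dots> = (E 1 - 1) * (I t / E t) + I 1 * (1 / E t)"
      using E(2)[of t] by (simp add: field_simps)
    finally show "0 < (E 1 - 1) * (I t / E t) + I 1 * (1 / E t)" .
  qed
  ultimately show ?thesis by simp
qed

lemma linear_periodic_solution:
  assumes a: "continuous_on {0..1} a"
    and sol: "periodic_solution (\<lambda>t x. a t * x) (\<lambda>_. 0) c \<sigma> y"
  shows "c = \<sigma> * unit_drift a" "t \<in> {0..1} \<Longrightarrow> y t = \<sigma> * unit_solution a t"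
proof -
  note y = periodic_solutionD[OF sol]
  define E I where "E = int_factor a" and "I = int_factor_primitive a"
  have E: "continuous_on {0..1} E" "\<And>t. 0 < E t"
    unfolding E_def using int_factor_continuous[OF a] int_factor_pos by auto
  have I: "continuous_on {0..1} I" unfolding I_def by (rule int_factor_primitive_continuous[OF a])
  have nz: "\<forall>t\<in>{0..1}. E t \<noteq> 0" using E(2) by (metis less_irrefl)
  have Ey: "E t * y t = y 0 + c * I t" if t: "t \<in> {0..1}" for t
  proof -
    have "((\<lambda>r. E r * (c - 0)) has_integral E t * y t - E 0 * y 0) {0..t}"
    proof (rule fundamental_theorem_of_calculus)
      fix r assume "r \<in> {0..t}"
      then have r: "r \<in> {0..1}" "{0..t} \<subseteq> {0..1}" using t by auto
      have "((\<lambda>t. E t * y t) has_real_derivative E r * (c - 0)) (at r within {0..1})"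
        unfolding E_def int_factor_def
        by (rule linear_integrating_factor[OF a continuous_on_const y(1) _ r(1)])
           (use y(2)[unfolded add_0_right] in \<open>simp only: add_0_right\<close>)
      then show "((\<lambda>t. E t * y t) has_vector_derivative E r * (c - 0)) (at r within {0..t})"
        unfolding has_real_derivative_iff_has_vector_derivative[symmetric]
        by (rule DERIV_subset) (rule r(2))
    qed (use t in simp)
    then have "integral {0..t} (\<lambda>r. E r * (c - 0)) = E t * y t - E 0 * y 0" by (rule integral_unique)
    moreover have "E 0 = 1" by (simp add: E_def int_factor_def)
    ultimately show ?thesis by (simp add: I_def int_factor_primitive_def E_def mult.commute)
  qed
  have y_eq: "y t = (y 0 + c * I t) / E t" if "t \<in> {0..1}" for t
    using Ey[OF that, symmetric] E(2)[of t] by simp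
  define \<alpha> \<beta> where "\<alpha> = integral {0..1} (\<lambda>t. 1 / E t)" and "\<beta> = integral {0..1} (\<lambda>t. I t / E t)"
  \<comment> \<open>Periodicity and the prescribed mean are two linear equations for
    \<open>(y 0, c)\<close>; eliminating one unknown at a time produces the determinant
    \<open>period_det a\<close>.\<close>
  have per: "y 0 * (E 1 - 1) = c * I 1"
    using Ey[of 1] y(3) by (simp add: algebra_simps)
  have "\<sigma> = integral {0..1} (\<lambda>t. y 0 * (1 / E t) + c * (I t / E t))"
    unfolding y(4)[symmetric]
    by (rule integral_cong) (use y_eq in \<open>simp only: add_divide_distrib times_divide_eq_right mult_1_right\<close>)
  also have "\<dots> = y 0 * \<alpha> + c * \<beta>"
    unfolding \<alpha>_def \<beta>_def
    by (rule integral_linear_combination) (intro continuous_intros E I nz)+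
  finally have mean: "\<sigma> = y 0 * \<alpha> + c * \<beta>" .
  have det: "period_det a = (E 1 - 1) * \<beta> + I 1 * \<alpha>"
    by (simp add: period_det_def \<alpha>_def \<beta>_def E_def I_def)
  have pos: "0 < period_det a" by (rule period_det_pos[OF a])
  have "\<sigma> * (E 1 - 1) = y 0 * (E 1 - 1) * \<alpha> + c * \<beta> * (E 1 - 1)" by (simp add: mean algebra_simps)
  also have "\<dots> = c * period_det a" unfolding per det by (simp add: algebra_simps)
  finally show c: "c = \<sigma> * unit_drift a"
    using pos by (simp add: unit_drift_def E_def field_simps)
  have "\<sigma> * I 1 = y 0 * \<alpha> * I 1 + (c * I 1) * \<beta>" by (simp add: mean algebra_simps)
  also have "\<dots> = y 0 * period_det a" unfolding per[symmetric] det by (simp add: algebra_simps)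
  finally have y0: "y 0 = \<sigma> * I 1 / period_det a" using pos by (simp add: field_simps)
  show "y t = \<sigma> * unit_solution a t" if t: "t \<in> {0..1}"
  proof -
    have "y t = (\<sigma> * I 1 / period_det a + \<sigma> * ((E 1 - 1) / period_det a) * I t) / E t"
      using y_eq[OF t] c y0 by (simp add: unit_drift_def E_def)
    also have "\<dots> = \<sigma> * ((I 1 + (E 1 - 1) * I t) / (period_det a * E t))"
      using pos E(2)[of t] by (simp add: field_simps)
    finally show ?thesis by (simp add: unit_solution_def E_def I_def)
  qed
qed

section \<open>Families of functions depending smoothly on a real parameter\<close>

text \<open>The parameter \<open>p\<close> labels the fibre, \<open>s\<close> is the position on it
  and \<open>t\<close> is time, of which only [0,1] is recorded.\<close>

definition joint_continuous :: "('p :: topological_space \<Rightarrow> real \<Rightarrow> real \<Rightarrow> real) \<Rightarrow> bool" where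
  "joint_continuous y \<longleftrightarrow> continuous_on (UNIV \<times> UNIV \<times> {0..1}) (\<lambda>(p, s, t). y p s t)"

definition has_ds :: "('p \<Rightarrow> real \<Rightarrow> real \<Rightarrow> real) \<Rightarrow> ('p \<Rightarrow> real \<Rightarrow> real \<Rightarrow> real) \<Rightarrow> bool" where
  "has_ds y y' \<longleftrightarrow> (\<forall>p s. \<forall>t\<in>{0..1}. ((\<lambda>s. y p s t) has_real_derivative y' p s t) (at s))"

text \<open>Derivatives are taken in \<open>s\<close> alone; in \<open>p\<close> and
  \<open>t\<close> joint continuity is carried along, from which the continuity of the final
  coefficients follows. The derivative is given existentially because it is determined for
  \<open>t\<close> in [0,1] only.\<close>

primrec Ck :: "nat \<Rightarrow> ('p :: topological_space \<Rightarrow> real \<Rightarrow> real \<Rightarrow> real) \<Rightarrow> bool" where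
  "Ck 0 y \<longleftrightarrow> joint_continuous y"
| "Ck (Suc k) y \<longleftrightarrow> joint_continuous y \<and> (\<exists>y'. has_ds y y' \<and> Ck k y')"

lemma Ck_continuous: "Ck k y \<Longrightarrow> joint_continuous y"
  by (cases k) auto

lemma Ck_SucD: "Ck (Suc k) y \<Longrightarrow> Ck k y"
proof (induction k arbitrary: y)
  case (Suc k)
  then obtain y' where "has_ds y y'" "Ck (Suc k) y'" by auto
  then show ?case using Suc.IH[of y'] Ck_continuous[OF Suc.prems] by auto
qed auto

lemma Ck_SucI: "joint_continuous y \<Longrightarrow> has_ds y y' \<Longrightarrow> Ck k y' \<Longrightarrow> Ck (Suc k) y"
  by auto

lemma Ck_SucE:
  assumes "Ck (Suc k) y"
  obtains y' where "has_ds y y'" "Ck k y'"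
  using assms by auto

lemma joint_continuous_cong:
  assumes "\<And>p s t. t \<in> {0..1} \<Longrightarrow> y p s t = z p s t"
  shows "joint_continuous y \<longleftrightarrow> joint_continuous z"
  unfolding joint_continuous_def by (rule continuous_on_cong) (auto simp: assms)

lemma has_ds_cong:
  assumes "\<And>p s t. t \<in> {0..1} \<Longrightarrow> y p s t = z p s t" "\<And>p s t. t \<in> {0..1} \<Longrightarrow> y' p s t = z' p s t"
  shows "has_ds y y' \<longleftrightarrow> has_ds z z'"
  unfolding has_ds_def using assms by simp

lemma Ck_cong:
  assumes "\<And>p s t. t \<in> {0..1} \<Longrightarrow> y p s t = z p s t"
  shows "Ck k y \<longleftrightarrow> Ck k z"
proof (cases k)
  case 0
  then show ?thesis using joint_continuous_cong[OF assms] by simp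
next
  case (Suc n)
  have "has_ds y y' \<longleftrightarrow> has_ds z y'" for y' by (rule has_ds_cong) (simp_all add: assms)
  then show ?thesis using Suc joint_continuous_cong[of y z, OF assms] by simp
qed

lemma joint_continuousD:
  assumes "joint_continuous y" "continuous_on S p" "continuous_on S s" "continuous_on S t"
    "\<And>x. x \<in> S \<Longrightarrow> t x \<in> {0..1}"
  shows "continuous_on S (\<lambda>x. y (p x) (s x) (t x))"
proof -
  have "continuous_on S (\<lambda>x. (\<lambda>(p, s, t). y p s t) (p x, s x, t x))"
    by (rule continuous_on_compose2[OF assms(1)[unfolded joint_continuous_def]])
       (use assms in \<open>auto intro!: continuous_intros\<close>)
  then show ?thesis by simp
qed

lemma joint_continuous_slice:
  "joint_continuous y \<Longrightarrow> S \<subseteq> {0..1} \<Longrightarrow> continuous_on S (y p s)"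
  by (rule joint_continuousD) (auto intro!: continuous_intros)

lemma joint_continuousI:
  assumes "continuous_on (UNIV \<times> UNIV \<times> {0..1}) (\<lambda>x. y (fst x) (fst (snd x)) (snd (snd x)))"
  shows "joint_continuous y"
  using assms by (simp add: joint_continuous_def case_prod_unfold)

lemma joint_continuous_self:
  assumes "joint_continuous y"
  shows "continuous_on (UNIV \<times> UNIV \<times> {0..1}) (\<lambda>x. y (fst x) (fst (snd x)) (snd (snd x)))"
  using assms by (simp add: joint_continuous_def case_prod_unfold)

lemma Ck_fixed:
  assumes "continuous_on {0..1} g"
  shows "Ck k (\<lambda>p s t. g t)"
proof -
  have c: "joint_continuous (\<lambda>(p :: 'a) s t. g t)" if "continuous_on {0..1} g" for g
    by (intro joint_continuousI continuous_on_compose2[OF that] continuous_intros) auto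
  show ?thesis
    using assms
  proof (induction k arbitrary: g)
    case (Suc k)
    have "has_ds (\<lambda>(p :: 'a) s t. g t) (\<lambda>_ _ _. 0)" by (simp add: has_ds_def)
    then show ?case using Suc.IH[of "\<lambda>_. 0"] c[OF Suc.prems] by (auto intro: Ck_SucI)
  qed (simp add: c)
qed

lemma Ck_const: "Ck k (\<lambda>p s t. c)"
  by (rule Ck_fixed) simp

lemma has_ds_add: "has_ds y y' \<Longrightarrow> has_ds z z' \<Longrightarrow> has_ds (\<lambda>p s t. y p s t + z p s t) (\<lambda>p s t. y' p s t + z' p s t)"
  unfolding has_ds_def by (auto intro!: derivative_eq_intros)

lemma has_ds_mult: "has_ds y y' \<Longrightarrow> has_ds z z' \<Longrightarrow>
    has_ds (\<lambda>p s t. y p s t * z p s t) (\<lambda>p s t. y' p s t * z p s t + y p s t * z' p s t)"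
  unfolding has_ds_def by (auto intro!: derivative_eq_intros)

lemma joint_continuous_add:
  assumes "joint_continuous y" "joint_continuous z"
  shows "joint_continuous (\<lambda>p s t. y p s t + z p s t)"
  by (rule joint_continuousI) (intro continuous_intros joint_continuous_self[OF assms(1)] joint_continuous_self[OF assms(2)])

lemma joint_continuous_mult:
  assumes "joint_continuous y" "joint_continuous z"
  shows "joint_continuous (\<lambda>p s t. y p s t * z p s t)"
  by (rule joint_continuousI) (intro continuous_intros joint_continuous_self[OF assms(1)] joint_continuous_self[OF assms(2)])

lemma Ck_add: "Ck k y \<Longrightarrow> Ck k z \<Longrightarrow> Ck k (\<lambda>p s t. y p s t + z p s t)"
proof (induction k arbitrary: y z)
  case 0
  then show ?case by (simp add: joint_continuous_add)
next
  case (Suc k)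
  obtain y' z' where "has_ds y y'" "Ck k y'" "has_ds z z'" "Ck k z'"
    using Suc.prems by (meson Ck_SucE)
  moreover have "joint_continuous (\<lambda>p s t. y p s t + z p s t)"
    using Suc.prems[THEN Ck_continuous] by (rule joint_continuous_add)
  ultimately show ?case by (intro Ck_SucI[OF _ has_ds_add] Suc.IH)
qed

lemma Ck_mult: "Ck k y \<Longrightarrow> Ck k z \<Longrightarrow> Ck k (\<lambda>p s t. y p s t * z p s t)"
proof (induction k arbitrary: y z)
  case 0
  then show ?case by (simp add: joint_continuous_mult)
next
  case (Suc k)
  obtain y' z' where "has_ds y y'" "Ck k y'" "has_ds z z'" "Ck k z'"
    using Suc.prems by (meson Ck_SucE)
  moreover have "joint_continuous (\<lambda>p s t. y p s t * z p s t)"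
    using Suc.prems[THEN Ck_continuous] by (rule joint_continuous_mult)
  ultimately show ?case using Suc.prems[THEN Ck_SucD]
    by (intro Ck_SucI[OF _ has_ds_mult] Ck_add Suc.IH)
qed

lemma Ck_uminus: "Ck k y \<Longrightarrow> Ck k (\<lambda>p s t. - y p s t)"
  using Ck_mult[OF Ck_const[of k "-1"], of y] by simp

lemma Ck_diff: "Ck k y \<Longrightarrow> Ck k z \<Longrightarrow> Ck k (\<lambda>p s t. y p s t - z p s t)"
  using Ck_add[of k y "\<lambda>p s t. - z p s t"] Ck_uminus[of k z] by simp

lemma Ck_power: "Ck k y \<Longrightarrow> Ck k (\<lambda>p s t. y p s t ^ n)"
  by (induction n) (auto intro: Ck_const Ck_mult)

lemma has_ds_compose:
  assumes "has_ds y y'" "\<And>t x. t \<in> {0..1} \<Longrightarrow> (g t has_real_derivative g' t x) (at x)"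
  shows "has_ds (\<lambda>p s t. g t (y p s t)) (\<lambda>p s t. g' t (y p s t) * y' p s t)"
  using assms unfolding has_ds_def by (auto intro: DERIV_chain2)

lemma joint_continuous_compose:
  assumes "joint_continuous y" "continuous_on ({0..1} \<times> UNIV) (\<lambda>(t, x). g t x)"
  shows "joint_continuous (\<lambda>p s t. g t (y p s t))"
proof (rule joint_continuousI)
  have "continuous_on (UNIV \<times> UNIV \<times> {0..1})
      (\<lambda>x. (\<lambda>(t, x). g t x) (snd (snd x), y (fst x) (fst (snd x)) (snd (snd x))))"
    by (rule continuous_on_compose2[OF assms(2)])
       (auto intro!: continuous_intros joint_continuous_self[OF assms(1)])
  then show "continuous_on (UNIV \<times> UNIV \<times> {0..1}) (\<lambda>x. g (snd (snd x)) (y (fst x) (fst (snd x)) (snd (snd x))))"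
    by simp
qed

lemma Ck_compose:
  fixes g :: "nat \<Rightarrow> real \<Rightarrow> real \<Rightarrow> real"
  assumes g: "\<And>j. continuous_on ({0..1} \<times> UNIV) (\<lambda>(t, x). g j t x)"
    "\<And>j t x. t \<in> {0..1} \<Longrightarrow> (g j t has_real_derivative g (Suc j) t x) (at x)"
  shows "Ck k y \<Longrightarrow> Ck k (\<lambda>p s t. g j t (y p s t))"
proof (induction k arbitrary: y j)
  case 0
  then show ?case by (simp add: joint_continuous_compose g)
next
  case (Suc k)
  obtain y' where y': "has_ds y y'" "Ck k y'" using Suc.prems by (meson Ck_SucE)
  show ?case
  proof (rule Ck_SucI)
    show "joint_continuous (\<lambda>p s t. g j t (y p s t))"
      by (rule joint_continuous_compose[OF Ck_continuous[OF Suc.prems] g(1)])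
    show "has_ds (\<lambda>p s t. g j t (y p s t)) (\<lambda>p s t. g (Suc j) t (y p s t) * y' p s t)"
      by (rule has_ds_compose[OF y'(1) g(2)])
    show "Ck k (\<lambda>p s t. g (Suc j) t (y p s t) * y' p s t)"
      by (intro Ck_mult Suc.IH y'(2) Ck_SucD[OF Suc.prems])
  qed
qed

lemma Ck_exp: "Ck k y \<Longrightarrow> Ck k (\<lambda>p s t. exp (y p s t))"
  by (rule Ck_compose[where g = "\<lambda>_ _. exp"])
     (auto simp: case_prod_unfold intro!: continuous_intros DERIV_exp)

lemma Ck_inverse:
  assumes nz: "\<And>p s t. t \<in> {0..1} \<Longrightarrow> y p s t \<noteq> 0"
  shows "Ck k y \<Longrightarrow> Ck k (\<lambda>p s t. inverse (y p s t))"
proof (induction k)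
  have c: "joint_continuous (\<lambda>p s t. inverse (y p s t))" if "joint_continuous y"
    by (rule joint_continuousI, rule continuous_on_inverse[OF joint_continuous_self[OF that]]) (use nz in auto)
  {
    case 0
    then show ?case by (simp add: c)
  next
    case (Suc k)
    obtain y' where y': "has_ds y y'" "Ck k y'" using Suc.prems by (meson Ck_SucE)
    have "has_ds (\<lambda>p s t. inverse (y p s t)) (\<lambda>p s t. - (y' p s t * (inverse (y p s t) * inverse (y p s t))))"
      unfolding has_ds_def
    proof (intro allI ballI)
      fix p s and t :: real assume t: "t \<in> {0..1}"
      have "((\<lambda>s. y p s t) has_real_derivative y' p s t) (at s)" using y'(1) t by (auto simp: has_ds_def)
      from DERIV_inverse_fun[OF this nz[OF t]]
      show "((\<lambda>s. inverse (y p s t)) has_real_derivative - (y' p s t * (inverse (y p s t) * inverse (y p s t)))) (at s)"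
        by (simp add: mult_ac numeral_2_eq_2)
    qed
    moreover have "Ck k (\<lambda>p s t. - (y' p s t * (inverse (y p s t) * inverse (y p s t))))"
      using Suc.IH[OF Ck_SucD[OF Suc.prems]] by (intro Ck_uminus Ck_mult y')
    ultimately show ?case by (intro Ck_SucI c Ck_continuous[OF Suc.prems])
  }
qed

lemma Ck_divide:
  "Ck k y \<Longrightarrow> Ck k z \<Longrightarrow> (\<And>p s t. t \<in> {0..1} \<Longrightarrow> z p s t \<noteq> 0) \<Longrightarrow> Ck k (\<lambda>p s t. y p s t / z p s t)"
  unfolding divide_inverse by (intro Ck_mult Ck_inverse)

text \<open>The moving endpoint becomes a parameter of the integrand, so continuity in
  \<open>t\<close> follows from the continuity of parameter integrals over a fixed interval.\<close>

lemma integral_rescale: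
  fixes g :: "real \<Rightarrow> real"
  assumes g: "continuous_on {0..1} g" and t: "t \<in> {0..1}"
  shows "integral {0..t} g = t * integral {0..1} (\<lambda>\<theta>. g (t * \<theta>))"
proof -
  have "((\<lambda>\<theta>. g (t * \<theta>) * t) has_integral integral {0..t * 1} g - integral {0..t * 0} g) {0..1}"
  proof (rule fundamental_theorem_of_calculus)
    fix \<theta> :: real assume \<theta>: "\<theta> \<in> {0..1}"
    then have m: "t * \<theta> \<in> {0..1}" "(\<lambda>\<theta>. t * \<theta>) ` {0..1} \<subseteq> {0..1}" using t by (auto intro: mult_le_one)
    have "((\<lambda>x. integral {0..x} g) has_real_derivative g (t * \<theta>)) (at (t * \<theta>) within {0..1})"
      by (rule integral_has_real_derivative[OF g m(1)])
    then have "((\<lambda>x. integral {0..x} g) has_real_derivative g (t * \<theta>)) (at (t * \<theta>) within (\<lambda>\<theta>. t * \<theta>) ` {0..1})"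
      by (rule DERIV_subset) (rule m(2))
    moreover have "((\<lambda>\<theta>. t * \<theta>) has_real_derivative t) (at \<theta> within {0..1})"
      by (auto intro!: derivative_eq_intros)
    ultimately have "((\<lambda>\<theta>. integral {0..t * \<theta>} g) has_real_derivative g (t * \<theta>) * t) (at \<theta> within {0..1})"
      by (rule DERIV_image_chain[unfolded o_def])
    then show "((\<lambda>\<theta>. integral {0..t * \<theta>} g) has_vector_derivative g (t * \<theta>) * t) (at \<theta> within {0..1})"
      by (simp add: has_real_derivative_iff_has_vector_derivative)
  qed simp
  from integral_unique[OF this] show ?thesis by (simp add: mult.commute)
qed

lemma joint_continuous_integral:
  assumes y: "joint_continuous y"
  shows "joint_continuous (\<lambda>p s t. integral {0..t} (y p s))"
proof -
  have "continuous_on ((UNIV \<times> UNIV \<times> {0..1}) \<times> cbox 0 1)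
      (\<lambda>x. y (fst (fst x)) (fst (snd (fst x))) (snd (snd (fst x)) * snd x))"
    by (rule joint_continuousD[OF y]) (auto intro!: continuous_intros mult_le_one)
  then have "continuous_on (UNIV \<times> UNIV \<times> {0..1})
      (\<lambda>x. integral (cbox 0 1) (\<lambda>\<theta>. y (fst x) (fst (snd x)) (snd (snd x) * \<theta>)))"
    by (intro integral_continuous_on_param) (simp add: case_prod_unfold)
  then have "joint_continuous (\<lambda>p s t. t * integral {0..1} (\<lambda>\<theta>. y p s (t * \<theta>)))"
    by (intro joint_continuousI continuous_intros) simp
  moreover have "integral {0..t} (y p s) = t * integral {0..1} (\<lambda>\<theta>. y p s (t * \<theta>))" if "t \<in> {0..1}" for p s t
    by (rule integral_rescale[OF joint_continuous_slice[OF y order_refl] that])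
  ultimately show ?thesis
    by (subst joint_continuous_cong[where z = "\<lambda>p s t. t * integral {0..1} (\<lambda>\<theta>. y p s (t * \<theta>))"]) auto
qed

lemma has_ds_integral:
  assumes y: "joint_continuous y" and y': "joint_continuous y'" and ds: "has_ds y y'"
  shows "has_ds (\<lambda>p s t. integral {0..t} (y p s)) (\<lambda>p s t. integral {0..t} (y' p s))"
  unfolding has_ds_def
proof (intro allI ballI)
  fix p s and t :: real assume t: "t \<in> {0..1}"
  have "((\<lambda>s. integral (cbox 0 t) (y p s)) has_field_derivative integral (cbox 0 t) (y' p s)) (at s within UNIV)"
  proof (rule leibniz_rule_field_derivative)
    show "((\<lambda>s. y p s r) has_field_derivative y' p s r) (at s within UNIV)" if "r \<in> cbox 0 t" for s r
      using ds that t by (auto simp: has_ds_def)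
    show "y p s integrable_on cbox 0 t" for s
      using t by (auto intro!: integrable_continuous_real joint_continuous_slice[OF y])
    show "continuous_on (UNIV \<times> cbox 0 t) (\<lambda>(s, r). y' p s r)"
      unfolding case_prod_unfold using t by (intro joint_continuousD[OF y'] continuous_intros) auto
  qed auto
  then show "((\<lambda>s. integral {0..t} (y p s)) has_real_derivative integral {0..t} (y' p s)) (at s)" by simp
qed

lemma Ck_integral: "Ck k y \<Longrightarrow> Ck k (\<lambda>p s t. integral {0..t} (y p s))"
proof (induction k arbitrary: y)
  case 0
  then show ?case by (simp add: joint_continuous_integral)
next
  case (Suc k)
  obtain y' where y': "has_ds y y'" "Ck k y'" using Suc.prems by (meson Ck_SucE)
  have y: "joint_continuous y" by (rule Ck_continuous[OF Suc.prems])
  show ?case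
    by (rule Ck_SucI[OF joint_continuous_integral[OF y]
          has_ds_integral[OF y Ck_continuous[OF y'(2)] y'(1)] Suc.IH[OF y'(2)]])
qed

lemma has_ds_at: "has_ds y y' \<Longrightarrow> r \<in> {0..1} \<Longrightarrow> has_ds (\<lambda>p s t. y p s r) (\<lambda>p s t. y' p s r)"
  by (simp add: has_ds_def)

lemma Ck_at: "r \<in> {0..1} \<Longrightarrow> Ck k y \<Longrightarrow> Ck k (\<lambda>p s t. y p s r)"
proof (induction k arbitrary: y)
  have c: "joint_continuous (\<lambda>p s t. y p s r)" if "r \<in> {0..1}" "joint_continuous y" for y :: "'a \<Rightarrow> real \<Rightarrow> real \<Rightarrow> real"
    by (intro joint_continuousI joint_continuousD[OF that(2)] continuous_intros) (use that in auto)
  {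
    case 0
    then show ?case by (simp add: c)
  next
    case (Suc k)
    obtain y' where y': "has_ds y y'" "Ck k y'" using Suc.prems by (meson Ck_SucE)
    show ?case
      by (rule Ck_SucI[OF c[OF Suc.prems(1) Ck_continuous[OF Suc.prems(2)]] has_ds_at[OF y'(1) Suc.prems(1)]
            Suc.IH[OF Suc.prems(1) y'(2)]])
  }
qed

lemma Ck_integral_1: "Ck k y \<Longrightarrow> Ck k (\<lambda>p s t. integral {0..1} (y p s))"
  using Ck_at[OF _ Ck_integral, of 1] by simp

lemma Ck_int_factor: "Ck k a \<Longrightarrow> Ck k (\<lambda>p s t. int_factor (a p s) t)"
  unfolding int_factor_def by (intro Ck_exp Ck_integral)

lemma Ck_int_factor_primitive: "Ck k a \<Longrightarrow> Ck k (\<lambda>p s t. int_factor_primitive (a p s) t)"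
  unfolding int_factor_primitive_def by (intro Ck_integral Ck_int_factor)

lemma Ck_period_det: "Ck k a \<Longrightarrow> Ck k (\<lambda>p s t. period_det (a p s))"
  unfolding period_det_def
  by (intro Ck_add Ck_mult Ck_diff Ck_const Ck_at[OF _ Ck_int_factor] Ck_at[OF _ Ck_int_factor_primitive]
      Ck_integral_1 Ck_divide Ck_int_factor Ck_int_factor_primitive) (auto simp: int_factor_def)

lemma Ck_unit_solution: "Ck k a \<Longrightarrow> Ck k (\<lambda>p s t. unit_solution (a p s) t)"
  unfolding unit_solution_def
proof (intro Ck_divide Ck_add Ck_mult Ck_diff Ck_const Ck_at[OF _ Ck_int_factor]
    Ck_at[OF _ Ck_int_factor_primitive] Ck_int_factor Ck_int_factor_primitive Ck_period_det)
  fix p s t assume a: "Ck k a"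
  have "0 < period_det (a p s)"
    by (intro period_det_pos joint_continuous_slice[OF Ck_continuous[OF a]] order_refl)
  then show "period_det (a p s) * int_factor (a p s) t \<noteq> 0" using int_factor_pos[of "a p s" t] by simp
qed auto

lemma Ck_unit_drift: "Ck k a \<Longrightarrow> Ck k (\<lambda>p s t. unit_drift (a p s))"
  unfolding unit_drift_def
proof (intro Ck_divide Ck_diff Ck_const Ck_at[OF _ Ck_int_factor] Ck_period_det)
  fix p s assume a: "Ck k a"
  have "0 < period_det (a p s)"
    by (intro period_det_pos joint_continuous_slice[OF Ck_continuous[OF a]] order_refl)
  then show "period_det (a p s) \<noteq> 0" by simp
qed auto

section \<open>Families with fibre derivatives of all orders\<close>

definition smooth :: "('p :: topological_space \<Rightarrow> real \<Rightarrow> real \<Rightarrow> real) \<Rightarrow> bool" where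
  "smooth y \<longleftrightarrow> (\<forall>k. Ck k y)"

lemma smooth_fixed: "continuous_on {0..1} g \<Longrightarrow> smooth (\<lambda>p s t. g t)"
  and smooth_const: "smooth (\<lambda>p s t. c)"
  and smooth_add: "smooth y \<Longrightarrow> smooth z \<Longrightarrow> smooth (\<lambda>p s t. y p s t + z p s t)"
  and smooth_diff: "smooth y \<Longrightarrow> smooth z \<Longrightarrow> smooth (\<lambda>p s t. y p s t - z p s t)"
  and smooth_uminus: "smooth y \<Longrightarrow> smooth (\<lambda>p s t. - y p s t)"
  and smooth_mult: "smooth y \<Longrightarrow> smooth z \<Longrightarrow> smooth (\<lambda>p s t. y p s t * z p s t)"
  and smooth_power: "smooth y \<Longrightarrow> smooth (\<lambda>p s t. y p s t ^ n)"
  and smooth_exp: "smooth y \<Longrightarrow> smooth (\<lambda>p s t. exp (y p s t))"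
  and smooth_divide: "smooth y \<Longrightarrow> smooth z \<Longrightarrow> (\<And>p s t. t \<in> {0..1} \<Longrightarrow> z p s t \<noteq> 0) \<Longrightarrow>
    smooth (\<lambda>p s t. y p s t / z p s t)"
  and smooth_integral: "smooth y \<Longrightarrow> smooth (\<lambda>p s t. integral {0..t} (y p s))"
  and smooth_integral_1: "smooth y \<Longrightarrow> smooth (\<lambda>p s t. integral {0..1} (y p s))"
  and smooth_at: "r \<in> {0..1} \<Longrightarrow> smooth y \<Longrightarrow> smooth (\<lambda>p s t. y p s r)"
  unfolding smooth_def
  by (blast intro: Ck_fixed Ck_const Ck_add Ck_diff Ck_uminus Ck_mult Ck_power Ck_exp Ck_divide
      Ck_integral Ck_integral_1 Ck_at)+

lemma smooth_continuous: "smooth y \<Longrightarrow> joint_continuous y"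
  unfolding smooth_def by (blast intro: Ck_continuous)

lemma smooth_slice: "smooth y \<Longrightarrow> continuous_on {0..1} (y p s)"
  by (rule joint_continuous_slice[OF smooth_continuous order_refl])

lemma smooth_id: "smooth (\<lambda>p s t. t)"
  by (rule smooth_fixed) simp

lemmas smooth_intros = smooth_const smooth_id smooth_add smooth_diff smooth_uminus smooth_mult
  smooth_power smooth_exp smooth_integral smooth_integral_1

lemma has_ds_unique:
  assumes "has_ds y y'" "has_ds y z'" "t \<in> {0..1}"
  shows "y' p s t = z' p s t"
  using assms unfolding has_ds_def by (blast intro: DERIV_unique)

text \<open>The \<open>s\<close>-derivative is unique for \<open>t\<close> in [0,1], so an explicit
  formula for it inherits the regularity of the existential witnesses.\<close>

lemma smooth_ds:
  assumes y: "smooth y" and ds: "has_ds y y'"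
  shows "smooth y'"
  unfolding smooth_def
proof
  fix k
  have "Ck (Suc k) y" using y by (simp add: smooth_def)
  then obtain z' where z': "has_ds y z'" "Ck k z'" by (rule Ck_SucE)
  then show "Ck k y'" using Ck_cong[of y' z' k] has_ds_unique[OF ds z'(1)] by blast
qed

lemma smooth_has_ds:
  assumes "smooth y"
  obtains y' where "has_ds y y'" "smooth y'"
  using assms smooth_ds unfolding smooth_def by (metis Ck_SucE)

lemma has_ds_const: "has_ds (\<lambda>p s t. g p t) (\<lambda>p s t. 0)"
  by (simp add: has_ds_def)

lemma has_ds_diff: "has_ds y y' \<Longrightarrow> has_ds z z' \<Longrightarrow> has_ds (\<lambda>p s t. y p s t - z p s t) (\<lambda>p s t. y' p s t - z' p s t)"
  unfolding has_ds_def by (auto intro!: derivative_eq_intros)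

lemma has_ds_power: "has_ds y y' \<Longrightarrow> has_ds (\<lambda>p s t. y p s t ^ n) (\<lambda>p s t. of_nat n * y p s t ^ (n - 1) * y' p s t)"
  unfolding has_ds_def by (auto intro!: derivative_eq_intros)

lemma has_ds_integral_smooth: "smooth y \<Longrightarrow> has_ds y y' \<Longrightarrow>
    has_ds (\<lambda>p s t. integral {0..t} (y p s)) (\<lambda>p s t. integral {0..t} (y' p s))"
  by (intro has_ds_integral smooth_continuous smooth_ds[of y y'])

lemma has_ds_integral_1: "smooth y \<Longrightarrow> has_ds y y' \<Longrightarrow>
    has_ds (\<lambda>p s t. integral {0..1} (y p s)) (\<lambda>p s t. integral {0..1} (y' p s))"
  using has_ds_at[OF has_ds_integral_smooth, of y y' 1] by simp

lemma has_ds_sum: "(\<And>j. j \<in> J \<Longrightarrow> has_ds (y j) (y' j)) \<Longrightarrow>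
    has_ds (\<lambda>p s t. \<Sum>j\<in>J. y j p s t) (\<lambda>p s t. \<Sum>j\<in>J. y' j p s t)"
  by (induction J rule: infinite_finite_induct) (auto intro: has_ds_const has_ds_add)

subsection \<open>The ideal of a sequence of functions\<close>

text \<open>The coefficients may depend on \<open>t\<close> and are smooth in \<open>s\<close>,
  since members of the ideal are integrated in time and differentiated along the fibre again. For
  \<open>n = 0\<close> only zero is left, which makes congruence at level 0 equality on
  [0,1].\<close>

definition in_ideal :: "(nat \<Rightarrow> 'p :: topological_space \<Rightarrow> real \<Rightarrow> real) \<Rightarrow> nat \<Rightarrow> ('p \<Rightarrow> real \<Rightarrow> real \<Rightarrow> real) \<Rightarrow> bool" where
  "in_ideal \<sigma> n y \<longleftrightarrow> (\<exists>b. (\<forall>j. smooth (b j)) \<and>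
     (\<forall>p s. \<forall>t\<in>{0..1}. y p s t = (\<Sum>j=1..n. b j p s t * \<sigma> j p s)))"

lemma in_idealI:
  assumes "\<And>j. smooth (b j)" "\<And>p s t. t \<in> {0..1} \<Longrightarrow> y p s t = (\<Sum>j=1..n. b j p s t * \<sigma> j p s)"
  shows "in_ideal \<sigma> n y"
  using assms unfolding in_ideal_def by blast

lemma in_ideal_cong:
  "(\<And>p s t. t \<in> {0..1} \<Longrightarrow> y p s t = z p s t) \<Longrightarrow> in_ideal \<sigma> n y \<longleftrightarrow> in_ideal \<sigma> n z"
  unfolding in_ideal_def by simp

lemma in_ideal_0: "in_ideal \<sigma> n (\<lambda>p s t. 0)"
  by (rule in_idealI[of "\<lambda>_ _ _ _. 0"]) (auto intro: smooth_const)

lemma in_ideal_add: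
  assumes "in_ideal \<sigma> n y" "in_ideal \<sigma> n z"
  shows "in_ideal \<sigma> n (\<lambda>p s t. y p s t + z p s t)"
proof -
  obtain b where b: "\<And>j. smooth (b j)" "\<And>p s t. t \<in> {0..1} \<Longrightarrow> y p s t = (\<Sum>j=1..n. b j p s t * \<sigma> j p s)"
    using assms(1) unfolding in_ideal_def by blast
  obtain d where d: "\<And>j. smooth (d j)" "\<And>p s t. t \<in> {0..1} \<Longrightarrow> z p s t = (\<Sum>j=1..n. d j p s t * \<sigma> j p s)"
    using assms(2) unfolding in_ideal_def by blast
  show ?thesis
    by (rule in_idealI[of "\<lambda>j p s t. b j p s t + d j p s t"])
       (auto simp: b(2) d(2) distrib_right sum.distrib intro: smooth_add b d)
qed

lemma in_ideal_mult:
  assumes "smooth x" "in_ideal \<sigma> n y"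
  shows "in_ideal \<sigma> n (\<lambda>p s t. x p s t * y p s t)"
proof -
  obtain b where b: "\<And>j. smooth (b j)" "\<And>p s t. t \<in> {0..1} \<Longrightarrow> y p s t = (\<Sum>j=1..n. b j p s t * \<sigma> j p s)"
    using assms(2) unfolding in_ideal_def by blast
  show ?thesis
    by (rule in_idealI[of "\<lambda>j p s t. x p s t * b j p s t"])
       (auto simp: b(2) sum_distrib_left mult.assoc intro: smooth_mult b assms)
qed

lemma in_ideal_generator:
  assumes "j \<in> {1..n}" "smooth x"
  shows "in_ideal \<sigma> n (\<lambda>p s t. x p s t * \<sigma> j p s)"
proof (rule in_idealI[of "\<lambda>i. if i = j then x else (\<lambda>_ _ _. 0)"])
  show "smooth (if i = j then x else (\<lambda>_ _ _. 0))" for i by (simp add: assms smooth_const)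
  show "x p s t * \<sigma> j p s = (\<Sum>i=1..n. (if i = j then x else (\<lambda>_ _ _. 0)) p s t * \<sigma> i p s)" for p s t
  proof -
    have "(\<Sum>i=1..n. (if i = j then x else (\<lambda>_ _ _. 0)) p s t * \<sigma> i p s)
        = (\<Sum>i=1..n. if i = j then x p s t * \<sigma> i p s else 0)"
      by (rule sum.cong) auto
    then show ?thesis using assms(1) by (simp add: sum.delta)
  qed
qed

lemma in_ideal_mono:
  assumes "in_ideal \<sigma> n y" "n \<le> m"
  shows "in_ideal \<sigma> m y"
proof -
  obtain b where b: "\<And>j. smooth (b j)" "\<And>p s t. t \<in> {0..1} \<Longrightarrow> y p s t = (\<Sum>j=1..n. b j p s t * \<sigma> j p s)"
    using assms(1) unfolding in_ideal_def by blast
  show ?thesis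
  proof (rule in_idealI[of "\<lambda>i. if i \<le> n then b i else (\<lambda>_ _ _. 0)"])
    show "smooth (if i \<le> n then b i else (\<lambda>_ _ _. 0))" for i by (simp add: b smooth_const)
    fix p s t assume t: "t \<in> {0..1::real}"
    have "(\<Sum>j=1..n. b j p s t * \<sigma> j p s) = (\<Sum>j=1..m. (if j \<le> n then b j else (\<lambda>_ _ _. 0)) p s t * \<sigma> j p s)"
      using assms(2) by (intro sum.mono_neutral_cong_left) auto
    then show "y p s t = (\<Sum>j=1..m. (if j \<le> n then b j else (\<lambda>_ _ _. 0)) p s t * \<sigma> j p s)"
      using b(2)[OF t] by simp
  qed
qed

lemma in_ideal_integral:
  assumes "in_ideal \<sigma> n y"
  shows "in_ideal \<sigma> n (\<lambda>p s t. integral {0..t} (y p s))"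
proof -
  obtain b where b: "\<And>j. smooth (b j)" "\<And>p s t. t \<in> {0..1} \<Longrightarrow> y p s t = (\<Sum>j=1..n. b j p s t * \<sigma> j p s)"
    using assms(1) unfolding in_ideal_def by blast
  show ?thesis
  proof (rule in_idealI[of "\<lambda>j p s t. integral {0..t} (b j p s)"])
    show "smooth (\<lambda>p s t. integral {0..t} (b j p s))" for j by (intro smooth_integral b)
    fix p s t assume t: "t \<in> {0..1::real}"
    have c: "b j p s integrable_on {0..t}" for j
      using t by (intro integrable_continuous_real joint_continuous_slice[OF smooth_continuous[OF b(1)]]) auto
    have "integral {0..t} (y p s) = integral {0..t} (\<lambda>r. \<Sum>j=1..n. b j p s r * \<sigma> j p s)"
      using t by (intro integral_cong b(2)) auto
    also have "\<dots> = (\<Sum>j=1..n. integral {0..t} (\<lambda>r. b j p s r * \<sigma> j p s))"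
      by (rule integral_sum) (auto intro: integrable_on_mult_left c)
    finally show "integral {0..t} (y p s) = (\<Sum>j=1..n. integral {0..t} (b j p s) * \<sigma> j p s)" by simp
  qed
qed

lemma in_ideal_at:
  assumes "in_ideal \<sigma> n y" "r \<in> {0..1}"
  shows "in_ideal \<sigma> n (\<lambda>p s t. y p s r)"
proof -
  obtain b where b: "\<And>j. smooth (b j)" "\<And>p s t. t \<in> {0..1} \<Longrightarrow> y p s t = (\<Sum>j=1..n. b j p s t * \<sigma> j p s)"
    using assms(1) unfolding in_ideal_def by blast
  show ?thesis
    by (rule in_idealI[of "\<lambda>j p s t. b j p s r"]) (auto simp: b(2)[OF assms(2)] intro: smooth_at assms b)
qed

definition cong_ideal :: "(nat \<Rightarrow> 'p :: topological_space \<Rightarrow> real \<Rightarrow> real) \<Rightarrow> nat \<Rightarrow>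
    ('p \<Rightarrow> real \<Rightarrow> real \<Rightarrow> real) \<Rightarrow> ('p \<Rightarrow> real \<Rightarrow> real \<Rightarrow> real) \<Rightarrow> bool" where
  "cong_ideal \<sigma> n y z \<longleftrightarrow> in_ideal \<sigma> n (\<lambda>p s t. y p s t - z p s t)"

lemma cong_ideal_eq: "(\<And>p s t. t \<in> {0..1} \<Longrightarrow> y p s t = z p s t) \<Longrightarrow> cong_ideal \<sigma> n y z"
  unfolding cong_ideal_def using in_ideal_cong[of "\<lambda>p s t. y p s t - z p s t" "\<lambda>p s t. 0"] in_ideal_0 by fastforce

lemma cong_ideal_trans [trans]: "cong_ideal \<sigma> n x y \<Longrightarrow> cong_ideal \<sigma> n y z \<Longrightarrow> cong_ideal \<sigma> n x z"
  unfolding cong_ideal_def using in_ideal_add[of \<sigma> n "\<lambda>p s t. x p s t - y p s t" "\<lambda>p s t. y p s t - z p s t"] by simp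

lemma cong_ideal_mono: "cong_ideal \<sigma> n y z \<Longrightarrow> n \<le> m \<Longrightarrow> cong_ideal \<sigma> m y z"
  unfolding cong_ideal_def by (rule in_ideal_mono)

lemma cong_ideal_add:
  "cong_ideal \<sigma> n y y' \<Longrightarrow> cong_ideal \<sigma> n z z' \<Longrightarrow> cong_ideal \<sigma> n (\<lambda>p s t. y p s t + z p s t) (\<lambda>p s t. y' p s t + z' p s t)"
  unfolding cong_ideal_def
  using in_ideal_add[of \<sigma> n "\<lambda>p s t. y p s t - y' p s t" "\<lambda>p s t. z p s t - z' p s t"]
  by (simp add: algebra_simps)

lemma cong_ideal_mult_left:
  "smooth x \<Longrightarrow> cong_ideal \<sigma> n y z \<Longrightarrow> cong_ideal \<sigma> n (\<lambda>p s t. x p s t * y p s t) (\<lambda>p s t. x p s t * z p s t)"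
  unfolding cong_ideal_def using in_ideal_mult[of x \<sigma> n "\<lambda>p s t. y p s t - z p s t"] by (simp add: algebra_simps)

lemma cong_ideal_diff:
  assumes "cong_ideal \<sigma> n y y'" "cong_ideal \<sigma> n z z'"
  shows "cong_ideal \<sigma> n (\<lambda>p s t. y p s t - z p s t) (\<lambda>p s t. y' p s t - z' p s t)"
  using cong_ideal_add[OF assms(1) cong_ideal_mult_left[OF smooth_const[of "-1"] assms(2)]] by simp

lemma cong_ideal_integral:
  assumes "cong_ideal \<sigma> n y z" "smooth y" "smooth z"
  shows "cong_ideal \<sigma> n (\<lambda>p s t. integral {0..t} (y p s)) (\<lambda>p s t. integral {0..t} (z p s))"
proof -
  have "integral {0..t} (\<lambda>r. y p s r - z p s r) = integral {0..t} (y p s) - integral {0..t} (z p s)"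
    if "t \<in> {0..1}" for p s t
    using that by (intro integral_diff integrable_continuous_real
        joint_continuous_slice[OF smooth_continuous] assms) auto
  then show ?thesis
    using in_ideal_integral[OF assms(1)[unfolded cong_ideal_def]] in_ideal_cong
    unfolding cong_ideal_def by (smt (verit, best))
qed

lemma cong_ideal_at: "cong_ideal \<sigma> n y z \<Longrightarrow> r \<in> {0..1} \<Longrightarrow> cong_ideal \<sigma> n (\<lambda>p s t. y p s r) (\<lambda>p s t. z p s r)"
  unfolding cong_ideal_def by (rule in_ideal_at)

lemma cong_ideal_integral_1:
  "cong_ideal \<sigma> n y z \<Longrightarrow> smooth y \<Longrightarrow> smooth z \<Longrightarrow>
    cong_ideal \<sigma> n (\<lambda>p s t. integral {0..1} (y p s)) (\<lambda>p s t. integral {0..1} (z p s))"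
  using cong_ideal_at[OF cong_ideal_integral, of \<sigma> n y z 1] by simp

lemma cong_ideal_drop:
  assumes "in_ideal \<sigma> n z"
  shows "cong_ideal \<sigma> n (\<lambda>p s t. y p s t + z p s t) y"
  using assms unfolding cong_ideal_def by simp

text \<open>In the product rule the derivatives of the coefficients stay in the ideal, while the
  derivative of each generator climbs by at most one index; so one new generator is enough.\<close>

lemma in_ideal_ds:
  assumes y: "in_ideal \<sigma> n y" and ds: "has_ds y y'"
    and \<sigma>: "\<And>j. j \<in> {1..n} \<Longrightarrow> smooth (\<lambda>p s t. \<sigma> j p s)"
    and step: "\<And>j. j \<in> {1..n} \<Longrightarrow> has_ds (\<lambda>p s t. \<sigma> j p s) (\<lambda>p s t. d j p s t)"
      "\<And>j. j \<in> {1..n} \<Longrightarrow> in_ideal \<sigma> (Suc j) (d j)"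
  shows "in_ideal \<sigma> (Suc n) y'"
proof -
  obtain b where b: "\<And>j. smooth (b j)" "\<And>p s t. t \<in> {0..1} \<Longrightarrow> y p s t = (\<Sum>j=1..n. b j p s t * \<sigma> j p s)"
    using y unfolding in_ideal_def by blast
  have "\<exists>b'. has_ds (b j) b' \<and> smooth b'" for j using smooth_has_ds[OF b(1)] by metis
  then obtain b' where b': "\<And>j. has_ds (b j) (b' j)" "\<And>j. smooth (b' j)" by metis
  have ds1: "has_ds (\<lambda>p s t. \<Sum>j=1..n. b j p s t * \<sigma> j p s)
      (\<lambda>p s t. \<Sum>j=1..n. b' j p s t * \<sigma> j p s + b j p s t * d j p s t)"
    by (intro has_ds_sum has_ds_mult b' step)
  have ds2: "has_ds (\<lambda>p s t. \<Sum>j=1..n. b j p s t * \<sigma> j p s) y'"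
    using ds has_ds_cong[of y "\<lambda>p s t. \<Sum>j=1..n. b j p s t * \<sigma> j p s" y' y'] b(2) by simp
  have "y' p s t = (\<Sum>j=1..n. b' j p s t * \<sigma> j p s + b j p s t * d j p s t)" if "t \<in> {0..1}" for p s t
    by (rule has_ds_unique[OF ds2 ds1 that])
  moreover have "in_ideal \<sigma> (Suc n) (\<lambda>p s t. \<Sum>j\<in>J. b' j p s t * \<sigma> j p s + b j p s t * d j p s t)"
    if "finite J" "J \<subseteq> {1..n}" for J
    using that
  proof (induction J rule: finite_induct)
    case (insert i J)
    have "in_ideal \<sigma> (Suc n) (\<lambda>p s t. b' i p s t * \<sigma> i p s + b i p s t * d i p s t)"
      using insert.prems
      by (intro in_ideal_add in_ideal_generator in_ideal_mult b b' in_ideal_mono[OF step(2)]) auto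
    then show ?case using insert by (simp add: in_ideal_add)
  qed (simp add: in_ideal_0)
  from this[of "{1..n}"] have "in_ideal \<sigma> (Suc n) (\<lambda>p s t. \<Sum>j=1..n. b' j p s t * \<sigma> j p s + b j p s t * d j p s t)"
    by simp
  ultimately show ?thesis
    using in_ideal_cong[of y' "\<lambda>p s t. \<Sum>j=1..n. b' j p s t * \<sigma> j p s + b j p s t * d j p s t"] by simp
qed

section \<open>Integral identities for the fibre computations\<close>

text \<open>The integrand is half the derivative of a square. It evaluates the integrals of
  \<open>fU 2 * W * A\<close> and \<open>fU 3 * W ^ 2 * B\<close>.\<close>

lemma integral_by_square:
  fixes g :: "real \<Rightarrow> real"
  assumes g: "continuous_on {0..1} g" and t: "t \<in> {0..1}"
  shows "integral {0..t} (\<lambda>r. g r * integral {0..r} g) = (integral {0..t} g)\<^sup>2 / 2"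
proof -
  have "((\<lambda>r. g r * integral {0..r} g) has_integral (integral {0..t} g)\<^sup>2 / 2 - (integral {0..0} g)\<^sup>2 / 2) {0..t}"
  proof (rule fundamental_theorem_of_calculus)
    fix r assume r: "r \<in> {0..t}"
    then have r1: "r \<in> {0..1}" "{0..t} \<subseteq> {0..1}" using t by auto
    have "((\<lambda>r. integral {0..r} g) has_real_derivative g r) (at r within {0..1})"
      by (rule integral_has_real_derivative[OF g r1(1)])
    then have "((\<lambda>r. integral {0..r} g) has_real_derivative g r) (at r within {0..t})"
      by (rule DERIV_subset) (rule r1(2))
    then have "((\<lambda>r. (integral {0..r} g)\<^sup>2 / 2) has_real_derivative g r * integral {0..r} g) (at r within {0..t})"
      by (auto intro!: derivative_eq_intros)
    then show "((\<lambda>r. (integral {0..r} g)\<^sup>2 / 2) has_vector_derivative g r * integral {0..r} g) (at r within {0..t})"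
      by (simp add: has_real_derivative_iff_has_vector_derivative)
  qed (use t in simp)
  from integral_unique[OF this] show ?thesis by simp
qed

text \<open>The weight \<open>r - 1/2\<close> is \<open>kappa\<close> on [0,1). Integration by parts
  turns it into the mean of the primitive, which is the source of \<open>Abar\<close>.\<close>

lemma integral_by_parts_centered:
  fixes g :: "real \<Rightarrow> real"
  assumes g: "continuous_on {0..1} g"
  shows "integral {0..1} (\<lambda>r. (r - 1/2) * g r) = integral {0..1} g / 2 - integral {0..1} (\<lambda>r. integral {0..r} g)"
proof -
  define G where "G r = integral {0..r} g" for r
  have G: "continuous_on {0..1} G" unfolding G_def
    by (intro indefinite_integral_continuous_1 integrable_continuous_real g)
  have "((\<lambda>r. (r - 1/2) * g r + G r) has_integral (1 - 1/2) * G 1 - (0 - 1/2) * G 0) {0..1}"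
  proof (rule fundamental_theorem_of_calculus)
    fix r :: real assume r: "r \<in> {0..1}"
    have "(G has_real_derivative g r) (at r within {0..1})"
      unfolding G_def by (rule integral_has_real_derivative[OF g r])
    then have "((\<lambda>r. (r - 1/2) * G r) has_real_derivative (r - 1/2) * g r + G r) (at r within {0..1})"
      by (auto intro!: derivative_eq_intros)
    then show "((\<lambda>r. (r - 1/2) * G r) has_vector_derivative (r - 1/2) * g r + G r) (at r within {0..1})"
      by (simp add: has_real_derivative_iff_has_vector_derivative)
  qed simp
  from integral_unique[OF this]
  have "integral {0..1} (\<lambda>r. (r - 1/2) * g r + G r) = G 1 / 2" by (simp add: G_def)
  moreover have "integral {0..1} (\<lambda>r. (r - 1/2) * g r + G r) = integral {0..1} (\<lambda>r. (r - 1/2) * g r) + integral {0..1} G"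
    by (intro integral_add integrable_continuous_real continuous_intros g G)
  ultimately have "integral {0..1} (\<lambda>r. (r - 1/2) * g r) = G 1 / 2 - integral {0..1} G" by linarith
  then show ?thesis by (simp add: G_def[abs_def])
qed

text \<open>Division of \<open>exp (m * t) - 1\<close> by \<open>m\<close> with a cofactor that is
  regular at \<open>m = 0\<close>; used with \<open>m\<close> equal to Sigma_1 or its
  negative.\<close>

lemma exp_minus_1_eq: "exp (m * t) - 1 = m * integral {0..t} (\<lambda>r. exp (m * r))" if "0 \<le> t" for m t :: real
proof -
  have "((\<lambda>r. m * exp (m * r)) has_integral exp (m * t) - exp (m * 0)) {0..t}"
    using that by (intro fundamental_theorem_of_calculus)
      (auto intro!: derivative_eq_intros simp flip: has_real_derivative_iff_has_vector_derivative)
  from integral_unique[OF this] show ?thesis by simp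
qed

section \<open>Derivatives along the fibres\<close>

lemma integral_add_diff:
  fixes g h k :: "real \<Rightarrow> real"
  assumes "continuous_on {a..b} g" "continuous_on {a..b} h" "continuous_on {a..b} k"
  shows "integral {a..b} (\<lambda>r. g r + h r - k r) = integral {a..b} g + integral {a..b} h - integral {a..b} k"
  using assms[THEN integrable_continuous_real] by (simp add: integral_add integral_diff integrable_add)

text \<open>\<open>f j\<close> stands for the j-th derivative of the nonlinearity in the state,
  \<open>U\<close> for the solutions along a fibre and \<open>\<phi>\<close> for the last component
  of the normal form. The tangent to the fibre solves the linearised equation and has mean 1, as the
  mean of the solution is the fibre coordinate.\<close>

locale smooth_solution_family =
  fixes f :: "nat \<Rightarrow> real \<Rightarrow> real \<Rightarrow> real"
    and U :: "'p :: topological_space \<Rightarrow> real \<Rightarrow> real \<Rightarrow> real" and \<phi> :: "'p \<Rightarrow> real \<Rightarrow> real"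
  assumes f_continuous: "continuous_on ({0..1} \<times> UNIV) (\<lambda>(t, x). f j t x)"
    and f_deriv: "t \<in> {0..1} \<Longrightarrow> (f j t has_real_derivative f (Suc j) t x) (at x)"
    and U_continuous: "joint_continuous U"
    and U_ds: "has_ds U (\<lambda>p s. unit_solution (\<lambda>r. f 1 r (U p s r)))"
    and \<phi>_ds: "has_ds (\<lambda>p s t. \<phi> p s) (\<lambda>p s t. unit_drift (\<lambda>r. f 1 r (U p s r)))"
begin

definition fU :: "nat \<Rightarrow> 'p \<Rightarrow> real \<Rightarrow> real \<Rightarrow> real" where
  "fU j p s t = f j t (U p s t)"

definition P :: "'p \<Rightarrow> real \<Rightarrow> real \<Rightarrow> real" where
  "P p s t = unit_solution (fU 1 p s) t"

lemma U_ds': "has_ds U P"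
  using U_ds unfolding P_def[abs_def] fU_def[abs_def] .

lemma Ck_fU: "Ck k U \<Longrightarrow> Ck k (fU j)"
  unfolding fU_def[abs_def] by (rule Ck_compose[of f, OF f_continuous f_deriv])

text \<open>Bootstrapping: the \<open>s\<close>-derivative of \<open>U\<close> is an explicit functional of \<open>U\<close> itself.\<close>

lemma smooth_U: "smooth U"
  unfolding smooth_def
proof
  show "Ck k U" for k
  proof (induction k)
    case (Suc k)
    have "Ck k P" unfolding P_def[abs_def] by (rule Ck_unit_solution[OF Ck_fU[OF Suc]])
    then show ?case by (rule Ck_SucI[OF U_continuous U_ds'])
  qed (simp add: U_continuous)
qed

lemma smooth_fU: "smooth (fU j)"
  using smooth_U unfolding smooth_def by (blast intro: Ck_fU)

lemma smooth_P: "smooth P"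
  by (rule smooth_ds[OF smooth_U U_ds'])

lemma fU_ds: "has_ds (fU j) (\<lambda>p s t. fU (Suc j) p s t * P p s t)"
  unfolding fU_def by (rule has_ds_compose[OF U_ds' f_deriv])

definition centered :: "'p \<Rightarrow> real \<Rightarrow> real" where
  "centered p s = integral {0..1} (\<lambda>r. (r - 1/2) * fU 1 p s r)"

definition \<sigma>1 :: "'p \<Rightarrow> real \<Rightarrow> real" where
  "\<sigma>1 p s = integral {0..1} (fU 1 p s)"

text \<open>The weight \<open>w\<close> with its integral against the discontinuous
  \<open>kappa\<close> evaluated in closed form, where smoothness in \<open>s\<close> is
  visible.\<close>

definition W :: "'p \<Rightarrow> real \<Rightarrow> real \<Rightarrow> real" where
  "W p s t = exp (t * \<sigma>1 p s - integral {0..t} (fU 1 p s) - centered p s)"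

definition A :: "'p \<Rightarrow> real \<Rightarrow> real \<Rightarrow> real" where
  "A p s t = integral {0..t} (\<lambda>r. fU 2 p s r * W p s r)"

text \<open>The logarithm of the weight has mean zero for every \<open>s\<close>, so up to the ideal
  its derivative along the fibre is proportional to \<open>Abar - A\<close> and not to
  \<open>- A\<close>.\<close>

definition Abar :: "'p \<Rightarrow> real \<Rightarrow> real" where
  "Abar p s = integral {0..1} (A p s)"

definition B :: "'p \<Rightarrow> real \<Rightarrow> real \<Rightarrow> real" where
  "B p s t = integral {0..t} (\<lambda>r. fU 3 p s r * W p s r ^ 2)"

definition \<sigma> :: "nat \<Rightarrow> 'p \<Rightarrow> real \<Rightarrow> real" where
  "\<sigma> i p s = [\<sigma>1 p s, integral {0..1} (\<lambda>t. fU 2 p s t * W p s t),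
     integral {0..1} (\<lambda>t. fU 3 p s t * W p s t ^ 2),
     integral {0..1} (\<lambda>t. fU 4 p s t * W p s t ^ 3 - 2 * fU 3 p s t * W p s t ^ 2 * A p s t),
     integral {0..1} (\<lambda>t. fU 5 p s t * W p s t ^ 4 - 5 * fU 4 p s t * W p s t ^ 3 * A p s t
       + 5 * fU 3 p s t * W p s t ^ 2 * A p s t ^ 2)] ! (i - 1)"

lemma \<sigma>_1: "\<sigma> 1 p s = \<sigma>1 p s" "\<sigma> (Suc 0) p s = \<sigma>1 p s"
  by (simp_all add: \<sigma>_def)

lemma \<sigma>_simps:
  "\<sigma> 1 p s = integral {0..1} (fU 1 p s)"
  "\<sigma> 2 p s = A p s 1"
  "\<sigma> 3 p s = B p s 1"
  "\<sigma> 4 p s = integral {0..1} (\<lambda>t. fU 4 p s t * W p s t ^ 3 - 2 * fU 3 p s t * W p s t ^ 2 * A p s t)"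
  "\<sigma> 5 p s = integral {0..1} (\<lambda>t. fU 5 p s t * W p s t ^ 4 - 5 * fU 4 p s t * W p s t ^ 3 * A p s t
       + 5 * fU 3 p s t * W p s t ^ 2 * A p s t ^ 2)"
  by (simp_all add: \<sigma>_def \<sigma>1_def A_def B_def numeral_eq_Suc)

lemma smooth_\<sigma>1: "smooth (\<lambda>p s t. \<sigma>1 p s)"
  unfolding \<sigma>1_def by (intro smooth_integral_1 smooth_fU)

lemma smooth_centered: "smooth (\<lambda>p s t. centered p s)"
  unfolding centered_def by (intro smooth_intros smooth_fU)

lemma smooth_W: "smooth W"
  unfolding W_def[abs_def] by (intro smooth_intros smooth_\<sigma>1 smooth_centered smooth_fU)

lemma smooth_A: "smooth A"
  unfolding A_def[abs_def] by (intro smooth_intros smooth_fU smooth_W)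

lemma smooth_Abar: "smooth (\<lambda>p s t. Abar p s)"
  unfolding Abar_def by (intro smooth_intros smooth_A)

lemma smooth_B: "smooth B"
  unfolding B_def[abs_def] by (intro smooth_intros smooth_fU smooth_W)

lemma smooth_\<sigma>: "i \<in> {1..5} \<Longrightarrow> smooth (\<lambda>p s t. \<sigma> i p s)"
proof -
  assume "i \<in> {1..5}"
  then consider "i = 1" | "i = 2" | "i = 3" | "i = 4" | "i = 5" by (auto simp: numeral_eq_Suc le_Suc_eq)
  then show ?thesis
  proof cases
    case 1 then show ?thesis unfolding 1 \<sigma>_simps by (intro smooth_intros smooth_fU)
  next
    case 2 then show ?thesis unfolding 2 \<sigma>_simps by (intro smooth_at smooth_A) simp
  next
    case 3 then show ?thesis unfolding 3 \<sigma>_simps by (intro smooth_at smooth_B) simp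
  next
    case 4 then show ?thesis unfolding 4 \<sigma>_simps by (intro smooth_intros smooth_fU smooth_W smooth_A)
  next
    case 5 then show ?thesis unfolding 5 \<sigma>_simps by (intro smooth_intros smooth_fU smooth_W smooth_A)
  qed
qed

lemmas smooth_all = smooth_intros smooth_fU smooth_P smooth_W smooth_A smooth_Abar smooth_B smooth_centered smooth_\<sigma>1

lemma fU_continuous: "continuous_on {0..1} (fU j p s)"
  by (rule smooth_slice[OF smooth_fU])

text \<open>The constant c between tangent and weight. If Sigma_1 vanishes, \<open>P\<close> is
  \<open>int_factor_primitive\<close> at 1 divided by the determinant and the integrating factor,
  and \<open>W\<close> is \<open>exp (- centered p s)\<close> divided by the integrating factor;
  this is their quotient.\<close>

definition speed :: "'p \<Rightarrow> real \<Rightarrow> real" where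
  "speed p s = int_factor_primitive (fU 1 p s) 1 * exp (centered p s) / period_det (fU 1 p s)"

lemma period_det_nonzero: "period_det (fU 1 p s) \<noteq> 0" "0 < period_det (fU 1 p s)"
  using period_det_pos[OF fU_continuous, of 1 p s] by auto

lemma speed_pos: "0 < speed p s"
  unfolding speed_def using int_factor_primitive_pos[OF fU_continuous, of 1 p s] period_det_nonzero(2)
  by simp

lemma smooth_period_det: "smooth (\<lambda>p s t. period_det (fU 1 p s))"
  using smooth_fU unfolding smooth_def by (blast intro: Ck_period_det)

lemma smooth_int_factor_primitive: "smooth (\<lambda>p s t. int_factor_primitive (fU 1 p s) t)"
  using smooth_fU unfolding smooth_def by (blast intro: Ck_int_factor_primitive)

lemma smooth_int_factor: "smooth (\<lambda>p s t. int_factor (fU 1 p s) t)"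
  using smooth_fU unfolding smooth_def by (blast intro: Ck_int_factor)

lemma smooth_speed: "smooth (\<lambda>p s t. speed p s)"
  unfolding speed_def
  by (intro smooth_divide smooth_mult smooth_exp smooth_centered smooth_period_det
      smooth_at[OF _ smooth_int_factor_primitive] period_det_nonzero) simp

abbreviation cong :: "nat \<Rightarrow> ('p \<Rightarrow> real \<Rightarrow> real \<Rightarrow> real) \<Rightarrow> ('p \<Rightarrow> real \<Rightarrow> real \<Rightarrow> real) \<Rightarrow> bool" where
  "cong \<equiv> cong_ideal \<sigma>"

text \<open>The left side is the numerator of \<open>unit_drift\<close>, so the first derivative of
  \<open>\<phi>\<close> is a positive multiple of Sigma_1.\<close>

lemma int_factor_1_eq: "int_factor (fU 1 p s) 1 - 1 = \<sigma> 1 p s * integral {0..1} (\<lambda>r. exp (\<sigma>1 p s * r))"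
  unfolding int_factor_def \<sigma>_1 \<sigma>1_def[symmetric] using exp_minus_1_eq[of 1 "\<sigma>1 p s"] by simp

text \<open>Two deviations from proportionality, both multiples of Sigma_1: the term of
  \<open>unit_solution\<close> that carries \<open>int_factor (fU 1 p s) 1 - 1\<close>, and the
  factor \<open>exp (t * \<sigma>1 p s)\<close> that \<open>W\<close> has and the homogeneous part
  of \<open>P\<close> lacks. \<open>?b\<close> adds their cofactors.\<close>

lemma P_cong: "cong 1 P (\<lambda>p s t. speed p s * W p s t)"
  unfolding cong_ideal_def
proof (rule in_idealI)
  let ?E = "\<lambda>p s t. int_factor (fU 1 p s) t" and ?I = "\<lambda>p s t. int_factor_primitive (fU 1 p s) t"
    and ?D = "\<lambda>p s. period_det (fU 1 p s)"
  let ?b = "\<lambda>p s t. integral {0..1} (\<lambda>r. exp (\<sigma>1 p s * r)) * ?I p s t / (?D p s * ?E p s t)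
    + speed p s * W p s t * integral {0..t} (\<lambda>r. exp (- \<sigma>1 p s * r)) * (-1)"
  show "smooth ?b" for j :: nat
    by (intro smooth_all smooth_divide smooth_int_factor smooth_int_factor_primitive smooth_period_det smooth_speed)
       (use period_det_nonzero int_factor_pos in \<open>simp add: less_imp_neq[THEN not_sym]\<close>)
  fix p s t assume t: "t \<in> {0..1::real}"
  define m where "m = \<sigma>1 p s"
  have W: "W p s t * exp (centered p s) = exp (t * m) / ?E p s t"
    by (simp add: W_def int_factor_def m_def exp_diff)
  have "exp (- m * t) - 1 = - m * integral {0..t} (\<lambda>r. exp (- m * r))"
    using t by (intro exp_minus_1_eq) auto
  then have e: "1 = exp (- (t * m)) + m * integral {0..t} (\<lambda>r. exp (- m * r))" by (simp add: mult.commute)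
  have inv: "exp (t * m) * exp (- (t * m)) = 1" by (simp add: exp_minus)
  have "speed p s * W p s t * exp (- (t * m)) = ?I p s 1 / ?D p s * (W p s t * exp (centered p s)) * exp (- (t * m))"
    by (simp add: speed_def)
  also have "\<dots> = ?I p s 1 / ?D p s * ((exp (t * m) * exp (- (t * m))) / ?E p s t)"
    unfolding W by simp
  also have "\<dots> = ?I p s 1 / (?D p s * ?E p s t)" unfolding inv by simp
  finally have main: "speed p s * W p s t * exp (- (t * m)) = ?I p s 1 / (?D p s * ?E p s t)" .
  have "P p s t = ?I p s 1 / (?D p s * ?E p s t) + (?E p s 1 - 1) * ?I p s t / (?D p s * ?E p s t)"
    by (simp add: P_def unit_solution_def add_divide_distrib)
  also have "\<dots> = speed p s * W p s t * exp (- (t * m)) + (?E p s 1 - 1) * ?I p s t / (?D p s * ?E p s t)"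
    unfolding main ..
  also have "exp (- (t * m)) = 1 - m * integral {0..t} (\<lambda>r. exp (- m * r))" using e by simp
  finally have "P p s t - speed p s * W p s t = ?b p s t * \<sigma> 1 p s"
    unfolding int_factor_1_eq by (simp add: m_def \<sigma>_1 algebra_simps)
  then show "P p s t - speed p s * W p s t = (\<Sum>j=1..1. ?b p s t * \<sigma> j p s)" by simp
qed

lemma fUP_cong: "smooth x \<Longrightarrow>
    cong 1 (\<lambda>p s t. x p s t * P p s t) (\<lambda>p s t. speed p s * (x p s t * W p s t))"
  using cong_ideal_mult_left[OF _ P_cong, of x] by (simp add: mult.left_commute)

lemma int_fUP_cong:
  assumes "smooth x"
  shows "cong 1 (\<lambda>p s t. integral {0..t} (\<lambda>r. x p s r * P p s r))
    (\<lambda>p s t. speed p s * integral {0..t} (\<lambda>r. x p s r * W p s r))"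
  using cong_ideal_integral[OF fUP_cong[OF assms]] assms by (simp add: smooth_all smooth_speed)

lemma W_ds: "has_ds W (\<lambda>p s t. W p s t * (t * integral {0..1} (\<lambda>r. fU 2 p s r * P p s r)
    - integral {0..t} (\<lambda>r. fU 2 p s r * P p s r)
    - integral {0..1} (\<lambda>r. (r - 1/2) * (fU 2 p s r * P p s r))))"
proof -
  have f1: "has_ds (fU 1) (\<lambda>p s t. fU 2 p s t * P p s t)"
    using fU_ds[of 1] by (simp add: numeral_2_eq_2)
  have "has_ds (\<lambda>p s t. (t - 1/2) * fU 1 p s t) (\<lambda>p s t. 0 * fU 1 p s t + (t - 1/2) * (fU 2 p s t * P p s t))"
    by (rule has_ds_mult[OF has_ds_const f1])
  then have c: "has_ds (\<lambda>p s t. centered p s) (\<lambda>p s t. integral {0..1} (\<lambda>r. (r - 1/2) * (fU 2 p s r * P p s r)))"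
    unfolding centered_def by (intro has_ds_integral_1 smooth_all) simp
  have "has_ds (\<lambda>p s t. t * \<sigma>1 p s) (\<lambda>p s t. 0 * \<sigma>1 p s + t * integral {0..1} (\<lambda>r. fU 2 p s r * P p s r))"
    unfolding \<sigma>1_def by (intro has_ds_mult has_ds_const has_ds_integral_1 smooth_all f1)
  then have m: "has_ds (\<lambda>p s t. t * \<sigma>1 p s) (\<lambda>p s t. t * integral {0..1} (\<lambda>r. fU 2 p s r * P p s r))" by simp
  have "has_ds (\<lambda>p s t. t * \<sigma>1 p s - integral {0..t} (fU 1 p s) - centered p s)
    (\<lambda>p s t. t * integral {0..1} (\<lambda>r. fU 2 p s r * P p s r)
    - integral {0..t} (\<lambda>r. fU 2 p s r * P p s r)
    - integral {0..1} (\<lambda>r. (r - 1/2) * (fU 2 p s r * P p s r)))"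
    by (intro has_ds_diff m c has_ds_integral_smooth smooth_all f1)
  from has_ds_compose[OF this, of "\<lambda>_. exp" "\<lambda>_. exp"]
  show ?thesis unfolding W_def by (simp add: DERIV_exp)
qed

definition W' :: "'p \<Rightarrow> real \<Rightarrow> real \<Rightarrow> real" where
  "W' p s t = W p s t * (t * integral {0..1} (\<lambda>r. fU 2 p s r * P p s r)
    - integral {0..t} (\<lambda>r. fU 2 p s r * P p s r)
    - integral {0..1} (\<lambda>r. (r - 1/2) * (fU 2 p s r * P p s r)))"

lemma W_ds': "has_ds W W'"
  using W_ds unfolding W'_def[abs_def] .

lemma smooth_W': "smooth W'"
  by (rule smooth_ds[OF smooth_W W_ds'])

text \<open>Replacing \<open>P\<close> by \<open>speed * W\<close> turns the three integrals into
  multiples of \<open>A p s 1\<close>, \<open>A p s t\<close> and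
  \<open>A p s 1 / 2 - Abar p s\<close>. As \<open>A p s 1\<close> is Sigma_2, it drops out at level
  2, and \<open>Abar - A\<close> remains.\<close>

lemma W'_cong: "cong 2 W' (\<lambda>p s t. speed p s * (W p s t * (Abar p s - A p s t)))"
proof -
  have s2: "smooth (\<lambda>p s t. (t - 1/2) * fU 2 p s t)" by (intro smooth_all)
  have g: "continuous_on {0..1} (\<lambda>r. fU 2 p s r * W p s r)" for p s
    by (intro continuous_intros fU_continuous smooth_slice[OF smooth_W])
  have 1: "cong 1 (\<lambda>p s t. integral {0..t} (\<lambda>r. fU 2 p s r * P p s r)) (\<lambda>p s t. speed p s * A p s t)"
    unfolding A_def by (rule int_fUP_cong[OF smooth_fU])
  have 2: "cong 1 (\<lambda>p s t. integral {0..1} (\<lambda>r. fU 2 p s r * P p s r)) (\<lambda>p s t. speed p s * A p s 1)"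
    using cong_ideal_at[OF 1, of 1] by simp
  have by_parts: "integral {0..1} (\<lambda>r. (r - 1/2) * (fU 2 p s r * W p s r)) = A p s 1 / 2 - Abar p s" for p s
    using integral_by_parts_centered[OF g, of p s] by (simp add: A_def[abs_def] Abar_def)
  have 3: "cong 1 (\<lambda>p s t. integral {0..1} (\<lambda>r. (r - 1/2) * (fU 2 p s r * P p s r)))
      (\<lambda>p s t. speed p s * (A p s 1 / 2 - Abar p s))"
    using cong_ideal_at[OF int_fUP_cong[OF s2], of 1] by (simp only: mult.assoc by_parts) simp
  have "cong 1 W' (\<lambda>p s t. W p s t * (t * (speed p s * A p s 1) - speed p s * A p s t
      - speed p s * (A p s 1 / 2 - Abar p s)))"
    unfolding W'_def[abs_def] by (intro cong_ideal_mult_left cong_ideal_diff 1 2 3 smooth_all)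
  then have "cong 2 W' (\<lambda>p s t. W p s t * (t * (speed p s * A p s 1) - speed p s * A p s t
      - speed p s * (A p s 1 / 2 - Abar p s)))"
    by (rule cong_ideal_mono) simp
  also have "cong 2 \<dots> (\<lambda>p s t. speed p s * (W p s t * (Abar p s - A p s t))
      + (W p s t * speed p s * (t - 1/2)) * \<sigma> 2 p s)"
    by (rule cong_ideal_eq) (simp add: \<sigma>_simps algebra_simps)
  also have "cong 2 \<dots> (\<lambda>p s t. speed p s * (W p s t * (Abar p s - A p s t)))"
    by (intro cong_ideal_drop in_ideal_generator smooth_all smooth_speed) simp
  finally show ?thesis .
qed

lemma fUW'_cong: "smooth x \<Longrightarrow>
    cong 2 (\<lambda>p s t. x p s t * W' p s t) (\<lambda>p s t. speed p s * (x p s t * W p s t * (Abar p s - A p s t)))"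
  using cong_ideal_mult_left[OF _ W'_cong, of x] by (simp add: mult_ac)

lemma fUP_cong2: "smooth x \<Longrightarrow>
    cong 2 (\<lambda>p s t. x p s t * P p s t) (\<lambda>p s t. speed p s * (x p s t * W p s t))"
  using fUP_cong by (rule cong_ideal_mono) simp_all

definition A' :: "'p \<Rightarrow> real \<Rightarrow> real \<Rightarrow> real" where
  "A' p s t = integral {0..t} (\<lambda>r. fU 3 p s r * P p s r * W p s r + fU 2 p s r * W' p s r)"

lemma fU_ds_numeral:
  "has_ds (fU 2) (\<lambda>p s t. fU 3 p s t * P p s t)" "has_ds (fU 3) (\<lambda>p s t. fU 4 p s t * P p s t)"
  "has_ds (fU 4) (\<lambda>p s t. fU 5 p s t * P p s t)"
  using fU_ds[of 2] fU_ds[of 3] fU_ds[of 4] by (simp_all add: numeral_eq_Suc)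

lemma A_ds: "has_ds A A'"
  unfolding A_def[abs_def] A'_def[abs_def]
  by (intro has_ds_integral_smooth has_ds_mult fU_ds_numeral W_ds' smooth_all)

text \<open>Up to \<open>speed\<close> the first summand contributes \<open>B\<close>, and the
  second the integral of \<open>fU 2 * W * (Abar - A)\<close>, which is
  \<open>Abar * A - A ^ 2 / 2\<close> by the square formula.\<close>

lemma A'_cong: "cong 2 A' (\<lambda>p s t. speed p s * (B p s t + Abar p s * A p s t - A p s t ^ 2 / 2))"
proof -
  have "cong 2 (\<lambda>p s t. fU 3 p s t * P p s t * W p s t + fU 2 p s t * W' p s t)
      (\<lambda>p s t. speed p s * (fU 3 p s t * W p s t * W p s t) + speed p s * (fU 2 p s t * W p s t * (Abar p s - A p s t)))"
    using fUP_cong2[of "\<lambda>p s t. fU 3 p s t * W p s t"]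
    by (intro cong_ideal_add fUW'_cong smooth_all) (simp add: smooth_all mult_ac)
  then have "cong 2 A' (\<lambda>p s t. integral {0..t} (\<lambda>r. speed p s * (fU 3 p s r * W p s r * W p s r)
      + speed p s * (fU 2 p s r * W p s r * (Abar p s - A p s r))))"
    unfolding A'_def[abs_def] by (rule cong_ideal_integral) (intro smooth_all smooth_speed smooth_W')+
  also have "cong 2 \<dots> (\<lambda>p s t. speed p s * (B p s t + Abar p s * A p s t - A p s t ^ 2 / 2))"
  proof (rule cong_ideal_eq)
    fix p s t assume t: "t \<in> {0..1::real}"
    have sub: "{0..t} \<subseteq> {0..1}" using t by auto
    have c: "continuous_on {0..t} (fU j p s)" "continuous_on {0..t} (W p s)" "continuous_on {0..t} (A p s)" for j
      by (auto intro!: continuous_on_subset[OF _ sub] smooth_slice smooth_fU smooth_W smooth_A)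
    have g: "continuous_on {0..1} (\<lambda>r. fU 2 p s r * W p s r)"
      by (intro continuous_intros smooth_slice smooth_fU smooth_W)
    have "integral {0..t} (\<lambda>r. speed p s * (fU 3 p s r * W p s r * W p s r)
        + speed p s * (fU 2 p s r * W p s r * (Abar p s - A p s r)))
      = integral {0..t} (\<lambda>r. speed p s * (fU 3 p s r * W p s r ^ 2)
        + (speed p s * Abar p s) * (fU 2 p s r * W p s r) - speed p s * (fU 2 p s r * W p s r * A p s r))"
      by (rule integral_cong) (simp add: algebra_simps power2_eq_square)
    also have "\<dots> = integral {0..t} (\<lambda>r. speed p s * (fU 3 p s r * W p s r ^ 2))
        + integral {0..t} (\<lambda>r. (speed p s * Abar p s) * (fU 2 p s r * W p s r))
        - integral {0..t} (\<lambda>r. speed p s * (fU 2 p s r * W p s r * A p s r))"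
      by (intro integral_add_diff continuous_intros c)
    also have "\<dots> = speed p s * B p s t + speed p s * Abar p s * A p s t
        - speed p s * integral {0..t} (\<lambda>r. fU 2 p s r * W p s r * A p s r)"
      by (simp add: B_def A_def)
    also have "integral {0..t} (\<lambda>r. fU 2 p s r * W p s r * A p s r) = A p s t ^ 2 / 2"
      unfolding A_def by (rule integral_by_square[OF g t])
    finally show "integral {0..t} (\<lambda>r. speed p s * (fU 3 p s r * W p s r * W p s r)
        + speed p s * (fU 2 p s r * W p s r * (Abar p s - A p s r)))
      = speed p s * (B p s t + Abar p s * A p s t - A p s t ^ 2 / 2)"
      by (simp add: algebra_simps)
  qed
  finally show ?thesis .
qed

section \<open>Derivatives of the functionals along the fibre\<close>

lemma \<sigma>_ds_1: "has_ds (\<lambda>p s t. \<sigma> 1 p s) (\<lambda>p s t. integral {0..1} (\<lambda>r. fU 2 p s r * P p s r))"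
  unfolding \<sigma>_simps using fU_ds[of 1] by (intro has_ds_integral_1 smooth_all) (simp add: numeral_2_eq_2)

lemma \<sigma>_cong_1: "cong 1 (\<lambda>p s t. integral {0..1} (\<lambda>r. fU 2 p s r * P p s r)) (\<lambda>p s t. speed p s * \<sigma> 2 p s)"
  using cong_ideal_at[OF int_fUP_cong[OF smooth_fU[of 2]], of 1] by (simp add: \<sigma>_simps A_def)

lemma \<sigma>_ds_2: "has_ds (\<lambda>p s t. \<sigma> 2 p s) (\<lambda>p s t. A' p s 1)"
  unfolding \<sigma>_simps by (rule has_ds_at[OF A_ds]) simp

text \<open>At \<open>t = 1\<close> the function \<open>A\<close> equals Sigma_2, so both terms
  containing it vanish modulo the ideal and only \<open>B p s 1\<close>, which is Sigma_3, is
  left.\<close>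

lemma \<sigma>_cong_2: "cong 2 (\<lambda>p s t. A' p s 1) (\<lambda>p s t. speed p s * \<sigma> 3 p s)"
proof -
  have "cong 2 (\<lambda>p s t. A' p s 1) (\<lambda>p s t. speed p s * (B p s 1 + Abar p s * A p s 1 - A p s 1 ^ 2 / 2))"
    by (rule cong_ideal_at[OF A'_cong]) simp
  also have "cong 2 \<dots> (\<lambda>p s t. speed p s * \<sigma> 3 p s + (speed p s * (Abar p s - A p s 1 / 2)) * \<sigma> 2 p s)"
    by (rule cong_ideal_eq) (simp add: \<sigma>_simps algebra_simps power2_eq_square)
  also have "cong 2 \<dots> (\<lambda>p s t. speed p s * \<sigma> 3 p s)"
    by (intro cong_ideal_drop in_ideal_generator smooth_mult smooth_speed smooth_diff smooth_Abar smooth_divide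
        smooth_at[OF _ smooth_A] smooth_const) simp_all
  finally show ?thesis .
qed

definition \<sigma>3' :: "'p \<Rightarrow> real \<Rightarrow> real \<Rightarrow> real" where
  "\<sigma>3' p s t = fU 4 p s t * P p s t * W p s t ^ 2 + fU 3 p s t * (2 * W p s t * W' p s t)"

lemma W_power_ds: "has_ds (\<lambda>p s t. W p s t ^ 2) (\<lambda>p s t. 2 * W p s t * W' p s t)"
    "has_ds (\<lambda>p s t. W p s t ^ 3) (\<lambda>p s t. 3 * W p s t ^ 2 * W' p s t)"
  using has_ds_power[OF W_ds', of 2] has_ds_power[OF W_ds', of 3] by simp_all

lemma \<sigma>_ds_3: "has_ds (\<lambda>p s t. \<sigma> 3 p s) (\<lambda>p s t. integral {0..1} (\<sigma>3' p s))"
  unfolding \<sigma>_simps B_def \<sigma>3'_def[abs_def]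
  by (intro has_ds_integral_1 has_ds_mult fU_ds_numeral W_power_ds smooth_all)

lemma smooth_\<sigma>3': "smooth \<sigma>3'"
  unfolding \<sigma>3'_def[abs_def] by (intro smooth_all smooth_W')

text \<open>Up to \<open>speed\<close>, differentiating \<open>fU 3 * W ^ 2\<close> gives
  \<open>fU 4 * W ^ 3 + 2 * fU 3 * W ^ 2 * (Abar - A)\<close>. The part without \<open>Abar\<close>
  is the integrand of Sigma_4, which explains its coefficient -2; the rest integrates to
  \<open>2 * Abar\<close> times Sigma_3.\<close>

lemma \<sigma>_cong_3: "cong 3 (\<lambda>p s t. integral {0..1} (\<sigma>3' p s)) (\<lambda>p s t. speed p s * \<sigma> 4 p s)"
proof -
  define g where "g p s t = speed p s * (fU 4 p s t * W p s t ^ 3 - 2 * fU 3 p s t * W p s t ^ 2 * A p s t)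
      + (2 * speed p s * Abar p s) * (fU 3 p s t * W p s t ^ 2)" for p s t
  have sg: "smooth g" unfolding g_def[abs_def] by (intro smooth_all smooth_speed)
  have 1: "cong 2 (\<lambda>p s t. (fU 4 p s t * W p s t ^ 2) * P p s t)
      (\<lambda>p s t. speed p s * (fU 4 p s t * W p s t ^ 2 * W p s t))"
    by (intro fUP_cong2 smooth_all)
  have 2: "cong 2 (\<lambda>p s t. (fU 3 p s t * (2 * W p s t)) * W' p s t)
      (\<lambda>p s t. speed p s * (fU 3 p s t * (2 * W p s t) * W p s t * (Abar p s - A p s t)))"
    by (intro fUW'_cong smooth_all)
  have "cong 2 \<sigma>3' (\<lambda>p s t. (fU 4 p s t * W p s t ^ 2) * P p s t + (fU 3 p s t * (2 * W p s t)) * W' p s t)"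
    by (rule cong_ideal_eq) (simp add: \<sigma>3'_def algebra_simps)
  also have "cong 2 \<dots> (\<lambda>p s t. speed p s * (fU 4 p s t * W p s t ^ 2 * W p s t)
      + speed p s * (fU 3 p s t * (2 * W p s t) * W p s t * (Abar p s - A p s t)))"
    by (rule cong_ideal_add[OF 1 2])
  also have "cong 2 \<dots> g"
    by (rule cong_ideal_eq) (simp add: g_def algebra_simps power2_eq_square power3_eq_cube)
  finally have "cong 3 \<sigma>3' g" by (rule cong_ideal_mono) simp
  then have "cong 3 (\<lambda>p s t. integral {0..1} (\<sigma>3' p s)) (\<lambda>p s t. integral {0..1} (g p s))"
    by (rule cong_ideal_integral_1[OF _ smooth_\<sigma>3' sg])
  also have "cong 3 \<dots> (\<lambda>p s t. speed p s * \<sigma> 4 p s + (2 * speed p s * Abar p s) * \<sigma> 3 p s)"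
    unfolding g_def \<sigma>_simps B_def
    by (intro cong_ideal_eq integral_linear_combination continuous_intros smooth_slice smooth_fU smooth_W smooth_A)
  also have "cong 3 \<dots> (\<lambda>p s t. speed p s * \<sigma> 4 p s)"
    by (intro cong_ideal_drop in_ideal_generator smooth_all smooth_speed) simp
  finally show ?thesis .
qed

definition \<sigma>4' :: "'p \<Rightarrow> real \<Rightarrow> real \<Rightarrow> real" where
  "\<sigma>4' p s t = (fU 5 p s t * P p s t * W p s t ^ 3 + fU 4 p s t * (3 * W p s t ^ 2 * W' p s t))
     - 2 * ((fU 4 p s t * P p s t * W p s t ^ 2 + fU 3 p s t * (2 * W p s t * W' p s t)) * A p s t
       + fU 3 p s t * W p s t ^ 2 * A' p s t)"

lemma \<sigma>_ds_4: "has_ds (\<lambda>p s t. \<sigma> 4 p s) (\<lambda>p s t. integral {0..1} (\<sigma>4' p s))"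
proof -
  have "has_ds (\<lambda>p s t. fU 4 p s t * W p s t ^ 3 - 2 * (fU 3 p s t * W p s t ^ 2 * A p s t))
      (\<lambda>p s t. (fU 5 p s t * P p s t * W p s t ^ 3 + fU 4 p s t * (3 * W p s t ^ 2 * W' p s t))
     - (0 * (fU 3 p s t * W p s t ^ 2 * A p s t)
       + 2 * ((fU 4 p s t * P p s t * W p s t ^ 2 + fU 3 p s t * (2 * W p s t * W' p s t)) * A p s t
       + fU 3 p s t * W p s t ^ 2 * A' p s t)))"
    by (intro has_ds_diff has_ds_mult fU_ds_numeral W_power_ds A_ds has_ds_const)
  then have "has_ds (\<lambda>p s t. fU 4 p s t * W p s t ^ 3 - 2 * fU 3 p s t * W p s t ^ 2 * A p s t) \<sigma>4'"
    unfolding \<sigma>4'_def[abs_def] by (simp add: mult.assoc)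
  then show ?thesis unfolding \<sigma>_simps by (intro has_ds_integral_1 smooth_all)
qed

lemma smooth_A': "smooth A'"
  by (rule smooth_ds[OF smooth_A A_ds])

lemma smooth_\<sigma>4': "smooth \<sigma>4'"
  unfolding \<sigma>4'_def[abs_def] by (intro smooth_all smooth_W' smooth_A')

text \<open>Here the coefficients of Sigma_5 arise. For \<open>fU 4 * W ^ 3 * A\<close>, -2 from
  differentiating \<open>fU 3\<close> and -3 from \<open>W ^ 3\<close> make -5; for
  \<open>fU 3 * W ^ 2 * A ^ 2\<close>, 4 from \<open>W ^ 2\<close> and 1 from \<open>A\<close> make
  5. The terms with \<open>Abar\<close> assemble to \<open>3 * Abar\<close> times Sigma_4, and the
  term with \<open>B\<close> integrates to a multiple of \<open>B p s 1 ^ 2\<close>, hence of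
  Sigma_3.\<close>

lemma \<sigma>_cong_4: "cong 4 (\<lambda>p s t. integral {0..1} (\<sigma>4' p s)) (\<lambda>p s t. speed p s * \<sigma> 5 p s)"
proof -
  define g5 g4 gB where
    "g5 p s t = fU 5 p s t * W p s t ^ 4 - 5 * fU 4 p s t * W p s t ^ 3 * A p s t + 5 * fU 3 p s t * W p s t ^ 2 * A p s t ^ 2" and
    "g4 p s t = fU 4 p s t * W p s t ^ 3 - 2 * fU 3 p s t * W p s t ^ 2 * A p s t" and
    "gB p s t = fU 3 p s t * W p s t ^ 2 * B p s t" for p s t
  define g where "g p s t = speed p s * g5 p s t + (3 * speed p s * Abar p s) * g4 p s t - (2 * speed p s) * gB p s t" for p s t
  have s: "smooth g5" "smooth g4" "smooth gB"
    unfolding g5_def[abs_def] g4_def[abs_def] gB_def[abs_def] by (intro smooth_all)+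
  have sg: "smooth g" unfolding g_def[abs_def] by (intro smooth_all s smooth_speed)
  have 1: "cong 2 (\<lambda>p s t. (fU 5 p s t * W p s t ^ 3 - 2 * fU 4 p s t * W p s t ^ 2 * A p s t) * P p s t)
      (\<lambda>p s t. speed p s * ((fU 5 p s t * W p s t ^ 3 - 2 * fU 4 p s t * W p s t ^ 2 * A p s t) * W p s t))"
    by (intro fUP_cong2 smooth_all)
  have 2: "cong 2 (\<lambda>p s t. (3 * fU 4 p s t * W p s t ^ 2 - 4 * fU 3 p s t * W p s t * A p s t) * W' p s t)
      (\<lambda>p s t. speed p s * ((3 * fU 4 p s t * W p s t ^ 2 - 4 * fU 3 p s t * W p s t * A p s t) * W p s t * (Abar p s - A p s t)))"
    by (intro fUW'_cong smooth_all)
  have 3: "cong 2 (\<lambda>p s t. (-2 * fU 3 p s t * W p s t ^ 2) * A' p s t)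
      (\<lambda>p s t. (-2 * fU 3 p s t * W p s t ^ 2) * (speed p s * (B p s t + Abar p s * A p s t - A p s t ^ 2 / 2)))"
    by (intro cong_ideal_mult_left A'_cong smooth_all)
  have "cong 2 \<sigma>4' (\<lambda>p s t. (fU 5 p s t * W p s t ^ 3 - 2 * fU 4 p s t * W p s t ^ 2 * A p s t) * P p s t
      + (3 * fU 4 p s t * W p s t ^ 2 - 4 * fU 3 p s t * W p s t * A p s t) * W' p s t
      + (-2 * fU 3 p s t * W p s t ^ 2) * A' p s t)"
    by (rule cong_ideal_eq) (simp add: \<sigma>4'_def algebra_simps)
  also have "cong 2 \<dots> (\<lambda>p s t.
        speed p s * ((fU 5 p s t * W p s t ^ 3 - 2 * fU 4 p s t * W p s t ^ 2 * A p s t) * W p s t)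
      + speed p s * ((3 * fU 4 p s t * W p s t ^ 2 - 4 * fU 3 p s t * W p s t * A p s t) * W p s t * (Abar p s - A p s t))
      + (-2 * fU 3 p s t * W p s t ^ 2) * (speed p s * (B p s t + Abar p s * A p s t - A p s t ^ 2 / 2)))"
    by (intro cong_ideal_add 1 2 3)
  also have "cong 2 \<dots> g"
    by (rule cong_ideal_eq)
       (simp add: g_def g5_def g4_def gB_def field_simps power2_eq_square power3_eq_cube power4_eq_xxxx)
  finally have "cong 4 \<sigma>4' g" by (rule cong_ideal_mono) simp
  then have "cong 4 (\<lambda>p s t. integral {0..1} (\<sigma>4' p s)) (\<lambda>p s t. integral {0..1} (g p s))"
    by (rule cong_ideal_integral_1[OF _ smooth_\<sigma>4' sg])
  also have "cong 4 \<dots> (\<lambda>p s t. speed p s * \<sigma> 5 p s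
      + ((3 * speed p s * Abar p s) * \<sigma> 4 p s + (- speed p s * B p s 1) * \<sigma> 3 p s))"
  proof (rule cong_ideal_eq)
    fix p s and t :: real
    have "integral {0..1} (g p s) = speed p s * integral {0..1} (g5 p s)
        + (3 * speed p s * Abar p s) * integral {0..1} (g4 p s) - (2 * speed p s) * integral {0..1} (gB p s)"
      unfolding g_def
      by (subst integral_add_diff) (auto intro!: continuous_intros s[THEN smooth_slice])
    moreover have "integral {0..1} (gB p s) = B p s 1 ^ 2 / 2"
      unfolding gB_def B_def
      by (rule integral_by_square) (auto intro!: continuous_intros fU_continuous smooth_slice[OF smooth_W])
    ultimately show "integral {0..1} (g p s) = speed p s * \<sigma> 5 p s
      + ((3 * speed p s * Abar p s) * \<sigma> 4 p s + (- speed p s * B p s 1) * \<sigma> 3 p s)"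
      by (simp add: \<sigma>_simps g5_def[abs_def] g4_def[abs_def] power2_eq_square)
  qed
  also have "cong 4 \<dots> (\<lambda>p s t. speed p s * \<sigma> 5 p s)"
    by (intro cong_ideal_drop in_ideal_add in_ideal_generator smooth_all smooth_speed smooth_at[OF _ smooth_B]) simp_all
  finally show ?thesis .
qed

lemma \<sigma>_step:
  assumes "i \<in> {1..4}"
  obtains d where "has_ds (\<lambda>p s t. \<sigma> i p s) d" "cong i d (\<lambda>p s t. speed p s * \<sigma> (Suc i) p s)"
proof -
  from assms consider "i = 1" | "i = 2" | "i = 3" | "i = 4" by (auto simp: numeral_eq_Suc le_Suc_eq)
  then show ?thesis
  proof cases
    case 1 then show ?thesis using that \<sigma>_ds_1 \<sigma>_cong_1 by (simp add: numeral_eq_Suc)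
  next
    case 2 then show ?thesis using that \<sigma>_ds_2 \<sigma>_cong_2 by (simp add: numeral_eq_Suc)
  next
    case 3 then show ?thesis using that \<sigma>_ds_3 \<sigma>_cong_3 by (simp add: numeral_eq_Suc)
  next
    case 4 then show ?thesis using that \<sigma>_ds_4 \<sigma>_cong_4 by (simp add: numeral_eq_Suc)
  qed
qed

lemma in_ideal_of_cong:
  assumes "cong i d (\<lambda>p s t. speed p s * \<sigma> (Suc i) p s)"
  shows "in_ideal \<sigma> (Suc i) d"
proof -
  have "in_ideal \<sigma> (Suc i) (\<lambda>p s t. (d p s t - speed p s * \<sigma> (Suc i) p s) + speed p s * \<sigma> (Suc i) p s)"
    using assms unfolding cong_ideal_def
    by (intro in_ideal_add in_ideal_generator smooth_speed) (auto intro: in_ideal_mono)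
  then show ?thesis by simp
qed

text \<open>The diagonal coefficient \<open>h\<close> starts as the cofactor of Sigma_1 in
  \<open>unit_drift\<close> and gains a factor \<open>speed\<close> with each differentiation, so it
  stays positive; all other terms of the product rule lie in the ideal of the earlier
  functionals.\<close>

lemma \<phi>_derivatives:
  "i \<in> {1..5} \<Longrightarrow> \<exists>G h. G 0 = (\<lambda>p s t. \<phi> p s) \<and> (\<forall>j<i. has_ds (G j) (G (Suc j))) \<and> smooth (G i) \<and>
    smooth h \<and> (\<forall>p s. \<forall>t\<in>{0..1}. 0 < h p s t) \<and> cong (i - 1) (G i) (\<lambda>p s t. h p s t * \<sigma> i p s)"
proof (induction i)
  case (Suc i)
  show ?case
  proof (cases "i = 0")
    case True
    let ?drift = "\<lambda>p s t. unit_drift (fU 1 p s)"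
    let ?h = "\<lambda>p s t. integral {0..1} (\<lambda>r. exp (\<sigma>1 p s * r)) / period_det (fU 1 p s)"
    have ds: "has_ds (\<lambda>p s t. \<phi> p s) ?drift" using \<phi>_ds unfolding fU_def[abs_def] .
    have "smooth ?drift" using smooth_fU unfolding smooth_def by (blast intro: Ck_unit_drift)
    moreover have "smooth ?h"
      by (intro smooth_divide smooth_period_det period_det_nonzero smooth_all)
    moreover have "0 < ?h p s t" for p s t
      using period_det_nonzero(2) by (intro divide_pos_pos integral_pos_continuous) (auto intro!: continuous_intros)
    moreover have "cong 0 ?drift (\<lambda>p s t. ?h p s t * \<sigma> 1 p s)"
      by (rule cong_ideal_eq) (simp add: unit_drift_def int_factor_1_eq[simplified] mult.commute)
    ultimately show ?thesis
      using True ds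
      by (intro exI[of _ "\<lambda>j. if j = 0 then (\<lambda>p s t. \<phi> p s) else ?drift"] exI[of _ ?h]) auto
  next
    case False
    then have i: "i \<in> {1..4}" using Suc.prems by auto
    then obtain G h where G: "G 0 = (\<lambda>p s t. \<phi> p s)" "\<And>j. j < i \<Longrightarrow> has_ds (G j) (G (Suc j))" "smooth (G i)"
      and h: "smooth h" "\<And>p s t. t \<in> {0..1} \<Longrightarrow> 0 < h p s t" "cong (i - 1) (G i) (\<lambda>p s t. h p s t * \<sigma> i p s)"
      using Suc.IH by (auto; blast)
    obtain G' where G': "has_ds (G i) G'" "smooth G'" using smooth_has_ds[OF G(3)] by blast
    obtain h' where h': "has_ds h h'" "smooth h'" using smooth_has_ds[OF h(1)] by blast
    obtain d where d: "has_ds (\<lambda>p s t. \<sigma> i p s) d" "cong i d (\<lambda>p s t. speed p s * \<sigma> (Suc i) p s)"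
      using \<sigma>_step[OF i] by blast
    have ds: "has_ds (\<lambda>p s t. G i p s t - h p s t * \<sigma> i p s) (\<lambda>p s t. G' p s t - (h' p s t * \<sigma> i p s + h p s t * d p s t))"
      by (intro has_ds_diff has_ds_mult G' h' d)
    have "\<exists>d. has_ds (\<lambda>p s t. \<sigma> j p s) d \<and> in_ideal \<sigma> (Suc j) d" if "j \<in> {1..4}" for j
      using \<sigma>_step[OF that] in_ideal_of_cong[of j] by blast
    then have "\<forall>j\<in>{1..4}. \<exists>d. has_ds (\<lambda>p s t. \<sigma> j p s) d \<and> in_ideal \<sigma> (Suc j) d" by blast
    \<comment> \<open>Differentiating a member of the ideal involves the derivatives of all its
      generators, so these are chosen simultaneously.\<close>
    from bchoice[OF this] obtain e where e: "\<And>j. j \<in> {1..4} \<Longrightarrow> has_ds (\<lambda>p s t. \<sigma> j p s) (e j)"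
      "\<And>j. j \<in> {1..4} \<Longrightarrow> in_ideal \<sigma> (Suc j) (e j)" by blast
    have "in_ideal \<sigma> (Suc (i - 1)) (\<lambda>p s t. G' p s t - (h' p s t * \<sigma> i p s + h p s t * d p s t))"
      by (rule in_ideal_ds[OF h(3)[unfolded cong_ideal_def] ds, where d = e])
         (use i in \<open>auto intro: smooth_\<sigma> e\<close>)
    then have 1: "in_ideal \<sigma> i (\<lambda>p s t. G' p s t - (h' p s t * \<sigma> i p s + h p s t * d p s t))"
      using i by simp
    have 2: "in_ideal \<sigma> i (\<lambda>p s t. h' p s t * \<sigma> i p s)" using i by (intro in_ideal_generator h') auto
    have 3: "in_ideal \<sigma> i (\<lambda>p s t. h p s t * (d p s t - speed p s * \<sigma> (Suc i) p s))"
      using d(2) unfolding cong_ideal_def by (intro in_ideal_mult h)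
    have "cong i G' (\<lambda>p s t. (h p s t * speed p s) * \<sigma> (Suc i) p s)"
      unfolding cong_ideal_def using in_ideal_add[OF in_ideal_add[OF 1 2] 3]
      by (rule in_ideal_cong[THEN iffD1, rotated]) (simp add: algebra_simps)
    moreover have "smooth (\<lambda>p s t. h p s t * speed p s)" by (intro smooth_mult h smooth_speed)
    moreover have "0 < h p s t * speed p s" if "t \<in> {0..1}" for p s t using h(2)[OF that] speed_pos by simp
    ultimately show ?thesis
      using G G' by (intro exI[of _ "G(Suc i := G')"] exI[of _ "\<lambda>p s t. h p s t * speed p s"]) (auto simp: less_Suc_eq)
  qed
qed simp

end

section \<open>The hypotheses on the nonlinearity\<close>

lemma D2_0: "D2 0 f = f"
  by (simp add: D2_def fun_eq_iff)

text \<open>Iterated \<open>deriv\<close> in the state is identified with the directional derivative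
  of the plane function along \<open>(0, 1)\<close>; the recursion in \<open>cont_diff\<close> then
  passes regularity of every order from \<open>D2 j f\<close> to
  \<open>D2 (Suc j) f\<close>.\<close>

lemma cont_diff_D2:
  assumes "smooth_on_circle f"
  shows "cont_diff k (\<lambda>(t, x). D2 j f t x)"
    and "(D2 j f t has_real_derivative D2 (Suc j) f t x) (at x)"
proof -
  have deriv: "(D2 j f t has_real_derivative D2 (Suc j) f t x) (at x) \<and>
      frechet_derivative (\<lambda>(t, x). D2 j f t x) (at (t, x)) (0, 1) = D2 (Suc j) f t x"
    if g: "cont_diff (Suc 0) (\<lambda>(t, x). D2 j f t x)" for j t x
  proof -
    define g' where "g' = frechet_derivative (\<lambda>(t, x). D2 j f t x) (at (t, x))"
    have "(\<lambda>(t, x). D2 j f t x) differentiable at (t, x)" using g by simp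
    then have g': "((\<lambda>(t, x). D2 j f t x) has_derivative g') (at (t, x))"
      unfolding g'_def by (simp add: frechet_derivative_works)
    have "((\<lambda>x. (t, x)) has_derivative (\<lambda>h. (0, h))) (at x)" by (auto intro!: derivative_eq_intros)
    from has_derivative_compose[OF this g']
    have "((\<lambda>x. D2 j f t x) has_derivative (\<lambda>h. g' (0, h))) (at x)" by simp
    moreover have "(\<lambda>h. g' (0, h)) = (*) (g' (0, 1))"
    proof
      fix h :: real
      have "g' (h *\<^sub>R (0, 1)) = h *\<^sub>R g' (0, 1)" by (rule linear_cmul[OF has_derivative_linear[OF g']])
      then show "g' (0, h) = g' (0, 1) * h" by simp
    qed
    ultimately have d: "(D2 j f t has_real_derivative g' (0, 1)) (at x)"
      by (simp add: has_field_derivative_def)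
    then have "D2 (Suc j) f t x = g' (0, 1)"
      by (simp add: D2_def[abs_def] DERIV_imp_deriv)
    then show ?thesis using d g'_def by simp
  qed
  have all: "\<forall>k. cont_diff k (\<lambda>(t, x). D2 j f t x)" for j
  proof (induction j)
    case 0
    then show ?case using assms by (simp add: smooth_on_circle_def D2_def)
  next
    case (Suc j)
    show ?case
    proof
      fix k
      have "cont_diff (Suc k) (\<lambda>(t, x). D2 j f t x)" using Suc by blast
      then have "cont_diff k (\<lambda>p. frechet_derivative (\<lambda>(t, x). D2 j f t x) (at p) (0, 1))" by simp
      moreover have "(\<lambda>p. frechet_derivative (\<lambda>(t, x). D2 j f t x) (at p) (0, 1)) = (\<lambda>(t, x). D2 (Suc j) f t x)"
        using deriv[of j] Suc by (simp add: fun_eq_iff)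
      ultimately show "cont_diff k (\<lambda>(t, x). D2 (Suc j) f t x)" by simp
    qed
  qed
  show "cont_diff k (\<lambda>(t, x). D2 j f t x)" using all by blast
  show "(D2 j f t has_real_derivative D2 (Suc j) f t x) (at x)" using deriv all by blast
qed

lemma continuous_on_D2: "smooth_on_circle f \<Longrightarrow> continuous_on S (\<lambda>(t, x). D2 j f t x)"
  using cont_diff_D2(1)[of f 0 j] by (auto intro: continuous_on_subset)

lemma D2_periodic: "smooth_on_circle f \<Longrightarrow> D2 j f (t + 1) x = D2 j f t x"
proof -
  assume "smooth_on_circle f"
  then have "f (t + 1) = f t" by (simp add: smooth_on_circle_def fun_eq_iff)
  then show ?thesis by (simp add: D2_def)
qed

text \<open>If the partial integrals were bounded, the monotone antiderivative would converge, and
  the integral over the half-line would be the finite number \<open>T - \<Phi> 0\<close>.\<close>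

lemma slow_of_nn_integral:
  assumes M: "continuous_on UNIV M" "\<And>x. 1 \<le> M x"
    and inf: "\<not> (\<integral>\<^sup>+s\<in>{0..}. ennreal (1 / M s) \<partial>lborel) < \<infinity>"
  shows "slow M"
proof (rule ccontr)
  assume "\<not> slow M"
  then obtain B where B: "\<And>N. 0 \<le> N \<Longrightarrow> integral {0..N} (\<lambda>x. 1 / M x) < B"
    unfolding slow_def by (meson not_le)
  have pos: "0 < M x" for x using M(2)[of x] by linarith
  have cont: "continuous_on UNIV (\<lambda>x. 1 / M x)"
    using pos by (intro continuous_intros M(1)) (metis less_irrefl)
  obtain \<Phi> where \<Phi>: "\<And>x. (\<Phi> has_real_derivative 1 / M x) (at x)"
    using continuous_antiderivative[OF cont] by blast
  have mono: "\<Phi> x \<le> \<Phi> y" if "x \<le> y" for x y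
    by (rule DERIV_nonneg_imp_nondecreasing[OF that]) (use \<Phi> pos in \<open>meson less_imp_le zero_less_divide_1_iff\<close>)
  have bound: "\<Phi> N \<le> \<Phi> 0 + B" if "0 \<le> N" for N
  proof -
    have "((\<lambda>x. 1 / M x) has_integral \<Phi> N - \<Phi> 0) {0..N}"
      using that by (intro fundamental_theorem_of_calculus)
        (auto simp flip: has_real_derivative_iff_has_vector_derivative intro: has_field_derivative_at_within \<Phi>)
    then show ?thesis using B[OF that] by (simp add: integral_unique)
  qed
  define T where "T = Sup (\<Phi> ` {0..})"
  have bdd: "bdd_above (\<Phi> ` {0..})" using bound by (intro bdd_aboveI[of _ "\<Phi> 0 + B"]) auto
  have le_T: "\<Phi> x \<le> T" if "0 \<le> x" for x unfolding T_def using that by (intro cSup_upper bdd) auto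
  have "(\<Phi> \<longlongrightarrow> T) at_top"
  proof (rule order_tendstoI)
    fix a assume "a < T"
    then obtain x0 where x0: "0 \<le> x0" "a < \<Phi> x0"
      unfolding T_def using less_cSup_iff[OF _ bdd] by auto
    show "eventually (\<lambda>x. a < \<Phi> x) at_top"
      using eventually_ge_at_top[of x0] by eventually_elim (use x0 mono in \<open>meson less_le_trans\<close>)
  next
    fix a assume a: "T < a"
    show "eventually (\<lambda>x. \<Phi> x < a) at_top"
      using eventually_ge_at_top[of 0] by eventually_elim (use le_T a in \<open>meson le_less_trans\<close>)
  qed
  then have "(\<integral>\<^sup>+s. ennreal (1 / M s) * indicator {0..} s \<partial>lborel) = ennreal (T - \<Phi> 0)"
    using pos \<Phi> borel_measurable_continuous_onI[OF cont]
    by (intro nn_integral_FTC_atLeast) (auto intro: less_imp_le)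
  then show False using inf by simp
qed

lemma nn_integral_atMost_reflect:
  fixes M :: "real \<Rightarrow> real"
  assumes "continuous_on UNIV M" "\<And>x. 1 \<le> M x"
  shows "(\<integral>\<^sup>+s\<in>{..0}. ennreal (1 / M s) \<partial>lborel) = (\<integral>\<^sup>+s\<in>{0..}. ennreal (1 / M (- s)) \<partial>lborel)"
proof -
  have "0 < M x" for x using assms(2)[of x] by linarith
  then have "continuous_on UNIV (\<lambda>x. 1 / M x)"
    by (intro continuous_intros assms(1)) (metis less_irrefl)
  then have "(\<lambda>x. ennreal (1 / M x) * indicator {..0} x) \<in> borel_measurable borel"
    using borel_measurable_continuous_onI by (intro borel_measurable_times_ennreal measurable_compose[OF _ measurable_ennreal]) auto
  then have "(\<integral>\<^sup>+s\<in>{..0}. ennreal (1 / M s) \<partial>lborel)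
      = (\<integral>\<^sup>+s. ennreal (1 / M (- s)) * indicator {..0} (- s) \<partial>lborel)"
    by (subst nn_integral_real_affine[where c = "-1" and t = 0]) (auto simp: one_ennreal_def[symmetric])
  also have "\<dots> = (\<integral>\<^sup>+s\<in>{0..}. ennreal (1 / M (- s)) \<partial>lborel)"
    by (rule nn_integral_cong) (auto simp: indicator_def)
  finally show ?thesis .
qed

text \<open>By periodicity the supremum is over a compact period and hence finite. The slope
  \<open>f'\<close> is bounded there uniformly in \<open>t\<close>, locally in the state, so the
  supremum is locally Lipschitz and thus continuous.\<close>

lemma sup_envelope:
  fixes f f' :: "real \<Rightarrow> real \<Rightarrow> real"
  assumes f: "continuous_on ({0..1} \<times> UNIV) (\<lambda>(t, x). f t x)"
    and f': "continuous_on ({0..1} \<times> UNIV) (\<lambda>(t, x). f' t x)"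
    and deriv: "\<And>t x. (f t has_real_derivative f' t x) (at x)"
    and per: "\<And>t x. f (t + 1) x = f t x"
  shows "f t x \<le> max 1 (SUP t. f t x)" and "continuous_on UNIV (\<lambda>x. max 1 (SUP t. f t x))"
proof -
  have frac: "f t x = f (frac t) x" for t x
  proof -
    have "(\<lambda>t. f t x) (frac t + of_int \<lfloor>t\<rfloor>) = f (frac t) x" by (rule periodic_int_shift) (rule per)
    then show ?thesis by (simp add: frac_def)
  qed
  have frac01: "frac t \<in> {0..1}" for t :: real by (simp add: frac_lt_1 less_imp_le)
  have bdd: "bdd_above (range (\<lambda>t. f t x))" for x
  proof -
    obtain B where "\<And>t y. t \<in> {0..1} \<Longrightarrow> \<bar>y\<bar> \<le> \<bar>x\<bar> \<Longrightarrow> \<bar>f t y\<bar> \<le> B"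
      using bounded_on_strip[OF f] by blast
    then have "f t x \<le> B" for t using frac[of t x] frac01[of t] by (metis abs_le_D1 order_refl)
    then show ?thesis by (intro bdd_aboveI[of _ B]) auto
  qed
  have upper: "f t x \<le> (SUP t. f t x)" for t x by (intro cSUP_upper bdd) simp
  show "f t x \<le> max 1 (SUP t. f t x)" using upper[of t x] by simp
  have "continuous_on UNIV (\<lambda>x. SUP t. f t x)"
    unfolding continuous_on_eq_continuous_at[OF open_UNIV] continuous_at_eps_delta
  proof (intro ballI allI impI)
    fix x e :: real assume e: "0 < e"
    obtain L where L: "0 \<le> L" "\<And>t y. t \<in> {0..1} \<Longrightarrow> \<bar>y\<bar> \<le> \<bar>x\<bar> + 1 \<Longrightarrow> \<bar>f' t y\<bar> \<le> L"
      using bounded_on_strip[OF f'] by blast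
    have lip: "\<bar>f t y - f t z\<bar> \<le> L * \<bar>y - z\<bar>" if "\<bar>y - x\<bar> \<le> 1" "\<bar>z - x\<bar> \<le> 1" for t y z
    proof -
      have "norm (f (frac t) y - f (frac t) z) \<le> L * norm (y - z)"
      proof (rule field_differentiable_bound[of "{x - 1..x + 1}" _ "f' (frac t)"])
        fix r assume "r \<in> {x - 1..x + 1}"
        then show "norm (f' (frac t) r) \<le> L" using L(2)[OF frac01, of r t] by auto
      qed (use that deriv in \<open>auto intro: has_field_derivative_at_within\<close>)
      then show ?thesis using frac[of t y] frac[of t z] by simp
    qed
    have le: "(SUP t. f t y) \<le> (SUP t. f t z) + L * \<bar>y - z\<bar>" if "\<bar>y - x\<bar> \<le> 1" "\<bar>z - x\<bar> \<le> 1" for y z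
    proof (rule cSUP_least)
      fix t
      show "f t y \<le> (SUP t. f t z) + L * \<bar>y - z\<bar>" using lip[OF that, of t] upper[of t z] by linarith
    qed simp
    show "\<exists>d>0. \<forall>y. dist y x < d \<longrightarrow> dist (SUP t. f t y) (SUP t. f t x) < e"
    proof (intro exI[of _ "min 1 (e / (L + 1))"] conjI allI impI)
      show "0 < min 1 (e / (L + 1))" using e L(1) by simp
      fix y assume y: "dist y x < min 1 (e / (L + 1))"
      have "dist (SUP t. f t y) (SUP t. f t x) \<le> L * \<bar>y - x\<bar>"
        using le[of y x] le[of x y] y by (auto simp: dist_real_def abs_minus_commute)
      also have "\<dots> \<le> (L + 1) * \<bar>y - x\<bar>" by (intro mult_right_mono) auto
      also have "\<dots> < e" using y L(1) by (simp add: dist_real_def field_simps)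
      finally show "dist (SUP t. f t y) (SUP t. f t x) < e" .
    qed
  qed
  then show "continuous_on UNIV (\<lambda>x. max 1 (SUP t. f t x))" by (intro continuous_intros)
qed

text \<open>Not being wild at an end means that one of the two integrals diverges there, so the
  corresponding majorant is slow; the left end is reduced to the right one by reflection.\<close>

lemma slow_growth_tame:
  assumes smooth: "smooth_on_circle f" and tame: "tame f"
  shows "slow_growth f"
proof -
  define Mp Mm where "Mp x = max 1 (SUP t. f t x)" and "Mm x = max 1 (SUP t. - f t x)" for x
  have f: "continuous_on ({0..1} \<times> UNIV) (\<lambda>(t, x). f t x)"
    using continuous_on_D2[OF smooth, of _ 0] by (simp add: D2_0)
  have f': "continuous_on ({0..1} \<times> UNIV) (\<lambda>(t, x). D2 1 f t x)" by (rule continuous_on_D2[OF smooth])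
  have d: "(f t has_real_derivative D2 1 f t x) (at x)" for t x
    using cont_diff_D2(2)[OF smooth, of 0 t x] by (simp add: D2_0)
  have per: "f (t + 1) x = f t x" for t x using smooth by (simp add: smooth_on_circle_def)
  have Mp: "\<And>t x. f t x \<le> Mp x" "continuous_on UNIV Mp"
    unfolding Mp_def[abs_def] by (rule sup_envelope[OF f f' d per])+
  have "continuous_on ({0..1} \<times> UNIV) (\<lambda>(t, x). - f t x)" "continuous_on ({0..1} \<times> UNIV) (\<lambda>(t, x). - D2 1 f t x)"
    using continuous_on_minus[OF f] continuous_on_minus[OF f'] by (simp_all add: case_prod_unfold)
  moreover have "((\<lambda>x. - f t x) has_real_derivative - D2 1 f t x) (at x)" "- f (t + 1) x = - f t x" for t x
    by (rule DERIV_minus[OF d]) (simp add: per)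
  ultimately have Mm: "\<And>t x. - f t x \<le> Mm x" "continuous_on UNIV Mm"
    unfolding Mm_def[abs_def] by (rule sup_envelope[of "\<lambda>t x. - f t x" "\<lambda>t x. - D2 1 f t x"])+
  have M1: "1 \<le> Mp x" "1 \<le> Mm x" for x by (simp_all add: Mp_def Mm_def)
  have refl: "continuous_on UNIV (\<lambda>x. Mp (- x))" "continuous_on UNIV (\<lambda>x. Mm (- x))"
    by (auto intro!: continuous_on_compose2[OF Mp(2)] continuous_on_compose2[OF Mm(2)] continuous_intros)
  have "\<not> (\<integral>\<^sup>+s\<in>{0..}. ennreal (1 / Mp s) \<partial>lborel) < \<infinity> \<or> \<not> (\<integral>\<^sup>+s\<in>{0..}. ennreal (1 / Mm s) \<partial>lborel) < \<infinity>"
    using tame unfolding tame_def wild_on_def Mp_def Mm_def by blast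
  then have "slow Mp \<or> slow Mm" using slow_of_nn_integral Mp(2) Mm(2) M1 by blast
  moreover have "\<not> (\<integral>\<^sup>+s\<in>{..0}. ennreal (1 / Mp s) \<partial>lborel) < \<infinity> \<or> \<not> (\<integral>\<^sup>+s\<in>{..0}. ennreal (1 / Mm s) \<partial>lborel) < \<infinity>"
    using tame unfolding tame_def wild_on_def Mp_def Mm_def by blast
  then have "slow (\<lambda>x. Mp (- x)) \<or> slow (\<lambda>x. Mm (- x))"
    unfolding nn_integral_atMost_reflect[OF Mp(2) M1(1)] nn_integral_atMost_reflect[OF Mm(2) M1(2)]
    using slow_of_nn_integral refl M1 by blast
  ultimately show ?thesis
    unfolding slow_growth_def using Mp Mm M1 by blast
qed

lemma admissible_tame:
  assumes "smooth_on_circle f" "tame f"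
  shows "admissible f (D2 1 f)"
  unfolding admissible_def
proof (intro conjI allI ballI)
  show "f (t + 1) x = f t x" for t x using assms(1) by (simp add: smooth_on_circle_def)
  show "D2 1 f (t + 1) x = D2 1 f t x" for t x by (rule D2_periodic[OF assms(1)])
  show "continuous_on ({0..1} \<times> UNIV) (\<lambda>(t, x). f t x)"
    using continuous_on_D2[OF assms(1), of _ 0] by (simp add: D2_0)
  show "continuous_on ({0..1} \<times> UNIV) (\<lambda>(t, x). D2 1 f t x)" by (rule continuous_on_D2[OF assms(1)])
  show "(f t has_real_derivative D2 1 f t x) (at x)" for t x
    using cont_diff_D2(2)[OF assms(1), of 0 t x] by (simp add: D2_0)
  show "slow_growth f" by (rule slow_growth_tame[OF assms])
qed

section \<open>The normal form\<close>

text \<open>For \<open>s < t\<close> the floor of \<open>s - t\<close> is -1, and for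
  \<open>t \<le> s < 1\<close> it is 0. So \<open>kappa (s - t)\<close> is
  \<open>s - t - 1/2\<close>, raised by 1 to the left of \<open>t\<close>, up to finitely many
  points.\<close>

lemma kappa_integral:
  fixes a :: "real \<Rightarrow> real"
  assumes a: "continuous_on {0..1} a" and t: "t \<in> {0..1}"
  shows "integral {0..1} (\<lambda>s. kappa (s - t) * a s)
    = integral {0..1} (\<lambda>s. (s - 1/2) * a s) - t * integral {0..1} a + integral {0..t} a"
proof -
  define g where "g s = (s - t - 1/2) * a s" for s
  have sub: "{0..t} \<subseteq> {0..1}" "{t..1} \<subseteq> {0..1}" using t by auto
  have g: "continuous_on {0..1} g" unfolding g_def by (intro continuous_intros a)
  have int: "g integrable_on {0..t}" "a integrable_on {0..t}" "g integrable_on {t..1}" "g integrable_on {0..1}"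
    by (auto intro!: integrable_continuous_real continuous_on_subset[OF g] continuous_on_subset[OF a] sub)
  have "((\<lambda>s. g s + a s) has_integral integral {0..t} g + integral {0..t} a) {0..t}"
    by (intro has_integral_add integrable_integral int)
  then have 1: "((\<lambda>s. kappa (s - t) * a s) has_integral integral {0..t} g + integral {0..t} a) {0..t}"
  proof (rule has_integral_spike_finite[of "{t}", rotated 2])
    fix s assume s: "s \<in> {0..t} - {t}"
    then have "\<lfloor>s - t\<rfloor> = -1" using t by (intro floor_unique) auto
    then show "kappa (s - t) * a s = g s + a s" by (simp add: kappa_def g_def algebra_simps)
  qed simp
  have 2: "((\<lambda>s. kappa (s - t) * a s) has_integral integral {t..1} g) {t..1}"
  proof (rule has_integral_spike_finite[of "{1}", rotated 2, OF integrable_integral[OF int(3)]])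
    fix s assume s: "s \<in> {t..1} - {1}"
    then have "\<lfloor>s - t\<rfloor> = 0" using t by (intro floor_unique) auto
    then show "kappa (s - t) * a s = g s" by (simp add: kappa_def g_def)
  qed simp
  have "((\<lambda>s. kappa (s - t) * a s) has_integral (integral {0..t} g + integral {0..t} a) + integral {t..1} g) {0..1}"
    by (rule has_integral_combine[OF _ _ 1 2]) (use t in auto)
  then have "integral {0..1} (\<lambda>s. kappa (s - t) * a s) = integral {0..t} g + integral {0..t} a + integral {t..1} g"
    by (rule integral_unique)
  also have "\<dots> = integral {0..1} g + integral {0..t} a"
    using integral_combine_left[OF g, of t 1] t by simp
  also have "integral {0..1} g = integral {0..1} (\<lambda>s. 1 * ((s - 1/2) * a s) + (- t) * a s)"
    by (rule integral_cong) (simp add: g_def algebra_simps)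
  also have "\<dots> = 1 * integral {0..1} (\<lambda>s. (s - 1/2) * a s) + (- t) * integral {0..1} a"
    by (intro integral_linear_combination continuous_intros a)
  finally show ?thesis by simp
qed

context circle_pair
begin

text \<open>Evaluations are bounded uniformly in time by \<open>K\<close>, so joint continuity
  reduces to the continuity in time of one fixed function.\<close>

lemma ev_continuous_within:
  assumes \<phi>: "continuous_on S \<phi>" and t: "continuous_on S t" "\<And>x. x \<in> S \<Longrightarrow> t x \<in> {0..1}"
  shows "continuous_on S (\<lambda>x. ev (\<phi> x :: 'a) (t x))"
proof -
  have "continuous_on (UNIV \<times> {0..1}) (\<lambda>(u :: 'a, t). ev u t)"
    unfolding continuous_on_iff
  proof (intro ballI allI impI)
    fix p :: "'a \<times> real" and e :: real assume p: "p \<in> UNIV \<times> {0..1}" and e: "0 < e"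
    obtain u0 t0 where p_eq: "p = (u0, t0)" by fastforce
    have t0: "t0 \<in> {0..1}" using p p_eq by simp
    from ev_continuous[of u0, unfolded continuous_on_iff, rule_format, OF t0, of "e / 2"] e
    obtain d where d: "0 < d" "\<And>t. t \<in> {0..1} \<Longrightarrow> dist t t0 < d \<Longrightarrow> dist (ev u0 t) (ev u0 t0) < e / 2"
      by auto
    show "\<exists>d>0. \<forall>q\<in>UNIV \<times> {0..1}. dist q p < d \<longrightarrow> dist (case q of (u, t) \<Rightarrow> ev u t) (case p of (u, t) \<Rightarrow> ev u t) < e"
    proof (intro exI[of _ "min d (e / (2 * K))"] conjI ballI impI)
      show "0 < min d (e / (2 * K))" using d e K1 by simp
      fix q :: "'a \<times> real" assume q: "q \<in> UNIV \<times> {0..1}" and dq: "dist q p < min d (e / (2 * K))"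
      obtain u t where q_eq: "q = (u, t)" by fastforce
      have t: "t \<in> {0..1}" using q q_eq by simp
      have du: "norm (u - u0) < e / (2 * K)" and dt: "dist t t0 < d"
        using dq dist_fst_le[of q p] dist_snd_le[of q p] by (auto simp: p_eq q_eq dist_norm)
      have "\<bar>ev u t - ev u0 t\<bar> \<le> K * norm (u - u0)" using ev_bound[OF t, of "u - u0"] by (simp add: ev_simps)
      also have "\<dots> < e / 2" using du K1 by (simp add: field_simps)
      finally have "\<bar>ev u t - ev u0 t\<bar> < e / 2" .
      moreover have "\<bar>ev u0 t - ev u0 t0\<bar> < e / 2" using d(2)[OF t dt] by (simp add: dist_real_def)
      ultimately have "\<bar>ev u t - ev u0 t0\<bar> < e" by linarith
      then show "dist (case q of (u, t) \<Rightarrow> ev u t) (case p of (u, t) \<Rightarrow> ev u t) < e"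
        by (simp add: p_eq q_eq dist_real_def)
    qed
  qed
  then have "continuous_on S (\<lambda>x. (\<lambda>(u :: 'a, t). ev u t) (\<phi> x, t x))"
    by (rule continuous_on_compose2) (use t in \<open>auto intro!: continuous_intros \<phi>\<close>)
  then show ?thesis by simp
qed

lemma bounded_linear_const: "bounded_linear (const :: real \<Rightarrow> 'b)"
  by (rule bounded_linear_intro[of _ K]) (auto simp: const_simps mult.commute norm_const)

lemma bounded_linear_mean: "bounded_linear (mean :: 'b \<Rightarrow> real)"
  by (rule bounded_linear_intro[of _ K]) (use mean_bound in \<open>auto simp: mean_simps mult.commute\<close>)

section \<open>Fibres of the normal form\<close>

context
  fixes f :: "real \<Rightarrow> real \<Rightarrow> real"
  assumes smooth_f: "smooth_on_circle f" and adm: "admissible f (D2 1 f)"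
begin

abbreviation \<Psi> :: "'a \<Rightarrow> 'b" where "\<Psi> \<equiv> Psi (F f)"

text \<open>The label \<open>v\<close> is an arbitrary element of B^0 whose mean is discarded, so
  the parameter of the families ranges over a whole type instead of the mean-zero subspace.\<close>

definition fibre_point :: "'b \<Rightarrow> real \<Rightarrow> 'a" where
  "fibre_point v s = inv \<Psi> (v - const (mean v) + const s)"

definition fibre :: "'b \<Rightarrow> real \<Rightarrow> real \<Rightarrow> real" where
  "fibre v s = ev (fibre_point v s)"

definition height :: "'b \<Rightarrow> real \<Rightarrow> real" where
  "height v s = Phi (F f) (v - const (mean v)) s"

lemma Psi_fibre_point: "\<Psi> (fibre_point v s) = v - const (mean v) + const s"
  unfolding fibre_point_def by (rule Psi_inv(1)[OF adm])

lemma fibre_point_Psi: "fibre_point (\<Psi> u) (mean (\<Psi> u)) = u"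
  unfolding fibre_point_def by (simp add: Psi_inv(2)[OF adm])

lemma height_eq: "height v s = mean (F f (fibre_point v s))"
  by (simp add: height_def Phi_def fibre_point_def)

lemma fibre_solution:
  "periodic_solution f (prim (v - const (mean v))) (height v s) s (fibre v s)"
proof -
  have m: "mean (\<Psi> (fibre_point v s)) = s" by (simp add: Psi_fibre_point mean_simps mean_const)
  then have "\<Psi> (fibre_point v s) - const (mean (\<Psi> (fibre_point v s))) = v - const (mean v)"
    by (simp only: m) (simp add: Psi_fibre_point)
  then show ?thesis
    using Psi_solution[OF adm, of "fibre_point v s"] by (simp add: m height_eq fibre_def)
qed

lemma fibre_continuous: "joint_continuous fibre"
proof (rule joint_continuousI)
  have inv: "continuous_on UNIV (inv \<Psi>)"
    using inv_Psi_continuous[OF adm] by (simp add: continuous_on_eq_continuous_at)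
  have "continuous_on (UNIV \<times> UNIV \<times> {0..1}) (\<lambda>x :: 'b \<times> real \<times> real. fibre_point (fst x) (fst (snd x)))"
    unfolding fibre_point_def
    by (intro continuous_on_compose2[OF inv] continuous_intros bounded_linear.continuous_on[OF bounded_linear_const]
        bounded_linear.continuous_on[OF bounded_linear_mean]) auto
  then show "continuous_on (UNIV \<times> UNIV \<times> {0..1}) (\<lambda>x. fibre (fst x) (fst (snd x)) (snd (snd x)))"
    unfolding fibre_def by (intro ev_continuous_within continuous_intros) auto
qed

text \<open>
  Difference quotients along a fibre solve the same linear problem as the derivative, with the
  slope \<open>D2 1 f\<close> averaged between the two points.
\<close>

definition secant_slope :: "'b \<times> real \<Rightarrow> real \<Rightarrow> real \<Rightarrow> real" where
  "secant_slope p s r = mean_slope (D2 1 f) r (fibre (fst p) (snd p) r) (fibre (fst p) s r)"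

lemma secant_slope_diag: "secant_slope (v, s) s = (\<lambda>r. D2 1 f r (fibre v s r))"
  by (simp add: secant_slope_def mean_slope_def fun_eq_iff)

lemma Ck_secant_slope: "Ck 0 secant_slope"
  unfolding Ck.simps
proof (rule joint_continuousI)
  have c: "continuous_on (UNIV \<times> UNIV \<times> {0..1}) (\<lambda>x :: ('b \<times> real) \<times> real \<times> real. fst (fst x))"
    "continuous_on (UNIV \<times> UNIV \<times> {0..1}) (\<lambda>x :: ('b \<times> real) \<times> real \<times> real. snd (fst x))"
    "continuous_on (UNIV \<times> UNIV \<times> {0..1}) (\<lambda>x :: ('b \<times> real) \<times> real \<times> real. fst (snd x))"
    "continuous_on (UNIV \<times> UNIV \<times> {0..1}) (\<lambda>x :: ('b \<times> real) \<times> real \<times> real. snd (snd x))"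
    by (intro continuous_intros)+
  show "continuous_on (UNIV \<times> UNIV \<times> {0..1}) (\<lambda>x. secant_slope (fst x) (fst (snd x)) (snd (snd x)))"
    unfolding secant_slope_def
    by (intro continuous_on_mean_slope[OF admissibleD(4)[OF adm]] joint_continuousD[OF fibre_continuous] c) auto
qed

lemma fibre_difference:
  shows "height v z - height v s = unit_drift (secant_slope (v, s) z) * (z - s)"
    and "t \<in> {0..1} \<Longrightarrow> fibre v z t - fibre v s t = unit_solution (secant_slope (v, s) z) t * (z - s)"
proof -
  have a: "continuous_on {0..1} (secant_slope (v, s) z)"
    by (rule joint_continuous_slice[OF Ck_secant_slope[THEN Ck_continuous] order_refl])
  have "periodic_solution (\<lambda>t x. secant_slope (v, s) z t * x) (\<lambda>_. 0) (height v z - height v s) (z - s)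
      (\<lambda>t. fibre v z t - fibre v s t)"
    using periodic_solution_difference[OF admissibleD(3,4)[OF adm] admissibleD(5)[OF adm]
        fibre_solution[of v s] fibre_solution[of v z]]
    by (simp add: secant_slope_def)
  note sol = linear_periodic_solution[OF a this]
  show "height v z - height v s = unit_drift (secant_slope (v, s) z) * (z - s)"
    using sol(1) by (simp add: mult.commute)
  show "fibre v z t - fibre v s t = unit_solution (secant_slope (v, s) z) t * (z - s)" if "t \<in> {0..1}"
    using sol(2)[OF that] by (simp add: mult.commute)
qed

interpretation fibres: smooth_solution_family "\<lambda>j. D2 j f" fibre height
proof
  show "continuous_on ({0..1} \<times> UNIV) (\<lambda>(t, x). D2 j f t x)" for j by (rule continuous_on_D2[OF smooth_f])
  show "(D2 j f t has_real_derivative D2 (Suc j) f t x) (at x)" for j t x by (rule cont_diff_D2(2)[OF smooth_f])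
  show "joint_continuous fibre" by (rule fibre_continuous)
  show "has_ds fibre (\<lambda>v s. unit_solution (\<lambda>r. D2 1 f r (fibre v s r)))"
    \<comment> \<open>Caratheodory's criterion: the increment is \<open>z - s\<close> times a
      function continuous in \<open>z\<close>, namely the mean-1 solution for the secant slope,
      whose value at \<open>z = s\<close> is the claimed derivative.\<close>
    unfolding has_ds_def CARAT_DERIV
  proof (intro allI ballI exI conjI)
    fix v s and t :: real assume t: "t \<in> {0..1}"
    show "fibre v z t - fibre v s t = unit_solution (secant_slope (v, s) z) t * (z - s)" for z
      by (rule fibre_difference(2)[OF t])
    have "joint_continuous (\<lambda>p z t. unit_solution (secant_slope p z) t)"
      using Ck_unit_solution[OF Ck_secant_slope] by simp
    then have "continuous_on UNIV (\<lambda>z. unit_solution (secant_slope (v, s) z) t)"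
      by (rule joint_continuousD) (use t in \<open>auto intro!: continuous_intros\<close>)
    then show "isCont (\<lambda>z. unit_solution (secant_slope (v, s) z) t) s" by (simp add: continuous_on_eq_continuous_at)
    show "unit_solution (secant_slope (v, s) s) t = unit_solution (\<lambda>r. D2 1 f r (fibre v s r)) t"
      by (simp add: secant_slope_diag)
  qed
  show "has_ds (\<lambda>v s t. height v s) (\<lambda>v s t. unit_drift (\<lambda>r. D2 1 f r (fibre v s r)))"
    unfolding has_ds_def CARAT_DERIV
  proof (intro allI ballI exI conjI)
    fix v s and t :: real
    show "height v z - height v s = unit_drift (secant_slope (v, s) z) * (z - s)" for z
      by (rule fibre_difference(1))
    have "joint_continuous (\<lambda>p z t. unit_drift (secant_slope p z))"
      using Ck_unit_drift[OF Ck_secant_slope] by simp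
    then have "continuous_on UNIV (\<lambda>z. unit_drift (secant_slope (v, s) z))"
      by (rule joint_continuousD[where t = "\<lambda>_. 0"]) (auto intro!: continuous_intros)
    then show "isCont (\<lambda>z. unit_drift (secant_slope (v, s) z)) s" by (simp add: continuous_on_eq_continuous_at)
    show "unit_drift (secant_slope (v, s) s) = unit_drift (\<lambda>r. D2 1 f r (fibre v s r))"
      by (simp add: secant_slope_diag)
  qed
qed


lemma fibre_Psi: "fibre (\<Psi> u) (mean (\<Psi> u)) = ev u"
  by (simp add: fibre_def fibre_point_Psi)

lemma weight_eq: "t \<in> {0..1} \<Longrightarrow> weight f (ev u) t = fibres.W (\<Psi> u) (mean (\<Psi> u)) t"
  using kappa_integral[OF fibres.fU_continuous[of 1 "\<Psi> u" "mean (\<Psi> u)"], of t]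
  by (simp add: weight_def fibres.W_def fibres.centered_def fibres.\<sigma>1_def fibres.fU_def[abs_def] fibre_Psi)

lemma A_fun_eq: "t \<in> {0..1} \<Longrightarrow> A_fun f (ev u) t = fibres.A (\<Psi> u) (mean (\<Psi> u)) t"
  unfolding A_fun_def fibres.A_def by (rule integral_cong) (simp add: weight_eq fibres.fU_def fibre_Psi)

lemma Sigma_eq:
  assumes "i \<in> {1..5}"
  shows "Sigma_fun f i u = fibres.\<sigma> i (\<Psi> u) (mean (\<Psi> u))"
proof -
  let ?v = "\<Psi> u" and ?s = "mean (\<Psi> u)"
  have fU: "fibres.fU j ?v ?s t = D2 j f t (ev u t)" for j t by (simp add: fibres.fU_def fibre_Psi)
  have 1: "Sigma1 f (ev u) = fibres.\<sigma>1 ?v ?s"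
    unfolding Sigma1_def fibres.\<sigma>1_def by (rule integral_cong) (simp add: fU)
  have 2: "Sigma2 f (ev u) = integral {0..1} (\<lambda>t. fibres.fU 2 ?v ?s t * fibres.W ?v ?s t)"
    unfolding Sigma2_def by (rule integral_cong) (simp add: fU weight_eq)
  have 3: "Sigma3 f (ev u) = integral {0..1} (\<lambda>t. fibres.fU 3 ?v ?s t * fibres.W ?v ?s t ^ 2)"
    unfolding Sigma3_def by (rule integral_cong) (simp add: fU weight_eq)
  have 4: "Sigma4 f (ev u) = integral {0..1} (\<lambda>t. fibres.fU 4 ?v ?s t * fibres.W ?v ?s t ^ 3
      - 2 * fibres.fU 3 ?v ?s t * fibres.W ?v ?s t ^ 2 * fibres.A ?v ?s t)"
    unfolding Sigma4_def by (rule integral_cong) (simp add: fU weight_eq A_fun_eq)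
  have 5: "Sigma5 f (ev u) = integral {0..1} (\<lambda>t. fibres.fU 5 ?v ?s t * fibres.W ?v ?s t ^ 4
      - 5 * fibres.fU 4 ?v ?s t * fibres.W ?v ?s t ^ 3 * fibres.A ?v ?s t
      + 5 * fibres.fU 3 ?v ?s t * fibres.W ?v ?s t ^ 2 * fibres.A ?v ?s t ^ 2)"
    unfolding Sigma5_def by (rule integral_cong) (simp add: fU weight_eq A_fun_eq)
  show ?thesis unfolding Sigma_fun_def fibres.\<sigma>_def 1 2 3 4 5 ..
qed

text \<open>The coefficients are those of the ideal membership, taken at the point of the fibre that
  passes through \<open>u\<close>, that is at \<open>s = mean (\<Psi> u)\<close>. Their continuity
  in \<open>u\<close> is joint continuity composed with \<open>\<Psi>\<close>.\<close>

lemma normal_form_coefficients: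
  assumes i: "i \<in> {1..5}"
  shows "\<exists>H. (\<forall>j u. continuous (at u) (H j)) \<and> (\<forall>u. 0 < H i u) \<and>
    (\<forall>u. D2_Phi (F f) i (\<Psi> u) = (\<Sum>j=1..i. H j u * Sigma_fun f j u))"
proof -
  obtain G h where G: "G 0 = (\<lambda>v s t. height v s)" "\<And>j. j < i \<Longrightarrow> has_ds (G j) (G (Suc j))"
    and h: "smooth h" "\<And>v s t. t \<in> {0..1} \<Longrightarrow> 0 < h v s t"
      "in_ideal fibres.\<sigma> (i - 1) (\<lambda>v s t. G i v s t - h v s t * fibres.\<sigma> i v s)"
    using fibres.\<phi>_derivatives[OF i] unfolding cong_ideal_def by blast
  obtain b where b: "\<And>j. smooth (b j)"
    "\<And>v s t. t \<in> {0..1} \<Longrightarrow> G i v s t - h v s t * fibres.\<sigma> i v s = (\<Sum>j=1..i - 1. b j v s t * fibres.\<sigma> j v s)"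
    using h(3) unfolding in_ideal_def by blast
  define B where "B j = (if j = i then h else b j)" for j
  \<comment> \<open>The identity between functions of the fibre holds at every \<open>t\<close> in
    [0,1]; it is read at \<open>t = 0\<close>.\<close>
  define H where "H j u = B j (\<Psi> u) (mean (\<Psi> u)) 0" for j u
  have iterate: "(deriv ^^ j) (height v) = (\<lambda>s. G j v s 0)" if "j \<le> i" for j v
    using that
  proof (induction j)
    case (Suc j)
    have "deriv (\<lambda>s. G j v s 0) s = G (Suc j) v s 0" for s
      using G(2)[of j] Suc.prems by (intro DERIV_imp_deriv) (auto simp: has_ds_def)
    then show ?case using Suc by simp
  qed (simp add: G(1))
  have D2: "D2_Phi (F f) i v = G i v (mean v) 0" for v
    using iterate[of i v] by (simp add: D2_Phi_def height_def[abs_def])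
  have \<Psi>: "continuous_on UNIV \<Psi>" using Psi_continuous[OF adm] by (simp add: continuous_on_eq_continuous_at)
  have "continuous_on UNIV (H j)" for j
  proof -
    have "joint_continuous (B j)" using h(1) b(1) by (auto simp: B_def intro: smooth_continuous)
    then show ?thesis
      unfolding H_def
      by (rule joint_continuousD[of "B j" UNIV \<Psi> "\<lambda>u. mean (\<Psi> u)" "\<lambda>_. 0"])
         (simp_all add: \<Psi> bounded_linear.continuous_on[OF bounded_linear_mean \<Psi>])
  qed
  then have "continuous (at u) (H j)" for j u by (simp add: continuous_on_eq_continuous_at)
  moreover have "0 < H i u" for u using h(2) by (simp add: H_def B_def)
  moreover have "D2_Phi (F f) i (\<Psi> u) = (\<Sum>j=1..i. H j u * Sigma_fun f j u)" for u
  proof -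
    obtain k where k: "i = Suc k" using i by (cases i) auto
    have "(\<Sum>j=1..k. b j (\<Psi> u) (mean (\<Psi> u)) 0 * fibres.\<sigma> j (\<Psi> u) (mean (\<Psi> u))) = (\<Sum>j=1..k. H j u * Sigma_fun f j u)"
      using i k by (intro sum.cong) (auto simp: Sigma_eq H_def B_def)
    moreover have "h (\<Psi> u) (mean (\<Psi> u)) 0 * fibres.\<sigma> i (\<Psi> u) (mean (\<Psi> u)) = H i u * Sigma_fun f i u"
      using i by (simp add: Sigma_eq H_def B_def)
    ultimately show ?thesis
      using b(2)[of 0 "\<Psi> u" "mean (\<Psi> u)"] unfolding D2 by (simp add: k)
  qed
  ultimately show ?thesis by blast
qed

lemma normal_form:
  obtains H where "\<And>i j (u :: 'a). continuous (at u) (H i j)" "\<And>i u. H i i u \<noteq> 0"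
    "\<And>i u. i \<in> {1..5} \<Longrightarrow> D2_Phi (F f) i (\<Psi> u) = (\<Sum>j=1..i. H i j u * Sigma_fun f j u)"
proof -
  have "\<exists>H. (\<forall>j u. continuous (at (u :: 'a)) (H j)) \<and> (\<forall>u. H i u \<noteq> (0 :: real)) \<and>
    (i \<in> {1..5} \<longrightarrow> (\<forall>u. D2_Phi (F f) i (\<Psi> u) = (\<Sum>j=1..i. H j u * Sigma_fun f j u)))" for i
  proof (cases "i \<in> {1..5}")
    case True
    then show ?thesis using normal_form_coefficients[OF True] by (metis less_irrefl)
  next
    case False
    \<comment> \<open>For other indices a nonzero constant serves as a default.\<close>
    then show ?thesis by (intro exI[of _ "\<lambda>_ _. 1"]) auto
  qed
  then have "\<exists>H. \<forall>i. (\<forall>j u. continuous (at (u :: 'a)) (H i j)) \<and> (\<forall>u. H i i u \<noteq> (0 :: real)) \<and>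
    (i \<in> {1..5} \<longrightarrow> (\<forall>u. D2_Phi (F f) i (\<Psi> u) = (\<Sum>j=1..i. H i j u * Sigma_fun f j u)))"
    by (intro choice) blast
  then show ?thesis using that by blast
qed

lemma D2_Phi_vanish_iff:
  assumes "k \<le> 5"
  shows "(\<forall>j\<in>{1..k}. D2_Phi (F f) j (\<Psi> u) = 0) \<longleftrightarrow> (\<forall>j\<in>{1..k}. Sigma_fun f j u = 0)"
proof -
  obtain H where "\<And>i j (u :: 'a). continuous (at u) (H i j)" and H: "\<And>i u. H i i u \<noteq> 0"
    "\<And>i u. i \<in> {1..5} \<Longrightarrow> D2_Phi (F f) i (\<Psi> u) = (\<Sum>j=1..i. H i j u * Sigma_fun f j u)"
    using normal_form by blast
  show ?thesis
  proof
    assume D: "\<forall>j\<in>{1..k}. D2_Phi (F f) j (\<Psi> u) = 0"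
    show "\<forall>j\<in>{1..k}. Sigma_fun f j u = 0"
    proof
      fix j assume "j \<in> {1..k}"
      then show "Sigma_fun f j u = 0"
        by (rule triangular_inject[of "\<lambda>i j. H i j u" k "\<lambda>j. Sigma_fun f j u" "\<lambda>_. 0", OF H(1), rotated])
           (use D H(2) assms in auto)
    qed
  next
    assume "\<forall>j\<in>{1..k}. Sigma_fun f j u = 0"
    then show "\<forall>j\<in>{1..k}. D2_Phi (F f) j (\<Psi> u) = 0" using H(2) assms by auto
  qed
qed

theorem singular_strata: "k \<in> {1..5} \<Longrightarrow> S_set (F f) k = {u. \<forall>i\<in>{1..k}. Sigma_fun f i u = 0}"
  unfolding S_set_def using D2_Phi_vanish_iff[of k] by auto

text \<open>The remaining conditions are compared under (a) only. There the relation of index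
  \<open>k + 1\<close> reduces to its diagonal term, and in the first \<open>k - 1\<close> relations
  all Sigma_j vanish at \<open>u\<close>, so surjectivity passes between the two families once
  \<open>\<Psi>\<close> has carried it to B^1.\<close>

theorem morin_iff:
  assumes k: "k \<in> {1..4}"
  shows "morin_singularity (F f) k u \<longleftrightarrow> (\<forall>i\<in>{1..k}. Sigma_fun f i u = 0) \<and>
    Sigma_fun f (k + 1) u \<noteq> 0 \<and> surj_derivative (k - 1) (Sigma_fun f) u"
proof -
  obtain H where H: "\<And>i j (u :: 'a). continuous (at u) (H i j)" "\<And>i u. H i i u \<noteq> 0"
    "\<And>i u. i \<in> {1..5} \<Longrightarrow> D2_Phi (F f) i (\<Psi> u) = (\<Sum>j=1..i. H i j u * Sigma_fun f j u)"
    using normal_form by blast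
  have van: "(\<forall>j\<in>{1..k}. D2_Phi (F f) j (\<Psi> u) = 0) \<longleftrightarrow> (\<forall>j\<in>{1..k}. Sigma_fun f j u = 0)"
    using k by (intro D2_Phi_vanish_iff) auto
  have "D2_Phi (F f) (k + 1) (\<Psi> u) \<noteq> 0 \<longleftrightarrow> Sigma_fun f (k + 1) u \<noteq> 0"
    and "surj_derivative (k - 1) (D2_Phi (F f)) (\<Psi> u) \<longleftrightarrow> surj_derivative (k - 1) (Sigma_fun f) u"
    if S: "\<forall>j\<in>{1..k}. Sigma_fun f j u = 0"
  proof -
    have "D2_Phi (F f) (k + 1) (\<Psi> u) = (\<Sum>j=1..k. H (k + 1) j u * Sigma_fun f j u) + H (k + 1) (k + 1) u * Sigma_fun f (k + 1) u"
      using H(3)[of "k + 1" u] k by simp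
    also have "(\<Sum>j=1..k. H (k + 1) j u * Sigma_fun f j u) = 0" using S by (intro sum.neutral) auto
    finally show "D2_Phi (F f) (k + 1) (\<Psi> u) \<noteq> 0 \<longleftrightarrow> Sigma_fun f (k + 1) u \<noteq> 0" using H(2) by simp
    have "surj_derivative (k - 1) (\<lambda>i x. D2_Phi (F f) i (\<Psi> x)) u \<longleftrightarrow> surj_derivative (k - 1) (Sigma_fun f) u"
      by (rule surj_derivative_triangular[of _ _ H]) (use k S H in auto)
    then show "surj_derivative (k - 1) (D2_Phi (F f)) (\<Psi> u) \<longleftrightarrow> surj_derivative (k - 1) (Sigma_fun f) u"
      using surj_derivative_Psi[OF adm] by blast
  qed
  then show ?thesis unfolding morin_singularity_def van by blast
qed

end

end

section \<open>The two pairs of function spaces\<close>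

lemma periodic_frac:
  fixes u :: "real \<Rightarrow> real"
  assumes "\<And>t. u (t + 1) = u t"
  shows "u t = u (frac t)"
  using periodic_int_shift[of u "frac t" "\<lfloor>t\<rfloor>", OF assms] by (simp add: frac_def)

lemma frac_unit_interval: "frac t \<in> {0..1 :: real}"
  by (simp add: frac_lt_1 less_imp_le)

text \<open>Two adjacent unit intervals are glued, so that integer points get a full
  neighbourhood.\<close>

lemma circle_function_continuous_UNIV:
  assumes "circle_function g"
  shows "continuous_on UNIV g"
proof -
  have per: "g (t + 1) = g t" for t using assms by (simp add: circle_function_def)
  have g: "continuous_on {0..1} g" using assms by (simp add: circle_function_def)
  have shift: "continuous_on {of_int n..of_int n + 1} g" for n
  proof -
    have "continuous_on {of_int n..of_int n + 1} (\<lambda>t. g (t - of_int n))"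
      by (rule continuous_on_compose2[OF g]) (auto intro!: continuous_intros)
    moreover have "g (t - of_int n) = g t" for t
      using periodic_int_shift[of g "t - of_int n" n, OF per] by simp
    ultimately show ?thesis by simp
  qed
  show ?thesis
    unfolding continuous_on_eq_continuous_at[OF open_UNIV]
  proof
    fix t :: real
    define n where "n = \<lfloor>t\<rfloor>"
    have "continuous_on ({of_int (n - 1)..of_int (n - 1) + 1} \<union> {of_int n..of_int n + 1}) g"
      by (intro continuous_on_closed_Un shift) auto
    then have "continuous_on {of_int n - 1<..<of_int n + 1} g" by (rule continuous_on_subset) auto
    moreover have "t \<in> {of_int n - 1<..<of_int n + 1}" unfolding n_def by (auto; linarith)
    ultimately show "isCont g t" by (simp add: continuous_on_eq_continuous_at)
  qed
qed

section \<open>The pair \<open>c1\<close>, \<open>c0\<close>\<close>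

abbreviation c0_fun :: "c0 \<Rightarrow> real \<Rightarrow> real" where
  "c0_fun v \<equiv> apply_bcontfun (bcontfun_of_c0 v)"

lemma c0_fun_periodic: "c0_fun v (t + 1) = c0_fun v t"
  using bcontfun_of_c0[of v] by simp

lemma c0_fun_frac: "c0_fun v t = c0_fun v (frac t)"
  by (rule periodic_frac) (rule c0_fun_periodic)

lemma c0_fun_continuous: "continuous_on S (c0_fun v)"
  by (intro continuous_on_apply_bcontfun continuous_on_id)

lemma c0_norm_bounded: "\<bar>c0_fun v t\<bar> \<le> norm v"
  using norm_bounded[of "bcontfun_of_c0 v" t] by (simp add: norm_c0.rep_eq)

lemma c0_norm_bound:
  assumes "\<And>t. t \<in> {0..1} \<Longrightarrow> \<bar>c0_fun v t\<bar> \<le> C"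
  shows "norm v \<le> C"
  unfolding norm_c0.rep_eq
proof (rule norm_bound)
  show "norm (c0_fun v t) \<le> C" for t
    using assms[OF frac_unit_interval, of t] c0_fun_frac[of v t] by simp
qed

lemma c0_fun_of_fun: "circle_function g \<Longrightarrow> c0_fun (of_fun g) = g"
  unfolding of_fun_c0_def
  by (rule apply_c0_of_fun[OF circle_function_continuous_UNIV]) (auto simp: circle_function_def)

text \<open>Equal primitives have equal derivatives within [0,1], and fractional parts reach every
  point.\<close>

lemma c0_integral_inject:
  assumes "\<And>t. t \<in> {0..1} \<Longrightarrow> integral {0..t} (c0_fun v) = integral {0..t} (c0_fun w)"
  shows "v = w"
proof (rule c0_eqI, rule ext)
  fix t :: real
  define r where "r = frac t"
  have r: "r \<in> {0..<1}" by (simp add: r_def frac_lt_1)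
  have d: "((\<lambda>t. integral {0..t} (c0_fun v)) has_real_derivative c0_fun v r) (at r within {0..1})" for v
    using r by (intro integral_has_real_derivative c0_fun_continuous) auto
  have "((\<lambda>t. integral {0..t} (c0_fun v)) has_real_derivative c0_fun w r) (at r within {0..1})"
    by (rule has_field_derivative_transform_within[OF d, of 1]) (use r assms in auto)
  then have "c0_fun v r = c0_fun w r"
    using d[of v] r vector_derivative_unique_within_closed_interval[of 0 1 r]
    by (auto simp: has_real_derivative_iff_has_vector_derivative)
  then show "c0_fun v t = c0_fun w t"
    unfolding r_def c0_fun_frac[of _ t] .
qed

text \<open>An antiderivative of a periodic function grows by the same constant over each period,
  the integral, and is periodic when this vanishes.\<close>

lemma c1_exists:
  assumes "integral {0..1} (c0_fun v) = 0"
  shows "\<exists>u. deriv_c1 u = v \<and> fun_of_c1 u 0 = x"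
proof -
  obtain G where G: "\<And>t. (G has_real_derivative c0_fun v t) (at t)"
    using continuous_antiderivative[OF c0_fun_continuous] by blast
  have "((\<lambda>t. G (t + 1) - G t) has_real_derivative 0) (at t)" for t
  proof -
    have "((\<lambda>t. G (t + 1)) has_real_derivative c0_fun v (t + 1)) (at t)"
      using G[of "t + 1"] by (simp add: DERIV_shift)
    from DERIV_diff[OF this G] show ?thesis by (simp add: c0_fun_periodic)
  qed
  then have const: "G (t + 1) - G t = G 1 - G 0" for t
    using DERIV_isconst_all[of "\<lambda>t. G (t + 1) - G t" t 0] by auto
  have "(c0_fun v has_integral G 1 - G 0) {0..1}"
    by (intro fundamental_theorem_of_calculus)
       (auto simp flip: has_real_derivative_iff_has_vector_derivative intro: has_field_derivative_at_within G)
  then have "G 1 - G 0 = 0" using assms by (simp add: integral_unique)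
  then have per: "G (t + 1) = G t" for t using const[of t] by simp
  define u where "u t = x + (G t - G 0)" for t
  have du: "(u has_real_derivative c0_fun v t) (at t)" for t
    unfolding u_def using G[of t] by (auto intro!: derivative_eq_intros)
  then have deriv_u: "deriv u = c0_fun v" by (auto intro: DERIV_imp_deriv)
  have "u \<in> {u. (\<forall>t. u (t + 1) = u t) \<and> (\<forall>t. u differentiable at t) \<and> continuous_on UNIV (deriv u)}"
    using du per deriv_u c0_fun_continuous by (auto simp: u_def real_differentiable_def)
  then have rep: "fun_of_c1 (c1_of_fun u) = u" by (rule c1_of_fun_inverse)
  have "deriv_c1 (c1_of_fun u) = v"
    by (rule c0_eqI) (simp add: apply_deriv_c1 rep deriv_u)
  then show ?thesis using rep by (intro exI[of _ "c1_of_fun u"]) (simp add: u_def)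
qed

interpretation c1_c0: circle_pair deriv_c1 "\<lambda>v t. integral {0..t} (c0_fun v)" 1
proof (rule circle_pair.intro)
  fix u :: c1 and v w :: c0 and t C x :: real and g :: "real \<Rightarrow> real"
  have prim: "integral {0..t} (c0_fun (v + w)) = integral {0..t} (c0_fun v) + integral {0..t} (c0_fun w)" for v w t
    by (simp add: plus_c0.rep_eq integral_add integrable_continuous_real[OF c0_fun_continuous])
  show "linear (\<lambda>u :: c1. ev u t)"
    by (rule linearI) (simp_all add: ev_c1_def plus_c1.rep_eq scaleR_c1.rep_eq)
  show "linear deriv_c1" by (rule linearI) (simp_all add: deriv_c1_linear)
  show "linear (\<lambda>v. integral {0..t} (c0_fun v))"
    by (rule linearI) (simp_all add: prim scaleR_c0.rep_eq)
  show circ: "circle_function (ev u)" for u :: c1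
    using c0_fun_periodic[of "c0_of_c1 u"] c0_fun_continuous[of "{0..1}" "c0_of_c1 u"]
    by (simp add: circle_function_def ev_c1_def apply_c0_of_c1)
  show "(1::real) \<le> 1" by simp
  have norm_c0_of: "norm (c0_of_c1 u) \<le> norm u" "norm (deriv_c1 u) \<le> norm u" by (simp_all add: norm_c1_def)
  show "\<bar>ev u t\<bar> \<le> 1 * norm u"
    using c0_norm_bounded[of "c0_of_c1 u" t] norm_c0_of by (simp add: apply_c0_of_c1 ev_c1_def)
  show "norm (deriv_c1 u) \<le> 1 * norm u" using norm_c0_of by simp
  show bound: "\<bar>integral {0..t} (c0_fun v)\<bar> \<le> 1 * norm v" if t: "t \<in> {0..1}" for t v
  proof -
    have "\<bar>integral {0..t} (c0_fun v)\<bar> \<le> norm v * (t - 0)"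
      using t by (intro abs_integral_le c0_fun_continuous c0_norm_bounded) auto
    also have "\<dots> \<le> norm v" using t by (simp add: mult_left_le)
    finally show ?thesis by simp
  qed
  show "norm u \<le> 1 * (C + norm (deriv_c1 u))" if "\<And>t. t \<in> {0..1} \<Longrightarrow> \<bar>ev u t\<bar> \<le> C"
    using c0_norm_bound[of "c0_of_c1 u" C] that by (simp add: norm_c1_def apply_c0_of_c1 ev_c1_def)
  show "norm (of_fun g :: c0) \<le> 1 * C" if "circle_function g" "\<And>t. t \<in> {0..1} \<Longrightarrow> \<bar>g t\<bar> \<le> C"
    using c0_norm_bound[of "of_fun g" C] that by (simp only: c0_fun_of_fun mult_1)
  show "ev u t = ev u 0 + integral {0..t} (c0_fun (deriv_c1 u))" if "t \<in> {0..1}"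
  proof -
    have "(deriv (fun_of_c1 u) has_integral fun_of_c1 u t - fun_of_c1 u 0) {0..t}"
      using that by (intro fundamental_theorem_of_calculus)
        (auto simp flip: has_real_derivative_iff_has_vector_derivative
          intro: has_field_derivative_at_within fun_of_c1_has_deriv)
    then show ?thesis by (simp add: integral_unique apply_deriv_c1 ev_c1_def)
  qed
  show "integral {0..0} (c0_fun v) = 0" by simp
  show "continuous_on {0..1} (\<lambda>t. integral {0..t} (c0_fun v))"
    by (intro indefinite_integral_continuous_1 integrable_continuous_real c0_fun_continuous)
  show "mean v = integral {0..1} (c0_fun v)" by (simp add: mean_c0_def)
  show "v = w" if "\<And>t. t \<in> {0..1} \<Longrightarrow> integral {0..t} (c0_fun v) = integral {0..t} (c0_fun w)"
    using that by (rule c0_integral_inject)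
  show "integral {0..t} (c0_fun (of_fun g)) = integral {0..t} g" if "circle_function g"
    by (simp add: c0_fun_of_fun that)
  show "\<exists>n. (\<forall>x y. 0 \<le> x \<longrightarrow> x \<le> y \<longrightarrow> y \<le> 1 \<longrightarrow>
      \<bar>integral {0..y} (c0_fun v) - integral {0..x} (c0_fun v)\<bar> \<le> n y - n x) \<and> n 1 - n 0 \<le> 1 * norm v"
  proof (intro exI[of _ "\<lambda>t. norm v * t"] conjI allI impI)
    fix x y :: real assume xy: "0 \<le> x" "x \<le> y" "y \<le> 1"
    then have "integral {0..y} (c0_fun v) - integral {0..x} (c0_fun v) = integral {x..y} (c0_fun v)"
      by (intro integral_combine_left c0_fun_continuous)
    also have "\<bar>\<dots>\<bar> \<le> norm v * (y - x)"
      using xy by (intro abs_integral_le c0_fun_continuous c0_norm_bounded)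
    finally show "\<bar>integral {0..y} (c0_fun v) - integral {0..x} (c0_fun v)\<bar> \<le> norm v * y - norm v * x"
      by (simp add: right_diff_distrib)
  qed simp
  show "\<exists>u. deriv_c1 u = v \<and> ev u 0 = x" if "mean v = 0"
    unfolding ev_c1_def using that by (intro c1_exists) (simp add: mean_c0_def)
qed

section \<open>The pair \<open>h1\<close>, \<open>l2\<close>\<close>

lemma l2_representative:
  obtains g where "square_integrable g" "v = l2_of_fun g" "l2_rel g g"
proof (rule that)
  show rel: "l2_rel (fun_of_l2 v) (fun_of_l2 v)" by (rule Quotient_rep_reflp[OF Quotient_l2])
  show "v = l2_of_fun (fun_of_l2 v)" by (rule Quotient_abs_rep[OF Quotient_l2, symmetric])
  show "square_integrable (fun_of_l2 v)" using rel by (rule l2_relD)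
qed

lemma l2_rel_refl: "square_integrable g \<Longrightarrow> l2_rel g g"
  by (simp add: l2_rel_def)

lemma inner_l2_of_fun:
  "square_integrable g \<Longrightarrow> square_integrable h \<Longrightarrow>
    inner (l2_of_fun g) (l2_of_fun h) = (LINT t|circle_measure. g t * h t)"
  by (rule inner_l2.abs_eq) (simp_all add: l2_rel_refl)

lemma primitive_l2_of_fun:
  "square_integrable g \<Longrightarrow> primitive_l2 (l2_of_fun g) t = (LINT s:{0..<t}|circle_measure. g s)"
  by (simp add: primitive_l2.abs_eq l2_rel_refl)

lemma mean_l2_of_fun:
  "square_integrable g \<Longrightarrow> mean (l2_of_fun g) = (LINT t|circle_measure. g t)"
  by (simp add: mean_l2.abs_eq l2_rel_refl)

lemma square_integrable_bounded:
  assumes [measurable]: "g \<in> borel_measurable circle_measure" and C: "\<And>t. t \<in> {0..<1} \<Longrightarrow> \<bar>g t\<bar> \<le> C"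
  shows "square_integrable g"
  unfolding square_integrable_def
proof (intro conjI circle_measure.integrable_const_bound[where B = "C\<^sup>2"] AE_I2)
  fix t assume "t \<in> space circle_measure"
  then have "\<bar>g t\<bar>\<^sup>2 \<le> C\<^sup>2" by (intro power_mono C) auto
  then show "norm ((g t)\<^sup>2) \<le> C\<^sup>2" by simp
qed simp_all

lemma square_integrable_circle_function:
  assumes g: "circle_function g"
  shows "square_integrable g"
proof -
  have "continuous_on {0..<1} g"
    using g by (auto simp: circle_function_def elim: continuous_on_subset)
  then have "g \<in> borel_measurable (restrict_space borel {0..<1})"
    by (rule borel_measurable_continuous_on_restrict)
  moreover have "sets circle_measure = sets (restrict_space borel {0..<1})"
    by (simp add: circle_measure_def sets_restrict_space)
  ultimately have "g \<in> borel_measurable circle_measure" by (simp cong: measurable_cong_sets)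
  moreover obtain C where "\<And>t. t \<in> {0..1} \<Longrightarrow> \<bar>g t\<bar> \<le> C"
    using circle_function_bounded[OF g] by blast
  ultimately show ?thesis by (intro square_integrable_bounded[of g C]) auto
qed

lemma measure_circle_measure: "measure circle_measure (space circle_measure) = 1"
  by (simp add: circle_measure_def measure_restrict_space space_restrict_space)

lemma norm_l2_of_fun_le:
  assumes "square_integrable g" "0 \<le> C" "\<And>t. t \<in> {0..<1} \<Longrightarrow> \<bar>g t\<bar> \<le> C"
  shows "norm (l2_of_fun g) \<le> C"
proof -
  have "(LINT t|circle_measure. g t * g t) \<le> (LINT t|circle_measure. C * C)"
  proof (rule integral_mono)
    show "integrable circle_measure (\<lambda>t. g t * g t)" by (intro square_integrable_mult assms)
    fix t assume "t \<in> space circle_measure"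
    then have "\<bar>g t\<bar> * \<bar>g t\<bar> \<le> C * C" using assms by (intro mult_mono) auto
    then show "g t * g t \<le> C * C" by simp
  qed simp
  also have "\<dots> = C\<^sup>2" using measure_circle_measure by (simp add: power2_eq_square)
  finally have "inner (l2_of_fun g) (l2_of_fun g) \<le> C\<^sup>2" by (simp add: inner_l2_of_fun assms)
  then show ?thesis unfolding norm_l2_def using assms(2) by (intro real_le_lsqrt)
qed

text \<open>Cauchy-Schwarz against the indicator of an interval, whose norm is at most 1.\<close>

lemma primitive_l2_bound: "\<bar>primitive_l2 v t\<bar> \<le> norm v"
proof -
  obtain g where g: "square_integrable g" "v = l2_of_fun g" by (rule l2_representative)
  define i :: "real \<Rightarrow> real" where "i = indicator {0..<t}"
  have i_measurable: "i \<in> borel_measurable circle_measure"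
    unfolding i_def circle_measure_def by (intro measurable_restrict_space1) simp
  have i: "square_integrable i" by (rule square_integrable_bounded[OF i_measurable, of 1]) (simp add: i_def indicator_def)
  have "primitive_l2 v t = inner v (l2_of_fun i)"
    unfolding g(2) primitive_l2_of_fun[OF g(1)] inner_l2_of_fun[OF g(1) i]
    by (simp add: set_lebesgue_integral_def i_def mult.commute)
  also have "\<bar>\<dots>\<bar> \<le> norm v * norm (l2_of_fun i)" by (rule Cauchy_Schwarz_ineq2)
  also have "\<dots> \<le> norm v * 1"
    by (intro mult_left_mono norm_l2_of_fun_le i) (simp_all add: i_def indicator_def)
  finally show ?thesis by simp
qed

text \<open>The primitive of \<open>\<bar>g\<bar>\<close> dominates the variation, and its total is
  at most the norm of \<open>v\<close> because \<open>g\<close> and \<open>\<bar>g\<bar>\<close>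
  have the same norm.\<close>

lemma primitive_l2_variation:
  "\<exists>n. (\<forall>x y. 0 \<le> x \<longrightarrow> x \<le> y \<longrightarrow> y \<le> 1 \<longrightarrow> \<bar>primitive_l2 v y - primitive_l2 v x\<bar> \<le> n y - n x) \<and> n 1 - n 0 \<le> norm v"
proof -
  obtain g where g: "square_integrable g" "v = l2_of_fun g" by (rule l2_representative)
  have [measurable]: "g \<in> borel_measurable circle_measure" using g(1) by (simp add: square_integrable_def)
  have abs_g: "square_integrable (\<lambda>t. \<bar>g t\<bar>)" using g(1) by (simp add: square_integrable_def)
  define n where "n = primitive_l2 (l2_of_fun (\<lambda>t. \<bar>g t\<bar>))"
  have set_int: "set_integrable circle_measure {x..<y} h" if "integrable circle_measure h" for h :: "real \<Rightarrow> real" and x y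
  proof -
    have "integrable lborel (\<lambda>r. indicator {x..<y} r *\<^sub>R (indicator {0..<1} r * h r))"
      using that by (intro integrable_mult_indicator) (auto simp: integrable_circle_measure_iff)
    then show ?thesis by (simp add: set_integrable_def integrable_circle_measure_iff mult.left_commute)
  qed
  have diff: "primitive_l2 (l2_of_fun h) y - primitive_l2 (l2_of_fun h) x = (LINT s:{x..<y}|circle_measure. h s)"
    if h: "square_integrable h" and xy: "0 \<le> x" "x \<le> y" for h x y
  proof -
    have "{0..<y} = {0..<x} \<union> {x..<y}" using xy by auto
    moreover have "(LINT s:{0..<x} \<union> {x..<y}|circle_measure. h s)
        = (LINT s:{0..<x}|circle_measure. h s) + (LINT s:{x..<y}|circle_measure. h s)"
      by (rule set_integral_Un) (auto intro: set_int square_integrable_integrable h)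
    ultimately show ?thesis by (simp add: primitive_l2_of_fun h)
  qed
  show ?thesis
  proof (intro exI[of _ n] conjI allI impI)
    fix x y :: real assume xy: "0 \<le> x" "x \<le> y" "y \<le> 1"
    have "\<bar>LINT s:{x..<y}|circle_measure. g s\<bar> \<le> (LINT s:{x..<y}|circle_measure. \<bar>g s\<bar>)"
      using set_integral_norm_bound[OF set_int[OF square_integrable_integrable[OF g(1)]], of x y] by simp
    then show "\<bar>primitive_l2 v y - primitive_l2 v x\<bar> \<le> n y - n x"
      unfolding g(2) n_def diff[OF g(1) xy(1,2)] diff[OF abs_g xy(1,2)] .
  next
    have "n 1 - n 0 = n 1" unfolding n_def by (simp add: primitive_l2_of_fun abs_g set_lebesgue_integral_def)
    also have "\<dots> \<le> norm (l2_of_fun (\<lambda>t. \<bar>g t\<bar>))" unfolding n_def using primitive_l2_bound abs_le_D1 by blast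
    also have "\<dots> = norm v" unfolding g(2) norm_l2_def by (simp add: inner_l2_of_fun g abs_g)
    finally show "n 1 - n 0 \<le> norm v" .
  qed
qed

lemma primitive_l2_circle_function:
  assumes g: "circle_function g" and t: "t \<in> {0..1}"
  shows "primitive_l2 (l2_of_fun g) t = integral {0..t} g"
proof -
  note sq = square_integrable_circle_function[OF g]
  have "integrable lborel (\<lambda>x. indicator {0..<1} x * g x)"
    using square_integrable_integrable[OF sq] by (simp add: integrable_circle_measure_iff)
  then have "set_integrable lborel {0..<t} (\<lambda>x. indicator {0..<1} x * g x)"
    unfolding set_integrable_def by (intro integrable_mult_indicator) auto
  then have "primitive_l2 (l2_of_fun g) t = integral {0..<t} (\<lambda>x. indicator {0..<1} x * g x)"
    unfolding primitive_l2_of_fun[OF sq] set_integral_circle_measure by (rule set_borel_integral_eq_integral(2))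
  also have "\<dots> = integral {0..<t} g"
    using t by (intro integral_cong) (simp add: indicator_def)
  also have "\<dots> = integral {0..t} g"
    by (rule integral_subset_negligible) (auto intro: negligible_subset[of "{t}"])
  finally show ?thesis .
qed

lemma primitive_l2_0: "primitive_l2 v 0 = 0"
proof -
  obtain g where "square_integrable g" "v = l2_of_fun g" by (rule l2_representative)
  then show ?thesis by (simp add: primitive_l2_of_fun set_lebesgue_integral_def)
qed

lemma mean_l2_eq: "mean v = primitive_l2 v 1"
proof -
  obtain g where g: "square_integrable g" "v = l2_of_fun g" by (rule l2_representative)
  have "(LINT t|circle_measure. g t) = (LINT s:{0..<1}|circle_measure. g s)"
    unfolding set_lebesgue_integral_def by (rule Bochner_Integration.integral_cong) auto
  then show ?thesis by (simp add: g mean_l2_of_fun primitive_l2_of_fun)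
qed

text \<open>The extension by \<open>frac\<close> agrees with the primitive at 1 as well, because a
  mean-zero primitive returns to 0.\<close>

lemma h1_exists:
  assumes "mean v = 0"
  shows "\<exists>u. deriv_h1 u = v \<and> fun_of_h1 u 0 = x"
proof -
  define u where "u t = x + primitive_l2 v (frac t)" for t
  have u: "u t = x + primitive_l2 v t" if "t \<in> {0..1}" for t
    using that assms primitive_l2_0[of v] by (cases "t = 1") (auto simp: u_def frac_eq mean_l2_eq)
  have u0: "u 0 = x" using u[of 0] by (simp add: primitive_l2_0)
  have "u \<in> {u. (\<forall>t. u (t + 1) = u t) \<and> (\<exists>g. \<forall>t\<in>{0..1}. u t = u 0 + primitive_l2 g t)}"
    using u u0 by (auto simp: u_def frac_1_eq)
  then have rep: "fun_of_h1 (h1_of_fun u) = u" by (rule h1_of_fun_inverse)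
  have "deriv_h1 (h1_of_fun u) = v"
    by (rule deriv_h1_eqI) (simp add: rep u u0)
  then show ?thesis using rep u0 by (intro exI[of _ "h1_of_fun u"]) simp
qed

lemma circle_function_h1: "circle_function (fun_of_h1 u)"
  unfolding circle_function_def using fun_of_h1_periodic continuous_on_fun_of_h1 by blast

lemma norm_h1_components: "norm (l2_of_h1 u) \<le> norm u" "norm (deriv_h1 u) \<le> norm u"
    "norm u \<le> norm (l2_of_h1 u) + norm (deriv_h1 u)"
proof -
  have eq: "norm u = sqrt ((norm (l2_of_h1 u))\<^sup>2 + (norm (deriv_h1 u))\<^sup>2)"
    by (simp add: norm_h1_def inner_h1_def power2_norm_eq_inner)
  show "norm (l2_of_h1 u) \<le> norm u" "norm (deriv_h1 u) \<le> norm u" unfolding eq by simp_all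
  show "norm u \<le> norm (l2_of_h1 u) + norm (deriv_h1 u)"
    unfolding eq by (intro sqrt_sum_squares_le_sum) simp_all
qed

text \<open>Of the constant 3, one unit pays for the value at a point where \<open>u\<close> equals
  its mean, and two pay for the primitives of the derivative that lead from there to
  \<open>t\<close>.\<close>

lemma h1_sup_bound:
  assumes t: "t \<in> {0..1}"
  shows "\<bar>fun_of_h1 u t\<bar> \<le> 3 * norm u"
proof -
  obtain r where r: "r \<in> {0..1}" "fun_of_h1 u r = integral {0..1} (fun_of_h1 u)"
    using integral_attained[OF continuous_on_fun_of_h1] by blast
  have "fun_of_h1 u r = primitive_l2 (l2_of_h1 u) 1"
    unfolding l2_of_h1_def by (simp add: r(2) primitive_l2_circle_function[OF circle_function_h1])
  then have "\<bar>fun_of_h1 u r\<bar> \<le> norm u"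
    using primitive_l2_bound[of "l2_of_h1 u" 1] norm_h1_components(1)[of u] by linarith
  moreover have "fun_of_h1 u t = fun_of_h1 u r + primitive_l2 (deriv_h1 u) t - primitive_l2 (deriv_h1 u) r"
    using fun_of_h1_eq_primitive[OF t, of u] fun_of_h1_eq_primitive[OF r(1), of u] by linarith
  moreover have "\<bar>primitive_l2 (deriv_h1 u) s\<bar> \<le> norm u" for s
    using primitive_l2_bound[of "deriv_h1 u" s] norm_h1_components(2)[of u] by linarith
  from this[of t] this[of r] calculation show ?thesis by linarith
qed

interpretation h1_l2: circle_pair deriv_h1 primitive_l2 3
proof (rule circle_pair.intro)
  fix u :: h1 and v w :: l2 and t C x :: real and g :: "real \<Rightarrow> real"
  show "linear (\<lambda>u :: h1. ev u t)"
    by (rule linearI) (simp_all add: ev_h1_def plus_h1.rep_eq scaleR_h1.rep_eq)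
  show "linear deriv_h1" by (rule linearI) (simp_all add: deriv_h1_linear)
  show "linear (\<lambda>v. primitive_l2 v t)" by (rule linearI) (simp_all add: primitive_l2_linear)
  show "circle_function (ev u)" unfolding ev_h1_def by (rule circle_function_h1)
  show "(1::real) \<le> 3" by simp
  show "\<bar>ev u t\<bar> \<le> 3 * norm u" if "t \<in> {0..1}" unfolding ev_h1_def by (rule h1_sup_bound[OF that])
  show "norm (deriv_h1 u) \<le> 3 * norm u" using norm_h1_components(2)[of u] norm_ge_zero[of u] by linarith
  show "\<bar>primitive_l2 v t\<bar> \<le> 3 * norm v"
    using primitive_l2_bound[of v t] norm_ge_zero[of v] by linarith
  show "norm u \<le> 3 * (C + norm (deriv_h1 u))" if C: "\<And>t. t \<in> {0..1} \<Longrightarrow> \<bar>ev u t\<bar> \<le> C"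
  proof -
    have C0: "0 \<le> C" using C[of 0] by simp
    then have "norm (l2_of_h1 u) \<le> C"
      unfolding l2_of_h1_def using C by (intro norm_l2_of_fun_le square_integrable_fun_of_h1) (auto simp: ev_h1_def)
    then have "norm u \<le> C + norm (deriv_h1 u)" using norm_h1_components(3)[of u] by linarith
    also have "\<dots> \<le> 3 * (C + norm (deriv_h1 u))" using C0 by simp
    finally show ?thesis .
  qed
  show "norm (of_fun g :: l2) \<le> 3 * C" if g: "circle_function g" and C: "\<And>t. t \<in> {0..1} \<Longrightarrow> \<bar>g t\<bar> \<le> C"
  proof -
    have C0: "0 \<le> C" using C[of 0] by simp
    have "norm (of_fun g :: l2) \<le> C"
      unfolding of_fun_l2_def using C C0 by (intro norm_l2_of_fun_le square_integrable_circle_function g) auto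
    then show ?thesis using C0 by linarith
  qed
  show "ev u t = ev u 0 + primitive_l2 (deriv_h1 u) t" if "t \<in> {0..1}"
    unfolding ev_h1_def by (rule fun_of_h1_eq_primitive[OF that])
  show "primitive_l2 v 0 = 0" by (rule primitive_l2_0)
  show "continuous_on {0..1} (primitive_l2 v)" by (rule continuous_on_primitive_l2)
  show "mean v = primitive_l2 v 1" by (rule mean_l2_eq)
  show "v = w" if "\<And>t. t \<in> {0..1} \<Longrightarrow> primitive_l2 v t = primitive_l2 w t" using that by (rule primitive_l2_inject)
  show "primitive_l2 (of_fun g) t = integral {0..t} g" if "circle_function g" "t \<in> {0..1}"
    unfolding of_fun_l2_def using that by (rule primitive_l2_circle_function)
  show "\<exists>n. (\<forall>x y. 0 \<le> x \<longrightarrow> x \<le> y \<longrightarrow> y \<le> 1 \<longrightarrow> \<bar>primitive_l2 v y - primitive_l2 v x\<bar> \<le> n y - n x) \<and> n 1 - n 0 \<le> 3 * norm v"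
  proof -
    have "norm v \<le> 3 * norm v" using norm_ge_zero[of v] by linarith
    then show ?thesis using primitive_l2_variation[of v] order_trans by blast
  qed
  show "\<exists>u. deriv_h1 u = v \<and> ev u 0 = x" if "mean v = 0" unfolding ev_h1_def using that by (rule h1_exists)
qed

theorem proposition2p2:
  fixes f :: "real \<Rightarrow> real \<Rightarrow> real"
  assumes "smooth_on_circle f" and "tame f"
  shows
    "(regular_value (Sigma_fun f 1 :: c1 \<Rightarrow> real) 0 \<longrightarrow>
        (\<forall>k\<in>{1..5}. S_set (F_C f) k = {u. \<forall>i\<in>{1..k}. Sigma_fun f i u = 0}) \<and>
        (\<forall>k\<in>{1..4}. \<forall>u. morin_singularity (F_C f) k u \<longleftrightarrow>
            (\<forall>i\<in>{1..k}. Sigma_fun f i u = 0) \<and>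
            Sigma_fun f (k + 1) u \<noteq> 0 \<and>
            surj_derivative (k - 1) (Sigma_fun f) u)) \<and>
     (regular_value (Sigma_fun f 1 :: h1 \<Rightarrow> real) 0 \<longrightarrow>
        (\<forall>k\<in>{1..5}. S_set (F_H f) k = {u. \<forall>i\<in>{1..k}. Sigma_fun f i u = 0}) \<and>
        (\<forall>k\<in>{1..4}. \<forall>u. morin_singularity (F_H f) k u \<longleftrightarrow>
            (\<forall>i\<in>{1..k}. Sigma_fun f i u = 0) \<and>
            Sigma_fun f (k + 1) u \<noteq> 0 \<and>
            surj_derivative (k - 1) (Sigma_fun f) u))"
proof -
  note adm = admissible_tame[OF assms]
  have F_C: "F_C f = c1_c0.F f" by (simp add: fun_eq_iff F_C_def c1_c0.F_def)
  have F_H: "F_H f = h1_l2.F f" by (simp add: fun_eq_iff F_H_def h1_l2.F_def)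
  show ?thesis
    unfolding F_C F_H
    using c1_c0.singular_strata[OF assms(1) adm] c1_c0.morin_iff[OF assms(1) adm]
      h1_l2.singular_strata[OF assms(1) adm] h1_l2.morin_iff[OF assms(1) adm]
    by blast
qed

end
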